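(* Let $w:\mathbb R^{2d}\to(0,\infty)$ be an admissible TF weight and let $\varphi\in M^1_w(\mathbb R^d)$ with $\|\varphi\|_2=1$. Let $\{\eta_\gamma:\gamma\in\Gamma\}$ be a well-spread family (relative to $w$) of non-negative symbols on $\mathbb R^{2d}$ with $\sum_\gamma\eta_\gamma\approx1$, and let $v$ be a $w$-moderated weight. Then there is a constant $\alpha>0$ such that for every choice of numbers $N_\gamma\in\mathbb N$ with $\alpha\|\eta_\gamma\|_1\le N_\gamma$ and $\sup_\gamma N_\gamma<\infty$, the estimates $$\|f\|_{M^p_v}\approx\Big(\sum_{\gamma\in\Gamma}\sum_{k=1}^{N_\gamma}|\langle f,\lambda^\gamma_k\phi^\gamma_k\rangle|^pv(\gamma)^p\Big)^{1/p},\qquad f\in M^p_v(\mathbb R^d),$$ hold simultaneously for all $1\le p\le\infty$ (usual modification for $p=\infty$). Moreover, $\alpha$ can be chosen uniformly for any class of weights $v$ having a uniform constant $C_v$.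
   Context: For $z=(x,\xi)$, $\pi(z)f(t)=e^{2\pi i\xi t}f(t-x)$, $V_\varphi f(z)=\langle f,\pi(z)\varphi\rangle$. For $m\in L^\infty(\mathbb R^{2d})$, $H_mf=V_\varphi^*(mV_\varphi f)=\int m(z)V_\varphi f(z)\pi(z)\varphi\,dz$. For non-negative $\eta_\gamma\in L^1\cap L^\infty$, $H_{\eta_\gamma}$ is positive trace class on $L^2(\mathbb R^d)$ with diagonalization $H_{\eta_\gamma}f=\sum_{k\ge1}\lambda^\gamma_k\langle f,\phi^\gamma_k\rangle\phi^\gamma_k$, $\{\phi^\gamma_k\}_k$ orthonormal and $(\lambda^\gamma_k)_k$ non-increasing, non-negative. An admissible TF weight is a continuous even $w:\mathbb R^{2d}\to(0,\infty)$, submultiplicative, with $w(z)\le C(1+|z|)^N$ and $\lim_nw(nz)^{1/n}=1$. $v$ is $w$-moderated if $v(z+z')\le C_vw(z)v(z')$. $M^p_v(\mathbb R^d)$ is the space of $f\in M^\infty_{1/w}$ with $V_\varphi f\in L^p_v(\mathbb R^{2d})$, normed by $\|V_\varphi f\|_{L^p_v}$; $M^2=L^2$. $W(L^\infty,L^1_w)(\mathbb R^{2d})$: measurable $F$ with $z\mapsto\operatorname{ess\,sup}_{|y|\le1}|F(z+y)|$ in $L^1_w$. Symbols $\{\eta_\gamma\}$ are well-spread (relative to $w$) if $\sup_z\#(\Gamma\cap B_1(z))<\infty$ and $|\eta_\gamma(z)|\le g(z-\gamma)$ for some $g\in W(L^\infty,L^1_w)$. $\sum_\gamma\eta_\gamma\approx1$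 means $A\le\sum_\gamma\eta_\gamma\le B$ with $0<A\le B$. *)

theory Defs
  imports "HOL-Analysis.Analysis"
begin

definition tf_shift :: "(real^'d) \<times> (real^'d) \<Rightarrow> (real^'d \<Rightarrow> complex) \<Rightarrow> (real^'d \<Rightarrow> complex)" where
  "tf_shift z f = (\<lambda>t. cis (2 * pi * (snd z \<bullet> t)) * f (t - fst z))"

definition l2_inner :: "(real^'d \<Rightarrow> complex) \<Rightarrow> (real^'d \<Rightarrow> complex) \<Rightarrow> complex" where
  "l2_inner f g = integral\<^sup>L lborel (\<lambda>t. f t * cnj (g t))"

definition sq_integrable :: "(real^'d \<Rightarrow> complex) \<Rightarrow> bool" where
  "sq_integrable f \<longleftrightarrow> f \<in> borel_measurable lborel \<and> integrable lborel (\<lambda>t. (cmod (f t))\<^sup>2)"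

definition stft :: "(real^'d \<Rightarrow> complex) \<Rightarrow> (real^'d \<Rightarrow> complex) \<Rightarrow> (real^'d) \<times> (real^'d) \<Rightarrow> complex" where
  "stft \<phi> f z = l2_inner f (tf_shift z \<phi>)"

definition gauss :: "real^'d \<Rightarrow> complex" where
  "gauss t = complex_of_real (exp (- pi * (norm t)\<^sup>2))"

definition admissible_weight :: "((real^'d) \<times> (real^'d) \<Rightarrow> real) \<Rightarrow> bool" where
  "admissible_weight w \<longleftrightarrow>
     continuous_on UNIV w \<and> (\<forall>z. w z > 0) \<and> (\<forall>z. w (- z) = w z) \<and>
     (\<forall>z z'. w (z + z') \<le> w z * w z') \<and>
     (\<exists>C (N::nat). \<forall>z. w z \<le> C * (1 + norm z) ^ N) \<and>
     (\<forall>z. (\<lambda>n. w (real n *\<^sub>R z) powr (1 / real n)) \<longlonglongrightarrow> 1)"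

definition moderated_with :: "((real^'d) \<times> (real^'d) \<Rightarrow> real) \<Rightarrow> real \<Rightarrow> ((real^'d) \<times> (real^'d) \<Rightarrow> real) \<Rightarrow> bool" where
  "moderated_with w Cv v \<longleftrightarrow>
     v \<in> borel_measurable lborel \<and> (\<forall>z. v z > 0) \<and> (\<forall>z z'. v (z + z') \<le> Cv * w z * v z')"

definition M1 :: "((real^'d) \<times> (real^'d) \<Rightarrow> real) \<Rightarrow> (real^'d \<Rightarrow> complex) \<Rightarrow> bool" where
  "M1 w f \<longleftrightarrow> sq_integrable f \<and>
     (\<integral>\<^sup>+ z. ennreal (cmod (stft gauss f z) * w z) \<partial>lborel) < \<infinity>"

definition M1_norm :: "((real^'d) \<times> (real^'d) \<Rightarrow> real) \<Rightarrow> (real^'d \<Rightarrow> complex) \<Rightarrow> real" where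
  "M1_norm w f = (\<integral>z. cmod (stft gauss f z) * w z \<partial>lborel)"

text \<open>M^infinity_{1/w} = (M^1_w)^*: bounded conjugate-linear functionals F on M^1_w;
  F g plays the role of the pairing <f, g>.\<close>
definition Minf :: "((real^'d) \<times> (real^'d) \<Rightarrow> real) \<Rightarrow> ((real^'d \<Rightarrow> complex) \<Rightarrow> complex) \<Rightarrow> bool" where
  "Minf w F \<longleftrightarrow>
     (\<forall>f g a b. M1 w f \<longrightarrow> M1 w g \<longrightarrow>
        F (\<lambda>t. a * f t + b * g t) = cnj a * F f + cnj b * F g) \<and>
     (\<exists>C. \<forall>g. M1 w g \<longrightarrow> cmod (F g) \<le> C * M1_norm w g)"

definition enn_rpow :: "real \<Rightarrow> ennreal \<Rightarrow> ennreal" where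
  "enn_rpow q x = (if x = top then top else ennreal (enn2real x powr q))"

text \<open>Weighted L^p norm (1 <= p <= infinity) of a non-negative function h w.r.t. measure M
  (h already includes the weight); value infinity means "not in L^p".\<close>
definition Lp_norm :: "ennreal \<Rightarrow> 'a measure \<Rightarrow> ('a \<Rightarrow> real) \<Rightarrow> ennreal" where
  "Lp_norm p M h = (if p = top then (INF c \<in> {c. AE x in M. ennreal (h x) \<le> c}. c)
      else enn_rpow (1 / enn2real p) (\<integral>\<^sup>+ x. ennreal (h x powr enn2real p) \<partial>M))"

definition Mp_norm :: "ennreal \<Rightarrow> (real^'d \<Rightarrow> complex) \<Rightarrow> ((real^'d) \<times> (real^'d) \<Rightarrow> real)
    \<Rightarrow> ((real^'d \<Rightarrow> complex) \<Rightarrow> complex) \<Rightarrow> ennreal" where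
  "Mp_norm p \<phi> v F = Lp_norm p lborel (\<lambda>z. cmod (F (tf_shift z \<phi>)) * v z)"

definition local_esssup :: "('a::euclidean_space \<Rightarrow> real) \<Rightarrow> 'a \<Rightarrow> ennreal" where
  "local_esssup g z = (INF c \<in> {c. AE y in lborel. norm y \<le> 1 \<longrightarrow> ennreal \<bar>g (z + y)\<bar> \<le> c}. c)"

definition wiener_W :: "('a::euclidean_space \<Rightarrow> real) \<Rightarrow> ('a \<Rightarrow> real) \<Rightarrow> bool" where
  "wiener_W w g \<longleftrightarrow> g \<in> borel_measurable lborel \<and>
     (\<integral>\<^sup>+ z. local_esssup g z * ennreal (w z) \<partial>lborel) < \<infinity>"

definition well_spread :: "('a::euclidean_space \<Rightarrow> real) \<Rightarrow> 'a set \<Rightarrow> ('a \<Rightarrow> 'a \<Rightarrow> real) \<Rightarrow> bool" where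
  "well_spread w \<Gamma> \<eta> \<longleftrightarrow>
     (\<exists>K::nat. \<forall>z. finite (\<Gamma> \<inter> ball z 1) \<and> card (\<Gamma> \<inter> ball z 1) \<le> K) \<and>
     (\<exists>g. wiener_W w g \<and> (\<forall>\<gamma>\<in>\<Gamma>. \<forall>z. \<bar>\<eta> \<gamma> z\<bar> \<le> g (z - \<gamma>)))"

text \<open>Localization operator H_m in weak form: <H_m f, g> = int m V_phi f conj(V_phi g).\<close>
definition loc_form :: "(real^'d \<Rightarrow> complex) \<Rightarrow> ((real^'d) \<times> (real^'d) \<Rightarrow> real)
    \<Rightarrow> (real^'d \<Rightarrow> complex) \<Rightarrow> (real^'d \<Rightarrow> complex) \<Rightarrow> complex" where
  "loc_form \<phi> m f g = (\<integral>z. complex_of_real (m z) * stft \<phi> f z * cnj (stft \<phi> g z) \<partial>lborel)"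

text \<open>(lam k, phis k)_k (k = 0,1,...) is a spectral diagonalization of H_m:
  H_m f = sum_k lam_k <f, phis_k> phis_k, phis orthonormal, lam non-increasing, non-negative.\<close>
definition diagonalizes :: "(real^'d \<Rightarrow> complex) \<Rightarrow> ((real^'d) \<times> (real^'d) \<Rightarrow> real)
    \<Rightarrow> (nat \<Rightarrow> real) \<Rightarrow> (nat \<Rightarrow> real^'d \<Rightarrow> complex) \<Rightarrow> bool" where
  "diagonalizes \<phi> m lam phis \<longleftrightarrow>
     (\<forall>k. sq_integrable (phis k)) \<and>
     (\<forall>j k. l2_inner (phis j) (phis k) = (if j = k then 1 else 0)) \<and>
     (\<forall>k. 0 \<le> lam k \<and> lam (Suc k) \<le> lam k) \<and>
     (\<forall>f g. sq_integrable f \<longrightarrow> sq_integrable g \<longrightarrow>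
        (\<lambda>k. complex_of_real (lam k) * l2_inner f (phis k) * l2_inner (phis k) g)
          sums loc_form \<phi> m f g)"

end

theory Submission imports Defs "HOL-Probability.Probability"
begin

text \<open>
  A functional \<open>F\<close> is studied through \<open>G z = F (\<pi>(z) \<phi>)\<close>, which satisfies a reproducing formula with
  a kernel dominated by the convolution kernel \<open>\<Phi>\<close> of finite \<open>L\<^sup>1\<^sub>w\<close> norm. The exponentially damped energies
  \<open>\<beta> y = \<parallel>exp (- \<bar>z - y\<bar> / 2R) G\<parallel>\<^sub>2\<close> are finite even if \<open>G\<close> is not square integrable, and \<open>\<beta>\<close> and \<open>\<bar>G\<bar>\<close>
  have equivalent \<open>L\<^sup>p\<^sub>v\<close> norms for all \<open>p\<close> at once. Since \<open>\<Sum>\<eta>\<^sub>\<gamma> \<ge> A\<close>, it suffices to bound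
  \<open>\<integral> \<eta>\<^sub>\<gamma> exp (- \<bar>z - y\<bar> / R) \<bar>G\<bar>\<^sup>2\<close> for each \<open>\<gamma>\<close>. Replacing one factor \<open>exp (- \<bar>z - y\<bar> / R) G\<close> by the
  reproducing integral of its truncation to a ball around \<open>\<gamma>\<close> turns this into a pairing of the localization
  operator with the vector synthesized from that truncation, which the eigenfunction expansion controls: the
  first \<open>N\<^sub>\<gamma>\<close> eigenfunctions give the coefficients of \<open>F\<close>, and the rest is at most
  \<open>\<surd>\<lambda>\<^sub>N \<le> \<surd>(\<parallel>\<eta>\<^sub>\<gamma>\<parallel>\<^sub>1 / (N + 1))\<close> times a local energy. The commutator of the damping factor with the
  reproducing kernel costs a convolution with a kernel whose \<open>L\<^sup>1\<^sub>w\<close> norm tends to 0 as \<open>R\<close> grows. Choosing \<open>R\<close>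
  first and then \<open>\<alpha>\<close> large, both error terms are absorbed by Schur's test, uniformly in \<open>p\<close> and depending
  on \<open>v\<close> only through its moderateness constant.
\<close>

section \<open>Extended-valued $L^p$ norms and the Schur test\<close>

text \<open>The obstacle is that diagonalization gives L^2 information only, while F merely
  satisfies |G| \<le> C w, so no global L^2 argument reaches all p. The energy inequality at a fixed
  \<open>y\<close> is quadratic in G, but each term on its right carries the factor
  \<open>\<beta> y\<close>, which the damping keeps finite; dividing it out leaves a pointwise
  linear inequality between \<open>\<beta> y\<close> and convolutions or lattice sums. Inequalities
  of that form pass to every weighted L^p norm with the same constants. The truncation to a ball
  around \<gamma> puts the synthesized vector into L^2 and gives its norm the factor
  \<open>sexp R (y - \<gamma>)\<close>, which makes the sum over \<Gamma> a discrete convolution.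
  Absorption needs the absorbed norm to be finite; this is the role of restricting to functionals of
  finite M^p_v norm. The constants are fixed in the order: moderateness constant, damping radius
  \<open>R\<close>, radius \<open>r\<close> beyond which the symbols are negligible, size
  \<open>t\<close> allowed to the spectral remainder; with M a bound for the envelope of the
  symbols, \<alpha> = M e / t^2.\<close>

lemma enn_rpow_ennreal: "0 \<le> r \<Longrightarrow> enn_rpow q (ennreal r) = ennreal (r powr q)"
  by (simp add: enn_rpow_def)

lemma enn_rpow_top [simp]: "enn_rpow q top = top"
  by (simp add: enn_rpow_def)

lemma enn_rpow_0 [simp]: "enn_rpow q 0 = 0"
  by (simp add: enn_rpow_def)

lemma enn_rpow_mono: "0 < q \<Longrightarrow> x \<le> y \<Longrightarrow> enn_rpow q x \<le> enn_rpow q y"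
  by (cases x; cases y) (auto simp: enn_rpow_ennreal top_unique intro!: powr_mono2)

lemma enn_rpow_mult: "enn_rpow q (x * y) = enn_rpow q x * enn_rpow q y"
proof (cases x; cases y)
  fix r s assume "x = ennreal r" "0 \<le> r" "y = ennreal s" "0 \<le> s"
  then show ?thesis by (simp add: enn_rpow_ennreal powr_mult ennreal_mult[symmetric])
next
  fix r assume *: "x = ennreal r" "0 \<le> r" "y = top"
  show ?thesis by (cases "r = 0") (use * in \<open>auto simp: enn_rpow_ennreal ennreal_mult_top\<close>)
next
  fix r assume *: "x = top" "y = ennreal r" "0 \<le> r"
  show ?thesis by (cases "r = 0") (use * in \<open>auto simp: enn_rpow_ennreal ennreal_top_mult\<close>)
qed auto

lemma enn_rpow_rpow: "q \<noteq> 0 \<Longrightarrow> enn_rpow q (enn_rpow (1 / q) x) = x"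
  by (cases x) (auto simp: enn_rpow_ennreal powr_powr)

lemma enn_rpow_inverse_le_iff:
  assumes "0 < q"
  shows "enn_rpow (1 / q) x \<le> c \<longleftrightarrow> x \<le> enn_rpow q c"
proof
  assume "enn_rpow (1 / q) x \<le> c"
  from enn_rpow_mono[OF assms this] show "x \<le> enn_rpow q c"
    using assms by (simp add: enn_rpow_rpow)
next
  assume "x \<le> enn_rpow q c"
  from enn_rpow_mono[OF _ this, of "1 / q"] show "enn_rpow (1 / q) x \<le> c"
    using assms enn_rpow_rpow[of "1 / q" c] by simp
qed

lemma borel_measurable_enn_rpow [measurable]:
  assumes [measurable]: "f \<in> borel_measurable M"
  shows "(\<lambda>x. enn_rpow q (f x)) \<in> borel_measurable M"
proof -
  have [measurable]: "{x \<in> space M. f x = top} \<in> sets M"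
    by (rule borel_measurable_eq) auto
  show ?thesis unfolding enn_rpow_def by measurable
qed

text \<open>The norm of \<^const>\<open>Lp_norm\<close> for extended-valued functions, so that no finiteness has to be
  checked in the kernel estimates below.\<close>
definition LpN :: "ennreal \<Rightarrow> 'a measure \<Rightarrow> ('a \<Rightarrow> ennreal) \<Rightarrow> ennreal" where
  "LpN p M h = (if p = top then (INF c \<in> {c. AE x in M. h x \<le> c}. c)
     else enn_rpow (1 / enn2real p) (\<integral>\<^sup>+ x. enn_rpow (enn2real p) (h x) \<partial>M))"

lemma Lp_norm_eq_LpN:
  assumes "\<And>x. 0 \<le> h x"
  shows "Lp_norm p M h = LpN p M (\<lambda>x. ennreal (h x))"
  by (simp add: Lp_norm_def LpN_def enn_rpow_ennreal assms)

text \<open>The infimum of the almost-everywhere bounds is again such a bound: it is the infimum of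
  a sequence of them, and countably many null sets can be discarded together.\<close>

lemma AE_le_LpN_top: "AE x in M. h x \<le> LpN top M h"
proof -
  let ?S = "{c. AE x in M. h x \<le> c}"
  have "top \<in> ?S" by auto
  then have "?S \<noteq> {}" by blast
  then obtain f :: "nat \<Rightarrow> ennreal" where f: "range f \<subseteq> ?S" "Inf ?S = (INF i. f i)"
    using ennreal_Inf_countable_INF[of ?S] by metis
  have "AE x in M. \<forall>i. h x \<le> f i"
    using f(1) by (subst AE_all_countable) auto
  then show ?thesis
    by eventually_elim (use f(2) in \<open>auto simp: LpN_def intro!: INF_greatest\<close>)
qed

lemma LpN_top_le: "AE x in M. h x \<le> c \<Longrightarrow> LpN top M h \<le> c"
  unfolding LpN_def by (auto intro: Inf_lower)

lemma exponent_cases: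
  assumes "1 \<le> p"
  obtains "p = top" | q where "p = ennreal q" "1 \<le> q"
  using assms by (cases p) auto

lemma LpN_le_iff:
  assumes "1 \<le> q"
  shows "LpN (ennreal q) M h \<le> c \<longleftrightarrow> (\<integral>\<^sup>+ x. enn_rpow q (h x) \<partial>M) \<le> enn_rpow q c"
  using assms enn_rpow_inverse_le_iff[of q] by (simp add: LpN_def)

lemma LpN_power:
  assumes "1 \<le> q"
  shows "enn_rpow q (LpN (ennreal q) M h) = (\<integral>\<^sup>+ x. enn_rpow q (h x) \<partial>M)"
  using assms by (simp add: LpN_def enn_rpow_rpow)

lemma LpN_mono_AE:
  assumes "1 \<le> p" "AE x in M. f x \<le> g x"
  shows "LpN p M f \<le> LpN p M g"
  using assms(1)
proof (cases rule: exponent_cases)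
  case 1
  have "AE x in M. f x \<le> LpN top M g"
    using assms(2) AE_le_LpN_top[of g M] by eventually_elim auto
  then show ?thesis using 1 LpN_top_le by blast
next
  case (2 q)
  have "(\<integral>\<^sup>+ x. enn_rpow q (f x) \<partial>M) \<le> (\<integral>\<^sup>+ x. enn_rpow q (g x) \<partial>M)"
    using assms(2) by (intro nn_integral_mono_AE) (use 2 in \<open>auto elim!: eventually_mono intro!: enn_rpow_mono\<close>)
  then show ?thesis using 2 by (simp add: LpN_le_iff LpN_power)
qed

lemma LpN_mono: "1 \<le> p \<Longrightarrow> (\<And>x. x \<in> space M \<Longrightarrow> f x \<le> g x) \<Longrightarrow> LpN p M f \<le> LpN p M g"
  by (rule LpN_mono_AE) auto

lemma LpN_cmult_le:
  assumes "1 \<le> p" and [measurable]: "f \<in> borel_measurable M"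
  shows "LpN p M (\<lambda>x. c * f x) \<le> c * LpN p M f"
  using assms(1)
proof (cases rule: exponent_cases)
  case 1
  show ?thesis unfolding 1
    by (rule LpN_top_le, use AE_le_LpN_top[of f M] in eventually_elim) (auto intro: mult_left_mono)
next
  case (2 q)
  have "(\<integral>\<^sup>+ x. enn_rpow q (c * f x) \<partial>M) = enn_rpow q c * (\<integral>\<^sup>+ x. enn_rpow q (f x) \<partial>M)"
    by (simp add: enn_rpow_mult nn_integral_cmult)
  then show ?thesis using 2 by (simp add: LpN_le_iff LpN_power enn_rpow_mult)
qed

text \<open>The constant 4 instead of 1 suffices, as it does not depend on \<open>p\<close>.\<close>
lemma LpN_add_le:
  assumes "1 \<le> p" and [measurable]: "f \<in> borel_measurable M" "g \<in> borel_measurable M"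
  shows "LpN p M (\<lambda>x. f x + g x) \<le> 4 * (LpN p M f + LpN p M g)"
  using assms(1)
proof (cases rule: exponent_cases)
  case 1
  have "AE x in M. f x + g x \<le> LpN top M f + LpN top M g"
    using AE_le_LpN_top[of f M] AE_le_LpN_top[of g M] by eventually_elim (auto intro: add_mono)
  then have "LpN p M (\<lambda>x. f x + g x) \<le> 1 * (LpN p M f + LpN p M g)"
    using 1 LpN_top_le[of "\<lambda>x. f x + g x"] by simp
  also have "\<dots> \<le> 4 * (LpN p M f + LpN p M g)" by (intro mult_right_mono) auto
  finally show ?thesis .
next
  case (2 q)
  define m where "m = LpN p M f + LpN p M g"
  have *: "enn_rpow q (a + b) \<le> enn_rpow q 2 * (enn_rpow q a + enn_rpow q b)" for a b
  proof -
    have "a + b \<le> 2 * max a b" by (metis add_mono max.cobounded1 max.cobounded2 mult_2)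
    then have "enn_rpow q (a + b) \<le> enn_rpow q 2 * enn_rpow q (max a b)"
      using 2 enn_rpow_mono[of q] by (simp add: enn_rpow_mult[symmetric])
    also have "\<dots> \<le> enn_rpow q 2 * (enn_rpow q a + enn_rpow q b)"
      by (intro mult_left_mono) (auto simp: max_def)
    finally show ?thesis .
  qed
  have "(\<integral>\<^sup>+ x. enn_rpow q (f x + g x) \<partial>M) \<le> (\<integral>\<^sup>+ x. enn_rpow q 2 * (enn_rpow q (f x) + enn_rpow q (g x)) \<partial>M)"
    by (intro nn_integral_mono *)
  also have "\<dots> = enn_rpow q 2 * (enn_rpow q (LpN p M f) + enn_rpow q (LpN p M g))"
    using 2 by (simp add: nn_integral_cmult nn_integral_add LpN_power)
  also have "\<dots> \<le> enn_rpow q 2 * (enn_rpow q m + enn_rpow q m)"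
    using 2 by (intro mult_left_mono add_mono enn_rpow_mono) (auto simp: m_def)
  also have "\<dots> = enn_rpow q 2 * (2 * enn_rpow q m)" by (simp add: mult_2)
  also have "\<dots> \<le> enn_rpow q 2 * (enn_rpow q 2 * enn_rpow q m)"
  proof (intro mult_left_mono mult_right_mono)
    have "(2::real) powr 1 \<le> 2 powr q" using 2 by (intro powr_mono) auto
    then show "2 \<le> enn_rpow q 2" 
      using enn_rpow_ennreal[of 2 q] ennreal_leI[of 2 "2 powr q"] by simp
  qed auto
  also have "\<dots> = enn_rpow q (4 * m)"
  proof -
    have "(2::ennreal) * (2 * m) = 4 * m" 
      by (simp add: mult.assoc[symmetric])
    then show ?thesis by (metis enn_rpow_mult)
  qed
  finally show ?thesis using 2 by (simp add: LpN_le_iff m_def)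
qed

section \<open>Jensen's inequality and Schur's test\<close>

text \<open>Jensen's inequality for the measure with density \<open>k\<close>, up to the factor 2^q:
  integrate the elementary bound h \<le> s + s^(1-q) h^q against \<open>k\<close>. The loss becomes
  a factor 2 after the q-th root, uniformly in q.\<close>

lemma enn_rpow_nn_integral_le:
  assumes [measurable]: "k \<in> borel_measurable M" "h \<in> borel_measurable M"
    and k: "(\<integral>\<^sup>+ y. k y \<partial>M) \<le> ennreal C" and C: "0 < C" and q: "1 \<le> q"
  shows "enn_rpow q (\<integral>\<^sup>+ y. k y * h y \<partial>M)
    \<le> ennreal (2 powr q * C powr (q - 1)) * (\<integral>\<^sup>+ y. k y * enn_rpow q (h y) \<partial>M)"
proof -
  define X where "X = (\<integral>\<^sup>+ y. k y * enn_rpow q (h y) \<partial>M)"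
  consider "X = top" | "X = 0" | x where "X = ennreal x" "0 < x"
    by (cases X) (auto simp: less_le)
  then show ?thesis
  proof cases
    case 1
    then show ?thesis using C by (simp add: X_def[symmetric] ennreal_mult_top)
  next
    case 2
    then have "AE y in M. k y * enn_rpow q (h y) = 0"
      unfolding X_def by (subst (asm) nn_integral_0_iff_AE) auto
    then have "AE y in M. k y * h y = 0"
    proof eventually_elim
      case (elim y)
      have "h y = 0" if "enn_rpow q (h y) = 0" 
        using that q by (cases "h y") (auto simp: enn_rpow_ennreal)
      then show ?case using elim by auto
    qed
    then have "(\<integral>\<^sup>+ y. k y * h y \<partial>M) = 0" by (subst nn_integral_0_iff_AE) auto
    then show ?thesis by simp
  next
    case (3 x)
    \<comment> \<open>This value balances the two terms of the bound: s^(1-q) x = s C.\<close>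
    define s where "s = (x / C) powr (1 / q)"
    have s: "0 < s" "s powr q = x / C" using 3 C q by (auto simp: s_def powr_powr)
    have pt: "h y \<le> ennreal s + ennreal (s powr (1 - q)) * enn_rpow q (h y)" for y
    proof (cases "h y")
      case (real r)
      have "r \<le> s + s powr (1 - q) * r powr q"
      proof (cases "r \<le> s")
        case True then show ?thesis by (simp add: add_increasing2)
      next
        case False
        then have "s powr (1 - q) * r powr q = r * (r / s) powr (q - 1)"
          using s by (simp add: powr_diff powr_divide)
        also have "\<dots> \<ge> r * 1"
          using False s q by (intro mult_left_mono ge_one_powr_ge_zero) auto
        finally show ?thesis using s by simp
      qed
      then have "ennreal r \<le> ennreal (s + s powr (1 - q) * r powr q)" by (rule ennreal_leI)
      then show ?thesis using real s by (simp add: enn_rpow_ennreal ennreal_mult[symmetric])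
    qed (use s in \<open>auto simp: ennreal_mult_top\<close>)
    have "(\<integral>\<^sup>+ y. k y * h y \<partial>M) \<le> (\<integral>\<^sup>+ y. ennreal s * k y + ennreal (s powr (1 - q)) * (k y * enn_rpow q (h y)) \<partial>M)"
    proof (intro nn_integral_mono)
      fix y
      have "k y * h y \<le> k y * (ennreal s + ennreal (s powr (1 - q)) * enn_rpow q (h y))"
        by (intro mult_left_mono pt) auto
      also have "\<dots> = ennreal s * k y + ennreal (s powr (1 - q)) * (k y * enn_rpow q (h y))"
        by (simp add: algebra_simps)
      finally show "k y * h y \<le> \<dots>" .
    qed
    also have "\<dots> = ennreal s * (\<integral>\<^sup>+ y. k y \<partial>M) + ennreal (s powr (1 - q)) * X"
      by (simp add: nn_integral_add nn_integral_cmult X_def)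
    also have "\<dots> \<le> ennreal s * ennreal C + ennreal (s powr (1 - q)) * ennreal x"
      using 3 by (intro add_mono mult_left_mono k) auto
    also have "\<dots> = ennreal (s * C + s powr (1 - q) * x)"
      using s C 3 by (simp add: ennreal_mult[symmetric])
    also have "s powr (1 - q) * x = s * C"
      using s C 3 by (simp add: powr_diff)
    finally have "enn_rpow q (\<integral>\<^sup>+ y. k y * h y \<partial>M) \<le> enn_rpow q (ennreal (2 * s * C))"
      using q by (intro enn_rpow_mono) (auto simp: mult_ac)
    also have "\<dots> = ennreal (2 powr q * (s powr q * C powr q))"
      using s C by (subst enn_rpow_ennreal) (auto simp: powr_mult mult_ac)
    also have "2 powr q * (s powr q * C powr q) = 2 powr q * C powr (q - 1) * x"
      using C by (simp add: s powr_diff)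
    finally show ?thesis using 3 C by (simp add: X_def[symmetric] ennreal_mult)
  qed
qed

text \<open>For finite exponents, Jensen on each row, an exchange of integrals and the column bound;
  the constants combine to (2C)^q, whose root does not depend on q. Two arbitrary sigma-finite
  measures are allowed so that one test serves integrals over phase space as well as sums over
  \<Gamma> and over index pairs.\<close>

lemma Schur_test:
  assumes "sigma_finite_measure M" "sigma_finite_measure N"
    and k [measurable]: "(\<lambda>(x, y). k x y) \<in> borel_measurable (N \<Otimes>\<^sub>M M)"
    and h [measurable]: "h \<in> borel_measurable M"
    and row: "\<And>x. x \<in> space N \<Longrightarrow> (\<integral>\<^sup>+ y. k x y \<partial>M) \<le> ennreal C"
    and col: "\<And>y. y \<in> space M \<Longrightarrow> (\<integral>\<^sup>+ x. k x y \<partial>N) \<le> ennreal C"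
    and C: "0 < C" and p: "1 \<le> p"
  shows "LpN p N (\<lambda>x. \<integral>\<^sup>+ y. k x y * h y \<partial>M) \<le> ennreal (2 * C) * LpN p M h"
  using p
proof (cases rule: exponent_cases)
  interpret M: sigma_finite_measure M by fact
  interpret N: sigma_finite_measure N by fact
  interpret NM: pair_sigma_finite N M ..
  case 1
  have "(\<integral>\<^sup>+ y. k x y * h y \<partial>M) \<le> ennreal (2 * C) * LpN p M h" if x[measurable]: "x \<in> space N" for x
  proof -
    have [measurable]: "k x \<in> borel_measurable M"
      using measurable_compose[OF measurable_Pair1'[OF x] k] by simp
    have "(\<integral>\<^sup>+ y. k x y * h y \<partial>M) \<le> (\<integral>\<^sup>+ y. k x y * LpN p M h \<partial>M)"
      using AE_le_LpN_top[of h M] by (intro nn_integral_mono_AE) (auto elim!: eventually_mono intro: mult_left_mono simp: 1)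
    also have "\<dots> = (\<integral>\<^sup>+ y. k x y \<partial>M) * LpN p M h" by (rule nn_integral_multc) measurable
    also have "\<dots> \<le> ennreal (2 * C) * LpN p M h"
      using C by (intro mult_right_mono order_trans[OF row[OF x]]) (auto intro!: ennreal_leI)
    finally show ?thesis .
  qed
  then show ?thesis unfolding 1 by (intro LpN_top_le AE_I2)
next
  interpret M: sigma_finite_measure M by fact
  interpret N: sigma_finite_measure N by fact
  interpret NM: pair_sigma_finite N M ..
  case (2 q)
  let ?c = "2 powr q * C powr (q - 1)"
  have "(\<integral>\<^sup>+ x. enn_rpow q (\<integral>\<^sup>+ y. k x y * h y \<partial>M) \<partial>N)
     \<le> (\<integral>\<^sup>+ x. ennreal ?c * (\<integral>\<^sup>+ y. k x y * enn_rpow q (h y) \<partial>M) \<partial>N)"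
  proof (intro nn_integral_mono)
    fix x assume x: "x \<in> space N"
    have [measurable]: "k x \<in> borel_measurable M"
      using measurable_compose[OF measurable_Pair1'[OF x] k] by simp
    show "enn_rpow q (\<integral>\<^sup>+ y. k x y * h y \<partial>M) \<le> ennreal ?c * (\<integral>\<^sup>+ y. k x y * enn_rpow q (h y) \<partial>M)"
      using 2 C by (intro enn_rpow_nn_integral_le row x) auto
  qed
  also have "\<dots> = ennreal ?c * (\<integral>\<^sup>+ x. (\<integral>\<^sup>+ y. k x y * enn_rpow q (h y) \<partial>M) \<partial>N)"
    by (intro nn_integral_cmult) measurable
  also have "(\<integral>\<^sup>+ x. (\<integral>\<^sup>+ y. k x y * enn_rpow q (h y) \<partial>M) \<partial>N) = (\<integral>\<^sup>+ y. (\<integral>\<^sup>+ x. k x y * enn_rpow q (h y) \<partial>N) \<partial>M)"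
    by (intro NM.Fubini'[symmetric]) measurable
  also have "\<dots> \<le> (\<integral>\<^sup>+ y. ennreal C * enn_rpow q (h y) \<partial>M)"
  proof (intro nn_integral_mono)
    fix y assume y: "y \<in> space M"
    have [measurable]: "(\<lambda>x. k x y) \<in> borel_measurable N"
      using measurable_compose[OF measurable_Pair2'[OF y] k] by simp
    have "(\<integral>\<^sup>+ x. k x y * enn_rpow q (h y) \<partial>N) = (\<integral>\<^sup>+ x. k x y \<partial>N) * enn_rpow q (h y)"
      by (rule nn_integral_multc) measurable
    also have "\<dots> \<le> ennreal C * enn_rpow q (h y)" by (intro mult_right_mono col y) auto
    finally show "(\<integral>\<^sup>+ x. k x y * enn_rpow q (h y) \<partial>N) \<le> \<dots>" .
  qed
  also have "\<dots> = ennreal C * (\<integral>\<^sup>+ y. enn_rpow q (h y) \<partial>M)" by (intro nn_integral_cmult) measurable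
  finally have "(\<integral>\<^sup>+ x. enn_rpow q (\<integral>\<^sup>+ y. k x y * h y \<partial>M) \<partial>N)
     \<le> ennreal ?c * (ennreal C * (\<integral>\<^sup>+ y. enn_rpow q (h y) \<partial>M))" by (simp add: mult_left_mono)
  also have "\<dots> = ennreal (?c * C) * (\<integral>\<^sup>+ y. enn_rpow q (h y) \<partial>M)"
    using C by (simp add: ennreal_mult mult.assoc)
  also have "?c * C = (2 * C) powr q" using C by (simp add: powr_mult powr_diff)
  also have "ennreal \<dots> = enn_rpow q (ennreal (2 * C))" using C by (subst enn_rpow_ennreal) auto
  finally show ?thesis using 2 by (simp add: LpN_le_iff enn_rpow_mult LpN_power)
qed

section \<open>Weighted convolution inequalities\<close>

lemma nn_integral_translate:
  fixes f :: "'a::euclidean_space \<Rightarrow> ennreal"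
  assumes [measurable]: "f \<in> borel_measurable borel"
  shows "(\<integral>\<^sup>+ x. f (x + c) \<partial>lborel) = (\<integral>\<^sup>+ x. f x \<partial>lborel)"
proof -
  have "(\<integral>\<^sup>+ x. f x \<partial>lborel) = (\<integral>\<^sup>+ x. f x \<partial>(distr lborel borel ((+) c)))"
    by (simp add: lborel_distr_plus)
  then show ?thesis by (simp add: nn_integral_distr add.commute)
qed

lemma nn_integral_translate':
  fixes f :: "'a::euclidean_space \<Rightarrow> ennreal"
  assumes "f \<in> borel_measurable borel"
  shows "(\<integral>\<^sup>+ x. f (x - c) \<partial>lborel) = (\<integral>\<^sup>+ x. f x \<partial>lborel)"
  using nn_integral_translate[OF assms, of "- c"] by simp

lemma nn_integral_reflect:
  fixes f :: "'a::euclidean_space \<Rightarrow> ennreal"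
  assumes [measurable]: "f \<in> borel_measurable borel"
  shows "(\<integral>\<^sup>+ x. f (c - x) \<partial>lborel) = (\<integral>\<^sup>+ x. f x \<partial>lborel)"
proof -
  have "(\<integral>\<^sup>+ x. f x \<partial>lborel) = (\<integral>\<^sup>+ x. f x \<partial>(density (distr lborel borel (\<lambda>x. c + (- 1) *\<^sub>R x)) (\<lambda>_. \<bar>-1::real\<bar> ^ DIM('a))))"
    by (subst lborel_affine[of "-1" c]) simp_all
  then show ?thesis by (simp add: nn_integral_distr nn_integral_density)
qed

lemma emeasure_unit_ball:
  "0 < emeasure lborel (ball (x::'a::euclidean_space) 1)" "emeasure lborel (ball x 1) < \<infinity>"
  using content_ball_pos[of 1 x] emeasure_bounded_finite[of "ball x 1"]
  by (auto simp: emeasure_eq_ennreal_measure zero_less_iff_neq_zero emeasure_lborel_ball_finite)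

definition unit_vol :: "'a::euclidean_space itself \<Rightarrow> real" where
  "unit_vol _ = measure lborel (ball (0::'a) 1)"

lemma unit_vol_pos: "0 < unit_vol TYPE('a::euclidean_space)"
  using content_ball_pos[of 1 "0::'a"] by (simp add: unit_vol_def)

lemma emeasure_ball_unit_vol:
  "emeasure lborel (ball (x::'a::euclidean_space) 1) = ennreal (unit_vol TYPE('a))"
  using emeasure_unit_ball[of x] content_ball[of 1 x] content_ball[of 1 "0::'a"]
  by (simp add: unit_vol_def emeasure_eq_ennreal_measure)

lemma pred_mem_ball [measurable]: "Measurable.pred borel (\<lambda>y. y \<in> ball (x::'a::metric_space) r)"
  unfolding pred_def using borel_open[OF open_ball[of x r]] by (simp del: mem_ball)

lemma nn_integral_ball:
  "(\<integral>\<^sup>+ y. indicator (ball (x::'a::euclidean_space) 1) y * c \<partial>lborel) = ennreal (unit_vol TYPE('a)) * c"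
  by (subst nn_integral_multc) (auto simp: emeasure_ball_unit_vol)

lemma one_plus_power_le_exp:
  fixes s :: real
  assumes "0 < s"
  obtains C where "0 < C" "\<And>x. 0 \<le> x \<Longrightarrow> (1 + x) ^ N \<le> C * exp (s * x)"
proof -
  \<comment> \<open>The argument raises t (1 + x) \<le> 1 + t x \<le> exp (t x) to the power N,
    which requires t \<le> 1 and N t \<le> s.\<close>
  define t where "t = min 1 (s / (real N + 1))"
  have t: "0 < t" "t \<le> 1" "real N * t \<le> s"
    using assms by (auto simp: t_def min_def field_simps split: if_splits)
  show ?thesis
  proof
    show "0 < (1 / t) ^ N" using t by simp
    fix x :: real assume x: "0 \<le> x"
    have "t * (1 + x) \<le> 1 + t * x" using t by (simp add: algebra_simps)
    also have "\<dots> \<le> exp (t * x)" by (rule exp_ge_add_one_self)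
    finally have "1 + x \<le> exp (t * x) / t" using t by (simp add: field_simps)
    then have "(1 + x) ^ N \<le> (exp (t * x) / t) ^ N" using x by (intro power_mono) auto
    also have "\<dots> = (1 / t) ^ N * exp (real N * t * x)"
      by (simp add: power_divide exp_of_nat_mult[symmetric] mult.assoc)
    also have "\<dots> \<le> (1 / t) ^ N * exp (s * x)"
      using t x by (intro mult_left_mono) (auto intro: mult_right_mono)
    finally show "(1 + x) ^ N \<le> (1 / t) ^ N * exp (s * x)" .
  qed
qed

lemma nn_integral_exp_abs_finite:
  assumes "0 < (t::real)"
  shows "(\<integral>\<^sup>+ x. ennreal (exp (- (t * \<bar>x\<bar>))) \<partial>lborel) < \<infinity>"
proof -
  define I where "I = (\<integral>\<^sup>+ x. ennreal (exp (- (t * x))) * indicator {0..} x \<partial>lborel)"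
  have "(\<integral>\<^sup>+ x. ennreal (x ^ 0 * exp (- x)) * indicator {0..} x \<partial>lborel) = ennreal (real_of_nat (fact 0))"
    by (rule nn_intergal_power_times_exp_Ici)
  then have "1 = (\<integral>\<^sup>+ x. ennreal (exp (- x)) * indicator {0..} x \<partial>lborel)" by simp
  also have "\<dots> = t * (\<integral>\<^sup>+ x. ennreal (exp (- (0 + t * x))) * indicator {0..} (0 + t * x) \<partial>lborel)"
    using assms by (subst nn_integral_real_affine[where c=t and t=0]) auto
  also have "(\<integral>\<^sup>+ x. ennreal (exp (- (0 + t * x))) * indicator {0..} (0 + t * x) \<partial>lborel) = I"
    unfolding I_def using assms by (intro nn_integral_cong) (auto simp: indicator_def zero_le_mult_iff)
  finally have I: "I < \<infinity>"
    using assms by (cases I) (auto simp: ennreal_mult_top)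
  have "(\<integral>\<^sup>+ x. ennreal (exp (- (t * \<bar>x\<bar>))) \<partial>lborel) \<le>
      (\<integral>\<^sup>+ x. ennreal (exp (- (t * x))) * indicator {0..} x + ennreal (exp (- (t * (- x)))) * indicator {0..} (- x) \<partial>lborel)"
    by (intro nn_integral_mono) (auto simp: indicator_def abs_if)
  also have "\<dots> = I + (\<integral>\<^sup>+ x. ennreal (exp (- (t * (- x)))) * indicator {0..} (- x) \<partial>lborel)"
    by (subst nn_integral_add) (auto simp: I_def)
  also have "(\<integral>\<^sup>+ x. ennreal (exp (- (t * (- x)))) * indicator {0..} (- x) \<partial>lborel) = I"
    using nn_integral_reflect[of "\<lambda>x. ennreal (exp (- (t * x))) * indicator {0..} x" "0::real"]
    by (simp add: I_def)
  finally show ?thesis using I by (simp add: ennreal_add_eq_top less_top top_unique order.strict_trans1)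
qed

text \<open>The l^1 norm is at most the dimension times the Euclidean norm, so the integrand is
  dominated by a product of one-dimensional exponentials.\<close>

lemma nn_integral_exp_norm_finite:
  assumes "0 < s"
  shows "(\<integral>\<^sup>+ z. ennreal (exp (- (s * norm (z::'a::euclidean_space)))) \<partial>lborel) < \<infinity>"
proof -
  define t where "t = s / DIM('a)"
  have t: "0 < t" using assms by (simp add: t_def)
  have "ennreal (exp (- (s * norm z))) \<le> (\<Prod>b\<in>Basis. ennreal (exp (- (t * \<bar>z \<bullet> b\<bar>))))" for z :: 'a
  proof -
    have "(\<Sum>b\<in>Basis. t * \<bar>z \<bullet> b\<bar>) \<le> (\<Sum>b\<in>(Basis::'a set). t * norm z)"
      using t by (intro sum_mono mult_left_mono Basis_le_norm) auto
    also have "\<dots> = s * norm z" by (simp add: t_def)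
    finally have "exp (- (s * norm z)) \<le> exp (\<Sum>b\<in>Basis. - (t * \<bar>z \<bullet> b\<bar>))"
      by (simp add: sum_negf)
    also have "\<dots> = (\<Prod>b\<in>Basis. exp (- (t * \<bar>z \<bullet> b\<bar>)))" by (simp add: exp_sum)
    finally show ?thesis by (simp add: prod_ennreal ennreal_leI)
  qed
  then have "(\<integral>\<^sup>+ z. ennreal (exp (- (s * norm (z::'a)))) \<partial>lborel)
     \<le> (\<integral>\<^sup>+ z. (\<Prod>b\<in>Basis. ennreal (exp (- (t * \<bar>z \<bullet> b\<bar>)))) \<partial>(lborel :: 'a measure))"
    by (intro nn_integral_mono) auto
  also have "\<dots> = (\<Prod>b\<in>(Basis :: 'a set). \<integral>\<^sup>+ x. ennreal (exp (- (t * \<bar>x\<bar>))) \<partial>lborel)"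
    by (rule nn_integral_lborel_prod) auto
  also have "\<dots> < \<infinity>"
    using nn_integral_exp_abs_finite[OF t] by (simp add: power_less_top_ennreal)
  finally show ?thesis .
qed

section \<open>Slowly varying functions and sums over separated sets\<close>

text \<open>Control of the oscillation at unit scale. It allows point values to be replaced by
  unit-ball averages, and sums over \<Gamma> by integrals.\<close>

definition slowly_varying :: "real \<Rightarrow> ('a::real_normed_vector \<Rightarrow> ennreal) \<Rightarrow> bool" where
  "slowly_varying c \<theta> \<longleftrightarrow> (\<forall>z u. norm u \<le> 1 \<longrightarrow> \<theta> (z + u) \<le> ennreal c * \<theta> z)"

lemma slowly_varying_local_average:
  fixes \<theta> :: "'a::euclidean_space \<Rightarrow> ennreal"
  assumes "slowly_varying c \<theta>" "0 \<le> c" and [measurable]: "\<theta> \<in> borel_measurable borel"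
  shows "\<theta> z \<le> ennreal (c / unit_vol TYPE('a)) * (\<integral>\<^sup>+ y. indicator (ball z 1) y * \<theta> y \<partial>lborel)"
proof -
  have "ennreal (unit_vol TYPE('a)) * \<theta> z = (\<integral>\<^sup>+ y. indicator (ball z 1) y * \<theta> z \<partial>lborel)"
    by (simp add: nn_integral_ball)
  also have "\<dots> \<le> (\<integral>\<^sup>+ y. ennreal c * (indicator (ball z 1) y * \<theta> y) \<partial>lborel)"
  proof (intro nn_integral_mono)
    fix y
    have "\<theta> z \<le> ennreal c * \<theta> y" if "y \<in> ball z 1"
      using assms(1)[unfolded slowly_varying_def, rule_format, of "z - y" y] that by (simp add: dist_norm)
    then show "indicator (ball z 1) y * \<theta> z \<le> ennreal c * (indicator (ball z 1) y * \<theta> y)"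
      by (auto simp: indicator_def)
  qed
  also have "\<dots> = ennreal c * (\<integral>\<^sup>+ y. indicator (ball z 1) y * \<theta> y \<partial>lborel)"
    by (rule nn_integral_cmult) measurable
  finally have "ennreal (1 / unit_vol TYPE('a)) * (ennreal (unit_vol TYPE('a)) * \<theta> z)
      \<le> ennreal (1 / unit_vol TYPE('a)) * (ennreal c * (\<integral>\<^sup>+ y. indicator (ball z 1) y * \<theta> y \<partial>lborel))"
    by (rule mult_left_mono) simp
  then show ?thesis
    using unit_vol_pos[where 'a='a] assms(2) 
    by (simp add: mult.assoc[symmetric] ennreal_mult[symmetric])
qed

definition separated_by :: "nat \<Rightarrow> 'a::real_normed_vector set \<Rightarrow> bool" where
  "separated_by K \<Gamma> \<longleftrightarrow> (\<forall>z. finite (\<Gamma> \<inter> ball z 1) \<and> card (\<Gamma> \<inter> ball z 1) \<le> K)"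

text \<open>Unit balls around a countable dense set cover \<Gamma> and each holds finitely many of
  its points. Countability makes counting measure on \<Gamma> sigma-finite, on which the exchanges
  of sums and integrals rest.\<close>

lemma separated_by_countable:
  fixes \<Gamma> :: "'a::euclidean_space set"
  assumes "separated_by K \<Gamma>" shows "countable \<Gamma>"
proof -
  obtain D :: "'a set" where D: "countable D" "\<And>X. open X \<Longrightarrow> X \<noteq> {} \<Longrightarrow> \<exists>d\<in>D. d \<in> X"
    using countable_dense_exists by metis
  have "\<Gamma> \<subseteq> (\<Union>d\<in>D. \<Gamma> \<inter> ball d 1)"
  proof
    fix x assume "x \<in> \<Gamma>"
    then show "x \<in> (\<Union>d\<in>D. \<Gamma> \<inter> ball d 1)"
      using D(2)[of "ball x 1"] by (auto simp: dist_commute)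
  qed
  moreover have "countable (\<Union>d\<in>D. \<Gamma> \<inter> ball d 1)"
    using D(1) assms by (intro countable_UN) (auto simp: separated_by_def intro: countable_finite)
  ultimately show ?thesis by (rule countable_subset)
qed

lemma sigma_finite_count: "countable A \<Longrightarrow> sigma_finite_measure (count_space A)"
  by (rule sigma_finite_measure_count_space_countable)

lemma measurable_count_pair:
  fixes f :: "'a \<Rightarrow> 'b \<Rightarrow> ennreal"
  assumes "countable A" "\<And>i. i \<in> A \<Longrightarrow> f i \<in> borel_measurable M"
  shows "(\<lambda>(i, x). f i x) \<in> borel_measurable (count_space A \<Otimes>\<^sub>M M)"
  using assms by (intro measurable_pair_measure_countable1) auto

lemma measurable_count_pair':
  fixes f :: "'b \<Rightarrow> 'a \<Rightarrow> ennreal"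
  assumes "countable A" "\<And>i. i \<in> A \<Longrightarrow> (\<lambda>x. f x i) \<in> borel_measurable M"
  shows "(\<lambda>(x, i). f x i) \<in> borel_measurable (M \<Otimes>\<^sub>M count_space A)"
  using measurable_compose[OF measurable_pair_swap' measurable_count_pair[OF assms(1), of "\<lambda>i x. f x i"]] assms(2)
  by (simp add: case_prod_beta)

lemma count_space_Fubini:
  fixes f :: "'a \<Rightarrow> 'b::euclidean_space \<Rightarrow> ennreal"
  assumes "countable A" "\<And>i. i \<in> A \<Longrightarrow> f i \<in> borel_measurable lborel"
  shows "(\<integral>\<^sup>+ i. (\<integral>\<^sup>+ x. f i x \<partial>lborel) \<partial>count_space A) = (\<integral>\<^sup>+ x. (\<integral>\<^sup>+ i. f i x \<partial>count_space A) \<partial>lborel)"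
proof -
  interpret A: sigma_finite_measure "count_space A" by (rule sigma_finite_count) fact
  interpret pair_sigma_finite "count_space A" "lborel :: 'b measure" ..
  show ?thesis by (rule Fubini'[symmetric, OF measurable_count_pair[OF assms]])
qed

lemma borel_measurable_count_integral:
  fixes f :: "'a \<Rightarrow> 'b::euclidean_space \<Rightarrow> ennreal"
  assumes "countable A" "\<And>i. i \<in> A \<Longrightarrow> f i \<in> borel_measurable lborel"
  shows "(\<lambda>x. \<integral>\<^sup>+ i. f i x \<partial>count_space A) \<in> borel_measurable lborel"
proof -
  interpret A: sigma_finite_measure "count_space A" by (rule sigma_finite_count) fact
  show ?thesis
    by (rule A.borel_measurable_nn_integral) (rule measurable_count_pair'[OF assms])
qed

text \<open>Each term is compared with an average over the unit ball around \<gamma>, and a point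
  lies in at most \<open>K\<close> of these balls. The second function \<open>\<theta>'\<close> is
  there for truncated tails: a tail beyond radius r is comparable only with the tail beyond r -
  1.\<close>

lemma separated_sum_le:
  fixes \<theta> \<theta>' :: "'a::euclidean_space \<Rightarrow> ennreal"
  assumes \<Gamma>: "separated_by K \<Gamma>" and c: "0 \<le> c"
    and \<theta>: "\<And>z u. norm u < 1 \<Longrightarrow> \<theta> (z + u) \<le> ennreal c * \<theta>' z"
    and [measurable]: "\<theta>' \<in> borel_measurable borel"
  shows "(\<integral>\<^sup>+ \<gamma>. \<theta> (x - \<gamma>) \<partial>count_space \<Gamma>) \<le> ennreal (c * K / unit_vol TYPE('a)) * (\<integral>\<^sup>+ z. \<theta>' z \<partial>lborel)"
proof -
  let ?V = "unit_vol TYPE('a)"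
  have "ennreal ?V * (\<integral>\<^sup>+ \<gamma>. \<theta> (x - \<gamma>) \<partial>count_space \<Gamma>)
     = (\<integral>\<^sup>+ \<gamma>. (\<integral>\<^sup>+ y. indicator (ball \<gamma> 1) y * \<theta> (x - \<gamma>) \<partial>lborel) \<partial>count_space \<Gamma>)"
    by (simp add: nn_integral_ball nn_integral_cmult)
  also have "\<dots> \<le> (\<integral>\<^sup>+ \<gamma>. (\<integral>\<^sup>+ y. indicator (ball \<gamma> 1) y * (ennreal c * \<theta>' (x - y)) \<partial>lborel) \<partial>count_space \<Gamma>)"
  proof (intro nn_integral_mono)
    fix \<gamma> y
    have "\<theta> (x - \<gamma>) \<le> ennreal c * \<theta>' (x - y)" if "y \<in> ball \<gamma> 1"
      using \<theta>[of "y - \<gamma>" "x - y"] that by (simp add: dist_norm norm_minus_commute)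
    then show "indicator (ball \<gamma> 1) y * \<theta> (x - \<gamma>) \<le> indicator (ball \<gamma> 1) y * (ennreal c * \<theta>' (x - y))"
      by (auto simp: indicator_def)
  qed
  also have "\<dots> = (\<integral>\<^sup>+ y. (\<integral>\<^sup>+ \<gamma>. indicator (ball \<gamma> 1) y * (ennreal c * \<theta>' (x - y)) \<partial>count_space \<Gamma>) \<partial>lborel)"
    by (intro count_space_Fubini separated_by_countable[OF \<Gamma>]) measurable
  also have "\<dots> \<le> (\<integral>\<^sup>+ y. ennreal K * (ennreal c * \<theta>' (x - y)) \<partial>lborel)"
  proof (intro nn_integral_mono)
    fix y
    have fin: "finite (\<Gamma> \<inter> ball y 1)" "card (\<Gamma> \<inter> ball y 1) \<le> K" using \<Gamma> by (auto simp: separated_by_def)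
    have "(\<integral>\<^sup>+ \<gamma>. indicator (ball \<gamma> 1) y \<partial>count_space \<Gamma>) = (\<integral>\<^sup>+ \<gamma>. indicator (\<Gamma> \<inter> ball y 1) \<gamma> \<partial>count_space \<Gamma>)"
      by (intro nn_integral_cong) (auto simp: indicator_def dist_commute)
    also have "\<dots> = ennreal (card (\<Gamma> \<inter> ball y 1))"
      using fin by (simp add: ennreal_of_nat_eq_real_of_nat)
    also have "\<dots> \<le> ennreal K" using fin by (intro ennreal_leI) auto
    finally show "(\<integral>\<^sup>+ \<gamma>. indicator (ball \<gamma> 1) y * (ennreal c * \<theta>' (x - y)) \<partial>count_space \<Gamma>) \<le> ennreal K * (ennreal c * \<theta>' (x - y))"
      by (simp add: nn_integral_multc mult_right_mono)
  qed
  also have "\<dots> = ennreal (c * K) * (\<integral>\<^sup>+ z. \<theta>' z \<partial>lborel)"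
    using c by (simp add: nn_integral_cmult nn_integral_reflect ennreal_mult mult_ac)
  finally have "ennreal (1 / ?V) * (ennreal ?V * (\<integral>\<^sup>+ \<gamma>. \<theta> (x - \<gamma>) \<partial>count_space \<Gamma>))
     \<le> ennreal (1 / ?V) * (ennreal (c * K) * (\<integral>\<^sup>+ z. \<theta>' z \<partial>lborel))"
    by (rule mult_left_mono) simp
  then show ?thesis
    using unit_vol_pos[where 'a='a] c
    by (simp add: mult.assoc[symmetric] ennreal_mult[symmetric])
qed

lemma enn_rpow_half_sq: "(enn_rpow (1/2) x)\<^sup>2 = x"
proof (cases x)
  case (real r)
  then show ?thesis by (simp add: enn_rpow_ennreal ennreal_power powr_half_sqrt)
qed simp

lemma enn_rpow_half_le: "x \<le> y\<^sup>2 \<Longrightarrow> enn_rpow (1/2) x \<le> y"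
proof (cases y)
  case (real r)
  assume *: "x \<le> y\<^sup>2"
  have "enn_rpow (1/2) x \<le> enn_rpow (1/2) (y\<^sup>2)" using * by (intro enn_rpow_mono) auto
  also have "\<dots> = y" using real by (simp add: ennreal_power enn_rpow_ennreal powr_half_sqrt)
  finally show ?thesis .
qed auto

lemma Cauchy_Schwarz_enn:
  assumes "f \<in> borel_measurable M" "g \<in> borel_measurable M"
  shows "(\<integral>\<^sup>+x. f x * g x \<partial>M) \<le> enn_rpow (1/2) (\<integral>\<^sup>+x. (f x)\<^sup>2 \<partial>M) * enn_rpow (1/2) (\<integral>\<^sup>+x. (g x)\<^sup>2 \<partial>M)"
proof -
  have *: "a \<le> b" if "a\<^sup>2 \<le> b\<^sup>2" for a b :: ennreal
    using that by (cases a; cases b) (auto simp: ennreal_power top_unique intro!: power2_le_imp_le)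
  show ?thesis
    by (rule *) (simp add: power_mult_distrib enn_rpow_half_sq Cauchy_Schwarz_nn_integral[OF assms])
qed

section \<open>Polynomially growing weights and weighted Young inequalities\<close>

locale poly_weight =
  fixes w :: "'a::euclidean_space \<Rightarrow> real"
  assumes w_cont: "continuous_on UNIV w"
    and w_ge1: "1 \<le> w z"
    and w_even: "w (- z) = w z"
    and w_sub: "w (z + z') \<le> w z * w z'"
    and w_poly: "\<exists>C (N::nat). \<forall>z. w z \<le> C * (1 + norm z) ^ N"
begin

lemma w_borel [measurable]: "w \<in> borel_measurable borel"
  by (rule borel_measurable_continuous_onI[OF w_cont])

lemma w_pos: "0 < w z" using w_ge1[of z] by simp

lemma w_nonneg [simp]: "0 \<le> w z" using w_pos[of z] by simp

lemma w_diff_commute: "w (x - y) = w (y - x)"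
  using w_even[of "x - y"] by simp

lemma w_le_exp:
  assumes "0 < s"
  obtains C where "0 < C" "\<And>z. w z \<le> C * exp (s * norm z)"
proof -
  obtain C N where C: "\<And>z. w z \<le> C * (1 + norm z) ^ N" using w_poly by metis
  obtain D where D: "0 < D" "\<And>x. 0 \<le> x \<Longrightarrow> (1 + x) ^ N \<le> D * exp (s * x)"
    using one_plus_power_le_exp[OF assms] by metis
  have "0 < C" using C[of 0] w_ge1[of 0] by simp
  have "w z \<le> C * D * exp (s * norm z)" for z
    using order_trans[OF C[of z] mult_left_mono[OF D(2)[of "norm z"], of C]] \<open>0 < C\<close> by (simp add: mult.assoc)
  with \<open>0 < C\<close> \<open>0 < D\<close> show ?thesis by (intro that[of "C * D"]) auto
qed

definition w_unit_bound :: real where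
  "w_unit_bound = (SOME c. 1 \<le> c \<and> (\<forall>u. norm u \<le> 1 \<longrightarrow> w u \<le> c))"

lemma w_unit_bound: "1 \<le> w_unit_bound" "norm u \<le> 1 \<Longrightarrow> w u \<le> w_unit_bound"
proof -
  obtain C where C: "0 < C" "\<And>z. w z \<le> C * exp (1 * norm z)" using w_le_exp[of 1] by auto
  have "w u \<le> C * exp 1" if "norm u \<le> 1" for u
    using C(2)[of u] that C(1) by (auto elim!: order_trans intro!: mult_left_mono)
  then have "\<exists>c. 1 \<le> c \<and> (\<forall>u. norm u \<le> 1 \<longrightarrow> w u \<le> c)"
    by (intro exI[of _ "max 1 (C * exp 1)"]) (auto simp: le_max_iff_disj)
  then have "1 \<le> w_unit_bound \<and> (\<forall>u. norm u \<le> 1 \<longrightarrow> w u \<le> w_unit_bound)" unfolding w_unit_bound_def by (rule someI_ex)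
  then show "1 \<le> w_unit_bound" "norm u \<le> 1 \<Longrightarrow> w u \<le> w_unit_bound" by auto
qed

definition wnorm1 :: "('a \<Rightarrow> ennreal) \<Rightarrow> ennreal" where
  "wnorm1 \<theta> = (\<integral>\<^sup>+ z. \<theta> z * ennreal (w z) \<partial>lborel)"

lemma nn_integral_le_wnorm1: "(\<integral>\<^sup>+ z. \<theta> z \<partial>lborel) \<le> wnorm1 \<theta>"
  unfolding wnorm1_def
proof (intro nn_integral_mono)
  fix z show "\<theta> z \<le> \<theta> z * ennreal (w z)"
    using mult_left_mono[of 1 "ennreal (w z)" "\<theta> z"] ennreal_leI[OF w_ge1[of z]] by simp
qed

lemma wnorm1_exp_finite:
  assumes "0 < s"
  shows "wnorm1 (\<lambda>z. ennreal (exp (- (s * norm z)))) < \<infinity>"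
proof -
  obtain C where C: "0 < C" "\<And>z. w z \<le> C * exp (s / 2 * norm z)" using w_le_exp[of "s / 2"] assms by auto
  have "wnorm1 (\<lambda>z. ennreal (exp (- (s * norm z)))) \<le> (\<integral>\<^sup>+ z. ennreal C * ennreal (exp (- (s / 2 * norm (z::'a)))) \<partial>lborel)"
    unfolding wnorm1_def
  proof (intro nn_integral_mono)
    fix z :: 'a
    have "exp (- (s * norm z)) * w z \<le> exp (- (s * norm z)) * (C * exp (s / 2 * norm z))"
      by (intro mult_left_mono C) auto
    also have "\<dots> = C * exp (- (s / 2 * norm z))" by (simp add: exp_add[symmetric] mult_ac)
    finally show "ennreal (exp (- (s * norm z))) * ennreal (w z) \<le> ennreal C * ennreal (exp (- (s / 2 * norm z)))"
      using C(1) by (simp add: ennreal_mult[symmetric] ennreal_leI)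
  qed
  also have "\<dots> = ennreal C * (\<integral>\<^sup>+ z. ennreal (exp (- (s / 2 * norm (z::'a)))) \<partial>lborel)"
    by (rule nn_integral_cmult) measurable
  also have "\<dots> < \<infinity>"
    using nn_integral_exp_norm_finite[of "s / 2", where 'a='a] assms by (simp add: ennreal_mult_less_top)
  finally show ?thesis .
qed

definition moderated :: "real \<Rightarrow> ('a \<Rightarrow> real) \<Rightarrow> bool" where
  "moderated Cv v \<longleftrightarrow> v \<in> borel_measurable borel \<and> (\<forall>z. 0 < v z) \<and> (\<forall>z z'. v (z + z') \<le> Cv * w z * v z')"

lemma moderated_Cv_pos: "moderated Cv v \<Longrightarrow> 0 < Cv"
  unfolding moderated_def by (metis add_0 less_le_trans w_pos zero_less_mult_pos2)

text \<open>Moderateness, v x \<le> Cv w(x - y) v y, moves the weight from the output to the input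
  at the price of multiplying the kernel by w. Since v enters only through this inequality, the
  constant depends on v only through \<open>Cv\<close>.\<close>

lemma weighted_Schur:
  fixes k :: "'a \<Rightarrow> 'a \<Rightarrow> ennreal"
  assumes v: "moderated Cv v"
    and MN: "sigma_finite_measure M" "sigma_finite_measure N"
    and [measurable]: "(\<lambda>(x, y). k x y) \<in> borel_measurable (N \<Otimes>\<^sub>M M)"
      "(\<lambda>(x, y). ennreal (w (x - y))) \<in> borel_measurable (N \<Otimes>\<^sub>M M)"
      "h \<in> borel_measurable M" "v \<in> borel_measurable M"
    and row: "\<And>x. x \<in> space N \<Longrightarrow> (\<integral>\<^sup>+ y. k x y * ennreal (w (x - y)) \<partial>M) \<le> ennreal C"
    and col: "\<And>y. y \<in> space M \<Longrightarrow> (\<integral>\<^sup>+ x. k x y * ennreal (w (x - y)) \<partial>N) \<le> ennreal C"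
    and C: "0 < C" and p: "1 \<le> p"
  shows "LpN p N (\<lambda>x. (\<integral>\<^sup>+ y. k x y * h y \<partial>M) * ennreal (v x)) \<le> ennreal (2 * Cv * C) * LpN p M (\<lambda>y. h y * ennreal (v y))"
proof -
  have Cv: "0 < Cv" using moderated_Cv_pos[OF v] .
  have "LpN p N (\<lambda>x. (\<integral>\<^sup>+ y. k x y * h y \<partial>M) * ennreal (v x))
      \<le> LpN p N (\<lambda>x. \<integral>\<^sup>+ y. (ennreal Cv * (k x y * ennreal (w (x - y)))) * (h y * ennreal (v y)) \<partial>M)"
  proof (rule LpN_mono[OF p])
    fix x assume x: "x \<in> space N"
    have [measurable]: "k x \<in> borel_measurable M"
      using measurable_compose[OF measurable_Pair1'[OF x] assms(4)] by simp
    have "(\<integral>\<^sup>+ y. k x y * h y \<partial>M) * ennreal (v x) = (\<integral>\<^sup>+ y. k x y * h y * ennreal (v x) \<partial>M)"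
      by (rule nn_integral_multc[symmetric]) measurable
    also have "\<dots> \<le> (\<integral>\<^sup>+ y. (ennreal Cv * (k x y * ennreal (w (x - y)))) * (h y * ennreal (v y)) \<partial>M)"
    proof (intro nn_integral_mono)
      fix y
      have "v x \<le> Cv * w (x - y) * v y" using v[unfolded moderated_def] by (metis diff_add_cancel)
      moreover have "0 < v y" using v by (simp add: moderated_def)
      ultimately have "ennreal (v x) \<le> ennreal Cv * ennreal (w (x - y)) * ennreal (v y)"
        using Cv by (simp add: ennreal_mult[symmetric] ennreal_leI)
      then have "k x y * h y * ennreal (v x) \<le> k x y * h y * (ennreal Cv * ennreal (w (x - y)) * ennreal (v y))"
        by (rule mult_left_mono) simp
      then show "k x y * h y * ennreal (v x) \<le> (ennreal Cv * (k x y * ennreal (w (x - y)))) * (h y * ennreal (v y))"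
        by (simp add: mult_ac)
    qed
    finally show "(\<integral>\<^sup>+ y. k x y * h y \<partial>M) * ennreal (v x) \<le> \<dots>" .
  qed
  also have "\<dots> \<le> ennreal (2 * (Cv * C)) * LpN p M (\<lambda>y. h y * ennreal (v y))"
  proof (rule Schur_test[OF MN])
    fix x assume x: "x \<in> space N"
    have [measurable]: "(\<lambda>y. k x y * ennreal (w (x - y))) \<in> borel_measurable M"
      using measurable_compose[OF measurable_Pair1'[OF x] assms(4)] measurable_compose[OF measurable_Pair1'[OF x] assms(5)]
      by simp
    show "(\<integral>\<^sup>+ y. ennreal Cv * (k x y * ennreal (w (x - y))) \<partial>M) \<le> ennreal (Cv * C)"
      using Cv C row[OF x] by (simp add: nn_integral_cmult ennreal_mult mult_left_mono)
  next
    fix x assume x: "x \<in> space M"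
    have [measurable]: "(\<lambda>y. k y x * ennreal (w (y - x))) \<in> borel_measurable N"
      using measurable_compose[OF measurable_Pair2'[OF x] assms(4)] measurable_compose[OF measurable_Pair2'[OF x] assms(5)]
      by simp
    show "(\<integral>\<^sup>+ y. ennreal Cv * (k y x * ennreal (w (y - x))) \<partial>N) \<le> ennreal (Cv * C)"
      using Cv C col[OF x] by (simp add: nn_integral_cmult ennreal_mult mult_left_mono)
  qed (use p Cv C in \<open>auto intro!: borel_measurable_times_ennreal simp: case_prod_beta\<close>)
  finally show ?thesis by (simp add: mult_ac)
qed

lemma weighted_Young:
  assumes v: "moderated Cv v" and [measurable]: "\<theta> \<in> borel_measurable borel" "h \<in> borel_measurable borel"
    and "wnorm1 \<theta> \<le> ennreal C" "0 < C" "1 \<le> p"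
  shows "LpN p lborel (\<lambda>x. (\<integral>\<^sup>+ y. \<theta> (x - y) * h y \<partial>lborel) * ennreal (v x))
     \<le> ennreal (2 * Cv * C) * LpN p lborel (\<lambda>y. h y * ennreal (v y))"
proof (rule weighted_Schur[OF v])
  show "v \<in> borel_measurable lborel" using v by (simp add: moderated_def)
  show "(\<integral>\<^sup>+ y. \<theta> (x - y) * ennreal (w (x - y)) \<partial>lborel) \<le> ennreal C" for x
    using assms(4) nn_integral_reflect[of "\<lambda>y. \<theta> y * ennreal (w y)" x] by (simp add: wnorm1_def)
  show "(\<integral>\<^sup>+ x. \<theta> (x - y) * ennreal (w (x - y)) \<partial>lborel) \<le> ennreal C" for y
    using assms(4) nn_integral_translate'[of "\<lambda>y. \<theta> y * ennreal (w y)" y] by (simp add: wnorm1_def)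
qed (use assms in \<open>auto simp: lborel.sigma_finite_measure_axioms\<close>)

lemma wnorm1_reflect:
  assumes [measurable]: "\<theta> \<in> borel_measurable borel"
  shows "wnorm1 (\<lambda>z. \<theta> (- z)) = wnorm1 \<theta>"
  using nn_integral_reflect[of "\<lambda>z. \<theta> z * ennreal (w z)" 0] by (simp add: wnorm1_def w_even)

lemma weighted_Young':
  assumes v: "moderated Cv v" and [measurable]: "\<theta> \<in> borel_measurable borel" "h \<in> borel_measurable borel"
    and "wnorm1 \<theta> \<le> ennreal C" "0 < C" "1 \<le> p"
  shows "LpN p lborel (\<lambda>x. (\<integral>\<^sup>+ y. \<theta> (y - x) * h y \<partial>lborel) * ennreal (v x))
     \<le> ennreal (2 * Cv * C) * LpN p lborel (\<lambda>y. h y * ennreal (v y))"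
  using weighted_Young[OF v, of "\<lambda>z. \<theta> (- z)" h C p] assms wnorm1_reflect[of \<theta>] by simp

lemma weighted_to_lattice:
  assumes v: "moderated Cv v" and \<Gamma>: "countable \<Gamma>"
    and [measurable]: "\<theta> \<in> borel_measurable borel" "h \<in> borel_measurable borel"
    and "wnorm1 \<theta> \<le> ennreal C" "\<And>x. (\<integral>\<^sup>+ \<gamma>. \<theta> (x - \<gamma>) * ennreal (w (x - \<gamma>)) \<partial>count_space \<Gamma>) \<le> ennreal C"
    and "0 < C" "1 \<le> p"
  shows "LpN p (count_space \<Gamma>) (\<lambda>\<gamma>. (\<integral>\<^sup>+ y. \<theta> (y - \<gamma>) * h y \<partial>lborel) * ennreal (v \<gamma>))
     \<le> ennreal (2 * Cv * C) * LpN p lborel (\<lambda>y. h y * ennreal (v y))"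
proof (rule weighted_Schur[OF v])
  show "v \<in> borel_measurable lborel" using v by (simp add: moderated_def)
  show "(\<integral>\<^sup>+ y. \<theta> (y - x) * ennreal (w (x - y)) \<partial>lborel) \<le> ennreal C" for x
    using assms(5) nn_integral_translate'[of "\<lambda>y. \<theta> y * ennreal (w y)" x] 
    by (simp add: wnorm1_def w_diff_commute[of x])
  show "(\<integral>\<^sup>+ x. \<theta> (y - x) * ennreal (w (x - y)) \<partial>count_space \<Gamma>) \<le> ennreal C" for y
    using assms(6)[of y] by (simp add: w_diff_commute[of _ y])
qed (use assms in \<open>auto simp: lborel.sigma_finite_measure_axioms intro!: sigma_finite_count measurable_count_pair\<close>)

lemma weighted_from_lattice:
  assumes v: "moderated Cv v" and \<Gamma>: "countable \<Gamma>"
    and [measurable]: "\<theta> \<in> borel_measurable borel"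
    and "wnorm1 \<theta> \<le> ennreal C" "\<And>x. (\<integral>\<^sup>+ \<gamma>. \<theta> (x - \<gamma>) * ennreal (w (x - \<gamma>)) \<partial>count_space \<Gamma>) \<le> ennreal C"
    and "0 < C" "1 \<le> p"
  shows "LpN p lborel (\<lambda>y. (\<integral>\<^sup>+ \<gamma>. \<theta> (y - \<gamma>) * X \<gamma> \<partial>count_space \<Gamma>) * ennreal (v y))
     \<le> ennreal (2 * Cv * C) * LpN p (count_space \<Gamma>) (\<lambda>\<gamma>. X \<gamma> * ennreal (v \<gamma>))"
proof (rule weighted_Schur[OF v])
  show "(\<integral>\<^sup>+ y. \<theta> (y - x) * ennreal (w (y - x)) \<partial>lborel) \<le> ennreal C" for x
    using assms(4) nn_integral_translate'[of "\<lambda>y. \<theta> y * ennreal (w y)" x] by (simp add: wnorm1_def)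
qed (use assms in \<open>auto simp: lborel.sigma_finite_measure_axioms intro!: sigma_finite_count measurable_count_pair'\<close>)

text \<open>The weight itself varies slowly: w(z + u) \<le> w z \<open>w_unit_bound\<close> for |u|
  \<le> 1, so \<open>separated_sum_le\<close> applies to the weighted function.\<close>

lemma separated_weighted_sum_le:
  assumes "separated_by K \<Gamma>" "0 \<le> c"
    and \<theta>: "\<And>z u. norm u < 1 \<Longrightarrow> \<theta> (z + u) \<le> ennreal c * \<theta>' z"
    and [measurable]: "\<theta>' \<in> borel_measurable borel"
  shows "(\<integral>\<^sup>+ \<gamma>. \<theta> (x - \<gamma>) * ennreal (w (x - \<gamma>)) \<partial>count_space \<Gamma>)
     \<le> ennreal (c * w_unit_bound * K / unit_vol TYPE('a)) * wnorm1 \<theta>'"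
  unfolding wnorm1_def
proof (rule separated_sum_le[OF assms(1), of _ "\<lambda>z. \<theta> z * ennreal (w z)"])
  fix z u :: 'a assume u: "norm u < 1"
  have "w (z + u) \<le> w z * w_unit_bound"
    using w_sub[of z u] w_unit_bound(2)[of u] u by (auto elim!: order_trans intro!: mult_left_mono)
  then have "ennreal (w (z + u)) \<le> ennreal (w z) * ennreal w_unit_bound"
    using w_unit_bound(1) by (simp add: ennreal_mult[symmetric] ennreal_leI)
  then have "\<theta> (z + u) * ennreal (w (z + u)) \<le> (ennreal c * \<theta>' z) * (ennreal (w z) * ennreal w_unit_bound)"
    by (intro mult_mono \<theta> u) auto
  then show "\<theta> (z + u) * ennreal (w (z + u)) \<le> ennreal (c * w_unit_bound) * (\<theta>' z * ennreal (w z))"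
    using assms(2) w_unit_bound(1) by (simp add: ennreal_mult mult_ac)
qed (use assms(2) w_unit_bound(1) in auto)

end

section \<open>Exponentially damped local energies\<close>

text \<open>The square root of the damping factor exp(-|u| / R) of the energies; hence the 2 in the
  exponent.\<close>

definition sexp :: "real \<Rightarrow> 'a::real_normed_vector \<Rightarrow> ennreal" where
  "sexp R u = ennreal (exp (- (norm u / (2 * R))))"

lemma sexp_borel [measurable]: "sexp R \<in> borel_measurable (borel :: 'a::euclidean_space measure)"
  unfolding sexp_def by measurable

lemma sexp_shift:
  assumes "1 \<le> R"
  shows "sexp R z \<le> ennreal (exp (norm u / (2 * R))) * sexp R (z + u)"
proof -
  have "norm (z + u) / (2 * R) \<le> (norm u + norm z) / (2 * R)"
    using assms norm_triangle_ineq[of z u] by (intro divide_right_mono) auto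
  then have "exp (- (norm z / (2 * R))) \<le> exp (norm u / (2 * R)) * exp (- (norm (z + u) / (2 * R)))"
    by (simp add: exp_add[symmetric] add_divide_distrib)
  then show ?thesis by (simp add: sexp_def ennreal_mult[symmetric] ennreal_leI)
qed

lemma sexp_uminus [simp]: "sexp R (- u) = sexp R u"
  by (simp add: sexp_def)

lemma slowly_varying_sexp: "1 \<le> R \<Longrightarrow> slowly_varying (exp 1) (sexp R)"
  unfolding slowly_varying_def
proof (intro allI impI)
  fix z u :: 'a assume "norm u \<le> 1" "1 \<le> R"
  then have "sexp R (z + u) \<le> ennreal (exp (norm u / (2 * R))) * sexp R z"
    using sexp_shift[of R "z + u" "- u"] by simp
  also have "\<dots> \<le> ennreal (exp 1) * sexp R z"
    using \<open>norm u \<le> 1\<close> \<open>1 \<le> R\<close> by (intro mult_right_mono ennreal_leI) (auto simp: field_simps)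
  finally show "sexp R (z + u) \<le> ennreal (exp 1) * sexp R z" .
qed

text \<open>The damped energy called \<open>\<beta>\<close> in the overview.\<close>

definition loc2 :: "real \<Rightarrow> ('a::euclidean_space \<Rightarrow> ennreal) \<Rightarrow> 'a \<Rightarrow> ennreal" where
  "loc2 R g y = enn_rpow (1/2) (\<integral>\<^sup>+ z. (sexp R (z - y) * g z)\<^sup>2 \<partial>lborel)"

lemma loc2_borel [measurable]:
  assumes [measurable]: "g \<in> borel_measurable borel"
  shows "loc2 R g \<in> borel_measurable borel"
  unfolding loc2_def by measurable

lemma borel_measurable_indicator_ball [measurable]:
  fixes f h :: "'b \<Rightarrow> 'a::euclidean_space"
  assumes [measurable]: "f \<in> borel_measurable M" "h \<in> borel_measurable M"
  shows "(\<lambda>p. indicator (ball (f p) r) (h p) :: ennreal) \<in> borel_measurable M"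
proof -
  have "(\<lambda>p. if dist (f p) (h p) < r then 1 else 0 :: ennreal) \<in> borel_measurable M" by measurable
  then show ?thesis by (simp add: indicator_def mem_ball of_bool_def)
qed

lemma indicator_ball_commute: "indicator (ball x r) y = (indicator (ball y r) x :: ennreal)"
  by (simp add: indicator_def dist_commute)

text \<open>On the unit ball around \<open>y\<close> the damping factor is at least 1/e, so
  Cauchy-Schwarz on that ball suffices.\<close>

lemma ball_integral_le_loc2:
  fixes g :: "'a::euclidean_space \<Rightarrow> ennreal"
  assumes R: "1 \<le> R" and [measurable]: "g \<in> borel_measurable borel"
  shows "(\<integral>\<^sup>+ z. indicator (ball y 1) z * g z \<partial>lborel) \<le> ennreal (exp 1 * sqrt (unit_vol TYPE('a))) * loc2 R g y"
proof -
  have ge: "indicator (ball y 1) z * g z \<le> ennreal (exp 1) * (sexp R (z - y) * g z)" for z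
  proof (cases "z \<in> ball y 1")
    case True
    then have "norm (z - y) / (2 * R) \<le> 1" using R by (simp add: dist_norm norm_minus_commute)
    then have "1 \<le> exp 1 * exp (- (norm (z - y) / (2 * R)))" by (simp add: exp_add[symmetric])
    then have "1 \<le> ennreal (exp 1) * sexp R (z - y)"
      by (simp add: sexp_def ennreal_mult[symmetric])
    from mult_right_mono[OF this, of "g z"] show ?thesis using True by (simp add: mult.assoc)
  qed simp
  have "(\<integral>\<^sup>+ z. indicator (ball y 1) z * g z \<partial>lborel) \<le> (\<integral>\<^sup>+ z. indicator (ball y 1) z * (ennreal (exp 1) * (sexp R (z - y) * g z)) \<partial>lborel)"
  proof (intro nn_integral_mono)
    fix z show "indicator (ball y 1) z * g z \<le> indicator (ball y 1) z * (ennreal (exp 1) * (sexp R (z - y) * g z))"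
      using ge[of z] by (auto simp: indicator_def)
  qed
  also have "\<dots> \<le> enn_rpow (1/2) (\<integral>\<^sup>+ z. (indicator (ball y 1) z)\<^sup>2 \<partial>lborel) * enn_rpow (1/2) (\<integral>\<^sup>+ z. (ennreal (exp 1) * (sexp R (z - y) * g z))\<^sup>2 \<partial>lborel)"
    by (rule Cauchy_Schwarz_enn) measurable
  also have "(\<integral>\<^sup>+ z. (indicator (ball y 1) z)\<^sup>2 \<partial>lborel) = ennreal (unit_vol TYPE('a))"
  proof -
    have "(\<lambda>z. (indicator (ball y 1) z :: ennreal)\<^sup>2) = indicator (ball y 1)"
      by (auto simp: fun_eq_iff indicator_def)
    then show ?thesis by (simp add: emeasure_ball_unit_vol)
  qed
  also have "enn_rpow (1/2) \<dots> = ennreal (sqrt (unit_vol TYPE('a)))"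
    using unit_vol_pos[where 'a='a] by (simp add: enn_rpow_ennreal powr_half_sqrt)
  also have "(\<integral>\<^sup>+ z. (ennreal (exp 1) * (sexp R (z - y) * g z))\<^sup>2 \<partial>lborel) = (ennreal (exp 1))\<^sup>2 * (\<integral>\<^sup>+ z. (sexp R (z - y) * g z)\<^sup>2 \<partial>lborel)"
    by (simp add: power_mult_distrib nn_integral_cmult)
  also have "enn_rpow (1/2) \<dots> = ennreal (exp 1) * loc2 R g y"
    by (simp add: loc2_def enn_rpow_mult ennreal_power enn_rpow_ennreal powr_half_sqrt)
  finally show ?thesis
    using unit_vol_pos[where 'a='a] by (simp add: ennreal_mult mult_ac)
qed

definition conv_int :: "('a::euclidean_space \<Rightarrow> ennreal) \<Rightarrow> ('a \<Rightarrow> ennreal) \<Rightarrow> 'a \<Rightarrow> ennreal" where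
  "conv_int \<theta> h x = (\<integral>\<^sup>+ y. \<theta> (x - y) * h y \<partial>lborel)"

lemma conv_int_borel [measurable]:
  assumes [measurable]: "\<theta> \<in> borel_measurable borel" "h \<in> borel_measurable borel"
  shows "conv_int \<theta> h \<in> borel_measurable borel"
  unfolding conv_int_def by measurable

lemma conv_int_convolution_alt:
  assumes [measurable]: "\<theta> \<in> borel_measurable borel" "h \<in> borel_measurable borel"
  shows "conv_int \<theta> h x = (\<integral>\<^sup>+ u. \<theta> u * h (x - u) \<partial>lborel)"
  using nn_integral_reflect[of "\<lambda>u. \<theta> u * h (x - u)" x] by (simp add: conv_int_def)

lemma slowly_varying_conv_int:
  assumes "slowly_varying c \<theta>" and [measurable]: "\<theta> \<in> borel_measurable borel" "h \<in> borel_measurable borel"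
  shows "slowly_varying c (conv_int \<theta> h)"
  unfolding slowly_varying_def
proof (intro allI impI)
  fix z u :: 'a assume u: "norm u \<le> 1"
  have "conv_int \<theta> h (z + u) \<le> (\<integral>\<^sup>+ y. ennreal c * (\<theta> (z - y) * h y) \<partial>lborel)"
    unfolding conv_int_def
  proof (intro nn_integral_mono)
    fix y
    have "\<theta> ((z - y) + u) \<le> ennreal c * \<theta> (z - y)" using assms(1) u by (simp add: slowly_varying_def)
    from mult_right_mono[OF this, of "h y"]
    show "\<theta> (z + u - y) * h y \<le> ennreal c * (\<theta> (z - y) * h y)" by (simp add: algebra_simps)
  qed
  also have "\<dots> = ennreal c * conv_int \<theta> h z" unfolding conv_int_def by (rule nn_integral_cmult) measurable
  finally show "conv_int \<theta> h (z + u) \<le> ennreal c * conv_int \<theta> h z" .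
qed

text \<open>Point values are recovered from damped energies. Slow variation of \<open>\<Phi>\<close>
  lets \<open>g\<close> inside the convolution be replaced by its unit-ball averages, and these are
  dominated by \<open>loc2\<close>. The constant does not involve \<open>R\<close>.\<close>

lemma le_conv_int_loc2:
  fixes g :: "'a::euclidean_space \<Rightarrow> ennreal"
  assumes R: "1 \<le> R" and [measurable]: "g \<in> borel_measurable borel" "\<Phi> \<in> borel_measurable borel"
    and \<Phi>: "slowly_varying c \<Phi>" "0 \<le> c" and g: "\<And>z. g z \<le> conv_int \<Phi> g z"
  shows "g z \<le> ennreal (c * exp 1 / sqrt (unit_vol TYPE('a))) * conv_int \<Phi> (loc2 R g) z"
proof -
  let ?V = "unit_vol TYPE('a)"
  have V: "0 < ?V" by (rule unit_vol_pos)
  have "ennreal ?V * g z \<le> ennreal ?V * conv_int \<Phi> g z" by (intro mult_left_mono g) auto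
  also have "\<dots> = (\<integral>\<^sup>+ x. ennreal ?V * (\<Phi> (z - x) * g x) \<partial>lborel)"
    unfolding conv_int_def by (rule nn_integral_cmult[symmetric]) measurable
  also have "\<dots> = (\<integral>\<^sup>+ x. (\<integral>\<^sup>+ y. indicator (ball x 1) y * (\<Phi> (z - x) * g x) \<partial>lborel) \<partial>lborel)"
    by (simp add: nn_integral_ball)
  also have "\<dots> \<le> (\<integral>\<^sup>+ x. (\<integral>\<^sup>+ y. indicator (ball x 1) y * (ennreal c * \<Phi> (z - y) * g x) \<partial>lborel) \<partial>lborel)"
  proof (intro nn_integral_mono)
    fix x y
    have "\<Phi> (z - x) \<le> ennreal c * \<Phi> (z - y)" if "y \<in> ball x 1"
      using \<Phi>(1)[unfolded slowly_varying_def, rule_format, of "y - x" "z - y"] that by (simp add: dist_norm norm_minus_commute)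
    then show "indicator (ball x 1) y * (\<Phi> (z - x) * g x) \<le> indicator (ball x 1) y * (ennreal c * \<Phi> (z - y) * g x)"
      by (auto simp: indicator_def intro: mult_right_mono)
  qed
  also have "\<dots> = (\<integral>\<^sup>+ y. (\<integral>\<^sup>+ x. indicator (ball x 1) y * (ennreal c * \<Phi> (z - y) * g x) \<partial>lborel) \<partial>lborel)"
    by (subst lborel_pair.Fubini') (simp_all add: indicator_ball_commute[of _ 1] del: mem_ball)
  also have "\<dots> = (\<integral>\<^sup>+ y. ennreal c * (\<Phi> (z - y) * (\<integral>\<^sup>+ x. indicator (ball y 1) x * g x \<partial>lborel)) \<partial>lborel)"
  proof (intro nn_integral_cong)
    fix y
    have "(\<integral>\<^sup>+ x. indicator (ball x 1) y * (ennreal c * \<Phi> (z - y) * g x) \<partial>lborel)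
        = (\<integral>\<^sup>+ x. (ennreal c * \<Phi> (z - y)) * (indicator (ball y 1) x * g x) \<partial>lborel)"
      by (intro nn_integral_cong) (simp add: indicator_ball_commute[of _ _ y] mult_ac)
    also have "\<dots> = (ennreal c * \<Phi> (z - y)) * (\<integral>\<^sup>+ x. indicator (ball y 1) x * g x \<partial>lborel)"
      by (rule nn_integral_cmult) measurable
    finally show "(\<integral>\<^sup>+ x. indicator (ball x 1) y * (ennreal c * \<Phi> (z - y) * g x) \<partial>lborel)
        = ennreal c * (\<Phi> (z - y) * (\<integral>\<^sup>+ x. indicator (ball y 1) x * g x \<partial>lborel))" by (simp add: mult.assoc)
  qed
  also have "\<dots> \<le> (\<integral>\<^sup>+ y. ennreal c * (\<Phi> (z - y) * (ennreal (exp 1 * sqrt ?V) * loc2 R g y)) \<partial>lborel)"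
    by (intro nn_integral_mono mult_left_mono ball_integral_le_loc2[OF R]) auto
  also have "\<dots> = (\<integral>\<^sup>+ y. ennreal (c * exp 1 * sqrt ?V) * (\<Phi> (z - y) * loc2 R g y) \<partial>lborel)"
    using \<Phi>(2) V by (intro nn_integral_cong) (simp add: ennreal_mult mult_ac)
  also have "\<dots> = ennreal (c * exp 1 * sqrt ?V) * conv_int \<Phi> (loc2 R g) z"
    unfolding conv_int_def by (rule nn_integral_cmult) measurable
  finally have "ennreal (1 / ?V) * (ennreal ?V * g z) \<le> ennreal (1 / ?V) * (ennreal (c * exp 1 * sqrt ?V) * conv_int \<Phi> (loc2 R g) z)"
    by (rule mult_left_mono) simp
  also have "\<dots> = ennreal (c * exp 1 / sqrt ?V) * conv_int \<Phi> (loc2 R g) z"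
  proof -
    have "1 / ?V * (c * exp 1 * sqrt ?V) = c * exp 1 / sqrt ?V"
      using V by (simp add: field_simps)
    moreover have "0 \<le> c * exp 1 * sqrt ?V" using V \<Phi>(2) by simp
    ultimately show ?thesis using V by (metis mult.assoc ennreal_mult' ennreal_mult'' divide_nonneg_pos zero_le_one)
  qed
  finally show ?thesis
    using V by (simp add: mult.assoc[symmetric] ennreal_mult[symmetric])
qed

text \<open>The product of \<open>sexp\<close> and a slowly varying \<open>H\<close> is slowly
  varying, so its supremum is at most a multiple of its integral S; therefore the integral of its
  square is at most a multiple of S^2. This makes the L^2 quantity \<open>loc2\<close> linear in
  \<open>H\<close>, so that Young's inequality applies for every p.\<close>

lemma loc2_le_conv_int:
  fixes g H :: "'a::euclidean_space \<Rightarrow> ennreal"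
  assumes R: "1 \<le> R" and [measurable]: "g \<in> borel_measurable borel" "H \<in> borel_measurable borel"
    and H: "slowly_varying c H" "0 \<le> c" and g: "\<And>z. g z \<le> H z"
  shows "loc2 R g y \<le> ennreal (sqrt (exp 1 * c / unit_vol TYPE('a))) * conv_int (sexp R) H y"
proof -
  let ?V = "unit_vol TYPE('a)"
  have V: "0 < ?V" by (rule unit_vol_pos)
  define F where "F z = sexp R (z - y) * H z" for z
  have [measurable]: "F \<in> borel_measurable borel" unfolding F_def by measurable
  have "slowly_varying (exp 1 * c) F"
    unfolding slowly_varying_def
  proof (intro allI impI)
    fix z u :: 'a assume u: "norm u \<le> 1"
    have "sexp R ((z - y) + u) \<le> ennreal (exp 1) * sexp R (z - y)" "H (z + u) \<le> ennreal c * H z"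
      using slowly_varying_sexp[OF R, where 'a='a] H(1) u by (auto simp: slowly_varying_def)
    from mult_mono[OF this] show "F (z + u) \<le> ennreal (exp 1 * c) * F z"
      using H(2) by (simp add: F_def ennreal_mult algebra_simps)
  qed
  from slowly_varying_local_average[OF this] H(2)
  have pt: "F z \<le> ennreal (exp 1 * c / ?V) * (\<integral>\<^sup>+ x. indicator (ball z 1) x * F x \<partial>lborel)" for z by simp
  define S where "S = (\<integral>\<^sup>+ x. F x \<partial>lborel)"
  have "F z \<le> ennreal (exp 1 * c / ?V) * S" for z
    unfolding S_def by (rule order_trans[OF pt]) (auto intro!: mult_left_mono nn_integral_mono simp: indicator_def)
  then have FS: "F z \<le> ennreal (exp 1 * c / ?V) * S" for z .
  have gF: "sexp R (z - y) * g z \<le> F z" for z unfolding F_def by (intro mult_left_mono g) simp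
  have "(\<integral>\<^sup>+ z. (sexp R (z - y) * g z)\<^sup>2 \<partial>lborel) \<le> (\<integral>\<^sup>+ z. (ennreal (exp 1 * c / ?V) * S) * F z \<partial>lborel)"
    unfolding power2_eq_square by (intro nn_integral_mono mult_mono gF order_trans[OF gF FS]) simp_all
  also have "\<dots> = (ennreal (exp 1 * c / ?V) * S) * S"
    unfolding S_def by (rule nn_integral_cmult) measurable
  also have "\<dots> = (ennreal (sqrt (exp 1 * c / ?V)) * S)\<^sup>2"
    using H(2) V by (simp add: power_mult_distrib ennreal_power) (simp add: power2_eq_square mult_ac)
  finally have "loc2 R g y \<le> ennreal (sqrt (exp 1 * c / ?V)) * S" unfolding loc2_def by (rule enn_rpow_half_le)
  also have "S = conv_int (sexp R) H y"
    unfolding S_def conv_int_def F_def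
    by (intro nn_integral_cong) (metis minus_diff_eq sexp_uminus)
  finally show ?thesis .
qed

text \<open>Cauchy-Schwarz, after noting that damping a translate by \<open>u\<close> around
  \<open>y\<close> is the same as damping the original around \<open>y + u\<close>. It is what turns
  the commutator error into a convolution with \<open>loc2\<close>.\<close>

lemma loc2_cross:
  fixes g h :: "'a::euclidean_space \<Rightarrow> ennreal"
  assumes [measurable]: "g \<in> borel_measurable borel"
  shows "(\<integral>\<^sup>+ z. (sexp R (z - y))\<^sup>2 * (g z * g (z + u)) \<partial>lborel) \<le> loc2 R g y * loc2 R g (y + u)"
proof -
  have "(\<integral>\<^sup>+ z. (sexp R (z - y))\<^sup>2 * (g z * g (z + u)) \<partial>lborel)
      = (\<integral>\<^sup>+ z. (sexp R (z - y) * g z) * (sexp R (z - y) * g (z + u)) \<partial>lborel)"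
    by (simp add: power2_eq_square mult_ac)
  also have "\<dots> \<le> loc2 R g y * enn_rpow (1/2) (\<integral>\<^sup>+ z. (sexp R (z - y) * g (z + u))\<^sup>2 \<partial>lborel)"
    unfolding loc2_def by (rule Cauchy_Schwarz_enn) measurable
  also have "(\<integral>\<^sup>+ z. (sexp R (z - y) * g (z + u))\<^sup>2 \<partial>lborel) = (\<integral>\<^sup>+ z. (sexp R (z - (y + u)) * g z)\<^sup>2 \<partial>lborel)"
    using nn_integral_translate[of "\<lambda>z. (sexp R (z - (y + u)) * g z)\<^sup>2" u] by simp
  finally show ?thesis by (simp add: loc2_def)
qed

context poly_weight
begin

lemma wnorm1_sexp_finite: "1 \<le> R \<Longrightarrow> wnorm1 (sexp R) < \<infinity>"
  using wnorm1_exp_finite[of "1 / (2 * R)"] by (simp add: sexp_def[abs_def])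

lemma loc2_finite:
  assumes R: "1 \<le> R" and g: "\<And>z. g z \<le> ennreal (C * w z)"
  shows "loc2 R g y < \<infinity>"
proof -
  \<comment> \<open>The rate 1/(4R) is half the decay rate of \<open>sexp R\<close>, so the product
    of the damping with the weight still decays exponentially.\<close>
  obtain D where D: "0 < D" "\<And>z. w z \<le> D * exp (1 / (4 * R) * norm z)" using w_le_exp[of "1 / (4 * R)"] R by auto
  define E where "E = \<bar>C\<bar> * D * exp (norm y / (2 * R))"
  have "(sexp R (z - y) * g z)\<^sup>2 \<le> ennreal (E\<^sup>2) * ennreal (exp (- (1 / (2 * R) * norm z)))" for z
  proof -
    have "g z \<le> ennreal (\<bar>C\<bar> * (D * exp (1 / (4 * R) * norm z)))"
    proof (rule order_trans[OF g ennreal_leI])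
      show "C * w z \<le> \<bar>C\<bar> * (D * exp (1 / (4 * R) * norm z))"
        by (intro mult_mono D(2)) simp_all
    qed
    moreover have "norm z \<le> norm y + norm (z - y)" using norm_triangle_ineq[of y "z - y"] by simp
    then have "exp (- (norm (z - y) / (2 * R))) \<le> exp (norm y / (2 * R)) * exp (- (norm z / (2 * R)))"
      using R by (simp add: exp_add[symmetric] add_divide_distrib[symmetric] divide_right_mono field_simps)
    ultimately have "sexp R (z - y) * g z \<le> ennreal (exp (norm y / (2 * R)) * exp (- (norm z / (2 * R)))) * ennreal (\<bar>C\<bar> * (D * exp (1 / (4 * R) * norm z)))"
      unfolding sexp_def by (intro mult_mono ennreal_leI) auto
    also have "\<dots> = ennreal (E * exp (- (1 / (4 * R) * norm z)))"
      using D(1) R by (simp add: ennreal_mult[symmetric] E_def exp_add[symmetric] mult_ac)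
    finally have "(sexp R (z - y) * g z)\<^sup>2 \<le> (ennreal (E * exp (- (1 / (4 * R) * norm z))))\<^sup>2"
      by (rule power_mono) auto
    also have "\<dots> = ennreal (E\<^sup>2 * exp (- (1 / (2 * R) * norm z)))"
      using D(1) by (simp add: ennreal_power E_def power_mult_distrib exp_double[symmetric])
    finally show ?thesis by (simp add: ennreal_mult)
  qed
  then have "(\<integral>\<^sup>+ z. (sexp R (z - y) * g z)\<^sup>2 \<partial>lborel) \<le> (\<integral>\<^sup>+ z. ennreal (E\<^sup>2) * ennreal (exp (- (1 / (2 * R) * norm (z::'a)))) \<partial>lborel)"
    by (intro nn_integral_mono) auto
  also have "\<dots> = ennreal (E\<^sup>2) * (\<integral>\<^sup>+ z. ennreal (exp (- (1 / (2 * R) * norm (z::'a)))) \<partial>lborel)"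
    by (rule nn_integral_cmult) measurable
  also have "\<dots> < \<infinity>"
    using nn_integral_exp_norm_finite[of "1 / (2 * R)", where 'a='a] R by (simp add: ennreal_mult_less_top)
  finally show ?thesis unfolding loc2_def by (cases "\<integral>\<^sup>+ z. (sexp R (z - y) * g z)\<^sup>2 \<partial>lborel") (auto simp: enn_rpow_ennreal)
qed

end

section \<open>The commutator kernel and its smallness\<close>

lemma nn_integral_tail_tendsto_0:
  fixes f :: "'a::euclidean_space \<Rightarrow> ennreal"
  assumes [measurable]: "f \<in> borel_measurable borel" and fin: "(\<integral>\<^sup>+ z. f z \<partial>lborel) < \<infinity>"
    and a: "filterlim a at_top sequentially"
  shows "(\<lambda>n. \<integral>\<^sup>+ z. indicator {z. a n < norm z} z * f z \<partial>lborel) \<longlonglongrightarrow> 0"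
proof -
  have "(\<lambda>n. \<integral>\<^sup>+ z. indicator {z. a n < norm z} z * f z \<partial>lborel) \<longlonglongrightarrow> (\<integral>\<^sup>+ z. 0 \<partial>(lborel :: 'a measure))"
  proof (rule nn_integral_dominated_convergence[where w = f])
    show "AE z in lborel. (\<lambda>n. indicator {z. a n < norm z} z * f z) \<longlonglongrightarrow> 0"
    proof (rule AE_I2, rule tendsto_eventually)
      fix z :: 'a
      have "eventually (\<lambda>n. norm z \<le> a n) sequentially" using a by (simp add: filterlim_at_top)
      then show "eventually (\<lambda>n. indicator {z. a n < norm z} z * f z = 0) sequentially"
        by eventually_elim (auto simp: indicator_def)
    qed
    show "AE z in lborel. indicator {z. a n < norm z} z * f z \<le> f z" for n
      by (auto simp: indicator_def)
  qed (use fin in auto)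
  then show ?thesis by simp
qed

text \<open>Each of the two exponentials is at least exp(-|z - z'| / R) times the other. In the
  resulting bound the prefactor depends on z - z' only and tends to 0 as R grows, and each summand
  carries the damping at a single point, as \<open>loc2_cross\<close> requires.\<close>

lemma exp_dist_diff_le:
  fixes z z' y :: "'a::real_normed_vector"
  assumes "1 \<le> R"
  shows "\<bar>exp (- (norm (z - y) / R)) - exp (- (norm (z' - y) / R))\<bar>
    \<le> (1 - exp (- (norm (z - z') / R))) * (exp (- (norm (z - y) / R)) + exp (- (norm (z' - y) / R)))"
proof -
  have *: "exp (- (norm (x - y) / R)) - exp (- (norm (x' - y) / R))
    \<le> (1 - exp (- (norm (z - z') / R))) * (exp (- (norm (x - y) / R)) + exp (- (norm (x' - y) / R)))"
    if "norm (x - x') = norm (z - z')" for x x' :: 'a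
  proof -
    have "norm (x' - y) \<le> norm (x - y) + norm (z - z')"
      using norm_triangle_ineq[of "x - y" "x' - x"] that by (simp add: norm_minus_commute)
    then have "norm (x' - y) / R \<le> (norm (x - y) + norm (z - z')) / R"
      using assms by (intro divide_right_mono) auto
    then have "exp (- (norm (z - z') / R)) * exp (- (norm (x - y) / R)) \<le> exp (- (norm (x' - y) / R))"
      by (simp add: exp_add[symmetric] add_divide_distrib)
    moreover have "exp (- (norm (z - z') / R)) * exp (- (norm (x' - y) / R)) \<le> 1 * exp (- (norm (x' - y) / R))"
      using assms by (intro mult_right_mono) auto
    moreover have "e - e' \<le> (1 - p) * (e + e')" if "p * e \<le> e'" "p * e' \<le> 1 * e'" for p e e' :: real
      using that by (simp add: algebra_simps)
    ultimately show ?thesis by blast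
  qed
  show ?thesis using *[of z z'] *[of z' z] by (simp add: abs_le_iff norm_minus_commute add.commute)
qed

lemma sexp_square: "1 \<le> R \<Longrightarrow> (sexp R u)\<^sup>2 = ennreal (exp (- (norm u / R)))"
  by (simp add: sexp_def ennreal_power exp_double[symmetric])

lemma ennreal_bound_real:
  assumes "(x::ennreal) < \<infinity>"
  obtains C where "0 < C" "x \<le> ennreal C"
proof (cases x)
  case (real r)
  then show ?thesis by (intro that[of "r + 1"]) (auto intro: ennreal_leI)
qed (use assms in auto)

text \<open>Isolates what the phase-space estimates need: \<open>\<Phi>\<close> will majorize the
  reproducing kernel and \<open>E\<close> the Wiener envelope of the symbols, both slowly varying
  and in L^1_w. The bound by \<open>E\<close> is stated outside one null set common to all \<gamma>,
  so that it can be summed over \<Gamma> at a fixed \<open>z\<close>.\<close>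

locale phase = poly_weight w for w :: "'a::euclidean_space \<Rightarrow> real" +
  fixes \<Gamma> :: "'a set" and K :: nat and c :: real and \<Phi> E :: "'a \<Rightarrow> ennreal"
    and \<eta> :: "'a \<Rightarrow> 'a \<Rightarrow> ennreal" and A B :: real
  assumes sep: "separated_by K \<Gamma>" and c: "1 \<le> c"
    and \<Phi>_borel [measurable]: "\<Phi> \<in> borel_measurable borel" and \<Phi>_slowly_varying: "slowly_varying c \<Phi>" and \<Phi>_wnorm1: "wnorm1 \<Phi> < \<infinity>"
    and E_borel [measurable]: "E \<in> borel_measurable borel" and E_slowly_varying: "slowly_varying c E" and E_wnorm1: "wnorm1 E < \<infinity>"
    and \<eta>_borel: "\<And>\<gamma>. \<gamma> \<in> \<Gamma> \<Longrightarrow> \<eta> \<gamma> \<in> borel_measurable borel"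
    and \<eta>_le: "AE z in lborel. \<forall>\<gamma>\<in>\<Gamma>. \<eta> \<gamma> z \<le> E (z - \<gamma>)"
    and A: "0 < A" and AB: "A \<le> B"
    and \<eta>_lower: "\<And>z. ennreal A \<le> (\<integral>\<^sup>+ \<gamma>. \<eta> \<gamma> z \<partial>count_space \<Gamma>)"
    and \<eta>_upper: "\<And>z. (\<integral>\<^sup>+ \<gamma>. \<eta> \<gamma> z \<partial>count_space \<Gamma>) \<le> ennreal B"
begin

lemma countable_\<Gamma>: "countable \<Gamma>"
  using separated_by_countable[OF sep] .

definition tail :: "real \<Rightarrow> 'a \<Rightarrow> ennreal" where
  "tail r z = indicator {z. r < norm z} z * E z"

lemma tail_borel [measurable]: "tail r \<in> borel_measurable borel"
  unfolding tail_def by measurable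

lemma tail_shift: "norm u < 1 \<Longrightarrow> tail r (z + u) \<le> ennreal c * tail (r - 1) z"
  using E_slowly_varying norm_triangle_ineq[of z u] by (auto simp: tail_def slowly_varying_def indicator_def)

text \<open>The radius is the R/2 that arises in \<open>sum_cutoff_err_le\<close>, lowered by the
  unit shift of \<open>tail_shift\<close>.\<close>

definition tail_sum :: "real \<Rightarrow> ennreal" where
  "tail_sum R = ennreal (c * K / unit_vol TYPE('a)) * (\<integral>\<^sup>+ z. tail (R / 2 - 1) z \<partial>lborel)"

lemma tail_sum_bound: "(\<integral>\<^sup>+ \<gamma>. tail (R / 2) (x - \<gamma>) \<partial>count_space \<Gamma>) \<le> tail_sum R"
  unfolding tail_sum_def using c by (intro separated_sum_le[OF sep] tail_shift) auto

lemma nn_integral_finite: "wnorm1 f < \<infinity> \<Longrightarrow> (\<integral>\<^sup>+ z. f z \<partial>lborel) < \<infinity>"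
  using nn_integral_le_wnorm1[of f] by (rule order.strict_trans1)

lemma tail_sum_tendsto_0: "(\<lambda>n. tail_sum (real n)) \<longlonglongrightarrow> 0"
proof -
  have "filterlim (\<lambda>n. real n / 2 - 1) at_top sequentially" by real_asymp
  from nn_integral_tail_tendsto_0[OF E_borel nn_integral_finite[OF E_wnorm1] this]
  have "(\<lambda>n. ennreal (c * K / unit_vol TYPE('a)) * (\<integral>\<^sup>+ z. tail (real n / 2 - 1) z \<partial>lborel)) \<longlonglongrightarrow> ennreal (c * K / unit_vol TYPE('a)) * 0"
    unfolding tail_def by (intro ennreal_tendsto_cmult) auto
  then show ?thesis by (simp add: tail_sum_def)
qed

definition exp_defect :: "real \<Rightarrow> 'a \<Rightarrow> ennreal" where
  "exp_defect R u = ennreal (1 - exp (- (norm u / R)))"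

lemma exp_defect_borel [measurable]: "exp_defect R \<in> borel_measurable borel"
  unfolding exp_defect_def by measurable

definition far :: "real \<Rightarrow> 'a \<Rightarrow> ennreal" where
  "far R u = indicator {u. R / 2 \<le> norm u} u"

lemma far_borel [measurable]: "far R \<in> borel_measurable borel"
  unfolding far_def by measurable

text \<open>Majorizes the commutator of the damping factor with \<open>\<Phi>\<close> after summation over \<open>\<Gamma>\<close>;
  see \<open>sum_cutoff_err_le\<close>.\<close>
definition comm_kernel :: "real \<Rightarrow> 'a \<Rightarrow> ennreal" where
  "comm_kernel R u = \<Phi> u * (ennreal B * exp_defect R u + ennreal B * far R u + tail_sum R)"

lemma comm_kernel_borel [measurable]: "comm_kernel R \<in> borel_measurable borel"
  unfolding comm_kernel_def by measurable

lemma wnorm1_mult_tendsto_0: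
  assumes [measurable]: "\<And>n. f n \<in> borel_measurable borel"
    and "\<And>n z. f n z \<le> 1" "\<And>z. (\<lambda>n. f n z) \<longlonglongrightarrow> 0"
  shows "(\<lambda>n. wnorm1 (\<lambda>u. \<Phi> u * f n u)) \<longlonglongrightarrow> 0"
proof -
  \<comment> \<open>A null sequence may be multiplied by a fixed factor only where that factor is
    finite.\<close>
  have fin: "AE z in lborel. \<Phi> z * ennreal (w z) \<noteq> \<infinity>"
    by (rule nn_integral_noteq_infinite) (use \<Phi>_wnorm1 in \<open>auto simp: wnorm1_def\<close>)
  have "(\<lambda>n. wnorm1 (\<lambda>u. \<Phi> u * f n u)) \<longlonglongrightarrow> (\<integral>\<^sup>+ z. 0 \<partial>(lborel :: 'a measure))"
    unfolding wnorm1_def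
  proof (rule nn_integral_dominated_convergence[where w = "\<lambda>z. \<Phi> z * ennreal (w z)"])
    show "AE z in lborel. \<Phi> z * f n z * ennreal (w z) \<le> \<Phi> z * ennreal (w z)" for n
      using mult_left_mono[OF assms(2), of "\<Phi> _"] by (intro AE_I2 mult_right_mono) (auto simp: )
    show "AE z in lborel. (\<lambda>n. \<Phi> z * f n z * ennreal (w z)) \<longlonglongrightarrow> 0"
      using fin
    proof eventually_elim
      case (elim z)
      have "(\<lambda>n. (\<Phi> z * ennreal (w z)) * f n z) \<longlonglongrightarrow> (\<Phi> z * ennreal (w z)) * 0"
        using elim by (intro ennreal_tendsto_cmult assms(3)) (auto simp: less_top)
      then show ?case by (simp add: mult_ac)
    qed
  qed (use \<Phi>_wnorm1 in \<open>auto simp: wnorm1_def\<close>)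
  then show ?thesis by simp
qed

lemma comm_kernel_tendsto_0: "(\<lambda>n. wnorm1 (comm_kernel (real n))) \<longlonglongrightarrow> 0"
proof -
  have split: "wnorm1 (comm_kernel R) = ennreal B * wnorm1 (\<lambda>u. \<Phi> u * exp_defect R u) + ennreal B * wnorm1 (\<lambda>u. \<Phi> u * far R u) + tail_sum R * wnorm1 \<Phi>" for R
    unfolding wnorm1_def comm_kernel_def
    by (simp add: nn_integral_cmult[symmetric] nn_integral_add[symmetric] algebra_simps)
  have 1: "(\<lambda>n. wnorm1 (\<lambda>u. \<Phi> u * exp_defect (real n) u)) \<longlonglongrightarrow> 0"
  proof (rule wnorm1_mult_tendsto_0)
    fix z :: 'a
    have "(\<lambda>n. 1 - exp (- (norm z / real n))) \<longlonglongrightarrow> 0" by real_asymp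
    from tendsto_ennrealI[OF this] show "(\<lambda>n. exp_defect (real n) z) \<longlonglongrightarrow> 0" by (simp add: exp_defect_def)
  qed (auto simp: exp_defect_def)
  have 2: "(\<lambda>n. wnorm1 (\<lambda>u. \<Phi> u * far (real n) u)) \<longlonglongrightarrow> 0"
  proof (rule wnorm1_mult_tendsto_0)
    fix z :: 'a
    have "eventually (\<lambda>n. norm z < real n / 2) sequentially" by real_asymp
    then have "eventually (\<lambda>n. far (real n) z = 0) sequentially" by eventually_elim (auto simp: far_def)
    then show "(\<lambda>n. far (real n) z) \<longlonglongrightarrow> 0" by (rule tendsto_eventually)
  qed (auto simp: far_def indicator_def)
  have "(\<lambda>n. ennreal B * wnorm1 (\<lambda>u. \<Phi> u * exp_defect (real n) u) + ennreal B * wnorm1 (\<lambda>u. \<Phi> u * far (real n) u) + wnorm1 \<Phi> * tail_sum (real n)) \<longlonglongrightarrow> ennreal B * 0 + ennreal B * 0 + wnorm1 \<Phi> * 0"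
    by (intro tendsto_add ennreal_tendsto_cmult 1 2 tail_sum_tendsto_0) (use \<Phi>_wnorm1 in auto)
  then show ?thesis by (simp add: split mult.commute[of "wnorm1 \<Phi>"])
qed

lemma comm_kernel_small:
  assumes "0 < \<delta>"
  obtains R where "1 \<le> R" "wnorm1 (comm_kernel R) \<le> ennreal \<delta>"
proof -
  have "eventually (\<lambda>n. wnorm1 (comm_kernel (real n)) < ennreal \<delta>) sequentially"
    using comm_kernel_tendsto_0 assms by (intro order_tendstoD) auto
  then have "eventually (\<lambda>n. 1 \<le> real n \<and> wnorm1 (comm_kernel (real n)) \<le> ennreal \<delta>) sequentially"
    using eventually_ge_at_top[of 1] by eventually_elim auto
  then show ?thesis using that eventually_happens'[OF sequentially_bot] by blast
qed

text \<open>Replacing exp(-|z - y| / R) G z by the reproducing integral of its truncation to the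
  ball changes it by the integral of K(z, z') (exp(-|z - y| / R) - exp(-|z' - y| / R) 1_ball(z')) G
  z' over z'; this is the modulus of the bracket.\<close>

definition cutoff_err :: "real \<Rightarrow> 'a \<Rightarrow> 'a \<Rightarrow> 'a \<Rightarrow> 'a \<Rightarrow> ennreal" where
  "cutoff_err R y \<gamma> z z' = ennreal \<bar>exp (- (norm (z - y) / R)) - exp (- (norm (z' - y) / R)) * indicator (ball \<gamma> R) z'\<bar>"

lemma cutoff_err_borel [measurable]:
  "(\<lambda>(z, z'). cutoff_err R y \<gamma> z z') \<in> borel_measurable (borel \<Otimes>\<^sub>M borel)"
proof -
  have [measurable]: "indicator (ball \<gamma> R) \<in> borel_measurable (borel :: 'a measure)"
    by (intro borel_measurable_indicator) auto
  show ?thesis unfolding cutoff_err_def by measurable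
qed

lemma cutoff_err_le:
  assumes R: "1 \<le> R"
  shows "cutoff_err R y \<gamma> z z' \<le> exp_defect R (z - z') * ((sexp R (z - y))\<^sup>2 + (sexp R (z' - y))\<^sup>2)
     + (sexp R (z' - y))\<^sup>2 * indicator (- ball \<gamma> R) z'"
proof -
  let ?e = "\<lambda>z. exp (- (norm (z - y) / R))"
  have "\<bar>?e z - ?e z' * indicator (ball \<gamma> R) z'\<bar> \<le> \<bar>?e z - ?e z'\<bar> + ?e z' * indicator (- ball \<gamma> R) z'"
    by (auto simp: indicator_def)
  also have "\<dots> \<le> (1 - exp (- (norm (z - z') / R))) * (?e z + ?e z') + ?e z' * indicator (- ball \<gamma> R) z'"
    using exp_dist_diff_le[OF R] by simp
  finally have "cutoff_err R y \<gamma> z z' \<le> ennreal \<dots>" unfolding cutoff_err_def by (rule ennreal_leI)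
  also have "\<dots> = exp_defect R (z - z') * ((sexp R (z - y))\<^sup>2 + (sexp R (z' - y))\<^sup>2)
     + (sexp R (z' - y))\<^sup>2 * indicator (- ball \<gamma> R) z'"
  proof -
    have "0 \<le> 1 - exp (- (norm (z - z') / R))" using R by simp
    then show ?thesis using R by (simp add: exp_defect_def sexp_square ennreal_mult ennreal_plus ennreal_indicator)
  qed
  finally show ?thesis .
qed

text \<open>If z' lies outside the ball of radius R around \<gamma>, then either |z - z'| \<ge> R/2,
  where the kernel is small, or |z - \<gamma>| > R/2, where the symbol is in its tail. The part due
  to the varying damping factor is handled by \<open>exp_dist_diff_le\<close> and the upper bound of
  the symbol sum.\<close>

lemma sum_cutoff_err_le:
  assumes R: "1 \<le> R" and z: "\<forall>\<gamma>\<in>\<Gamma>. \<eta> \<gamma> z \<le> E (z - \<gamma>)"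
  shows "\<Phi> (z - z') * (\<integral>\<^sup>+ \<gamma>. \<eta> \<gamma> z * cutoff_err R y \<gamma> z z' \<partial>count_space \<Gamma>)
     \<le> comm_kernel R (z - z') * ((sexp R (z - y))\<^sup>2 + (sexp R (z' - y))\<^sup>2)"
proof -
  let ?s = "(sexp R (z - y))\<^sup>2" and ?s' = "(sexp R (z' - y))\<^sup>2"
  have far: "(\<integral>\<^sup>+ \<gamma>. \<eta> \<gamma> z * indicator (- ball \<gamma> R) z' \<partial>count_space \<Gamma>) \<le> ennreal B * far R (z - z') + tail_sum R"
  proof (cases "R / 2 \<le> norm (z - z')")
    case True
    have "(\<integral>\<^sup>+ \<gamma>. \<eta> \<gamma> z * indicator (- ball \<gamma> R) z' \<partial>count_space \<Gamma>) \<le> (\<integral>\<^sup>+ \<gamma>. \<eta> \<gamma> z \<partial>count_space \<Gamma>)"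
      by (intro nn_integral_mono) (auto simp: indicator_def)
    also have "\<dots> \<le> ennreal B" by (rule \<eta>_upper)
    finally show ?thesis using True by (simp add: far_def add_increasing2)
  next
    case False
    have "(\<integral>\<^sup>+ \<gamma>. \<eta> \<gamma> z * indicator (- ball \<gamma> R) z' \<partial>count_space \<Gamma>) \<le> (\<integral>\<^sup>+ \<gamma>. tail (R / 2) (z - \<gamma>) \<partial>count_space \<Gamma>)"
    proof (intro nn_integral_mono)
      fix \<gamma> assume "\<gamma> \<in> space (count_space \<Gamma>)"
      then have "\<eta> \<gamma> z \<le> E (z - \<gamma>)" using z by simp
      moreover have "R / 2 < norm (z - \<gamma>)" if "z' \<notin> ball \<gamma> R"
        using that False norm_triangle_ineq[of "z' - z" "z - \<gamma>"] 
        by (simp add: dist_norm norm_minus_commute)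
      ultimately show "\<eta> \<gamma> z * indicator (- ball \<gamma> R) z' \<le> tail (R / 2) (z - \<gamma>)"
        by (auto simp: tail_def indicator_def simp del: mem_ball)
    qed
    also have "\<dots> \<le> tail_sum R" by (rule tail_sum_bound)
    finally show ?thesis by (simp add: add_increasing)
  qed
  have "(\<integral>\<^sup>+ \<gamma>. \<eta> \<gamma> z * cutoff_err R y \<gamma> z z' \<partial>count_space \<Gamma>)
     \<le> (\<integral>\<^sup>+ \<gamma>. \<eta> \<gamma> z * (exp_defect R (z - z') * (?s + ?s')) + ?s' * (\<eta> \<gamma> z * indicator (- ball \<gamma> R) z') \<partial>count_space \<Gamma>)"
  proof (intro nn_integral_mono)
    fix \<gamma>
    have "\<eta> \<gamma> z * cutoff_err R y \<gamma> z z' \<le> \<eta> \<gamma> z * (exp_defect R (z - z') * (?s + ?s') + ?s' * indicator (- ball \<gamma> R) z')"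
      by (intro mult_left_mono cutoff_err_le[OF R]) simp
    then show "\<eta> \<gamma> z * cutoff_err R y \<gamma> z z' \<le> \<eta> \<gamma> z * (exp_defect R (z - z') * (?s + ?s')) + ?s' * (\<eta> \<gamma> z * indicator (- ball \<gamma> R) z')"
      by (simp add: distrib_left mult_ac)
  qed
  also have "\<dots> = (\<integral>\<^sup>+ \<gamma>. \<eta> \<gamma> z \<partial>count_space \<Gamma>) * (exp_defect R (z - z') * (?s + ?s')) + ?s' * (\<integral>\<^sup>+ \<gamma>. \<eta> \<gamma> z * indicator (- ball \<gamma> R) z' \<partial>count_space \<Gamma>)"
    by (simp add: nn_integral_add nn_integral_cmult nn_integral_multc)
  also have "\<dots> \<le> ennreal B * (exp_defect R (z - z') * (?s + ?s')) + ?s' * (ennreal B * far R (z - z') + tail_sum R)"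
    by (intro add_mono mult_right_mono mult_left_mono \<eta>_upper far) auto
  also have "\<dots> \<le> ennreal B * (exp_defect R (z - z') * (?s + ?s')) + (?s + ?s') * (ennreal B * far R (z - z') + tail_sum R)"
    by (intro add_mono mult_right_mono) auto
  also have "\<dots> = (ennreal B * exp_defect R (z - z') + ennreal B * far R (z - z') + tail_sum R) * (?s + ?s')"
    by (simp only: distrib_left distrib_right mult_ac add_ac)
  finally have "(\<integral>\<^sup>+ \<gamma>. \<eta> \<gamma> z * cutoff_err R y \<gamma> z z' \<partial>count_space \<Gamma>) \<le> \<dots>" .
  from mult_left_mono[OF this, of "\<Phi> (z - z')"] show ?thesis by (simp add: comm_kernel_def mult.assoc)
qed

text \<open>The hypothesis on \<open>g\<close> is what the diagonalizations of the localization operators provide;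
  see \<open>local_energy_bound\<close> below.\<close>
definition local_energy :: "real \<Rightarrow> ('a \<Rightarrow> ennreal) \<Rightarrow> ('a \<Rightarrow> ennreal) \<Rightarrow> bool" where
  "local_energy R g X \<longleftrightarrow> (\<forall>y. \<forall>\<gamma>\<in>\<Gamma>.
     (\<integral>\<^sup>+ z. \<eta> \<gamma> z * (sexp R (z - y) * g z)\<^sup>2 \<partial>lborel)
     \<le> X \<gamma> * enn_rpow (1/2) (\<integral>\<^sup>+ z. indicator (ball \<gamma> R) z * ((sexp R (z - y))\<^sup>2 * g z)\<^sup>2 \<partial>lborel)
       + (\<integral>\<^sup>+ z. (\<integral>\<^sup>+ z'. \<eta> \<gamma> z * (g z * (\<Phi> (z - z') * (cutoff_err R y \<gamma> z z' * g z'))) \<partial>lborel) \<partial>lborel))"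

section \<open>From local energies to a pointwise inequality\<close>

text \<open>Of the two factors \<open>sexp R (z - y)\<close>, one stays in \<open>loc2\<close>. The
  other is traded for \<open>sexp R (y - \<gamma>)\<close>: on a ball of radius R around \<gamma>
  the exponent changes by at most 1/2.\<close>

lemma ball_weight_le_loc2:
  assumes R: "1 \<le> R" and [measurable]: "g \<in> borel_measurable borel"
  shows "enn_rpow (1/2) (\<integral>\<^sup>+ z. indicator (ball \<gamma> R) z * ((sexp R (z - y))\<^sup>2 * g z)\<^sup>2 \<partial>lborel)
     \<le> ennreal (exp 1) * sexp R (y - \<gamma>) * loc2 R g y"
proof (rule enn_rpow_half_le)
  have "(\<integral>\<^sup>+ z. indicator (ball \<gamma> R) z * ((sexp R (z - y))\<^sup>2 * g z)\<^sup>2 \<partial>lborel)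
     \<le> (\<integral>\<^sup>+ z. (ennreal (exp 1) * sexp R (y - \<gamma>))\<^sup>2 * (sexp R (z - y) * g z)\<^sup>2 \<partial>lborel)"
  proof (intro nn_integral_mono)
    fix z
    have "(sexp R (z - y))\<^sup>2 * g z \<le> (ennreal (exp 1) * sexp R (y - \<gamma>)) * (sexp R (z - y) * g z)" if "z \<in> ball \<gamma> R"
    proof -
      have "norm (\<gamma> - z) / (2 * R) \<le> 1" using that R by (simp add: dist_norm)
      then have "ennreal (exp (norm (\<gamma> - z) / (2 * R))) \<le> ennreal (exp 1)" by (intro ennreal_leI) simp
      then have "sexp R (z - y) \<le> ennreal (exp 1) * sexp R (y - \<gamma>)"
        using sexp_shift[OF R, of "z - y" "\<gamma> - z"] sexp_uminus[of R "y - \<gamma>"]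
        by (auto elim!: order_trans intro: mult_right_mono)
      from mult_right_mono[OF this, of "sexp R (z - y) * g z"] show ?thesis
        by (simp add: power2_eq_square mult.assoc)
    qed
    then have "((sexp R (z - y))\<^sup>2 * g z)\<^sup>2 \<le> ((ennreal (exp 1) * sexp R (y - \<gamma>)) * (sexp R (z - y) * g z))\<^sup>2" if "z \<in> ball \<gamma> R"
      using that by (intro power_mono) auto
    then show "indicator (ball \<gamma> R) z * ((sexp R (z - y))\<^sup>2 * g z)\<^sup>2 \<le> (ennreal (exp 1) * sexp R (y - \<gamma>))\<^sup>2 * (sexp R (z - y) * g z)\<^sup>2"
      by (auto simp: indicator_def power_mult_distrib)
  qed
  also have "\<dots> = (ennreal (exp 1) * sexp R (y - \<gamma>))\<^sup>2 * (\<integral>\<^sup>+ z. (sexp R (z - y) * g z)\<^sup>2 \<partial>lborel)"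
    by (rule nn_integral_cmult) measurable
  also have "\<dots> = (ennreal (exp 1) * sexp R (y - \<gamma>) * loc2 R g y)\<^sup>2"
    by (simp add: power_mult_distrib loc2_def enn_rpow_half_sq)
  finally show "(\<integral>\<^sup>+ z. indicator (ball \<gamma> R) z * ((sexp R (z - y))\<^sup>2 * g z)\<^sup>2 \<partial>lborel) \<le> \<dots>" .
qed

text \<open>Write z' = z - u in the first case and z = z' + u in the second; for fixed
  \<open>u\<close> the inner integral is then an instance of \<open>loc2_cross\<close>. Two cases
  are needed because the damping may sit at either variable.\<close>

lemma double_integral_le:
  assumes [measurable]: "g \<in> borel_measurable borel" "\<theta> \<in> borel_measurable borel"
  shows "(\<integral>\<^sup>+ z. (\<integral>\<^sup>+ z'. \<theta> (z - z') * (sexp R (z - y))\<^sup>2 * (g z * g z') \<partial>lborel) \<partial>lborel)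
      \<le> loc2 R g y * conv_int \<theta> (loc2 R g) y" (is "?A \<le> _")
    and "(\<integral>\<^sup>+ z. (\<integral>\<^sup>+ z'. \<theta> (z - z') * (sexp R (z' - y))\<^sup>2 * (g z * g z') \<partial>lborel) \<partial>lborel)
      \<le> loc2 R g y * (\<integral>\<^sup>+ z. \<theta> (z - y) * loc2 R g z \<partial>lborel)" (is "?B \<le> _")
proof -
  have "?A = (\<integral>\<^sup>+ z. (\<integral>\<^sup>+ u. \<theta> u * ((sexp R (z - y))\<^sup>2 * (g z * g (z - u))) \<partial>lborel) \<partial>lborel)"
  proof (rule nn_integral_cong)
    fix z
    show "(\<integral>\<^sup>+ z'. \<theta> (z - z') * (sexp R (z - y))\<^sup>2 * (g z * g z') \<partial>lborel) = (\<integral>\<^sup>+ u. \<theta> u * ((sexp R (z - y))\<^sup>2 * (g z * g (z - u))) \<partial>lborel)"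
      using nn_integral_reflect[of "\<lambda>u. \<theta> u * ((sexp R (z - y))\<^sup>2 * (g z * g (z - u)))" z] by (simp add: mult.assoc)
  qed
  also have "\<dots> = (\<integral>\<^sup>+ u. (\<integral>\<^sup>+ z. \<theta> u * ((sexp R (z - y))\<^sup>2 * (g z * g (z - u))) \<partial>lborel) \<partial>lborel)"
    by (rule lborel_pair.Fubini') simp
  also have "\<dots> = (\<integral>\<^sup>+ u. \<theta> u * (\<integral>\<^sup>+ z. (sexp R (z - y))\<^sup>2 * (g z * g (z - u)) \<partial>lborel) \<partial>lborel)"
    by (intro nn_integral_cong nn_integral_cmult) measurable
  also have "\<dots> \<le> (\<integral>\<^sup>+ u. \<theta> u * (loc2 R g y * loc2 R g (y - u)) \<partial>lborel)"
    using loc2_cross[of g R y "- _"] by (intro nn_integral_mono mult_left_mono) auto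
  also have "\<dots> = (\<integral>\<^sup>+ u. loc2 R g y * (\<theta> u * loc2 R g (y - u)) \<partial>lborel)" by (simp add: mult_ac)
  also have "\<dots> = loc2 R g y * conv_int \<theta> (loc2 R g) y"
    by (subst conv_int_convolution_alt) (auto intro: nn_integral_cmult)
  finally show "?A \<le> loc2 R g y * conv_int \<theta> (loc2 R g) y" .
  have "?B = (\<integral>\<^sup>+ z'. (\<integral>\<^sup>+ z. \<theta> (z - z') * (sexp R (z' - y))\<^sup>2 * (g z * g z') \<partial>lborel) \<partial>lborel)"
    by (rule lborel_pair.Fubini') simp
  also have "\<dots> = (\<integral>\<^sup>+ z'. (\<integral>\<^sup>+ u. \<theta> u * ((sexp R (z' - y))\<^sup>2 * (g z' * g (z' + u))) \<partial>lborel) \<partial>lborel)"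
  proof (rule nn_integral_cong)
    fix z'
    show "(\<integral>\<^sup>+ z. \<theta> (z - z') * (sexp R (z' - y))\<^sup>2 * (g z * g z') \<partial>lborel) = (\<integral>\<^sup>+ u. \<theta> u * ((sexp R (z' - y))\<^sup>2 * (g z' * g (z' + u))) \<partial>lborel)"
      using nn_integral_translate'[of "\<lambda>u. \<theta> u * ((sexp R (z' - y))\<^sup>2 * (g z' * g (z' + u)))" z'] by (simp add: mult_ac)
  qed
  also have "\<dots> = (\<integral>\<^sup>+ u. (\<integral>\<^sup>+ z. \<theta> u * ((sexp R (z - y))\<^sup>2 * (g z * g (z + u))) \<partial>lborel) \<partial>lborel)"
    by (rule lborel_pair.Fubini') simp
  also have "\<dots> = (\<integral>\<^sup>+ u. \<theta> u * (\<integral>\<^sup>+ z. (sexp R (z - y))\<^sup>2 * (g z * g (z + u)) \<partial>lborel) \<partial>lborel)"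
    by (intro nn_integral_cong nn_integral_cmult) measurable
  also have "\<dots> \<le> (\<integral>\<^sup>+ u. \<theta> u * (loc2 R g y * loc2 R g (y + u)) \<partial>lborel)"
    using loc2_cross[of g R y] by (intro nn_integral_mono mult_left_mono) auto
  also have "\<dots> = (\<integral>\<^sup>+ u. loc2 R g y * (\<theta> u * loc2 R g (y + u)) \<partial>lborel)" by (simp add: mult_ac)
  also have "\<dots> = loc2 R g y * (\<integral>\<^sup>+ u. \<theta> u * loc2 R g (y + u) \<partial>lborel)"
    by (rule nn_integral_cmult) measurable
  also have "(\<integral>\<^sup>+ u. \<theta> u * loc2 R g (y + u) \<partial>lborel) = (\<integral>\<^sup>+ z. \<theta> (z - y) * loc2 R g z \<partial>lborel)"
    using nn_integral_translate'[of "\<lambda>u. \<theta> u * loc2 R g (y + u)" y] by simp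
  finally show "?B \<le> loc2 R g y * (\<integral>\<^sup>+ z. \<theta> (z - y) * loc2 R g z \<partial>lborel)" .
qed

text \<open>The sum over \<Gamma> is moved inside both integrals before anything is estimated, so
  that the bound on the sum of all symbols at a fixed point can be used instead of one estimate per
  \<gamma>.\<close>

lemma cutoff_error_total_le:
  assumes R: "1 \<le> R" and g [measurable]: "g \<in> borel_measurable borel"
  shows "(\<integral>\<^sup>+ \<gamma>. (\<integral>\<^sup>+ z. (\<integral>\<^sup>+ z'. \<eta> \<gamma> z * (g z * (\<Phi> (z - z') * (cutoff_err R y \<gamma> z z' * g z'))) \<partial>lborel) \<partial>lborel) \<partial>count_space \<Gamma>)
    \<le> loc2 R g y * (conv_int (comm_kernel R) (loc2 R g) y + (\<integral>\<^sup>+ z. comm_kernel R (z - y) * loc2 R g z \<partial>lborel))"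
proof -
  let ?f = "\<lambda>\<gamma> z z'. \<eta> \<gamma> z * (g z * (\<Phi> (z - z') * (cutoff_err R y \<gamma> z z' * g z')))"
  have f: "(\<lambda>(z, z'). ?f \<gamma> z z') \<in> borel_measurable (lborel \<Otimes>\<^sub>M lborel)" if "\<gamma> \<in> \<Gamma>" for \<gamma>
  proof -
    have [measurable]: "\<eta> \<gamma> \<in> borel_measurable borel" using that by (rule \<eta>_borel)
    show ?thesis by measurable
  qed
  have f1: "?f \<gamma> z \<in> borel_measurable lborel" if "\<gamma> \<in> \<Gamma>" for \<gamma> z
    using measurable_compose[OF measurable_Pair1' f[OF that], of z] by simp
  have f2: "(\<lambda>z. \<integral>\<^sup>+ z'. ?f \<gamma> z z' \<partial>lborel) \<in> borel_measurable lborel" if "\<gamma> \<in> \<Gamma>" for \<gamma>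
    by (rule lborel.borel_measurable_nn_integral[OF f[OF that]])
  have "(\<integral>\<^sup>+ \<gamma>. (\<integral>\<^sup>+ z. (\<integral>\<^sup>+ z'. ?f \<gamma> z z' \<partial>lborel) \<partial>lborel) \<partial>count_space \<Gamma>)
     = (\<integral>\<^sup>+ z. (\<integral>\<^sup>+ \<gamma>. (\<integral>\<^sup>+ z'. ?f \<gamma> z z' \<partial>lborel) \<partial>count_space \<Gamma>) \<partial>lborel)"
    by (rule count_space_Fubini[OF countable_\<Gamma> f2])
  also have "\<dots> = (\<integral>\<^sup>+ z. (\<integral>\<^sup>+ z'. (\<integral>\<^sup>+ \<gamma>. ?f \<gamma> z z' \<partial>count_space \<Gamma>) \<partial>lborel) \<partial>lborel)"
    by (intro nn_integral_cong count_space_Fubini[OF countable_\<Gamma> f1])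
  also have "\<dots> \<le> (\<integral>\<^sup>+ z. (\<integral>\<^sup>+ z'. comm_kernel R (z - z') * (sexp R (z - y))\<^sup>2 * (g z * g z')
       + comm_kernel R (z - z') * (sexp R (z' - y))\<^sup>2 * (g z * g z') \<partial>lborel) \<partial>lborel)"
  proof (rule nn_integral_mono_AE, use \<eta>_le in eventually_elim)
    case (elim z)
    show ?case
    proof (intro nn_integral_mono)
      fix z'
      have "(\<integral>\<^sup>+ \<gamma>. ?f \<gamma> z z' \<partial>count_space \<Gamma>) = (\<integral>\<^sup>+ \<gamma>. (g z * g z' * \<Phi> (z - z')) * (\<eta> \<gamma> z * cutoff_err R y \<gamma> z z') \<partial>count_space \<Gamma>)"
        by (simp add: mult_ac)
      also have "\<dots> = (g z * g z') * (\<Phi> (z - z') * (\<integral>\<^sup>+ \<gamma>. \<eta> \<gamma> z * cutoff_err R y \<gamma> z z' \<partial>count_space \<Gamma>))"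
        by (subst nn_integral_cmult) (auto simp: mult.assoc)
      also have "\<dots> \<le> (g z * g z') * (comm_kernel R (z - z') * ((sexp R (z - y))\<^sup>2 + (sexp R (z' - y))\<^sup>2))"
        by (intro mult_left_mono sum_cutoff_err_le[OF R elim]) simp
      finally show "(\<integral>\<^sup>+ \<gamma>. ?f \<gamma> z z' \<partial>count_space \<Gamma>) \<le> comm_kernel R (z - z') * (sexp R (z - y))\<^sup>2 * (g z * g z')
       + comm_kernel R (z - z') * (sexp R (z' - y))\<^sup>2 * (g z * g z')"
        by (simp add: distrib_left mult_ac)
    qed
  qed
  also have "\<dots> = (\<integral>\<^sup>+ z. (\<integral>\<^sup>+ z'. comm_kernel R (z - z') * (sexp R (z - y))\<^sup>2 * (g z * g z') \<partial>lborel) \<partial>lborel)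
     + (\<integral>\<^sup>+ z. (\<integral>\<^sup>+ z'. comm_kernel R (z - z') * (sexp R (z' - y))\<^sup>2 * (g z * g z') \<partial>lborel) \<partial>lborel)"
    by (simp add: nn_integral_add)
  also have "\<dots> \<le> loc2 R g y * conv_int (comm_kernel R) (loc2 R g) y + loc2 R g y * (\<integral>\<^sup>+ z. comm_kernel R (z - y) * loc2 R g z \<partial>lborel)"
    by (intro add_mono double_integral_le) measurable
  finally show ?thesis by (simp add: distrib_left)
qed

text \<open>Summing the local energies over \<Gamma> bounds A times the square of
  \<open>loc2 R g y\<close>. Each term on the right contains \<open>loc2 R g y\<close> once, and
  this factor cancels: it is finite, and if it vanishes nothing is to be shown.\<close>

lemma loc2_pointwise_bound:
  assumes R: "1 \<le> R" and g [measurable]: "g \<in> borel_measurable borel"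
    and fin: "loc2 R g y < \<infinity>" and loc: "local_energy R g X"
  shows "ennreal A * loc2 R g y \<le> conv_int (comm_kernel R) (loc2 R g) y + (\<integral>\<^sup>+ z. comm_kernel R (z - y) * loc2 R g z \<partial>lborel)
    + ennreal (exp 1) * (\<integral>\<^sup>+ \<gamma>. sexp R (y - \<gamma>) * X \<gamma> \<partial>count_space \<Gamma>)" (is "_ \<le> ?Y")
proof -
  define \<beta> where "\<beta> = loc2 R g y"
  let ?J = "\<lambda>\<gamma>. \<integral>\<^sup>+ z. (\<integral>\<^sup>+ z'. \<eta> \<gamma> z * (g z * (\<Phi> (z - z') * (cutoff_err R y \<gamma> z z' * g z'))) \<partial>lborel) \<partial>lborel"
  have "ennreal A * \<beta>\<^sup>2 = (\<integral>\<^sup>+ z. ennreal A * (sexp R (z - y) * g z)\<^sup>2 \<partial>lborel)"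
    by (simp add: \<beta>_def loc2_def enn_rpow_half_sq nn_integral_cmult)
  also have "\<dots> \<le> (\<integral>\<^sup>+ z. (\<integral>\<^sup>+ \<gamma>. \<eta> \<gamma> z * (sexp R (z - y) * g z)\<^sup>2 \<partial>count_space \<Gamma>) \<partial>lborel)"
    by (intro nn_integral_mono) (auto simp: nn_integral_multc intro!: mult_right_mono \<eta>_lower)
  also have "\<dots> = (\<integral>\<^sup>+ \<gamma>. (\<integral>\<^sup>+ z. \<eta> \<gamma> z * (sexp R (z - y) * g z)\<^sup>2 \<partial>lborel) \<partial>count_space \<Gamma>)"
  proof (rule count_space_Fubini[OF countable_\<Gamma>, symmetric])
    fix \<gamma> assume "\<gamma> \<in> \<Gamma>"
    then have [measurable]: "\<eta> \<gamma> \<in> borel_measurable borel" by (rule \<eta>_borel)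
    show "(\<lambda>z. \<eta> \<gamma> z * (sexp R (z - y) * g z)\<^sup>2) \<in> borel_measurable lborel" by measurable
  qed
  also have "\<dots> \<le> (\<integral>\<^sup>+ \<gamma>. X \<gamma> * (ennreal (exp 1) * sexp R (y - \<gamma>) * \<beta>) + ?J \<gamma> \<partial>count_space \<Gamma>)"
  proof (rule nn_integral_mono)
    fix \<gamma> assume "\<gamma> \<in> space (count_space \<Gamma>)"
    then have "(\<integral>\<^sup>+ z. \<eta> \<gamma> z * (sexp R (z - y) * g z)\<^sup>2 \<partial>lborel)
     \<le> X \<gamma> * enn_rpow (1/2) (\<integral>\<^sup>+ z. indicator (ball \<gamma> R) z * ((sexp R (z - y))\<^sup>2 * g z)\<^sup>2 \<partial>lborel) + ?J \<gamma>"
      using loc by (simp add: local_energy_def)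
    also have "\<dots> \<le> X \<gamma> * (ennreal (exp 1) * sexp R (y - \<gamma>) * \<beta>) + ?J \<gamma>"
      unfolding \<beta>_def by (intro add_mono mult_left_mono ball_weight_le_loc2[OF R g]) auto
    finally show "(\<integral>\<^sup>+ z. \<eta> \<gamma> z * (sexp R (z - y) * g z)\<^sup>2 \<partial>lborel) \<le> \<dots>" .
  qed
  also have "\<dots> = (\<integral>\<^sup>+ \<gamma>. (\<beta> * ennreal (exp 1)) * (sexp R (y - \<gamma>) * X \<gamma>) \<partial>count_space \<Gamma>) + (\<integral>\<^sup>+ \<gamma>. ?J \<gamma> \<partial>count_space \<Gamma>)"
    by (subst nn_integral_add) (auto simp: mult_ac)
  also have "\<dots> \<le> (\<beta> * ennreal (exp 1)) * (\<integral>\<^sup>+ \<gamma>. sexp R (y - \<gamma>) * X \<gamma> \<partial>count_space \<Gamma>)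
     + \<beta> * (conv_int (comm_kernel R) (loc2 R g) y + (\<integral>\<^sup>+ z. comm_kernel R (z - y) * loc2 R g z \<partial>lborel))"
    unfolding \<beta>_def by (intro add_mono cutoff_error_total_le[OF R g]) (simp add: nn_integral_cmult)
  also have "\<dots> = \<beta> * ?Y" by (simp add: distrib_left mult_ac add_ac)
  finally have *: "\<beta> * (ennreal A * \<beta>) \<le> \<beta> * ?Y" by (simp add: power2_eq_square mult_ac)
  show ?thesis
  proof (cases "\<beta> = 0")
    case True
    then show ?thesis by (simp add: \<beta>_def)
  next
    case False
    then show ?thesis using * fin ennreal_mult_le_mult_iff[of \<beta> "ennreal A * \<beta>" ?Y] by (simp add: \<beta>_def less_top)
  qed
qed

end

section \<open>Absorption of the error terms in weighted L^p norms\<close>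

text \<open>For \<open>N = top\<close> the premise carries no information, so the quantity to be
  absorbed has to be finite beforehand.\<close>

lemma ennreal_absorb:
  assumes N: "N < \<infinity>" and A: "0 < A" and le: "ennreal A * N \<le> ennreal (A / 2) * N + Y"
  shows "N \<le> ennreal (2 / A) * Y"
proof (cases "Y = top")
  case True
  then show ?thesis using A by (simp add: ennreal_mult_top)
next
  case False
  then obtain n y where ny: "N = ennreal n" "0 \<le> n" "Y = ennreal y" "0 \<le> y"
    using N by (cases N; cases Y) auto
  then have "A * n \<le> A / 2 * n + y"
    using le A by (simp add: ennreal_mult[symmetric] ennreal_plus[symmetric] del: ennreal_plus)
  then have "n \<le> 2 / A * y" using A by (simp add: field_simps)
  then show ?thesis using ny A by (simp add: ennreal_mult[symmetric] ennreal_leI)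
qed

lemma ennreal_mult3: "0 \<le> a \<Longrightarrow> 0 \<le> b \<Longrightarrow> 0 \<le> d \<Longrightarrow> ennreal a * (ennreal b * (ennreal d * x)) = ennreal (a * b * d) * x"
  by (simp add: ennreal_mult mult.assoc)

text \<open>The factor 16 = 4 * 4 stems from two nested uses of \<open>LpN_add_le\<close>.\<close>

lemma ennreal_mult16:
  assumes "0 \<le> d" "0 \<le> a" "0 \<le> b"
  shows "ennreal d * (4 * (4 * (ennreal a * x + ennreal b * x))) = ennreal (16 * d * (a + b)) * x"
proof -
  have "ennreal (16 * d * (a + b)) = 16 * ennreal d * (ennreal a + ennreal b)"
    using assms by (simp add: ennreal_mult)
  moreover have "ennreal d * (4 * (4 * (ennreal a * x + ennreal b * x))) = (4 * 4) * ennreal d * ((ennreal a + ennreal b) * x)"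
    by (simp only: distrib_right mult.assoc mult.left_commute)
  ultimately show ?thesis by (simp add: mult.assoc)
qed

lemma LpN_add_le':
  assumes "1 \<le> p" "f \<in> borel_measurable M" "g \<in> borel_measurable M" "LpN p M f \<le> a" "LpN p M g \<le> b"
  shows "LpN p M (\<lambda>x. f x + g x) \<le> 4 * (a + b)"
  by (rule order_trans[OF LpN_add_le[OF assms(1-3)]]) (intro mult_left_mono add_mono assms(4,5), simp)

lemma LpN_cmult_le':
  assumes "1 \<le> p" "f \<in> borel_measurable M" "LpN p M f \<le> a"
  shows "LpN p M (\<lambda>x. c * f x) \<le> c * a"
  by (rule order_trans[OF LpN_cmult_le[OF assms(1,2)]]) (intro mult_left_mono assms(3), simp)

context phase
begin

lemma moderated_borel: "moderated Cv v \<Longrightarrow> v \<in> borel_measurable borel"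
  by (simp add: moderated_def)

lemma lattice_const:
  assumes "slowly_varying b \<theta>" "0 \<le> b" and [measurable]: "\<theta> \<in> borel_measurable borel" and "wnorm1 \<theta> < \<infinity>"
  obtains C where "0 < C" "wnorm1 \<theta> \<le> ennreal C"
    "\<And>x. (\<integral>\<^sup>+ \<gamma>. \<theta> (x - \<gamma>) * ennreal (w (x - \<gamma>)) \<partial>count_space \<Gamma>) \<le> ennreal C"
proof -
  let ?k = "ennreal (b * w_unit_bound * K / unit_vol TYPE('a))"
  have "wnorm1 \<theta> + ?k * wnorm1 \<theta> < \<infinity>" using assms(4) by (auto simp: ennreal_mult_less_top ennreal_add_eq_top less_top)
  then obtain C where C: "0 < C" "wnorm1 \<theta> + ?k * wnorm1 \<theta> \<le> ennreal C" by (rule ennreal_bound_real)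
  show ?thesis
  proof (rule that[OF C(1)])
    show "wnorm1 \<theta> \<le> ennreal C" using C(2) by (auto elim: order_trans[rotated] simp: add_increasing2)
    fix x
    have "(\<integral>\<^sup>+ \<gamma>. \<theta> (x - \<gamma>) * ennreal (w (x - \<gamma>)) \<partial>count_space \<Gamma>) \<le> ?k * wnorm1 \<theta>"
      using assms(1) by (intro separated_weighted_sum_le[OF sep assms(2)]) (auto simp: slowly_varying_def)
    then show "(\<integral>\<^sup>+ \<gamma>. \<theta> (x - \<gamma>) * ennreal (w (x - \<gamma>)) \<partial>count_space \<Gamma>) \<le> ennreal C"
      using C(2) by (auto elim!: order_trans intro: order_trans[rotated, OF C(2)] simp: add_increasing)
  qed
qed

lemma conv_int_\<Phi>_bound:
  obtains C where "0 < C"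
    "\<And>Cv v h p. moderated Cv v \<Longrightarrow> h \<in> borel_measurable borel \<Longrightarrow> 1 \<le> p \<Longrightarrow>
       LpN p lborel (\<lambda>x. conv_int \<Phi> h x * ennreal (v x)) \<le> ennreal (2 * Cv * C) * LpN p lborel (\<lambda>x. h x * ennreal (v x))"
proof -
  obtain C where C: "0 < C" "wnorm1 \<Phi> \<le> ennreal C" using ennreal_bound_real[OF \<Phi>_wnorm1] by metis
  show ?thesis
    using weighted_Young[OF _ \<Phi>_borel _ C(2) C(1)] by (intro that[OF C(1)]) (simp add: conv_int_def)
qed

lemma norm_le_loc2_norm:
  obtains C where "0 < C"
    "\<And>R v g p. 1 \<le> R \<Longrightarrow> moderated Cv v \<Longrightarrow> g \<in> borel_measurable borel \<Longrightarrow> (\<And>z. g z \<le> conv_int \<Phi> g z) \<Longrightarrow> 1 \<le> p \<Longrightarrow>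
       LpN p lborel (\<lambda>x. g x * ennreal (v x)) \<le> ennreal C * LpN p lborel (\<lambda>x. loc2 R g x * ennreal (v x))"
proof (cases "0 < Cv")
  \<comment> \<open>No positive weight is moderated with a constant \<le> 0, so the claim is
    vacuous.\<close>
  case False
  then show ?thesis using that[of 1] moderated_Cv_pos[of Cv] by force
next
  case True
  obtain C where C: "0 < C"
    "\<And>Cv v h p. moderated Cv v \<Longrightarrow> h \<in> borel_measurable borel \<Longrightarrow> 1 \<le> p \<Longrightarrow>
       LpN p lborel (\<lambda>x. conv_int \<Phi> h x * ennreal (v x)) \<le> ennreal (2 * Cv * C) * LpN p lborel (\<lambda>x. h x * ennreal (v x))"
    using conv_int_\<Phi>_bound by blast
  define b where "b = c * exp 1 / sqrt (unit_vol TYPE('a))"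
  have b: "0 < b" using c unit_vol_pos[where 'a='a] by (simp add: b_def)
  show ?thesis
  proof (rule that[of "b * (2 * Cv * C)"])
    show "0 < b * (2 * Cv * C)" using b C True by simp
    fix R :: real and v :: "'a \<Rightarrow> real" and g p assume R: "1 \<le> R" and v: "moderated Cv v" and g [measurable]: "g \<in> borel_measurable borel"
      and le: "\<And>z. g z \<le> conv_int \<Phi> g z" and p: "1 \<le> (p::ennreal)"
    have [measurable]: "v \<in> borel_measurable borel" using v by (rule moderated_borel)
    have "LpN p lborel (\<lambda>x. g x * ennreal (v x)) \<le> LpN p lborel (\<lambda>x. ennreal b * (conv_int \<Phi> (loc2 R g) x * ennreal (v x)))"
      unfolding b_def mult.assoc[symmetric]
      by (intro LpN_mono[OF p] mult_right_mono le_conv_int_loc2 R g \<Phi>_slowly_varying le) (use c in auto)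
    also have "\<dots> \<le> ennreal b * (ennreal (2 * Cv * C) * LpN p lborel (\<lambda>x. loc2 R g x * ennreal (v x)))"
      by (intro LpN_cmult_le'[OF p] C(2)[OF v _ p]) measurable
    finally show "LpN p lborel (\<lambda>x. g x * ennreal (v x)) \<le> ennreal (b * (2 * Cv * C)) * LpN p lborel (\<lambda>x. loc2 R g x * ennreal (v x))"
      using b by (simp add: ennreal_mult' mult.assoc)
  qed
qed

text \<open>The majorant \<open>conv_int \<Phi> g\<close> of \<open>g\<close> is slowly varying,
  hence \<open>loc2_le_conv_int\<close> applies to it. The first estimate gives the finiteness
  needed for absorption; the second, at the points of \<Gamma>, later controls the spectral
  remainder.\<close>

lemma loc2_norms_le:
  assumes R: "1 \<le> R"
  shows "\<exists>C>0. \<forall>v g p. moderated Cv v \<longrightarrow> g \<in> borel_measurable borel \<longrightarrow> (\<forall>z. g z \<le> conv_int \<Phi> g z) \<longrightarrow> 1 \<le> p \<longrightarrow>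
       LpN p lborel (\<lambda>x. loc2 R g x * ennreal (v x)) \<le> ennreal C * LpN p lborel (\<lambda>x. g x * ennreal (v x)) \<and>
       LpN p (count_space \<Gamma>) (\<lambda>x. loc2 R g x * ennreal (v x)) \<le> ennreal C * LpN p lborel (\<lambda>x. g x * ennreal (v x))"
proof (cases "0 < Cv")
  case False
  then show ?thesis using moderated_Cv_pos[of Cv] by (intro exI[of _ 1]) auto
next
  case True
  obtain C where C: "0 < C"
    "\<And>Cv v h p. moderated Cv v \<Longrightarrow> h \<in> borel_measurable borel \<Longrightarrow> 1 \<le> p \<Longrightarrow>
       LpN p lborel (\<lambda>x. conv_int \<Phi> h x * ennreal (v x)) \<le> ennreal (2 * Cv * C) * LpN p lborel (\<lambda>x. h x * ennreal (v x))"
    using conv_int_\<Phi>_bound by blast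
  obtain D where D: "0 < D" "wnorm1 (sexp R) \<le> ennreal D"
    "\<And>x. (\<integral>\<^sup>+ \<gamma>. sexp R (x - \<gamma>) * ennreal (w (x - \<gamma>)) \<partial>count_space \<Gamma>) \<le> ennreal D"
    using lattice_const[OF slowly_varying_sexp[OF R] _ sexp_borel wnorm1_sexp_finite[OF R]] by auto
  define b where "b = sqrt (exp 1 * c / unit_vol TYPE('a))"
  have b: "0 < b" using c unit_vol_pos[where 'a='a] by (simp add: b_def)
  let ?C = "b * (2 * Cv * D) * (2 * Cv * C)"
  have eq: "ennreal b * (ennreal (2 * Cv * D) * (ennreal (2 * Cv * C) * x)) = ennreal ?C * x" for x
    using b C D True by (intro ennreal_mult3) auto
  have ptw: "loc2 R g x \<le> ennreal b * conv_int (sexp R) (conv_int \<Phi> g) x" 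
    if [measurable]: "g \<in> borel_measurable borel" and "\<And>z. g z \<le> conv_int \<Phi> g z" for g x
    unfolding b_def using c by (intro loc2_le_conv_int[OF R] slowly_varying_conv_int \<Phi>_slowly_varying that) auto
  show ?thesis
  proof (intro exI[of _ ?C] conjI allI impI)
    show "0 < ?C" using b C D True by simp
  next
    fix v g p assume v: "moderated Cv v" and g [measurable]: "g \<in> borel_measurable borel"
      and "\<forall>z. g z \<le> conv_int \<Phi> g z" and p: "1 \<le> (p::ennreal)"
    then have le: "g z \<le> conv_int \<Phi> g z" for z by simp
    have [measurable]: "v \<in> borel_measurable borel" using v by (rule moderated_borel)
    have "LpN p lborel (\<lambda>x. loc2 R g x * ennreal (v x)) \<le> LpN p lborel (\<lambda>x. ennreal b * (conv_int (sexp R) (conv_int \<Phi> g) x * ennreal (v x)))"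
      unfolding mult.assoc[symmetric] by (intro LpN_mono[OF p] mult_right_mono ptw g le) auto
    also have "\<dots> \<le> ennreal b * (ennreal (2 * Cv * D) * LpN p lborel (\<lambda>x. conv_int \<Phi> g x * ennreal (v x)))"
      unfolding conv_int_def[of "sexp R"]
      by (intro LpN_cmult_le'[OF p] weighted_Young[OF v _ _ D(2,1) p]) measurable
    also have "\<dots> \<le> ennreal b * (ennreal (2 * Cv * D) * (ennreal (2 * Cv * C) * LpN p lborel (\<lambda>x. g x * ennreal (v x))))"
      by (intro mult_left_mono C(2)[OF v g p]) auto
    finally show "LpN p lborel (\<lambda>x. loc2 R g x * ennreal (v x)) \<le> ennreal ?C * LpN p lborel (\<lambda>x. g x * ennreal (v x))"
      unfolding eq .
  next
    fix v g p assume v: "moderated Cv v" and g [measurable]: "g \<in> borel_measurable borel"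
      and "\<forall>z. g z \<le> conv_int \<Phi> g z" and p: "1 \<le> (p::ennreal)"
    then have le: "g z \<le> conv_int \<Phi> g z" for z by simp
    have "LpN p (count_space \<Gamma>) (\<lambda>x. loc2 R g x * ennreal (v x)) \<le> LpN p (count_space \<Gamma>) (\<lambda>x. ennreal b * ((\<integral>\<^sup>+ y. sexp R (y - x) * conv_int \<Phi> g y \<partial>lborel) * ennreal (v x)))"
    proof -
      have "conv_int (sexp R) (conv_int \<Phi> g) x = (\<integral>\<^sup>+ y. sexp R (y - x) * conv_int \<Phi> g y \<partial>lborel)" for x
        unfolding conv_int_def[of "sexp R"] by (rule nn_integral_cong) (metis minus_diff_eq sexp_uminus)
      then show ?thesis
        unfolding mult.assoc[symmetric] using ptw[OF g le] by (intro LpN_mono[OF p] mult_right_mono) auto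
    qed
    also have "\<dots> \<le> ennreal b * (ennreal (2 * Cv * D) * LpN p lborel (\<lambda>x. conv_int \<Phi> g x * ennreal (v x)))"
      by (intro LpN_cmult_le'[OF p] weighted_to_lattice[OF v countable_\<Gamma> _ _ D(2,3,1) p]) simp_all
    also have "\<dots> \<le> ennreal b * (ennreal (2 * Cv * D) * (ennreal (2 * Cv * C) * LpN p lborel (\<lambda>x. g x * ennreal (v x))))"
      by (intro mult_left_mono C(2)[OF v g p]) auto
    finally show "LpN p (count_space \<Gamma>) (\<lambda>x. loc2 R g x * ennreal (v x)) \<le> ennreal ?C * LpN p lborel (\<lambda>x. g x * ennreal (v x))"
      unfolding eq .
  qed
qed


text \<open>First absorption: the pointwise inequality is taken in norm, and \<open>R\<close> is so
  large that both commutator convolutions together cost at most half of the left side.\<close>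

lemma local_energy_norm_bound:
  assumes Cv: "0 < Cv"
  obtains R D where "1 \<le> R" "0 < D"
    "\<And>v g X p C. moderated Cv v \<Longrightarrow> g \<in> borel_measurable borel \<Longrightarrow> (\<And>z. g z \<le> conv_int \<Phi> g z)
      \<Longrightarrow> (\<And>z. g z \<le> ennreal (C * w z)) \<Longrightarrow> local_energy R g X \<Longrightarrow> 1 \<le> p
      \<Longrightarrow> LpN p lborel (\<lambda>x. g x * ennreal (v x)) < \<infinity>
      \<Longrightarrow> LpN p lborel (\<lambda>x. g x * ennreal (v x)) \<le> ennreal D * LpN p (count_space \<Gamma>) (\<lambda>x. X x * ennreal (v x))"
proof -
  \<comment> \<open>Chosen so that 4 * 4 * (2 Cv \<delta> + 2 Cv \<delta>) = A / 2: two commutator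
    terms from Young's inequality and two applications of the triangle inequality with constant
    4.\<close>
  define \<delta> where "\<delta> = A / (128 * Cv)"
  have \<delta>: "0 < \<delta>" using A Cv by (simp add: \<delta>_def)
  obtain R where R: "1 \<le> R" "wnorm1 (comm_kernel R) \<le> ennreal \<delta>" using comm_kernel_small[OF \<delta>] by metis
  obtain C1 where C1: "0 < C1"
    "\<And>R v g p. 1 \<le> R \<Longrightarrow> moderated Cv v \<Longrightarrow> g \<in> borel_measurable borel \<Longrightarrow> (\<And>z. g z \<le> conv_int \<Phi> g z) \<Longrightarrow> 1 \<le> p \<Longrightarrow>
       LpN p lborel (\<lambda>x. g x * ennreal (v x)) \<le> ennreal C1 * LpN p lborel (\<lambda>x. loc2 R g x * ennreal (v x))"
    using norm_le_loc2_norm[of Cv] by blast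
  obtain C2 where "0 < C2" and C2: "\<forall>v g p. moderated Cv v \<longrightarrow> g \<in> borel_measurable borel \<longrightarrow> (\<forall>z. g z \<le> conv_int \<Phi> g z) \<longrightarrow> 1 \<le> p \<longrightarrow>
       LpN p lborel (\<lambda>x. loc2 R g x * ennreal (v x)) \<le> ennreal C2 * LpN p lborel (\<lambda>x. g x * ennreal (v x)) \<and>
       LpN p (count_space \<Gamma>) (\<lambda>x. loc2 R g x * ennreal (v x)) \<le> ennreal C2 * LpN p lborel (\<lambda>x. g x * ennreal (v x))"
    using loc2_norms_le[OF R(1), of Cv] by blast
  obtain D where D: "0 < D" "wnorm1 (sexp R) \<le> ennreal D"
    "\<And>x. (\<integral>\<^sup>+ \<gamma>. sexp R (x - \<gamma>) * ennreal (w (x - \<gamma>)) \<partial>count_space \<Gamma>) \<le> ennreal D"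
    using lattice_const[OF slowly_varying_sexp[OF R(1)] _ sexp_borel wnorm1_sexp_finite[OF R(1)]] by auto
  define M where "M = 4 * (exp 1 * (2 * Cv * D))"
  have M: "0 < M" using D Cv by (simp add: M_def)
  show ?thesis
  proof (rule that[of R "C1 * (2 / A) * M"])
    show "0 < C1 * (2 / A) * M" using C1 A M by simp
    fix v g X p C
    assume v: "moderated Cv v" and g [measurable]: "g \<in> borel_measurable borel" and le: "\<And>z. g z \<le> conv_int \<Phi> g z"
      and gw: "\<And>z. g z \<le> ennreal (C * w z)" and loc: "local_energy R g X" and p: "1 \<le> (p::ennreal)"
      and fin: "LpN p lborel (\<lambda>x. g x * ennreal (v x)) < \<infinity>"
    have [measurable]: "v \<in> borel_measurable borel" using v by (rule moderated_borel)
    let ?N = "LpN p lborel (\<lambda>x. loc2 R g x * ennreal (v x))" and ?X = "LpN p (count_space \<Gamma>) (\<lambda>x. X x * ennreal (v x))"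
    let ?a = "\<lambda>x. conv_int (comm_kernel R) (loc2 R g) x" and ?b = "\<lambda>x. \<integral>\<^sup>+ z. comm_kernel R (z - x) * loc2 R g z \<partial>lborel"
      and ?s = "\<lambda>x. \<integral>\<^sup>+ \<gamma>. sexp R (x - \<gamma>) * X \<gamma> \<partial>count_space \<Gamma>"
    have [measurable]: "?s \<in> borel_measurable borel"
      using borel_measurable_count_integral[OF countable_\<Gamma>, of "\<lambda>\<gamma> x. sexp R (x - \<gamma>) * X \<gamma>"] by simp
    have N: "?N < \<infinity>"
      by (rule order.strict_trans1[OF C2[rule_format, OF v g le p, THEN conjunct1]]) (use fin in \<open>simp add: ennreal_mult_less_top\<close>)
    have 1: "LpN p lborel (\<lambda>x. ?a x * ennreal (v x)) \<le> ennreal (2 * Cv * \<delta>) * ?N"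
      unfolding conv_int_def by (intro weighted_Young[OF v _ _ R(2) \<delta> p]) measurable
    have 2: "LpN p lborel (\<lambda>x. ?b x * ennreal (v x)) \<le> ennreal (2 * Cv * \<delta>) * ?N"
      by (intro weighted_Young'[OF v _ _ R(2) \<delta> p]) measurable
    have 3: "LpN p lborel (\<lambda>x. ennreal (exp 1) * (?s x * ennreal (v x))) \<le> ennreal (exp 1) * (ennreal (2 * Cv * D) * ?X)"
      by (intro LpN_cmult_le'[OF p] weighted_from_lattice[OF v countable_\<Gamma> _ D(2,3,1) p]) measurable
    \<comment> \<open>\<open>LpN_cmult_le\<close> is only an upper bound, so A is brought inside the
      norm by writing \<open>loc2\<close> as 1/A times A \<open>loc2\<close>.\<close>
    have "ennreal A * ?N = ennreal A * LpN p lborel (\<lambda>x. ennreal (1 / A) * (ennreal A * loc2 R g x * ennreal (v x)))"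
      using A by (simp add: mult.assoc[symmetric] ennreal_mult[symmetric])
    also have "\<dots> \<le> ennreal A * (ennreal (1 / A) * LpN p lborel (\<lambda>x. ennreal A * loc2 R g x * ennreal (v x)))"
      by (intro mult_left_mono LpN_cmult_le[OF p]) simp_all
    also have "\<dots> = LpN p lborel (\<lambda>x. ennreal A * loc2 R g x * ennreal (v x))"
      using A by (simp add: mult.assoc[symmetric] ennreal_mult[symmetric])
    also have "\<dots> \<le> LpN p lborel (\<lambda>x. (?a x * ennreal (v x) + ?b x * ennreal (v x)) + ennreal (exp 1) * (?s x * ennreal (v x)))"
    proof (intro LpN_mono[OF p])
      fix x
      have "loc2 R g x < \<infinity>" by (rule loc2_finite[OF R(1) gw])
      from mult_right_mono[OF loc2_pointwise_bound[OF R(1) g this loc], of "ennreal (v x)"]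
      show "ennreal A * loc2 R g x * ennreal (v x) \<le> (?a x * ennreal (v x) + ?b x * ennreal (v x)) + ennreal (exp 1) * (?s x * ennreal (v x))"
        by (simp add: distrib_right mult.assoc)
    qed
    also have "\<dots> \<le> 4 * (4 * (ennreal (2 * Cv * \<delta>) * ?N + ennreal (2 * Cv * \<delta>) * ?N) + ennreal (exp 1) * (ennreal (2 * Cv * D) * ?X))"
      by (intro LpN_add_le'[OF p] 1 2 3) measurable
    also have "\<dots> = ennreal (A / 2) * ?N + ennreal M * ?X"
    proof -
      have "4 * (4 * (ennreal (2 * Cv * \<delta>) * ?N + ennreal (2 * Cv * \<delta>) * ?N)) = ennreal (32 * (2 * Cv * \<delta>)) * ?N"
        using Cv \<delta> ennreal_mult16[of 1 "2 * Cv * \<delta>" "2 * Cv * \<delta>" ?N] by simp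
      moreover have "32 * (2 * Cv * \<delta>) = A / 2" using Cv by (simp add: \<delta>_def)
      moreover have "4 * (ennreal (exp 1) * (ennreal (2 * Cv * D) * ?X)) = ennreal M * ?X"
        using Cv D ennreal_mult3[of 4 "exp 1" "2 * Cv * D" ?X] by (simp add: M_def mult.assoc)
      ultimately show ?thesis unfolding distrib_left[of "4::ennreal" _ "ennreal (exp 1) * (ennreal (2 * Cv * D) * ?X)"] by (simp only:)
    qed
    finally have "?N \<le> ennreal (2 / A) * (ennreal M * ?X)" by (rule ennreal_absorb[OF N A])
    then have "ennreal C1 * ?N \<le> ennreal C1 * (ennreal (2 / A) * (ennreal M * ?X))" by (rule mult_left_mono) simp
    with C1(2)[OF R(1) v g le p] 
    have "LpN p lborel (\<lambda>x. g x * ennreal (v x)) \<le> ennreal C1 * (ennreal (2 / A) * (ennreal M * ?X))" by (rule order_trans)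
    also have "\<dots> = ennreal (C1 * (2 / A) * M) * ?X" using C1 A M by (intro ennreal_mult3) auto
    finally show "LpN p lborel (\<lambda>x. g x * ennreal (v x)) \<le> ennreal (C1 * (2 / A) * M) * ?X" .
  qed (use R in auto)
qed

lemma tail_small:
  assumes "0 < \<kappa>"
  obtains r where "1 \<le> r" "wnorm1 (tail r) \<le> ennreal \<kappa>"
    "\<And>x. (\<integral>\<^sup>+ \<gamma>. tail r (x - \<gamma>) * ennreal (w (x - \<gamma>)) \<partial>count_space \<Gamma>) \<le> ennreal \<kappa>"
proof -
  let ?k = "c * w_unit_bound * K / unit_vol TYPE('a)"
  have k: "0 \<le> ?k" using c w_unit_bound(1) unit_vol_pos[where 'a='a] by simp
  have "filterlim (\<lambda>n. real n - 1) at_top sequentially" by real_asymp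
  from nn_integral_tail_tendsto_0[OF _ _ this, of "\<lambda>z::'a. E z * ennreal (w z)"]
  have lim: "(\<lambda>n. wnorm1 (tail (real n - 1))) \<longlonglongrightarrow> 0"
    using E_wnorm1 by (simp add: wnorm1_def tail_def mult.assoc)
  \<comment> \<open>Dividing by 1 + k makes one small number serve both claims: x / (1 + k) \<le> x
    and k x / (1 + k) \<le> x.\<close>
  have "0 < ennreal (\<kappa> / (1 + ?k))" using assms k by simp
  from order_tendstoD(2)[OF lim this]
  have "eventually (\<lambda>n. 1 \<le> real n \<and> wnorm1 (tail (real n - 1)) < ennreal (\<kappa> / (1 + ?k))) sequentially"
    using eventually_ge_at_top[of 1] by eventually_elim auto
  then obtain n where n: "1 \<le> real n" "wnorm1 (tail (real n - 1)) < ennreal (\<kappa> / (1 + ?k))"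
    using eventually_happens'[OF sequentially_bot] by blast
  have le: "wnorm1 (tail (real n)) \<le> wnorm1 (tail (real n - 1))"
    unfolding wnorm1_def tail_def by (intro nn_integral_mono mult_right_mono) (auto simp: indicator_def)
  have *: "x / (1 + k) \<le> x" "k * (x / (1 + k)) \<le> x" if "0 \<le> k" "0 < x" for k x :: real
    using that by (auto simp: field_simps)
  have "\<kappa> / (1 + ?k) \<le> \<kappa>" "?k * (\<kappa> / (1 + ?k)) \<le> \<kappa>" using *[OF k assms] by auto
  show ?thesis
  proof (rule that[OF n(1)])
    show "wnorm1 (tail (real n)) \<le> ennreal \<kappa>"
      using le n(2) ennreal_leI[OF \<open>\<kappa> / (1 + ?k) \<le> \<kappa>\<close>] by auto
    fix x
    have "(\<integral>\<^sup>+ \<gamma>. tail (real n) (x - \<gamma>) * ennreal (w (x - \<gamma>)) \<partial>count_space \<Gamma>) \<le> ennreal ?k * wnorm1 (tail (real n - 1))"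
      using c by (intro separated_weighted_sum_le[OF sep]) (auto intro: tail_shift)
    also have "\<dots> \<le> ennreal ?k * ennreal (\<kappa> / (1 + ?k))" using n(2) by (intro mult_left_mono) auto
    also have "\<dots> \<le> ennreal \<kappa>"
      using k assms \<open>?k * (\<kappa> / (1 + ?k)) \<le> \<kappa>\<close> by (subst ennreal_mult[symmetric]) (auto intro!: ennreal_leI)
    finally show "(\<integral>\<^sup>+ \<gamma>. tail (real n) (x - \<gamma>) * ennreal (w (x - \<gamma>)) \<partial>count_space \<Gamma>) \<le> ennreal \<kappa>" .
  qed
qed

text \<open>Second absorption. The local data at \<gamma> consist of \<open>P\<close>, which will be
  the sum of the first coefficients, a spectral remainder measured near \<gamma>, and a far tail of
  the symbol. The tail is made small by \<open>r\<close>, the remainder by \<open>t\<close>.\<close>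

lemma local_energy_truncated_bound:
  assumes Cv: "0 < Cv"
  obtains R r t D where "1 \<le> R" "1 \<le> r" "0 < t" "0 < D"
    "\<And>v g P p C. moderated Cv v \<Longrightarrow> g \<in> borel_measurable borel \<Longrightarrow> (\<And>z. g z \<le> conv_int \<Phi> g z)
      \<Longrightarrow> (\<And>z. g z \<le> ennreal (C * w z))
      \<Longrightarrow> local_energy R g (\<lambda>\<gamma>. P \<gamma> + (ennreal t * loc2 r g \<gamma> + (\<integral>\<^sup>+ z. tail r (z - \<gamma>) * g z \<partial>lborel))) \<Longrightarrow> 1 \<le> p
      \<Longrightarrow> LpN p lborel (\<lambda>x. g x * ennreal (v x)) < \<infinity>
      \<Longrightarrow> LpN p lborel (\<lambda>x. g x * ennreal (v x)) \<le> ennreal D * LpN p (count_space \<Gamma>) (\<lambda>x. P x * ennreal (v x))"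
proof -
  obtain R D where RD: "1 \<le> R" "0 < D"
    "\<And>v g X p C. moderated Cv v \<Longrightarrow> g \<in> borel_measurable borel \<Longrightarrow> (\<And>z. g z \<le> conv_int \<Phi> g z)
      \<Longrightarrow> (\<And>z. g z \<le> ennreal (C * w z)) \<Longrightarrow> local_energy R g X \<Longrightarrow> 1 \<le> p
      \<Longrightarrow> LpN p lborel (\<lambda>x. g x * ennreal (v x)) < \<infinity>
      \<Longrightarrow> LpN p lborel (\<lambda>x. g x * ennreal (v x)) \<le> ennreal D * LpN p (count_space \<Gamma>) (\<lambda>x. X x * ennreal (v x))"
    using local_energy_norm_bound[OF Cv] by blast
  \<comment> \<open>Together with \<open>t\<close> below, 16 D (t C2 + 2 Cv \<kappa>) = 1/2, each
    summand contributing 1/4. Here \<open>t\<close> has to come last, because C2 depends on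
    \<open>r\<close>.\<close>
  define \<kappa> where "\<kappa> = 1 / (128 * D * Cv)"
  have \<kappa>: "0 < \<kappa>" using RD(2) Cv by (simp add: \<kappa>_def)
  obtain r where r: "1 \<le> r" "wnorm1 (tail r) \<le> ennreal \<kappa>"
    "\<And>x. (\<integral>\<^sup>+ \<gamma>. tail r (x - \<gamma>) * ennreal (w (x - \<gamma>)) \<partial>count_space \<Gamma>) \<le> ennreal \<kappa>"
    using tail_small[OF \<kappa>] by metis
  obtain C2 where C2_pos: "0 < C2" and C2: "\<forall>v g p. moderated Cv v \<longrightarrow> g \<in> borel_measurable borel \<longrightarrow> (\<forall>z. g z \<le> conv_int \<Phi> g z) \<longrightarrow> 1 \<le> p \<longrightarrow>
       LpN p lborel (\<lambda>x. loc2 r g x * ennreal (v x)) \<le> ennreal C2 * LpN p lborel (\<lambda>x. g x * ennreal (v x)) \<and>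
       LpN p (count_space \<Gamma>) (\<lambda>x. loc2 r g x * ennreal (v x)) \<le> ennreal C2 * LpN p lborel (\<lambda>x. g x * ennreal (v x))"
    using loc2_norms_le[OF r(1), of Cv] by blast
  define t where "t = 1 / (64 * D * C2)"
  have t: "0 < t" using RD(2) C2_pos by (simp add: t_def)
  show ?thesis
  proof (rule that[of R r t "2 * (4 * D)"])
    fix v g P p C
    assume v: "moderated Cv v" and g [measurable]: "g \<in> borel_measurable borel" and le: "\<And>z. g z \<le> conv_int \<Phi> g z"
      and gw: "\<And>z. g z \<le> ennreal (C * w z)"
      and loc: "local_energy R g (\<lambda>\<gamma>. P \<gamma> + (ennreal t * loc2 r g \<gamma> + (\<integral>\<^sup>+ z. tail r (z - \<gamma>) * g z \<partial>lborel)))"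
      and p: "1 \<le> (p::ennreal)"
      and fin: "LpN p lborel (\<lambda>x. g x * ennreal (v x)) < \<infinity>"
    let ?N = "LpN p lborel (\<lambda>x. g x * ennreal (v x))" and ?P = "LpN p (count_space \<Gamma>) (\<lambda>x. P x * ennreal (v x))"
    let ?T = "\<lambda>\<gamma>. \<integral>\<^sup>+ z. tail r (z - \<gamma>) * g z \<partial>lborel"
    have 1: "LpN p (count_space \<Gamma>) (\<lambda>x. ennreal t * (loc2 r g x * ennreal (v x))) \<le> ennreal t * (ennreal C2 * ?N)"
      by (intro LpN_cmult_le'[OF p] C2[rule_format, OF v g le p, THEN conjunct2]) measurable
    have 2: "LpN p (count_space \<Gamma>) (\<lambda>x. ?T x * ennreal (v x)) \<le> ennreal (2 * Cv * \<kappa>) * ?N"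
      by (intro weighted_to_lattice[OF v countable_\<Gamma> _ _ r(2,3) \<kappa> p]) measurable
    have "?N \<le> ennreal D * LpN p (count_space \<Gamma>) (\<lambda>x. (P x + (ennreal t * loc2 r g x + ?T x)) * ennreal (v x))"
      by (rule RD(3)[OF v g le gw loc p fin])
    also have "(\<lambda>x. (P x + (ennreal t * loc2 r g x + ?T x)) * ennreal (v x))
      = (\<lambda>x. P x * ennreal (v x) + (ennreal t * (loc2 r g x * ennreal (v x)) + ?T x * ennreal (v x)))"
      by (simp add: distrib_right mult.assoc)
    also have "ennreal D * LpN p (count_space \<Gamma>) \<dots> \<le> ennreal D * (4 * (?P + 4 * (ennreal t * (ennreal C2 * ?N) + ennreal (2 * Cv * \<kappa>) * ?N)))"
      by (intro mult_left_mono LpN_add_le'[OF p] 1 2) simp_all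
    also have "\<dots> = ennreal (1 / 2) * ?N + ennreal (4 * D) * ?P"
    proof -
      have "ennreal D * (4 * (4 * (ennreal (t * C2) * ?N + ennreal (2 * Cv * \<kappa>) * ?N)))
         = ennreal (16 * D * (t * C2 + 2 * Cv * \<kappa>)) * ?N"
        using RD(2) t C2_pos \<kappa> Cv by (intro ennreal_mult16) auto
      moreover have "ennreal t * (ennreal C2 * ?N) = ennreal (t * C2) * ?N"
        using t C2_pos by (simp add: ennreal_mult mult.assoc)
      moreover have "16 * D * (t * C2 + 2 * Cv * \<kappa>) = 1 / 2"
        using RD(2) C2_pos Cv by (simp add: t_def \<kappa>_def field_simps)
      moreover have "ennreal D * (4 * ?P) = ennreal (4 * D) * ?P" using RD(2) by (simp add: ennreal_mult mult_ac)
      ultimately show ?thesis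
        unfolding distrib_left[of "4::ennreal" ?P] distrib_left[of "ennreal D" "4 * ?P"] add.commute[of "ennreal (1 / 2) * ?N"]
        by (simp only:)
    qed
    finally have "ennreal 1 * ?N \<le> ennreal (1 / 2) * ?N + ennreal (4 * D) * ?P" by simp
    then have "?N \<le> ennreal (2 / 1) * (ennreal (4 * D) * ?P)" by (rule ennreal_absorb[OF fin zero_less_one])
    then show "?N \<le> ennreal (2 * (4 * D)) * ?P" using RD(2) by (simp add: ennreal_mult mult.assoc)
  qed (use RD r t in auto)
qed

text \<open>For the upper frame inequality, where a coefficient at \<gamma> is at most the integral
  of E(z - \<gamma>) |G z|.\<close>

lemma lattice_norm_le:
  obtains C where "0 < C"
    "\<And>Cv v g p. moderated Cv v \<Longrightarrow> g \<in> borel_measurable borel \<Longrightarrow> 1 \<le> p \<Longrightarrow>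
       LpN p (count_space \<Gamma>) (\<lambda>\<gamma>. (\<integral>\<^sup>+ z. E (z - \<gamma>) * g z \<partial>lborel) * ennreal (v \<gamma>))
       \<le> ennreal (2 * Cv * C) * LpN p lborel (\<lambda>x. g x * ennreal (v x))"
proof -
  obtain C where C: "0 < C" "wnorm1 E \<le> ennreal C"
    "\<And>x. (\<integral>\<^sup>+ \<gamma>. E (x - \<gamma>) * ennreal (w (x - \<gamma>)) \<partial>count_space \<Gamma>) \<le> ennreal C"
    using lattice_const[OF E_slowly_varying _ E_borel E_wnorm1] c by auto
  show ?thesis
    by (rule that[OF C(1)]) (rule weighted_to_lattice[OF _ countable_\<Gamma> E_borel _ C(2,3,1)])
qed

end

section \<open>Square-integrable functions and the Gaussian integral\<close>

lemma borel_measurable_cis [measurable]: "cis \<in> borel_measurable borel"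
  by (intro borel_measurable_continuous_onI continuous_intros)

lemma borel_measurable_cnj [measurable]: "cnj \<in> borel_measurable borel"
  by (intro borel_measurable_continuous_onI continuous_intros)

lemma borel_measurable_fst_snd [measurable]:
  fixes h :: "'a \<Rightarrow> 'b::euclidean_space \<times> 'c::euclidean_space"
  assumes "h \<in> borel_measurable M"
  shows "(\<lambda>p. fst (h p)) \<in> borel_measurable M" "(\<lambda>p. snd (h p)) \<in> borel_measurable M"
  by (rule measurable_compose[OF assms], intro borel_measurable_continuous_onI continuous_intros)+

lemma integral_translate:
  fixes f :: "'a::euclidean_space \<Rightarrow> 'b::{banach, second_countable_topology}"
  assumes [measurable]: "f \<in> borel_measurable borel"
  shows "(\<integral>x. f (x + c) \<partial>lborel) = (\<integral>x. f x \<partial>lborel)"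
proof -
  have "(\<integral>x. f x \<partial>lborel) = (\<integral>x. f x \<partial>(distr lborel borel ((+) c)))"
    by (simp add: lborel_distr_plus)
  then show ?thesis by (simp add: integral_distr add.commute)
qed

lemma integrable_translate:
  fixes f :: "'a::euclidean_space \<Rightarrow> 'b::{banach, second_countable_topology}"
  assumes "integrable lborel f"
  shows "integrable lborel (\<lambda>x. f (x + c))"
proof -
  have [measurable]: "f \<in> borel_measurable borel" using borel_measurable_integrable[OF assms] by simp
  have "integrable (distr lborel borel ((+) c)) f" using assms by (simp add: lborel_distr_plus)
  then show ?thesis by (simp add: integrable_distr_eq add.commute)
qed

definition l2sq :: "(real^'d \<Rightarrow> complex) \<Rightarrow> real" where
  "l2sq f = (\<integral>t. (cmod (f t))\<^sup>2 \<partial>lborel)"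

lemma l2sq_nonneg [simp]: "0 \<le> l2sq f"
  by (simp add: l2sq_def)

lemma sq_integrable_borel: "sq_integrable f \<Longrightarrow> f \<in> borel_measurable borel"
  by (simp add: sq_integrable_def)

lemma nn_integral_l2sq:
  assumes "sq_integrable f"
  shows "(\<integral>\<^sup>+ t. (ennreal (cmod (f t)))\<^sup>2 \<partial>lborel) = ennreal (l2sq f)"
  using assms by (simp add: l2sq_def sq_integrable_def ennreal_power nn_integral_eq_integral)

lemma sq_integrableI_nn:
  assumes [measurable]: "f \<in> borel_measurable borel" and "(\<integral>\<^sup>+ t. (ennreal (cmod (f t)))\<^sup>2 \<partial>lborel) < \<infinity>"
  shows "sq_integrable f"
  using assms by (simp add: sq_integrable_def integrable_iff_bounded ennreal_power)

lemma integrable_mult_cnj: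
  assumes f: "sq_integrable f" and g: "sq_integrable g"
  shows "integrable lborel (\<lambda>t. f t * cnj (g t))"
proof (rule Bochner_Integration.integrable_bound)
  show "integrable lborel (\<lambda>t. (cmod (f t))\<^sup>2 + (cmod (g t))\<^sup>2)"
    using f g by (auto simp: sq_integrable_def)
  have "a * b \<le> a\<^sup>2 + b\<^sup>2" for a b :: real
    using sum_squares_bound[of a b] zero_le_power2[of a] zero_le_power2[of b] by linarith
  then show "AE t in lborel. norm (f t * cnj (g t)) \<le> norm ((cmod (f t))\<^sup>2 + (cmod (g t))\<^sup>2)"
    by (simp add: norm_mult)
  have [measurable]: "f \<in> borel_measurable borel" "g \<in> borel_measurable borel"
    using f g by (auto simp: sq_integrable_borel)
  show "(\<lambda>t. f t * cnj (g t)) \<in> borel_measurable lborel" by measurable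
qed

lemma sq_integrable_add:
  assumes f: "sq_integrable f" and g: "sq_integrable g"
  shows "sq_integrable (\<lambda>t. f t + g t)"
  unfolding sq_integrable_def
proof
  have [measurable]: "f \<in> borel_measurable borel" "g \<in> borel_measurable borel"
    using f g by (auto simp: sq_integrable_borel)
  show "(\<lambda>t. f t + g t) \<in> borel_measurable lborel" by measurable
  show "integrable lborel (\<lambda>t. (cmod (f t + g t))\<^sup>2)"
  proof (rule Bochner_Integration.integrable_bound)
    show "integrable lborel (\<lambda>t. 2 * ((cmod (f t))\<^sup>2 + (cmod (g t))\<^sup>2))"
      using f g by (auto simp: sq_integrable_def)
    have "(cmod (a + b))\<^sup>2 \<le> 2 * ((cmod a)\<^sup>2 + (cmod b)\<^sup>2)" for a b
    proof -
      have "(cmod (a + b))\<^sup>2 \<le> (cmod a + cmod b)\<^sup>2" by (intro power_mono norm_triangle_ineq) auto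
      also have "\<dots> \<le> 2 * ((cmod a)\<^sup>2 + (cmod b)\<^sup>2)"
        using sum_squares_bound[of "cmod a" "cmod b"] by (simp add: power2_sum)
      finally show ?thesis .
    qed
    then show "AE t in lborel. norm ((cmod (f t + g t))\<^sup>2) \<le> norm (2 * ((cmod (f t))\<^sup>2 + (cmod (g t))\<^sup>2))"
      by simp
  qed measurable
qed

lemma sq_integrable_cmult: "sq_integrable f \<Longrightarrow> sq_integrable (\<lambda>t. c * f t)"
  by (auto simp: sq_integrable_def norm_mult power_mult_distrib)

lemma sq_integrable_0 [simp]: "sq_integrable (\<lambda>t. 0)"
  by (simp add: sq_integrable_def)

lemma sq_integrable_diff:
  "sq_integrable f \<Longrightarrow> sq_integrable g \<Longrightarrow> sq_integrable (\<lambda>t. f t - g t)"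
  using sq_integrable_add[of f "\<lambda>t. (- 1) * g t"] sq_integrable_cmult[of g "- 1"] by simp

lemma sq_integrable_sum:
  "(\<And>i. i \<in> I \<Longrightarrow> sq_integrable (f i)) \<Longrightarrow> sq_integrable (\<lambda>t. \<Sum>i\<in>I. f i t)"
  by (induction I rule: infinite_finite_induct) (auto intro: sq_integrable_add)

lemma l2_inner_add:
  assumes "sq_integrable f" "sq_integrable g" "sq_integrable h"
  shows "l2_inner (\<lambda>t. f t + g t) h = l2_inner f h + l2_inner g h"
  using assms by (simp add: l2_inner_def distrib_right integrable_mult_cnj)

lemma l2_inner_diff:
  assumes "sq_integrable f" "sq_integrable g" "sq_integrable h"
  shows "l2_inner (\<lambda>t. f t - g t) h = l2_inner f h - l2_inner g h"
  using assms by (simp add: l2_inner_def left_diff_distrib integrable_mult_cnj)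

lemma l2_inner_cmult: "l2_inner (\<lambda>t. c * f t) h = c * l2_inner f h"
  by (simp add: l2_inner_def mult.assoc)

lemma l2_inner_sum:
  assumes "\<And>i. i \<in> I \<Longrightarrow> sq_integrable (f i)" "sq_integrable h"
  shows "l2_inner (\<lambda>t. \<Sum>i\<in>I. f i t) h = (\<Sum>i\<in>I. l2_inner (f i) h)"
  using assms by (simp add: l2_inner_def sum_distrib_right integrable_mult_cnj)

lemma l2_inner_commute: "l2_inner f g = cnj (l2_inner g f)"
proof -
  have "(\<integral>t. f t * cnj (g t) \<partial>lborel) = (\<integral>t. cnj (g t * cnj (f t)) \<partial>lborel)" by (simp add: mult.commute)
  then show ?thesis unfolding l2_inner_def by (simp only: Bochner_Integration.integral_cnj)
qed

lemma l2_inner_self: "l2_inner f f = complex_of_real (l2sq f)"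
  by (simp add: l2_inner_def l2sq_def complex_norm_square[symmetric] flip: integral_complex_of_real)

lemma l2sq_diff:
  assumes "sq_integrable f" "sq_integrable g"
  shows "complex_of_real (l2sq (\<lambda>t. f t - g t)) = l2_inner f f - l2_inner f g - l2_inner g f + l2_inner g g"
proof -
  have *: "l2_inner h (\<lambda>t. f t - g t) = l2_inner h f - l2_inner h g" if "sq_integrable h" for h
    using l2_inner_diff[OF assms that] l2_inner_commute[of h] by (metis complex_cnj_diff)
  show ?thesis
    using assms by (simp add: l2_inner_self[symmetric] l2_inner_diff sq_integrable_diff *)
qed

lemma l2_Cauchy_Schwarz:
  assumes f: "sq_integrable f" and g: "sq_integrable g"
  shows "(cmod (l2_inner f g))\<^sup>2 \<le> l2sq f * l2sq g"
proof -
  have [measurable]: "f \<in> borel_measurable borel" "g \<in> borel_measurable borel"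
    using f g by (auto simp: sq_integrable_borel)
  have "ennreal (cmod (l2_inner f g)) \<le> (\<integral>\<^sup>+ t. ennreal (cmod (f t * cnj (g t))) \<partial>lborel)"
    unfolding l2_inner_def by (rule integral_norm_bound_ennreal[OF integrable_mult_cnj[OF f g]])
  also have "\<dots> = (\<integral>\<^sup>+ t. ennreal (cmod (f t)) * ennreal (cmod (g t)) \<partial>lborel)"
    by (simp add: norm_mult ennreal_mult)
  finally have "(ennreal (cmod (l2_inner f g)))\<^sup>2 \<le> (\<integral>\<^sup>+ t. ennreal (cmod (f t)) * ennreal (cmod (g t)) \<partial>lborel)\<^sup>2"
    by (rule power_mono) simp
  also have "\<dots> \<le> ennreal (l2sq f) * ennreal (l2sq g)"
    unfolding nn_integral_l2sq[OF f, symmetric] nn_integral_l2sq[OF g, symmetric]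
    by (rule Cauchy_Schwarz_nn_integral) measurable
  finally show ?thesis by (simp add: ennreal_power ennreal_mult[symmetric])
qed

lemma cmod_l2_inner_le:
  assumes "sq_integrable f" "sq_integrable g"
  shows "cmod (l2_inner f g) \<le> sqrt (l2sq f) * sqrt (l2sq g)"
  using real_sqrt_le_mono[OF l2_Cauchy_Schwarz[OF assms]] by (simp add: real_sqrt_mult)

section \<open>Orthonormal systems and Bessel's inequality\<close>

definition proj_residual :: "(nat \<Rightarrow> real^'d \<Rightarrow> complex) \<Rightarrow> nat \<Rightarrow> (real^'d \<Rightarrow> complex) \<Rightarrow> (real^'d \<Rightarrow> complex)" where
  "proj_residual \<phi> n f = (\<lambda>t. f t - (\<Sum>j<n. l2_inner f (\<phi> j) * \<phi> j t))"

context
  fixes \<phi> :: "nat \<Rightarrow> real^'d \<Rightarrow> complex"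
  assumes \<phi>: "\<And>k. sq_integrable (\<phi> k)"
    and orth: "\<And>j k. l2_inner (\<phi> j) (\<phi> k) = (if j = k then 1 else 0)"
begin

lemma sq_integrable_proj: "sq_integrable (\<lambda>t. \<Sum>j<n. l2_inner f (\<phi> j) * \<phi> j t)"
  by (intro sq_integrable_sum sq_integrable_cmult \<phi>)

lemma sq_integrable_proj_residual: "sq_integrable f \<Longrightarrow> sq_integrable (proj_residual \<phi> n f)"
  unfolding proj_residual_def by (intro sq_integrable_diff sq_integrable_proj)

lemma l2_inner_proj:
  "sq_integrable h \<Longrightarrow> l2_inner (\<lambda>t. \<Sum>j<n. l2_inner f (\<phi> j) * \<phi> j t) h = (\<Sum>j<n. l2_inner f (\<phi> j) * l2_inner (\<phi> j) h)"
  by (subst l2_inner_sum) (auto intro: sq_integrable_cmult \<phi> simp: l2_inner_cmult)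

lemma l2_inner_proj_residual:
  assumes "sq_integrable f"
  shows "l2_inner (proj_residual \<phi> n f) (\<phi> k) = (if k < n then 0 else l2_inner f (\<phi> k))"
  unfolding proj_residual_def
  by (subst l2_inner_diff[OF assms sq_integrable_proj \<phi>])
    (simp add: l2_inner_proj[OF \<phi>] orth if_distrib cong: if_cong)

lemma l2sq_proj_residual:
  assumes f: "sq_integrable f"
  shows "l2sq (proj_residual \<phi> n f) = l2sq f - (\<Sum>j<n. (cmod (l2_inner f (\<phi> j)))\<^sup>2)"
proof -
  let ?p = "\<lambda>t. \<Sum>j<n. l2_inner f (\<phi> j) * \<phi> j t"
  let ?S = "complex_of_real (\<Sum>j<n. (cmod (l2_inner f (\<phi> j)))\<^sup>2)"
  have 1: "l2_inner ?p f = ?S"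
    using f by (simp add: l2_inner_proj l2_inner_commute[of "\<phi> _" f] flip: complex_norm_square)
  then have 2: "l2_inner f ?p = ?S" using l2_inner_commute[of f ?p] by simp
  have "l2_inner ?p ?p = (\<Sum>j<n. l2_inner f (\<phi> j) * l2_inner (\<phi> j) ?p)"
    by (rule l2_inner_proj[OF sq_integrable_proj])
  also have "\<dots> = ?S"
  proof -
    have "l2_inner (\<phi> j) ?p = cnj (l2_inner f (\<phi> j))" if "j < n" for j
      by (subst l2_inner_commute) (use that in \<open>simp add: l2_inner_proj[OF \<phi>] orth if_distrib cong: if_cong\<close>)
    then show ?thesis by (simp flip: complex_norm_square)
  qed
  finally have "complex_of_real (l2sq (proj_residual \<phi> n f)) = complex_of_real (l2sq f) - ?S"
    unfolding proj_residual_def l2sq_diff[OF f sq_integrable_proj] by (simp only: 1 2 l2_inner_self) simp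
  then show ?thesis by (metis of_real_diff of_real_eq_iff)
qed

lemma Bessel:
  assumes "sq_integrable f"
  shows "(\<Sum>j<n. (cmod (l2_inner f (\<phi> j)))\<^sup>2) \<le> l2sq f"
  using l2sq_proj_residual[OF assms, of n] l2sq_nonneg[of "proj_residual \<phi> n f"] by linarith

lemma l2sq_proj_residual_le: "sq_integrable f \<Longrightarrow> l2sq (proj_residual \<phi> n f) \<le> l2sq f"
  by (simp add: l2sq_proj_residual sum_nonneg)

end

section \<open>Time-frequency shifts and the short-time Fourier transform\<close>

lemma cmod_cis_mult [simp]: "cmod (cis a * b) = cmod b"
  by (simp add: norm_mult)

lemma cmod_tf_shift: "cmod (tf_shift z f t) = cmod (f (t - fst z))"
  by (simp add: tf_shift_def)

lemma sq_integrable_tf_shift: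
  assumes f: "sq_integrable f"
  shows "sq_integrable (tf_shift z f)"
  unfolding sq_integrable_def
proof
  have [measurable]: "f \<in> borel_measurable borel" using f by (rule sq_integrable_borel)
  show "tf_shift z f \<in> borel_measurable lborel" unfolding tf_shift_def by measurable
  show "integrable lborel (\<lambda>t. (cmod (tf_shift z f t))\<^sup>2)"
    using integrable_translate[of "\<lambda>t. (cmod (f t))\<^sup>2" "- fst z"] f by (simp add: cmod_tf_shift sq_integrable_def)
qed

lemma l2sq_tf_shift:
  assumes f: "sq_integrable f"
  shows "l2sq (tf_shift z f) = l2sq f"
proof -
  have [measurable]: "f \<in> borel_measurable borel" using f by (rule sq_integrable_borel)
  show ?thesis
    using integral_translate[of "\<lambda>t. (cmod (f t))\<^sup>2" "- fst z"] by (simp add: cmod_tf_shift l2sq_def)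
qed

lemma tf_shift_measurable [measurable]:
  fixes f :: "real^'d \<Rightarrow> complex" and h :: "'a \<Rightarrow> (real^'d) \<times> (real^'d)"
  assumes [measurable]: "f \<in> borel_measurable borel" "h \<in> borel_measurable M" "k \<in> borel_measurable M"
  shows "(\<lambda>p. tf_shift (h p) f (k p)) \<in> borel_measurable M"
  unfolding tf_shift_def by measurable

lemma stft_measurable [measurable]:
  fixes f \<phi> :: "real^'d \<Rightarrow> complex"
  assumes [measurable]: "f \<in> borel_measurable borel" "\<phi> \<in> borel_measurable borel"
  shows "stft \<phi> f \<in> borel_measurable borel"
proof -
  have "(\<lambda>z. \<integral>t. f t * cnj (tf_shift z \<phi> t) \<partial>lborel) \<in> borel_measurable borel"
    by (rule lborel.borel_measurable_lebesgue_integral) measurable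
  then show ?thesis by (simp add: stft_def[abs_def] l2_inner_def)
qed

lemma cmod_stft_le:
  assumes "sq_integrable f" "sq_integrable \<phi>"
  shows "cmod (stft \<phi> f z) \<le> sqrt (l2sq f) * sqrt (l2sq \<phi>)"
  unfolding stft_def
  using cmod_l2_inner_le[OF assms(1) sq_integrable_tf_shift[OF assms(2)]] l2sq_tf_shift[OF assms(2)] by simp

text \<open>The adjoint of pi(z) followed by pi(z') equals pi(z' - z) up to a unimodular phase, the
  \<open>?c\<close> of the proof, which the modulus removes.\<close>

lemma cmod_l2_inner_tf_shift:
  assumes f: "sq_integrable f" and g: "sq_integrable g"
  shows "cmod (l2_inner (tf_shift z f) (tf_shift z' g)) = cmod (stft g f (z' - z))"
proof -
  have [measurable]: "f \<in> borel_measurable borel" "g \<in> borel_measurable borel"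
    using f g by (auto simp: sq_integrable_borel)
  let ?F = "\<lambda>t. tf_shift z f t * cnj (tf_shift z' g t)"
  let ?c = "cis (2 * pi * (snd z \<bullet> fst z)) * cis (- (2 * pi * (snd z' \<bullet> fst z)))"
  have "l2_inner (tf_shift z f) (tf_shift z' g) = (\<integral>t. ?F (t + fst z) \<partial>lborel)"
    unfolding l2_inner_def by (rule integral_translate[symmetric]) measurable
  also have "\<dots> = (\<integral>t. ?c * (f t * cnj (tf_shift (z' - z) g t)) \<partial>lborel)"
  proof (rule Bochner_Integration.integral_cong)
    fix t
    have "cis (2 * pi * (snd z \<bullet> (t + fst z))) * cnj (cis (2 * pi * (snd z' \<bullet> (t + fst z)))) 
      = ?c * cnj (cis (2 * pi * ((snd z' - snd z) \<bullet> t)))"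
      by (simp add: cis_cnj cis_mult inner_add_right inner_diff_left algebra_simps)
    moreover have "t + fst z - fst z' = t - (fst z' - fst z)" by simp
    ultimately show "?F (t + fst z) = ?c * (f t * cnj (tf_shift (z' - z) g t))"
      by (simp add: tf_shift_def mult_ac diff_diff_eq2)
  qed simp
  also have "\<dots> = ?c * stft g f (z' - z)"
    by (simp add: stft_def l2_inner_def)
  finally show ?thesis by (simp add: norm_mult)
qed

section \<open>Exchange of integrals and Gaussian integrals\<close>

lemma integrable_pairI:
  fixes F :: "'a::euclidean_space \<Rightarrow> 'b::euclidean_space \<Rightarrow> 'c::{banach, second_countable_topology}"
  assumes [measurable]: "(\<lambda>(x, y). F x y) \<in> borel_measurable (borel \<Otimes>\<^sub>M borel)"
    and "(\<integral>\<^sup>+ x. (\<integral>\<^sup>+ y. ennreal (norm (F x y)) \<partial>lborel) \<partial>lborel) < \<infinity>"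
  shows "integrable (lborel \<Otimes>\<^sub>M lborel) (\<lambda>(x, y). F x y)"
proof -
  have "(\<integral>\<^sup>+ p. ennreal (norm (case p of (x, y) \<Rightarrow> F x y)) \<partial>(lborel \<Otimes>\<^sub>M lborel)) < \<infinity>"
    using assms(2) by (subst lborel.nn_integral_fst[symmetric]) (auto simp: case_prod_beta)
  then show ?thesis by (simp add: integrable_iff_bounded)
qed

lemma Fubini_swap:
  fixes F :: "'a::euclidean_space \<Rightarrow> 'b::euclidean_space \<Rightarrow> 'c::{banach, second_countable_topology}"
  assumes "(\<lambda>(x, y). F x y) \<in> borel_measurable (borel \<Otimes>\<^sub>M borel)"
    and "(\<integral>\<^sup>+ x. (\<integral>\<^sup>+ y. ennreal (norm (F x y)) \<partial>lborel) \<partial>lborel) < \<infinity>"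
  shows "(\<integral>x. (\<integral>y. F x y \<partial>lborel) \<partial>lborel) = (\<integral>y. (\<integral>x. F x y \<partial>lborel) \<partial>lborel)"
  by (rule lborel_pair.Fubini_integral[OF integrable_pairI[OF assms], symmetric])

lemma nn_integral_norm_finite:
  fixes f :: "'a \<Rightarrow> 'b::{banach, second_countable_topology}"
  shows "integrable M f \<Longrightarrow> (\<integral>\<^sup>+ x. ennreal (norm (f x)) \<partial>M) < \<infinity>"
  by (simp add: integrable_iff_bounded)

lemma integral_scale:
  fixes f :: "'a::euclidean_space \<Rightarrow> 'b::{banach, second_countable_topology}"
  assumes [measurable]: "f \<in> borel_measurable borel" and "0 < c"
  shows "(\<integral>x. f x \<partial>lborel) = c ^ DIM('a) *\<^sub>R (\<integral>x. f (c *\<^sub>R x) \<partial>lborel)"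
proof -
  have "(\<integral>x. f x \<partial>lborel) = (\<integral>x. f x \<partial>(density (distr lborel borel (\<lambda>x. 0 + c *\<^sub>R x)) (\<lambda>_. \<bar>c\<bar> ^ DIM('a))))"
    using assms(2) by (subst lborel_affine[of c 0]) simp_all
  then show ?thesis using assms(2) by (simp add: integral_density integral_distr)
qed

lemma integral_lborel_prod:
  fixes f :: "'a::euclidean_space \<Rightarrow> real \<Rightarrow> complex"
  assumes f: "\<And>b. b \<in> Basis \<Longrightarrow> integrable lborel (f b)"
  shows "(\<integral>x. (\<Prod>b\<in>Basis. f b (x \<bullet> b)) \<partial>lborel) = (\<Prod>b\<in>Basis. \<integral>y. f b y \<partial>lborel)"
proof -
  interpret product_sigma_finite "\<lambda>_. lborel :: real measure" ..
  have [measurable]: "f b \<in> borel_measurable borel" if "b \<in> Basis" for b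
    using borel_measurable_integrable[OF f[OF that]] by simp
  have "(\<integral>x. (\<Prod>b\<in>Basis. f b (x \<bullet> b)) \<partial>lborel)
     = (\<integral>g. (\<Prod>b\<in>Basis. f b ((\<Sum>c\<in>Basis. g c *\<^sub>R c) \<bullet> b)) \<partial>(\<Pi>\<^sub>M b\<in>(Basis::'a set). lborel))"
    by (subst lborel_eq, subst integral_distr) (auto intro!: borel_measurable_prod)
  also have "\<dots> = (\<integral>g. (\<Prod>b\<in>Basis. f b (g b)) \<partial>(\<Pi>\<^sub>M b\<in>(Basis::'a set). lborel))"
    by simp
  also have "\<dots> = (\<Prod>b\<in>Basis. \<integral>y. f b y \<partial>lborel)"
    using f by (intro product_integral_prod) auto
  finally show ?thesis .
qed

text \<open>After the substitution x = y / s with s^2 = 2 pi a, the Fourier integral is the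
  characteristic function of the standard normal distribution.\<close>

lemma gaussian_integrable_real:
  assumes "0 < a"
  shows "integrable lborel (\<lambda>x::real. exp (- (pi * a * x\<^sup>2)))"
    and "(\<integral>x. complex_of_real (exp (- (pi * a * x\<^sup>2))) * cis (- (2 * pi * (t * x))) \<partial>lborel)
      = complex_of_real (1 / sqrt a * exp (- (pi * t\<^sup>2 / a)))"
proof -
  define s where "s = sqrt (2 * pi * a)"
  have s: "0 < s" "s\<^sup>2 = 2 * pi * a" using assms by (auto simp: s_def)
  have d: "std_normal_density (0 + s * x) = 1 / sqrt (2 * pi) * exp (- (pi * a * x\<^sup>2))" for x
    using s by (simp add: std_normal_density_def power_mult_distrib)
  have "integrable lborel (\<lambda>x. std_normal_density (0 + s * x))"
    using s by (intro lborel_integrable_real_affine) auto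
  then show "integrable lborel (\<lambda>x::real. exp (- (pi * a * x\<^sup>2)))"
    unfolding d using integrable_mult_right[of "sqrt (2 * pi)" lborel "\<lambda>x. 1 / sqrt (2 * pi) * exp (- (pi * a * x\<^sup>2))"] by simp
  let ?u = "- (2 * pi * t / s)"
  have "complex_of_real (exp (- (?u\<^sup>2) / 2)) = char std_normal_distribution ?u"
    by (simp add: char_std_normal_distribution)
  also have "\<dots> = (\<integral>x. std_normal_density x *\<^sub>R iexp (?u * x) \<partial>lborel)"
    unfolding char_def by (subst integral_density) (auto simp: std_normal_density_def)
  also have "\<dots> = s *\<^sub>R (\<integral>x. std_normal_density (0 + s * x) *\<^sub>R iexp (?u * (0 + s * x)) \<partial>lborel)"
    using lborel_integral_real_affine[of s "\<lambda>x. std_normal_density x *\<^sub>R iexp (?u * x)" 0] s by simp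
  also have "(\<integral>x. std_normal_density (0 + s * x) *\<^sub>R iexp (?u * (0 + s * x)) \<partial>lborel)
     = (\<integral>x. complex_of_real (1 / sqrt (2 * pi)) * (complex_of_real (exp (- (pi * a * x\<^sup>2))) * cis (- (2 * pi * (t * x)))) \<partial>lborel)"
  proof (rule Bochner_Integration.integral_cong)
    fix x :: real
    have "iexp (?u * (0 + s * x)) = cis (- (2 * pi * (t * x)))"
      using s by (simp add: cis_conv_exp field_simps)
    then show "std_normal_density (0 + s * x) *\<^sub>R iexp (?u * (0 + s * x))
      = complex_of_real (1 / sqrt (2 * pi)) * (complex_of_real (exp (- (pi * a * x\<^sup>2))) * cis (- (2 * pi * (t * x))))"
      unfolding d by (simp add: scaleR_conv_of_real)
  qed simp
  also have "\<dots> = complex_of_real (1 / sqrt (2 * pi)) * (\<integral>x. complex_of_real (exp (- (pi * a * x\<^sup>2))) * cis (- (2 * pi * (t * x))) \<partial>lborel)"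
    by simp
  finally have *: "complex_of_real (exp (- (?u\<^sup>2) / 2)) = s *\<^sub>R (complex_of_real (1 / sqrt (2 * pi)) * (\<integral>x. complex_of_real (exp (- (pi * a * x\<^sup>2))) * cis (- (2 * pi * (t * x))) \<partial>lborel))" .
  have "- (?u\<^sup>2) / 2 = - (pi * t\<^sup>2 / a)" using assms s by (simp add: power_divide power_mult_distrib field_simps power2_eq_square)
  moreover have "s * (1 / sqrt (2 * pi)) = sqrt a" by (simp add: s_def real_sqrt_mult)
  ultimately have "complex_of_real (exp (- (pi * t\<^sup>2 / a))) = complex_of_real (sqrt a) * (\<integral>x. complex_of_real (exp (- (pi * a * x\<^sup>2))) * cis (- (2 * pi * (t * x))) \<partial>lborel)"
    using * by (metis (no_types, lifting) mult.assoc of_real_mult scaleR_conv_of_real)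
  then show "(\<integral>x. complex_of_real (exp (- (pi * a * x\<^sup>2))) * cis (- (2 * pi * (t * x))) \<partial>lborel)
      = complex_of_real (1 / sqrt a * exp (- (pi * t\<^sup>2 / a)))"
    using assms by (simp add: field_simps)
qed

lemma norm_sq_Basis: "(norm (x::'a::euclidean_space))\<^sup>2 = (\<Sum>b\<in>Basis. (x \<bullet> b)\<^sup>2)"
  unfolding power2_norm_eq_inner by (subst euclidean_inner) (simp add: power2_eq_square)

lemma cis_sum: "finite A \<Longrightarrow> cis (\<Sum>i\<in>A. f i) = (\<Prod>i\<in>A. cis (f i))"
  by (induction A rule: finite_induct) (auto simp: cis_mult[symmetric])

lemma gaussian_fourier:
  fixes \<xi> :: "'a::euclidean_space"
  assumes "0 < a"
  shows "(\<integral>x. complex_of_real (exp (- (pi * a * (norm x)\<^sup>2))) * cis (- (2 * pi * (\<xi> \<bullet> x))) \<partial>lborel)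
    = complex_of_real ((1 / sqrt a) ^ DIM('a) * exp (- (pi * (norm \<xi>)\<^sup>2 / a)))"
proof -
  let ?f = "\<lambda>b y. complex_of_real (exp (- (pi * a * y\<^sup>2))) * cis (- (2 * pi * ((\<xi> \<bullet> b) * y)))"
  have "complex_of_real (exp (- (pi * a * (norm x)\<^sup>2))) * cis (- (2 * pi * (\<xi> \<bullet> x))) = (\<Prod>b\<in>Basis. ?f b (x \<bullet> b))" for x :: 'a
  proof -
    have "exp (- (pi * a * (norm x)\<^sup>2)) = (\<Prod>b\<in>Basis. exp (- (pi * a * (x \<bullet> b)\<^sup>2)))"
      by (simp add: norm_sq_Basis sum_distrib_left exp_sum[symmetric] sum_negf)
    moreover have "cis (- (2 * pi * (\<xi> \<bullet> x))) = (\<Prod>b\<in>Basis. cis (- (2 * pi * ((\<xi> \<bullet> b) * (x \<bullet> b)))))"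
      by (subst euclidean_inner) (simp add: sum_distrib_left cis_sum[symmetric] sum_negf)
    ultimately show ?thesis by (simp add: prod.distrib)
  qed
  then have "(\<integral>x. complex_of_real (exp (- (pi * a * (norm x)\<^sup>2))) * cis (- (2 * pi * (\<xi> \<bullet> x))) \<partial>lborel)
     = (\<integral>x. (\<Prod>b\<in>Basis. ?f b (x \<bullet> b)) \<partial>lborel)" by simp
  also have "\<dots> = (\<Prod>b\<in>Basis. \<integral>y. ?f b y \<partial>lborel)"
  proof (rule integral_lborel_prod)
    fix b
    show "integrable lborel (?f b)"
      by (rule Bochner_Integration.integrable_bound[OF gaussian_integrable_real(1)[OF assms]]) (auto simp: norm_mult)
  qed
  also have "\<dots> = (\<Prod>b\<in>Basis. complex_of_real (1 / sqrt a * exp (- (pi * (\<xi> \<bullet> b)\<^sup>2 / a))))"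
    by (simp only: gaussian_integrable_real(2)[OF assms])
  also have "\<dots> = complex_of_real ((1 / sqrt a) ^ DIM('a) * exp (- (pi * (norm \<xi>)\<^sup>2 / a)))"
    by (simp only: of_real_prod[symmetric] prod.distrib prod_constant)
      (simp add: norm_sq_Basis sum_distrib_left sum_divide_distrib exp_sum[symmetric] sum_negf)
  finally show ?thesis .
qed

lemma gaussian_le_exp:
  assumes "0 < a"
  obtains C where "0 < C" "\<And>x::'a::real_normed_vector. exp (- (pi * a * (norm x)\<^sup>2)) \<le> C * exp (- norm x)"
proof
  show "0 < exp (1 / a)" by simp
  fix x :: 'a
  \<comment> \<open>Completing the square: expanding gives |x| \<le> a |x|^2 + 1/(4a).\<close>
  have "0 \<le> (sqrt a * norm x - 1 / (2 * sqrt a))\<^sup>2" by simp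
  then have "norm x \<le> a * (norm x)\<^sup>2 + 1 / (4 * a)" using assms by (simp add: power2_diff power_mult_distrib power_divide)
  also have "\<dots> \<le> pi * (a * (norm x)\<^sup>2) + 1 / a"
    using assms pi_gt3 by (intro add_mono mult_right_mono[of 1 pi, simplified]) (auto simp: field_simps)
  finally show "exp (- (pi * a * (norm x)\<^sup>2)) \<le> exp (1 / a) * exp (- norm x)"
    by (simp add: exp_add[symmetric] mult.assoc)
qed

lemma integrable_exp_norm: "integrable lborel (\<lambda>x::'a::euclidean_space. exp (- norm x))"
  using nn_integral_exp_norm_finite[of 1, where 'a='a] by (simp add: integrable_iff_bounded)

lemma gaussian_integrable:
  assumes "0 < a"
  shows "integrable lborel (\<lambda>x::'a::euclidean_space. exp (- (pi * a * (norm x)\<^sup>2)))"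
proof -
  obtain C where C: "0 < C" "\<And>x::'a. exp (- (pi * a * (norm x)\<^sup>2)) \<le> C * exp (- norm x)"
    using gaussian_le_exp[OF assms] by metis
  show ?thesis
    by (rule Bochner_Integration.integrable_bound[OF integrable_mult_right[OF integrable_exp_norm, of C]])
      (use C in \<open>auto simp: abs_of_pos\<close>)
qed

section \<open>Continuity of translations, Plancherel and Moyal identities\<close>

lemma l2sq_add_le:
  assumes f: "sq_integrable f" and g: "sq_integrable g"
  shows "l2sq (\<lambda>t. f t + g t) \<le> 2 * (l2sq f + l2sq g)"
proof -
  have "(cmod (a + b))\<^sup>2 \<le> 2 * ((cmod a)\<^sup>2 + (cmod b)\<^sup>2)" for a b
  proof -
    have "(cmod (a + b))\<^sup>2 \<le> (cmod a + cmod b)\<^sup>2" by (intro power_mono norm_triangle_ineq) auto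
    also have "\<dots> \<le> 2 * ((cmod a)\<^sup>2 + (cmod b)\<^sup>2)"
      using sum_squares_bound[of "cmod a" "cmod b"] by (simp add: power2_sum)
    finally show ?thesis .
  qed
  then have "l2sq (\<lambda>t. f t + g t) \<le> (\<integral>t. 2 * ((cmod (f t))\<^sup>2 + (cmod (g t))\<^sup>2) \<partial>lborel)"
    unfolding l2sq_def using f g sq_integrable_add[OF f g]
    by (intro integral_mono) (auto simp: sq_integrable_def)
  also have "\<dots> = 2 * (l2sq f + l2sq g)" using f g by (simp add: l2sq_def sq_integrable_def)
  finally show ?thesis .
qed

lemma sq_integrable_translate: "sq_integrable f \<Longrightarrow> sq_integrable (\<lambda>t. f (t + u))"
  using sq_integrable_tf_shift[of f "(- u, 0)"] by (simp add: tf_shift_def cis_zero)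

lemma l2sq_translate: "sq_integrable f \<Longrightarrow> l2sq (\<lambda>t. f (t + u)) = l2sq f"
  using l2sq_tf_shift[of f "(- u, 0)"] by (simp add: tf_shift_def cis_zero)

lemma l2_dominated_convergence:
  fixes F :: "nat \<Rightarrow> real^'d \<Rightarrow> complex"
  assumes [measurable]: "\<And>n. F n \<in> borel_measurable borel"
    and lim: "AE t in lborel. (\<lambda>n. F n t) \<longlonglongrightarrow> 0"
    and dom: "integrable lborel w" "\<And>n t. (cmod (F n t))\<^sup>2 \<le> w t"
  shows "(\<lambda>n. l2sq (F n)) \<longlonglongrightarrow> 0"
proof -
  have "(\<lambda>n. l2sq (F n)) \<longlonglongrightarrow> (\<integral>t. 0 \<partial>(lborel :: (real^'d) measure))"
    unfolding l2sq_def
  proof (rule integral_dominated_convergence[OF _ _ dom(1)])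
    show "AE t in lborel. (\<lambda>n. (cmod (F n t))\<^sup>2) \<longlonglongrightarrow> 0"
      using lim
    proof eventually_elim
      case (elim t)
      have "(\<lambda>n. (cmod (F n t))\<^sup>2) \<longlonglongrightarrow> (cmod 0)\<^sup>2" by (intro tendsto_intros elim)
      then show ?case by simp
    qed
  qed (use dom in auto)
  then show ?thesis by simp
qed

lemma integrable_const_cball:
  "integrable lborel (\<lambda>t::'a::euclidean_space. (c::real) * indicator (cball 0 r) t)"
  using emeasure_bounded_finite[of "cball (0::'a) r"]
  by (intro integrable_mult_right integrable_real_indicator) auto

text \<open>A measurable function is a limit of continuous ones off a null set. Cutting these off in
  modulus and in support makes the convergence dominated.\<close>

lemma bounded_support_approx:
  fixes f :: "real^'d \<Rightarrow> complex"
  assumes [measurable]: "f \<in> borel_measurable borel" and k: "0 < k"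
    and bound: "\<And>t. cmod (f t) \<le> k" and supp: "\<And>t. k < norm t \<Longrightarrow> f t = 0"
  obtains c where "\<And>n. continuous_on UNIV (c n)" "\<And>n t. cmod (c n t) \<le> k"
    "\<And>n t. k + 1 < norm t \<Longrightarrow> c n t = 0" "(\<lambda>n. l2sq (\<lambda>t. f t - c n t)) \<longlonglongrightarrow> 0"
proof -
  have "f \<in> borel_measurable lebesgue" using assms(1) by (simp add: measurable_completion)
  then have "f measurable_on UNIV"
    using lebesgue_measurable_imp_measurable_on[of f UNIV] by simp
  then obtain N g where N: "negligible N" and g: "\<And>n. continuous_on UNIV (g n)"
    and lim: "\<And>x. x \<notin> N \<Longrightarrow> (\<lambda>n. g n x) \<longlonglongrightarrow> f x"
    unfolding measurable_on_def by auto
  \<comment> \<open>The radial retraction of \<open>g n t\<close> to the disc of radius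
    \<open>k\<close>, times a continuous cutoff equal to 1 for norm t \<le> k. Neither operation
    changes the limit, since f obeys the same bounds.\<close>
  define c where "c n t = complex_of_real (max 0 (min 1 (k + 1 - norm t))) * ((k / max k (cmod (g n t))) *\<^sub>R g n t)" for n t
  have cont: "continuous_on UNIV (c n)" for n
    unfolding c_def using k by (intro continuous_intros g) (auto simp: max_def)
  have le: "cmod (c n t) \<le> k" for n t
  proof -
    have "cmod ((k / max k (cmod (g n t))) *\<^sub>R g n t) \<le> k"
      using k by (auto simp: max_def field_simps)
    moreover have "\<bar>max 0 (min 1 (k + 1 - norm t))\<bar> \<le> 1" by (auto simp: max_def min_def)
    ultimately show ?thesis
      unfolding c_def norm_mult norm_of_real using mult_mono[of _ 1 _ k] k by fastforce
  qed
  have z: "c n t = 0" if "k + 1 < norm t" for n t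
    using that by (simp add: c_def)
  have [measurable]: "c n \<in> borel_measurable borel" for n
    by (rule borel_measurable_continuous_onI[OF cont])
  have conv: "(\<lambda>n. c n t) \<longlonglongrightarrow> f t" if "t \<notin> N" for t
  proof -
    have "(\<lambda>n. c n t) \<longlonglongrightarrow> complex_of_real (max 0 (min 1 (k + 1 - norm t))) * ((k / max k (cmod (f t))) *\<^sub>R f t)"
      unfolding c_def using k by (intro tendsto_intros lim that) (auto simp: max_def)
    also have "complex_of_real (max 0 (min 1 (k + 1 - norm t))) * ((k / max k (cmod (f t))) *\<^sub>R f t) = f t"
      using bound[of t] supp[of t] k by (cases "k < norm t") (auto simp: max_def min_def)
    finally show ?thesis .
  qed
  have "(\<lambda>n. l2sq (\<lambda>t. f t - c n t)) \<longlonglongrightarrow> 0"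
  proof (rule l2_dominated_convergence[where w = "\<lambda>t. (2 * k)\<^sup>2 * indicator (cball 0 (k + 1)) t"])
    have "N \<in> null_sets lebesgue" using N by (simp add: negligible_iff_null_sets)
    then have "AE t in lebesgue. t \<notin> N" by (rule AE_not_in)
    then have "AE t in lebesgue. (\<lambda>n. f t - c n t) \<longlonglongrightarrow> 0"
      by eventually_elim (use conv in \<open>auto intro!: tendsto_eq_intros\<close>)
    then show "AE t in lborel. (\<lambda>n. f t - c n t) \<longlonglongrightarrow> 0"
      by (subst (asm) AE_completion_iff) auto
    show "integrable lborel (\<lambda>t::real^'d. (2 * k)\<^sup>2 * indicator (cball 0 (k + 1)) t)"
      by (rule integrable_const_cball)
    fix n t
    have "cmod (f t - c n t) \<le> 2 * k" using norm_triangle_ineq4[of "f t" "c n t"] bound[of t] le[of n t] by simp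
    then have "(cmod (f t - c n t))\<^sup>2 \<le> (2 * k)\<^sup>2" by (intro power_mono) auto
    then show "(cmod (f t - c n t))\<^sup>2 \<le> (2 * k)\<^sup>2 * indicator (cball 0 (k + 1)) t"
      using supp[of t] z[of t n] by (cases "norm t \<le> k + 1") (auto simp: indicator_def)
  qed measurable
  then show ?thesis using that cont le z by blast
qed

lemma bounded_support_sq_integrable:
  fixes f :: "real^'d \<Rightarrow> complex"
  assumes [measurable]: "f \<in> borel_measurable borel"
    and bound: "\<And>t. cmod (f t) \<le> k" and supp: "\<And>t. k' < norm t \<Longrightarrow> f t = 0"
  shows "sq_integrable f"
  unfolding sq_integrable_def
proof
  show "integrable lborel (\<lambda>t. (cmod (f t))\<^sup>2)"
  proof (rule Bochner_Integration.integrable_bound)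
    show "integrable lborel (\<lambda>t::real^'d. k\<^sup>2 * indicator (cball 0 k') t)"
      by (rule integrable_const_cball)
    show "AE t in lborel. norm ((cmod (f t))\<^sup>2) \<le> norm (k\<^sup>2 * indicator (cball 0 k') t :: real)"
    proof (rule AE_I2)
      fix t
      have "(cmod (f t))\<^sup>2 \<le> k\<^sup>2" using bound[of t] by (intro power_mono) auto
      then show "norm ((cmod (f t))\<^sup>2) \<le> norm (k\<^sup>2 * indicator (cball 0 k') t :: real)"
        using supp[of t] by (cases "norm t \<le> k'") (auto simp: indicator_def)
    qed
  qed measurable
qed measurable

lemma l2_truncate:
  fixes f :: "real^'d \<Rightarrow> complex"
  assumes f: "sq_integrable f"
  shows "(\<lambda>n. l2sq (\<lambda>t. f t - (if cmod (f t) \<le> real n \<and> norm t \<le> real n then f t else 0))) \<longlonglongrightarrow> 0"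
proof -
  have [measurable]: "f \<in> borel_measurable borel" using f by (rule sq_integrable_borel)
  show ?thesis
  proof (rule l2_dominated_convergence[where w = "\<lambda>t. (cmod (f t))\<^sup>2"])
    show "integrable lborel (\<lambda>t. (cmod (f t))\<^sup>2)" using f by (simp add: sq_integrable_def)
    show "AE t in lborel. (\<lambda>n. f t - (if cmod (f t) \<le> real n \<and> norm t \<le> real n then f t else 0)) \<longlonglongrightarrow> 0"
    proof (rule AE_I2, rule tendsto_eventually)
      fix t
      have "eventually (\<lambda>n. cmod (f t) \<le> real n) sequentially" "eventually (\<lambda>n. norm t \<le> real n) sequentially"
        using filterlim_real_sequentially by (auto simp: filterlim_at_top)
      then show "eventually (\<lambda>n. f t - (if cmod (f t) \<le> real n \<and> norm t \<le> real n then f t else 0) = 0) sequentially"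
        by eventually_elim auto
    qed
  qed auto
qed

lemma l2_continuous_approx:
  fixes f :: "real^'d \<Rightarrow> complex"
  assumes f: "sq_integrable f" and e: "0 < e"
  obtains c k where "continuous_on UNIV c" "\<And>t. cmod (c t) \<le> k" "\<And>t. k + 1 < norm t \<Longrightarrow> c t = 0" "sq_integrable c"
    "l2sq (\<lambda>t. f t - c t) < e"
proof -
  have [measurable]: "f \<in> borel_measurable borel" using f by (rule sq_integrable_borel)
  let ?T = "\<lambda>n t. if cmod (f t) \<le> real n \<and> norm t \<le> real n then f t else 0"
  have "eventually (\<lambda>n. l2sq (\<lambda>t. f t - ?T n t) < e / 4) sequentially"
    using order_tendstoD(2)[OF l2_truncate[OF f], of "e / 4"] e by simp
  then have "eventually (\<lambda>n. l2sq (\<lambda>t. f t - ?T n t) < e / 4 \<and> 0 < n) sequentially"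
    using eventually_gt_at_top[of 0] by eventually_elim auto
  then obtain m where m: "l2sq (\<lambda>t. f t - ?T m t) < e / 4" "0 < m"
    using eventually_happens'[OF sequentially_bot] by blast
  have [measurable]: "?T m \<in> borel_measurable borel" by measurable
  obtain c where c: "\<And>n. continuous_on UNIV (c n)" "\<And>n t. cmod (c n t) \<le> real m"
    "\<And>n t. real m + 1 < norm t \<Longrightarrow> c n t = 0" "(\<lambda>n. l2sq (\<lambda>t. ?T m t - c n t)) \<longlonglongrightarrow> 0"
    by (rule bounded_support_approx[of "?T m" "real m"]) (use m in auto)
  from order_tendstoD(2)[OF c(4), of "e / 4"] e obtain n where n: "l2sq (\<lambda>t. ?T m t - c n t) < e / 4"
    using eventually_happens'[OF sequentially_bot] by force
  have [measurable]: "c n \<in> borel_measurable borel" by (rule borel_measurable_continuous_onI[OF c(1)])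
  have sc: "sq_integrable (c n)" by (rule bounded_support_sq_integrable[OF _ c(2,3)]) simp
  have sT: "sq_integrable (?T m)" by (rule bounded_support_sq_integrable[of _ "real m" "real m"]) auto
  have "l2sq (\<lambda>t. f t - c n t) = l2sq (\<lambda>t. (f t - ?T m t) + (?T m t - c n t))" by simp
  also have "\<dots> \<le> 2 * (l2sq (\<lambda>t. f t - ?T m t) + l2sq (\<lambda>t. ?T m t - c n t))"
    by (intro l2sq_add_le sq_integrable_diff f sc sT)
  also have "\<dots> < e" using m(1) n by simp
  finally show ?thesis using that[OF c(1,2,3) sc] by blast
qed

text \<open>Approximate f by a continuous function of bounded support, for which dominated
  convergence applies; translation invariance makes the approximation error the same for all
  shifts.\<close>

lemma l2_translation_continuous:
  fixes f :: "real^'d \<Rightarrow> complex"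
  assumes f: "sq_integrable f" and u: "u \<longlonglongrightarrow> 0"
  shows "(\<lambda>n. l2sq (\<lambda>t. f (t + u n) - f t)) \<longlonglongrightarrow> 0"
proof (rule LIMSEQ_I)
  fix e :: real assume e: "0 < e"
  obtain c k where c: "continuous_on UNIV c" "\<And>t. cmod (c t) \<le> k" "\<And>t. k + 1 < norm t \<Longrightarrow> c t = 0" 
    and sc: "sq_integrable c" and fc: "l2sq (\<lambda>t. f t - c t) < e / 16"
    using l2_continuous_approx[OF f, of "e / 16"] e by auto
  have [measurable]: "c \<in> borel_measurable borel" using sc by (rule sq_integrable_borel)
  \<comment> \<open>Shifts longer than 1 are replaced by 0, so that all translates of
    \<open>c\<close> live in one ball. Eventually \<open>v\<close> agrees with
    \<open>u\<close>.\<close>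
  define v where "v n = (if norm (u n) \<le> 1 then u n else 0)" for n
  have "eventually (\<lambda>n. norm (u n) < 1) sequentially"
    using order_tendstoD(2)[OF tendsto_norm_zero[OF u], of 1] by simp
  then have uv: "eventually (\<lambda>n. v n = u n) sequentially" by eventually_elim (simp add: v_def)
  have v: "v \<longlonglongrightarrow> 0" using Lim_transform_eventually[OF u] uv by (simp add: eq_commute)
  have "(\<lambda>n. l2sq (\<lambda>t. c (t + v n) - c t)) \<longlonglongrightarrow> 0"
  proof (rule l2_dominated_convergence[where w = "\<lambda>t. (2 * k)\<^sup>2 * indicator (cball 0 (k + 2)) t"])
    show "integrable lborel (\<lambda>t::real^'d. (2 * k)\<^sup>2 * indicator (cball 0 (k + 2)) t)"
      by (rule integrable_const_cball)
    show "AE t in lborel. (\<lambda>n. c (t + v n) - c t) \<longlonglongrightarrow> 0"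
    proof (rule AE_I2)
      fix t
      have "isCont c t" using c(1) by (simp add: continuous_on_eq_continuous_at)
      moreover have "(\<lambda>n. t + v n) \<longlonglongrightarrow> t" using tendsto_add[OF tendsto_const v] by simp
      ultimately have "(\<lambda>n. c (t + v n)) \<longlonglongrightarrow> c t" by (rule isCont_tendsto_compose)
      then show "(\<lambda>n. c (t + v n) - c t) \<longlonglongrightarrow> 0" by (simp add: LIM_zero)
    qed
    fix n t
    have "cmod (c (t + v n) - c t) \<le> 2 * k" using norm_triangle_ineq4[of "c (t + v n)" "c t"] c(2)[of "t + v n"] c(2)[of t] by simp
    then have le: "(cmod (c (t + v n) - c t))\<^sup>2 \<le> (2 * k)\<^sup>2" by (intro power_mono) auto
    have "c (t + v n) = 0 \<and> c t = 0" if "k + 2 < norm t"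
    proof -
      have "norm (v n) \<le> 1" by (simp add: v_def)
      then have "k + 1 < norm (t + v n)" using that norm_triangle_ineq4[of "t + v n" "v n"] by simp
      then show ?thesis using c(3) that by simp
    qed
    then show "(cmod (c (t + v n) - c t))\<^sup>2 \<le> (2 * k)\<^sup>2 * indicator (cball 0 (k + 2)) t"
      using le by (cases "norm t \<le> k + 2") (auto simp: indicator_def)
  qed measurable
  then have "eventually (\<lambda>n. l2sq (\<lambda>t. c (t + v n) - c t) < e / 8) sequentially"
    using e by (intro order_tendstoD(2)) auto
  then have "eventually (\<lambda>n. norm (l2sq (\<lambda>t. f (t + u n) - f t) - 0) < e) sequentially"
    using uv
  proof eventually_elim
    case (elim n)
    have d: "sq_integrable (\<lambda>t. f t - c t)" using f sc by (rule sq_integrable_diff)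
    have d': "sq_integrable (\<lambda>t. c t - f t)" using sc f by (rule sq_integrable_diff)
    have "l2sq (\<lambda>t. c t - f t) = l2sq (\<lambda>t. f t - c t)" by (simp add: l2sq_def norm_minus_commute)
    note fc' = this
    have s: "sq_integrable (\<lambda>t. f (t + u n) - c (t + u n))" using sq_integrable_translate[OF d] .
    have s': "sq_integrable (\<lambda>t. c (t + u n) - c t)" using sc by (intro sq_integrable_diff sq_integrable_translate)
    have "l2sq (\<lambda>t. f (t + u n) - f t) = l2sq (\<lambda>t. (f (t + u n) - c (t + u n)) + ((c (t + u n) - c t) + (c t - f t)))"
      by simp
    also have "\<dots> \<le> 2 * (l2sq (\<lambda>t. f (t + u n) - c (t + u n)) + l2sq (\<lambda>t. (c (t + u n) - c t) + (c t - f t)))"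
      by (intro l2sq_add_le s sq_integrable_add s' d')
    also have "\<dots> \<le> 2 * (l2sq (\<lambda>t. f t - c t) + 2 * (l2sq (\<lambda>t. c (t + u n) - c t) + l2sq (\<lambda>t. f t - c t)))"
      using l2sq_add_le[OF s' d'] l2sq_translate[OF d, of "u n"] fc' by simp
    also have "\<dots> < e" using fc elim e by simp
    finally show ?case by simp
  qed
  then show "\<exists>no. \<forall>n\<ge>no. norm (l2sq (\<lambda>t. f (t + u n) - f t) - 0) < e"
    by (simp add: eventually_sequentially)
qed

lemma autocorrelation_continuous:
  fixes f :: "real^'d \<Rightarrow> complex"
  assumes f: "sq_integrable f" and u: "u \<longlonglongrightarrow> 0"
  shows "(\<lambda>n. l2_inner (\<lambda>t. f (t + u n)) f) \<longlonglongrightarrow> complex_of_real (l2sq f)"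
proof -
  have "(\<lambda>n. l2_inner (\<lambda>t. f (t + u n)) f - complex_of_real (l2sq f)) \<longlonglongrightarrow> 0"
  proof (rule Lim_null_comparison)
    show "\<forall>\<^sub>F n in sequentially. norm (l2_inner (\<lambda>t. f (t + u n)) f - complex_of_real (l2sq f))
       \<le> sqrt (l2sq (\<lambda>t. f (t + u n) - f t)) * sqrt (l2sq f)"
    proof (rule always_eventually, rule allI)
      fix n
      have "l2_inner (\<lambda>t. f (t + u n)) f - complex_of_real (l2sq f) = l2_inner (\<lambda>t. f (t + u n) - f t) f"
        using f by (simp add: l2_inner_diff sq_integrable_translate l2_inner_self)
      then show "norm (l2_inner (\<lambda>t. f (t + u n)) f - complex_of_real (l2sq f)) \<le> sqrt (l2sq (\<lambda>t. f (t + u n) - f t)) * sqrt (l2sq f)"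
        using f by (auto intro!: cmod_l2_inner_le sq_integrable_diff sq_integrable_translate)
    qed
    have "(\<lambda>n. sqrt (l2sq (\<lambda>t. f (t + u n) - f t)) * sqrt (l2sq f)) \<longlonglongrightarrow> sqrt 0 * sqrt (l2sq f)"
      by (intro tendsto_intros l2_translation_continuous f u)
    then show "(\<lambda>n. sqrt (l2sq (\<lambda>t. f (t + u n) - f t)) * sqrt (l2sq f)) \<longlonglongrightarrow> 0" by simp
  qed
  then show ?thesis by (simp add: LIM_zero_iff)
qed

section \<open>Plancherel's theorem on the intersection of L^1 and L^2\<close>

lemma Fubini_swap_product_bound:
  fixes F :: "'a::euclidean_space \<Rightarrow> 'b::euclidean_space \<Rightarrow> 'c::{banach, second_countable_topology}"
  assumes F: "(\<lambda>(x, y). F x y) \<in> borel_measurable (borel \<Otimes>\<^sub>M borel)"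
    and a: "integrable lborel (a :: 'a \<Rightarrow> real)" and b: "integrable lborel (b :: 'b \<Rightarrow> real)"
    and le: "\<And>x y. norm (F x y) \<le> a x * b y" and nn: "\<And>x. 0 \<le> a x" "\<And>y. 0 \<le> b y"
  shows "(\<integral>x. (\<integral>y. F x y \<partial>lborel) \<partial>lborel) = (\<integral>y. (\<integral>x. F x y \<partial>lborel) \<partial>lborel)"
proof (rule Fubini_swap[OF F])
  have [measurable]: "a \<in> borel_measurable borel" "b \<in> borel_measurable borel"
    using a b borel_measurable_integrable by auto
  have "(\<integral>\<^sup>+ x. (\<integral>\<^sup>+ y. ennreal (norm (F x y)) \<partial>lborel) \<partial>lborel) \<le> (\<integral>\<^sup>+ x. (\<integral>\<^sup>+ y. ennreal (a x) * ennreal (b y) \<partial>lborel) \<partial>lborel)"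
    using le nn by (intro nn_integral_mono) (simp add: ennreal_mult[symmetric] ennreal_leI)
  also have "\<dots> = (\<integral>\<^sup>+ x. ennreal (a x) \<partial>lborel) * (\<integral>\<^sup>+ y. ennreal (b y) \<partial>lborel)"
    by (simp add: nn_integral_cmult nn_integral_multc)
  also have "\<dots> < \<infinity>"
    using a b nn by (simp add: integrable_iff_bounded ennreal_mult_less_top)
  finally show "(\<integral>\<^sup>+ x. (\<integral>\<^sup>+ y. ennreal (norm (F x y)) \<partial>lborel) \<partial>lborel) < \<infinity>" .
qed

definition fourier :: "(real^'d \<Rightarrow> complex) \<Rightarrow> real^'d \<Rightarrow> complex" where
  "fourier h \<xi> = (\<integral>t. h t * cis (- (2 * pi * (\<xi> \<bullet> t))) \<partial>lborel)"

lemma fourier_measurable [measurable]: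
  assumes [measurable]: "h \<in> borel_measurable borel"
  shows "fourier h \<in> borel_measurable borel"
  unfolding fourier_def[abs_def] by (rule lborel.borel_measurable_lebesgue_integral) measurable

lemma cmod_fourier_le:
  assumes "integrable lborel h"
  shows "cmod (fourier h \<xi>) \<le> (\<integral>t. cmod (h t) \<partial>lborel)"
  unfolding fourier_def by (rule order_trans[OF integral_norm_bound]) (simp add: norm_mult)

text \<open>The Gaussian factor makes the triple integral absolutely convergent. Integrating over
  \<xi> first yields a Gaussian in n (t - s), and the substitution s = t + v / n turns the result
  into a Gaussian average of the autocorrelation of h.\<close>

lemma Plancherel_regularized:
  fixes h :: "real^'d \<Rightarrow> complex"
  assumes h1: "integrable lborel h" and h2: "sq_integrable h" and n: "0 < n"
  shows "(\<integral>\<xi>. complex_of_real (exp (- (pi * (1 / n\<^sup>2) * (norm \<xi>)\<^sup>2))) * (fourier h \<xi> * cnj (fourier h \<xi>)) \<partial>lborel)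
    = (\<integral>v. complex_of_real (exp (- (pi * 1 * (norm v)\<^sup>2))) * l2_inner h (\<lambda>t. h (t + (1 / n) *\<^sub>R v)) \<partial>lborel)"
proof -
  have [measurable]: "h \<in> borel_measurable borel" using h2 by (rule sq_integrable_borel)
  let ?\<gamma> = "\<lambda>\<xi>::real^'d. exp (- (pi * (1 / n\<^sup>2) * (norm \<xi>)\<^sup>2))"
  let ?\<kappa> = "\<lambda>v::real^'d. exp (- (pi * 1 * (norm v)\<^sup>2))"
  let ?D = "DIM(real^'d)"
  define L where "L = (\<integral>t. cmod (h t) \<partial>lborel)"
  have L: "0 \<le> L" by (simp add: L_def)
  have \<gamma>: "integrable lborel ?\<gamma>" using n by (intro gaussian_integrable) auto
  have \<kappa>: "integrable lborel ?\<kappa>" by (intro gaussian_integrable) auto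
  have hn: "integrable lborel (\<lambda>t. cmod (h t))" using h1 by simp
  have "(\<integral>\<xi>. complex_of_real (?\<gamma> \<xi>) * (fourier h \<xi> * cnj (fourier h \<xi>)) \<partial>lborel)
      = (\<integral>\<xi>. (\<integral>t. complex_of_real (?\<gamma> \<xi>) * cnj (fourier h \<xi>) * (h t * cis (- (2 * pi * (\<xi> \<bullet> t)))) \<partial>lborel) \<partial>lborel)"
  proof (rule Bochner_Integration.integral_cong[OF refl])
    fix \<xi> :: "real^'d"
    have "(\<integral>t. complex_of_real (?\<gamma> \<xi>) * cnj (fourier h \<xi>) * (h t * cis (- (2 * pi * (\<xi> \<bullet> t)))) \<partial>lborel)
      = complex_of_real (?\<gamma> \<xi>) * cnj (fourier h \<xi>) * fourier h \<xi>"
      unfolding fourier_def[of h \<xi>] by (rule integral_mult_right_zero)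
    then show "complex_of_real (?\<gamma> \<xi>) * (fourier h \<xi> * cnj (fourier h \<xi>))
      = (\<integral>t. complex_of_real (?\<gamma> \<xi>) * cnj (fourier h \<xi>) * (h t * cis (- (2 * pi * (\<xi> \<bullet> t)))) \<partial>lborel)"
      by (simp only: mult_ac)
  qed
  also have "\<dots> = (\<integral>t. (\<integral>\<xi>. complex_of_real (?\<gamma> \<xi>) * cnj (fourier h \<xi>) * (h t * cis (- (2 * pi * (\<xi> \<bullet> t)))) \<partial>lborel) \<partial>lborel)"
  proof (rule Fubini_swap_product_bound[where a = "\<lambda>\<xi>. L * ?\<gamma> \<xi>" and b = "\<lambda>t. cmod (h t)"])
    show "integrable lborel (\<lambda>\<xi>. L * ?\<gamma> \<xi>)" using \<gamma> by (rule integrable_mult_right)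
    show "norm (complex_of_real (?\<gamma> \<xi>) * cnj (fourier h \<xi>) * (h t * cis (- (2 * pi * (\<xi> \<bullet> t))))) \<le> L * ?\<gamma> \<xi> * cmod (h t)" for \<xi> t
      using cmod_fourier_le[OF h1, of \<xi>] by (simp add: norm_mult L_def mult_right_mono mult_left_mono mult.commute)
  qed (use hn L in \<open>simp_all add: case_prod_beta\<close>)
  also have "\<dots> = (\<integral>t. (\<integral>v. complex_of_real (?\<kappa> v) * (h t * cnj (h (t + (1 / n) *\<^sub>R v))) \<partial>lborel) \<partial>lborel)"
  proof (rule Bochner_Integration.integral_cong[OF refl])
    fix t
    have "(\<integral>\<xi>. complex_of_real (?\<gamma> \<xi>) * cnj (fourier h \<xi>) * (h t * cis (- (2 * pi * (\<xi> \<bullet> t)))) \<partial>lborel)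
       = (\<integral>\<xi>. (\<integral>s. complex_of_real (?\<gamma> \<xi>) * (h t * cnj (h s)) * cis (- (2 * pi * ((t - s) \<bullet> \<xi>))) \<partial>lborel) \<partial>lborel)"
    proof (rule Bochner_Integration.integral_cong[OF refl])
      fix \<xi> :: "real^'d"
      have "cnj (fourier h \<xi>) = (\<integral>s. cnj (h s) * cis (2 * pi * (\<xi> \<bullet> s)) \<partial>lborel)"
        unfolding fourier_def by (simp add: cis_cnj flip: Bochner_Integration.integral_cnj)
      then have "complex_of_real (?\<gamma> \<xi>) * cnj (fourier h \<xi>) * (h t * cis (- (2 * pi * (\<xi> \<bullet> t))))
        = (\<integral>s. (complex_of_real (?\<gamma> \<xi>) * (h t * cis (- (2 * pi * (\<xi> \<bullet> t))))) * (cnj (h s) * cis (2 * pi * (\<xi> \<bullet> s))) \<partial>lborel)"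
        by simp
      also have "\<dots> = (\<integral>s. complex_of_real (?\<gamma> \<xi>) * (h t * cnj (h s)) * cis (- (2 * pi * ((t - s) \<bullet> \<xi>))) \<partial>lborel)"
      proof (rule Bochner_Integration.integral_cong[OF refl])
        fix s
        have e: "cis (- (2 * pi * ((t - s) \<bullet> \<xi>))) = cis (- (2 * pi * (\<xi> \<bullet> t))) * cis (2 * pi * (\<xi> \<bullet> s))"
          by (simp add: cis_mult inner_diff_left inner_commute[of \<xi>] algebra_simps)
        show "(complex_of_real (?\<gamma> \<xi>) * (h t * cis (- (2 * pi * (\<xi> \<bullet> t))))) * (cnj (h s) * cis (2 * pi * (\<xi> \<bullet> s)))
          = complex_of_real (?\<gamma> \<xi>) * (h t * cnj (h s)) * cis (- (2 * pi * ((t - s) \<bullet> \<xi>)))"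
          unfolding e by (simp only: mult_ac)
      qed
      finally show "complex_of_real (?\<gamma> \<xi>) * cnj (fourier h \<xi>) * (h t * cis (- (2 * pi * (\<xi> \<bullet> t))))
        = (\<integral>s. complex_of_real (?\<gamma> \<xi>) * (h t * cnj (h s)) * cis (- (2 * pi * ((t - s) \<bullet> \<xi>))) \<partial>lborel)" .
    qed
    also have "\<dots> = (\<integral>s. (\<integral>\<xi>. complex_of_real (?\<gamma> \<xi>) * (h t * cnj (h s)) * cis (- (2 * pi * ((t - s) \<bullet> \<xi>))) \<partial>lborel) \<partial>lborel)"
      by (rule Fubini_swap_product_bound[where a = "\<lambda>\<xi>. cmod (h t) * ?\<gamma> \<xi>" and b = "\<lambda>t. cmod (h t)"])
        (use hn \<gamma> in \<open>simp_all add: case_prod_beta norm_mult\<close>)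
    also have "\<dots> = (\<integral>s. (h t * cnj (h s)) * complex_of_real (n ^ ?D * ?\<kappa> (n *\<^sub>R (t - s))) \<partial>lborel)"
    proof (rule Bochner_Integration.integral_cong[OF refl])
      fix s
      have "(\<integral>\<xi>. complex_of_real (?\<gamma> \<xi>) * (h t * cnj (h s)) * cis (- (2 * pi * ((t - s) \<bullet> \<xi>))) \<partial>lborel)
        = (h t * cnj (h s)) * (\<integral>\<xi>. complex_of_real (?\<gamma> \<xi>) * cis (- (2 * pi * ((t - s) \<bullet> \<xi>))) \<partial>lborel)"
        by (subst integral_mult_right_zero[symmetric]) (simp add: mult_ac)
      also have "(\<integral>\<xi>. complex_of_real (?\<gamma> \<xi>) * cis (- (2 * pi * ((t - s) \<bullet> \<xi>))) \<partial>lborel) 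
        = complex_of_real ((1 / sqrt (1 / n\<^sup>2)) ^ ?D * exp (- (pi * (norm (t - s))\<^sup>2 / (1 / n\<^sup>2))))"
        using n by (intro gaussian_fourier) auto
      also have "(1 / sqrt (1 / n\<^sup>2)) ^ ?D * exp (- (pi * (norm (t - s))\<^sup>2 / (1 / n\<^sup>2))) = n ^ ?D * ?\<kappa> (n *\<^sub>R (t - s))"
        using n by (simp add: real_sqrt_divide power_mult_distrib mult_ac)
      finally show "(\<integral>\<xi>. complex_of_real (?\<gamma> \<xi>) * (h t * cnj (h s)) * cis (- (2 * pi * ((t - s) \<bullet> \<xi>))) \<partial>lborel)
        = (h t * cnj (h s)) * complex_of_real (n ^ ?D * ?\<kappa> (n *\<^sub>R (t - s)))" .
    qed
    also have "\<dots> = (\<integral>u. (h t * cnj (h (u + t))) * complex_of_real (n ^ ?D * ?\<kappa> (n *\<^sub>R (t - (u + t)))) \<partial>lborel)"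
      by (rule integral_translate[symmetric]) measurable
    also have "\<dots> = (1 / n) ^ ?D *\<^sub>R (\<integral>v. (h t * cnj (h ((1 / n) *\<^sub>R v + t))) * complex_of_real (n ^ ?D * ?\<kappa> (n *\<^sub>R (t - ((1 / n) *\<^sub>R v + t)))) \<partial>lborel)"
      using n by (intro integral_scale) auto
    also have "\<dots> = (\<integral>v. (1 / n) ^ ?D *\<^sub>R ((h t * cnj (h ((1 / n) *\<^sub>R v + t))) * complex_of_real (n ^ ?D * ?\<kappa> (n *\<^sub>R (t - ((1 / n) *\<^sub>R v + t))))) \<partial>lborel)"
      by simp
    also have "\<dots> = (\<integral>v. complex_of_real (?\<kappa> v) * (h t * cnj (h (t + (1 / n) *\<^sub>R v))) \<partial>lborel)"
    proof (rule Bochner_Integration.integral_cong[OF refl])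
      fix v
      have "(1 / n) ^ ?D * (n ^ ?D * ?\<kappa> (n *\<^sub>R (t - ((1 / n) *\<^sub>R v + t)))) = ?\<kappa> v"
        using n by (simp add: power_one_over)
      then have e: "complex_of_real (?\<kappa> v) = complex_of_real ((1 / n) ^ ?D) * complex_of_real (n ^ ?D * ?\<kappa> (n *\<^sub>R (t - ((1 / n) *\<^sub>R v + t))))"
        by (simp only: of_real_mult[symmetric])
      show "(1 / n) ^ ?D *\<^sub>R ((h t * cnj (h ((1 / n) *\<^sub>R v + t))) * complex_of_real (n ^ ?D * ?\<kappa> (n *\<^sub>R (t - ((1 / n) *\<^sub>R v + t)))))
        = complex_of_real (?\<kappa> v) * (h t * cnj (h (t + (1 / n) *\<^sub>R v)))"
        unfolding add.commute[of t "(1 / n) *\<^sub>R v"] e scaleR_conv_of_real[where 'a=complex] by (simp only: mult_ac)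
    qed
    finally show "(\<integral>\<xi>. complex_of_real (?\<gamma> \<xi>) * cnj (fourier h \<xi>) * (h t * cis (- (2 * pi * (\<xi> \<bullet> t)))) \<partial>lborel)
      = (\<integral>v. complex_of_real (?\<kappa> v) * (h t * cnj (h (t + (1 / n) *\<^sub>R v))) \<partial>lborel)" .
  qed
  also have "\<dots> = (\<integral>v. (\<integral>t. complex_of_real (?\<kappa> v) * (h t * cnj (h (t + (1 / n) *\<^sub>R v))) \<partial>lborel) \<partial>lborel)"
  proof (rule Fubini_swap[symmetric])
    have "(\<integral>\<^sup>+ v. (\<integral>\<^sup>+ t. ennreal (norm (complex_of_real (?\<kappa> v) * (h t * cnj (h (t + (1 / n) *\<^sub>R v))))) \<partial>lborel) \<partial>lborel)
      \<le> (\<integral>\<^sup>+ v. ennreal (?\<kappa> v) * ennreal (2 * l2sq h) \<partial>lborel)"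
    proof (rule nn_integral_mono)
      fix v :: "real^'d"
      let ?u = "(1 / n) *\<^sub>R v"
      have ab: "a * b \<le> a\<^sup>2 + b\<^sup>2" for a b :: real
        using sum_squares_bound[of a b] zero_le_power2[of a] zero_le_power2[of b] by linarith
      have "(\<integral>\<^sup>+ t. ennreal (norm (complex_of_real (?\<kappa> v) * (h t * cnj (h (t + ?u))))) \<partial>lborel)
         \<le> (\<integral>\<^sup>+ t. ennreal (?\<kappa> v) * ((ennreal (cmod (h t)))\<^sup>2 + (ennreal (cmod (h (t + ?u))))\<^sup>2) \<partial>lborel)"
      proof (rule nn_integral_mono)
        fix t
        have "?\<kappa> v * (cmod (h t) * cmod (h (t + ?u))) \<le> ?\<kappa> v * ((cmod (h t))\<^sup>2 + (cmod (h (t + ?u)))\<^sup>2)"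
          by (intro mult_left_mono ab) simp
        then have "ennreal (?\<kappa> v * (cmod (h t) * cmod (h (t + ?u)))) \<le> ennreal (?\<kappa> v * ((cmod (h t))\<^sup>2 + (cmod (h (t + ?u)))\<^sup>2))"
          by (rule ennreal_leI)
        then show "ennreal (norm (complex_of_real (?\<kappa> v) * (h t * cnj (h (t + ?u))))) \<le> ennreal (?\<kappa> v) * ((ennreal (cmod (h t)))\<^sup>2 + (ennreal (cmod (h (t + ?u))))\<^sup>2)"
          by (simp add: norm_mult ennreal_mult ennreal_power)
      qed
      also have "\<dots> = ennreal (?\<kappa> v) * (ennreal (l2sq h) + ennreal (l2sq h))"
        using nn_integral_l2sq[OF h2] nn_integral_l2sq[OF sq_integrable_translate[OF h2], of ?u] l2sq_translate[OF h2, of ?u]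
        by (simp add: nn_integral_cmult nn_integral_add)
      finally show "(\<integral>\<^sup>+ t. ennreal (norm (complex_of_real (?\<kappa> v) * (h t * cnj (h (t + ?u))))) \<partial>lborel) \<le> ennreal (?\<kappa> v) * ennreal (2 * l2sq h)"
        by (simp flip: ennreal_plus)
    qed
    also have "\<dots> = (\<integral>\<^sup>+ v. ennreal (?\<kappa> v) \<partial>lborel) * ennreal (2 * l2sq h)"
      by (rule nn_integral_multc) measurable
    also have "\<dots> < \<infinity>" using nn_integral_norm_finite[OF \<kappa>] by (simp add: ennreal_mult_less_top)
    finally show "(\<integral>\<^sup>+ v. (\<integral>\<^sup>+ t. ennreal (norm (complex_of_real (?\<kappa> v) * (h t * cnj (h (t + (1 / n) *\<^sub>R v))))) \<partial>lborel) \<partial>lborel) < \<infinity>" .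
  qed measurable
  also have "\<dots> = (\<integral>v. complex_of_real (?\<kappa> v) * l2_inner h (\<lambda>t. h (t + (1 / n) *\<^sub>R v)) \<partial>lborel)"
    by (simp add: l2_inner_def)
  finally show ?thesis .
qed

text \<open>The autocorrelation is continuous at 0, with value the squared norm there, and the
  Gaussian has integral 1.\<close>

lemma Plancherel_regularized_limit:
  fixes h :: "real^'d \<Rightarrow> complex"
  assumes h: "sq_integrable h"
  shows "(\<lambda>n. \<integral>v. complex_of_real (exp (- (pi * 1 * (norm v)\<^sup>2))) * l2_inner h (\<lambda>t. h (t + (1 / real (Suc n)) *\<^sub>R v)) \<partial>lborel)
    \<longlonglongrightarrow> complex_of_real (l2sq h)"
proof -
  have [measurable]: "h \<in> borel_measurable borel" using h by (rule sq_integrable_borel)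
  let ?\<kappa> = "\<lambda>v::real^'d. exp (- (pi * 1 * (norm v)\<^sup>2))"
  have \<kappa>: "integrable lborel ?\<kappa>" by (intro gaussian_integrable) auto
  have meas [measurable]: "(\<lambda>v. l2_inner h (\<lambda>t. h (t + c *\<^sub>R v))) \<in> borel_measurable borel" for c
    unfolding l2_inner_def by (rule lborel.borel_measurable_lebesgue_integral) measurable
  have "(\<lambda>n. \<integral>v. complex_of_real (?\<kappa> v) * l2_inner h (\<lambda>t. h (t + (1 / real (Suc n)) *\<^sub>R v)) \<partial>lborel)
    \<longlonglongrightarrow> (\<integral>v. complex_of_real (?\<kappa> v) * complex_of_real (l2sq h) \<partial>lborel)"
  proof (rule integral_dominated_convergence[where w = "\<lambda>v. ?\<kappa> v * l2sq h"])
    show "integrable lborel (\<lambda>v. ?\<kappa> v * l2sq h)" using \<kappa> by (rule integrable_mult_left)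
    show "AE v in lborel. (\<lambda>n. complex_of_real (?\<kappa> v) * l2_inner h (\<lambda>t. h (t + (1 / real (Suc n)) *\<^sub>R v))) \<longlonglongrightarrow> complex_of_real (?\<kappa> v) * complex_of_real (l2sq h)"
    proof (rule AE_I2)
      fix v :: "real^'d"
      have "(\<lambda>n. 1 / real (Suc n)) \<longlonglongrightarrow> 0" by real_asymp
      from tendsto_scaleR[OF this tendsto_const[of v]] have "(\<lambda>n. (1 / real (Suc n)) *\<^sub>R v) \<longlonglongrightarrow> 0" by simp
      from tendsto_cnj[OF autocorrelation_continuous[OF h this]]
      have "(\<lambda>n. l2_inner h (\<lambda>t. h (t + (1 / real (Suc n)) *\<^sub>R v))) \<longlonglongrightarrow> complex_of_real (l2sq h)"
        by (simp add: l2_inner_commute[symmetric])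
      then show "(\<lambda>n. complex_of_real (?\<kappa> v) * l2_inner h (\<lambda>t. h (t + (1 / real (Suc n)) *\<^sub>R v))) \<longlonglongrightarrow> complex_of_real (?\<kappa> v) * complex_of_real (l2sq h)"
        by (intro tendsto_mult tendsto_const)
    qed
    fix n
    have "cmod (l2_inner h (\<lambda>t. h (t + u))) \<le> l2sq h" for u
      using cmod_l2_inner_le[OF h sq_integrable_translate[OF h], of u] l2sq_translate[OF h, of u] by simp
    then show "AE v in lborel. norm (complex_of_real (?\<kappa> v) * l2_inner h (\<lambda>t. h (t + (1 / real (Suc n)) *\<^sub>R v))) \<le> ?\<kappa> v * l2sq h"
      by (simp add: norm_mult mult_left_mono)
  qed measurable
  also have "(\<integral>v. complex_of_real (?\<kappa> v) * complex_of_real (l2sq h) \<partial>lborel) = (\<integral>v. complex_of_real (?\<kappa> v) \<partial>lborel) * complex_of_real (l2sq h)"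
    by (rule integral_mult_left_zero)
  also have "(\<integral>v. complex_of_real (?\<kappa> v) \<partial>lborel) = 1"
    using gaussian_fourier[of 1 "0::real^'d"] by (simp add: cis_zero)
  finally show ?thesis by simp
qed

text \<open>The Gaussian factors increase to 1, so monotone convergence identifies the limit of the
  regularized integrals without knowing beforehand that the transform is square integrable.\<close>

theorem Plancherel:
  fixes h :: "real^'d \<Rightarrow> complex"
  assumes h1: "integrable lborel h" and h2: "sq_integrable h"
  shows "(\<integral>\<^sup>+ \<xi>. (ennreal (cmod (fourier h \<xi>)))\<^sup>2 \<partial>lborel) = ennreal (l2sq h)"
proof -
  have [measurable]: "h \<in> borel_measurable borel" using h2 by (rule sq_integrable_borel)
  let ?\<gamma> = "\<lambda>n \<xi>::real^'d. exp (- (pi * (1 / (real (Suc n))\<^sup>2) * (norm \<xi>)\<^sup>2))"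
  let ?I = "\<lambda>n. \<integral>\<xi>. ?\<gamma> n \<xi> * (cmod (fourier h \<xi>))\<^sup>2 \<partial>lborel"
  have int: "integrable lborel (\<lambda>\<xi>. ?\<gamma> n \<xi> * (cmod (fourier h \<xi>))\<^sup>2)" for n
  proof (rule Bochner_Integration.integrable_bound)
    show "integrable lborel (\<lambda>\<xi>::real^'d. ?\<gamma> n \<xi> * (\<integral>t. cmod (h t) \<partial>lborel)\<^sup>2)"
      by (intro integrable_mult_left gaussian_integrable) auto
    show "AE \<xi> in lborel. norm (?\<gamma> n \<xi> * (cmod (fourier h \<xi>))\<^sup>2) \<le> norm (?\<gamma> n \<xi> * (\<integral>t. cmod (h t) \<partial>lborel)\<^sup>2)"
      using cmod_fourier_le[OF h1] by (auto intro!: mult_left_mono power_mono)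
  qed measurable
  have "complex_of_real (?I n) = (\<integral>\<xi>. complex_of_real (?\<gamma> n \<xi>) * (fourier h \<xi> * cnj (fourier h \<xi>)) \<partial>lborel)" for n
    by (simp add: integral_complex_of_real[symmetric] complex_norm_square[symmetric] del: integral_complex_of_real)
  then have "complex_of_real (?I n) = (\<integral>v. complex_of_real (exp (- (pi * 1 * (norm v)\<^sup>2))) * l2_inner h (\<lambda>t. h (t + (1 / real (Suc n)) *\<^sub>R v)) \<partial>lborel)" for n
    using Plancherel_regularized[OF h1 h2, of "real (Suc n)"] by simp
  with Plancherel_regularized_limit[OF h2] have "(\<lambda>n. complex_of_real (?I n)) \<longlonglongrightarrow> complex_of_real (l2sq h)" by presburger
  then have "?I \<longlonglongrightarrow> l2sq h" by (simp only: tendsto_of_real_iff)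
  then have lim: "(\<lambda>n. ennreal (?I n)) \<longlonglongrightarrow> ennreal (l2sq h)" by (rule tendsto_ennrealI)
  have eq: "ennreal (?I n) = (\<integral>\<^sup>+ \<xi>. ennreal (?\<gamma> n \<xi> * (cmod (fourier h \<xi>))\<^sup>2) \<partial>lborel)" for n
    by (rule nn_integral_eq_integral[OF int, symmetric]) auto
  have "(\<lambda>n. \<integral>\<^sup>+ \<xi>. ennreal (?\<gamma> n \<xi> * (cmod (fourier h \<xi>))\<^sup>2) \<partial>lborel) \<longlonglongrightarrow> (\<integral>\<^sup>+ \<xi>. (ennreal (cmod (fourier h \<xi>)))\<^sup>2 \<partial>lborel)"
  proof (rule nn_integral_LIMSEQ)
    show "incseq (\<lambda>n \<xi>. ennreal (?\<gamma> n \<xi> * (cmod (fourier h \<xi>))\<^sup>2))"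
    proof (intro incseq_SucI le_funI ennreal_leI mult_right_mono)
      fix n and \<xi> :: "real^'d"
      have "1 / (real (Suc (Suc n)))\<^sup>2 \<le> 1 / (real (Suc n))\<^sup>2"
        by (intro divide_left_mono power_mono) auto
      then have "pi * (1 / (real (Suc (Suc n)))\<^sup>2) * (norm \<xi>)\<^sup>2 \<le> pi * (1 / (real (Suc n))\<^sup>2) * (norm \<xi>)\<^sup>2"
        by (intro mult_right_mono mult_left_mono) auto
      then show "?\<gamma> n \<xi> \<le> ?\<gamma> (Suc n) \<xi>" by (simp only: exp_le_cancel_iff neg_le_iff_le)
    qed simp
    fix \<xi> :: "real^'d"
    have "(\<lambda>n. ?\<gamma> n \<xi>) \<longlonglongrightarrow> 1" by real_asymp
    from tendsto_mult[OF this tendsto_const[of "(cmod (fourier h \<xi>))\<^sup>2"]]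
    show "(\<lambda>n. ennreal (?\<gamma> n \<xi> * (cmod (fourier h \<xi>))\<^sup>2)) \<longlonglongrightarrow> (ennreal (cmod (fourier h \<xi>)))\<^sup>2"
      by (simp add: ennreal_power tendsto_ennrealI)
  qed measurable
  then show ?thesis unfolding eq[symmetric] by (rule LIMSEQ_unique[OF _ lim])
qed

section \<open>Moyal's identity\<close>

lemma stft_eq_fourier:
  "stft \<phi> f (x, \<xi>) = fourier (\<lambda>t. f t * cnj (\<phi> (t - x))) \<xi>"
  by (simp add: stft_def l2_inner_def fourier_def tf_shift_def cis_cnj mult_ac)

lemma nn_integral_lborel_pair:
  fixes F :: "'a::euclidean_space \<times> 'b::euclidean_space \<Rightarrow> ennreal"
  assumes "F \<in> borel_measurable borel"
  shows "(\<integral>\<^sup>+ z. F z \<partial>lborel) = (\<integral>\<^sup>+ x. (\<integral>\<^sup>+ y. F (x, y) \<partial>lborel) \<partial>lborel)"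
proof -
  have "(\<integral>\<^sup>+ z. F z \<partial>lborel) = (\<integral>\<^sup>+ z. F z \<partial>(lborel \<Otimes>\<^sub>M lborel))" by (simp add: lborel_prod)
  also have "\<dots> = (\<integral>\<^sup>+ x. (\<integral>\<^sup>+ y. F (x, y) \<partial>lborel) \<partial>lborel)"
    using assms by (intro lborel.nn_integral_fst[symmetric]) (simp add: lborel_prod)
  finally show ?thesis .
qed

text \<open>For fixed x the transform is the Fourier transform in \<xi> of t \<mapsto> f t
  cnj(\<phi>(t - x)). Plancherel is applied for each x, and Tonelli then separates f from
  \<phi>.\<close>

theorem Moyal_norm:
  fixes f \<phi> :: "real^'d \<Rightarrow> complex"
  assumes f: "sq_integrable f" and \<phi>: "sq_integrable \<phi>"
  shows "(\<integral>\<^sup>+ z. (ennreal (cmod (stft \<phi> f z)))\<^sup>2 \<partial>lborel) = ennreal (l2sq f * l2sq \<phi>)"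
proof -
  have [measurable]: "f \<in> borel_measurable borel" "\<phi> \<in> borel_measurable borel"
    using f \<phi> by (auto simp: sq_integrable_borel)
  define h where "h x t = f t * cnj (\<phi> (t - x))" for x t
  have hm [measurable]: "h x \<in> borel_measurable borel" for x unfolding h_def by measurable
  have h1: "integrable lborel (h x)" for x
    using integrable_mult_cnj[OF f sq_integrable_translate[OF \<phi>, of "- x"]] by (simp add: h_def[abs_def])
  have sq: "(ennreal (cmod (h x t)))\<^sup>2 = (ennreal (cmod (f t)))\<^sup>2 * (ennreal (cmod (\<phi> (t - x))))\<^sup>2" for x t
    by (simp add: h_def norm_mult ennreal_mult power_mult_distrib)
  have total: "(\<integral>\<^sup>+ x. (\<integral>\<^sup>+ t. (ennreal (cmod (h x t)))\<^sup>2 \<partial>lborel) \<partial>lborel) = ennreal (l2sq f * l2sq \<phi>)"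
  proof -
    have "(\<integral>\<^sup>+ x. (\<integral>\<^sup>+ t. (ennreal (cmod (h x t)))\<^sup>2 \<partial>lborel) \<partial>lborel)
       = (\<integral>\<^sup>+ t. (\<integral>\<^sup>+ x. (ennreal (cmod (f t)))\<^sup>2 * (ennreal (cmod (\<phi> (t - x))))\<^sup>2 \<partial>lborel) \<partial>lborel)"
      unfolding sq by (rule lborel_pair.Fubini') simp
    also have "\<dots> = (\<integral>\<^sup>+ t. (ennreal (cmod (f t)))\<^sup>2 * ennreal (l2sq \<phi>) \<partial>lborel)"
    proof (rule nn_integral_cong)
      fix t
      show "(\<integral>\<^sup>+ x. (ennreal (cmod (f t)))\<^sup>2 * (ennreal (cmod (\<phi> (t - x))))\<^sup>2 \<partial>lborel) = (ennreal (cmod (f t)))\<^sup>2 * ennreal (l2sq \<phi>)"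
        using nn_integral_reflect[of "\<lambda>x. (ennreal (cmod (\<phi> x)))\<^sup>2" t]
        by (subst nn_integral_cmult) (auto simp: nn_integral_l2sq[OF \<phi>])
    qed
    also have "\<dots> = ennreal (l2sq f * l2sq \<phi>)"
      by (simp add: nn_integral_multc nn_integral_l2sq[OF f] ennreal_mult)
    finally show ?thesis .
  qed
  have "(\<integral>\<^sup>+ z. (ennreal (cmod (stft \<phi> f z)))\<^sup>2 \<partial>lborel) = (\<integral>\<^sup>+ x. (\<integral>\<^sup>+ \<xi>. (ennreal (cmod (fourier (h x) \<xi>)))\<^sup>2 \<partial>lborel) \<partial>lborel)"
    by (subst nn_integral_lborel_pair) (simp_all add: stft_eq_fourier h_def[abs_def])
  also have "\<dots> = (\<integral>\<^sup>+ x. (\<integral>\<^sup>+ t. (ennreal (cmod (h x t)))\<^sup>2 \<partial>lborel) \<partial>lborel)"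
  proof (rule nn_integral_cong_AE)
    \<comment> \<open>The product \<open>h x\<close> is integrable for every x, but its square
      integrability is obtained only for almost every x, from the finite total.\<close>
    have "AE x in lborel. (\<integral>\<^sup>+ t. (ennreal (cmod (h x t)))\<^sup>2 \<partial>lborel) \<noteq> \<infinity>"
    proof (rule nn_integral_noteq_infinite)
      show "(\<lambda>x. \<integral>\<^sup>+ t. (ennreal (cmod (h x t)))\<^sup>2 \<partial>lborel) \<in> borel_measurable lborel"
        unfolding sq by (rule lborel.borel_measurable_nn_integral) measurable
    qed (simp add: total)
    then show "AE x in lborel. (\<integral>\<^sup>+ \<xi>. (ennreal (cmod (fourier (h x) \<xi>)))\<^sup>2 \<partial>lborel) = (\<integral>\<^sup>+ t. (ennreal (cmod (h x t)))\<^sup>2 \<partial>lborel)"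
    proof eventually_elim
      case (elim x)
      have "sq_integrable (h x)" using elim by (intro sq_integrableI_nn) (auto simp: less_top)
      then show ?case using Plancherel[OF h1] nn_integral_l2sq by metis
    qed
  qed
  finally show ?thesis using total by simp
qed

lemma stft_square_integrable:
  assumes "sq_integrable f" "sq_integrable \<phi>"
  shows "integrable lborel (\<lambda>z. (cmod (stft \<phi> f z))\<^sup>2)"
proof -
  have [measurable]: "f \<in> borel_measurable borel" "\<phi> \<in> borel_measurable borel"
    using assms by (auto simp: sq_integrable_borel)
  show ?thesis using Moyal_norm[OF assms] by (simp add: integrable_iff_bounded ennreal_power)
qed

lemma integral_stft_square:
  assumes "sq_integrable f" "sq_integrable \<phi>"
  shows "(\<integral>z. (cmod (stft \<phi> f z))\<^sup>2 \<partial>lborel) = l2sq f * l2sq \<phi>"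
  using Moyal_norm[OF assms] nn_integral_eq_integral[OF stft_square_integrable[OF assms]]
  by (simp add: ennreal_power)

lemma integrable_stft_mult_cnj:
  assumes "sq_integrable f" "sq_integrable g" "sq_integrable \<phi>" "sq_integrable \<psi>"
  shows "integrable lborel (\<lambda>z. stft \<phi> f z * cnj (stft \<psi> g z))"
proof (rule Bochner_Integration.integrable_bound)
  have [measurable]: "f \<in> borel_measurable borel" "g \<in> borel_measurable borel" "\<phi> \<in> borel_measurable borel" "\<psi> \<in> borel_measurable borel"
    using assms by (auto simp: sq_integrable_borel)
  show "integrable lborel (\<lambda>z. (cmod (stft \<phi> f z))\<^sup>2 + (cmod (stft \<psi> g z))\<^sup>2)"
    using assms by (intro Bochner_Integration.integrable_add stft_square_integrable)
  have "a * b \<le> a\<^sup>2 + b\<^sup>2" for a b :: real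
    using sum_squares_bound[of a b] zero_le_power2[of a] zero_le_power2[of b] by linarith
  then show "AE z in lborel. norm (stft \<phi> f z * cnj (stft \<psi> g z)) \<le> norm ((cmod (stft \<phi> f z))\<^sup>2 + (cmod (stft \<psi> g z))\<^sup>2)"
    by (simp add: norm_mult)
  show "(\<lambda>z. stft \<phi> f z * cnj (stft \<psi> g z)) \<in> borel_measurable lborel" by measurable
qed

lemma stft_add: "sq_integrable f \<Longrightarrow> sq_integrable g \<Longrightarrow> sq_integrable \<phi> \<Longrightarrow> stft \<phi> (\<lambda>t. f t + g t) z = stft \<phi> f z + stft \<phi> g z"
  by (simp add: stft_def l2_inner_add sq_integrable_tf_shift)

lemma stft_diff: "sq_integrable f \<Longrightarrow> sq_integrable g \<Longrightarrow> sq_integrable \<phi> \<Longrightarrow> stft \<phi> (\<lambda>t. f t - g t) z = stft \<phi> f z - stft \<phi> g z"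
  by (simp add: stft_def l2_inner_diff sq_integrable_tf_shift)

lemma stft_cmult: "stft \<phi> (\<lambda>t. c * f t) z = c * stft \<phi> f z"
  by (simp add: stft_def l2_inner_cmult)

text \<open>Polarization: the difference of the two sides is sesquilinear and vanishes on the diagonal.\<close>
theorem Moyal:
  fixes f g \<phi> :: "real^'d \<Rightarrow> complex"
  assumes f: "sq_integrable f" and g: "sq_integrable g" and \<phi>: "sq_integrable \<phi>"
  shows "(\<integral>z. stft \<phi> f z * cnj (stft \<phi> g z) \<partial>lborel) = complex_of_real (l2sq \<phi>) * l2_inner f g"
proof -
  define S where "S u v = (\<integral>z. stft \<phi> u z * cnj (stft \<phi> v z) \<partial>lborel) - complex_of_real (l2sq \<phi>) * l2_inner u v" for u v
  have diag: "S u u = 0" if "sq_integrable u" for u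
  proof -
    have "(\<integral>z. stft \<phi> u z * cnj (stft \<phi> u z) \<partial>lborel) = complex_of_real (\<integral>z. (cmod (stft \<phi> u z))\<^sup>2 \<partial>lborel)"
      by (simp add: complex_norm_square[symmetric] flip: integral_complex_of_real)
    then show ?thesis using that by (simp add: S_def integral_stft_square[OF that \<phi>] l2_inner_self)
  qed
  have expand: "S (\<lambda>t. f t + c * g t) (\<lambda>t. f t + c * g t) = S f f + cnj c * S f g + c * S g f + c * cnj c * S g g" for c
  proof -
    have cg: "sq_integrable (\<lambda>t. c * g t)" using g by (rule sq_integrable_cmult)
    have st: "stft \<phi> (\<lambda>t. f t + c * g t) z = stft \<phi> f z + c * stft \<phi> g z" for z
      by (simp add: stft_add[OF f cg \<phi>] stft_cmult)
    have r: "l2_inner u (\<lambda>t. f t + c * g t) = l2_inner u f + cnj c * l2_inner u g" if "sq_integrable u" for u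
      using that by (subst (1 2 3) l2_inner_commute) (simp add: l2_inner_add[OF f cg] l2_inner_cmult)
    have "l2_inner (\<lambda>t. f t + c * g t) (\<lambda>t. f t + c * g t)
       = l2_inner f f + cnj c * l2_inner f g + c * l2_inner g f + c * cnj c * l2_inner g g"
      by (simp add: l2_inner_add[OF f cg sq_integrable_add[OF f cg]] l2_inner_cmult r f g algebra_simps)
    moreover have "(\<integral>z. stft \<phi> (\<lambda>t. f t + c * g t) z * cnj (stft \<phi> (\<lambda>t. f t + c * g t) z) \<partial>lborel)
      = (\<integral>z. stft \<phi> f z * cnj (stft \<phi> f z) + cnj c * (stft \<phi> f z * cnj (stft \<phi> g z)) + c * (stft \<phi> g z * cnj (stft \<phi> f z)) + c * cnj c * (stft \<phi> g z * cnj (stft \<phi> g z)) \<partial>lborel)"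
      by (rule Bochner_Integration.integral_cong) (simp_all add: st algebra_simps)
    moreover have "\<dots> = (\<integral>z. stft \<phi> f z * cnj (stft \<phi> f z) \<partial>lborel) + cnj c * (\<integral>z. stft \<phi> f z * cnj (stft \<phi> g z) \<partial>lborel)
      + c * (\<integral>z. stft \<phi> g z * cnj (stft \<phi> f z) \<partial>lborel) + c * cnj c * (\<integral>z. stft \<phi> g z * cnj (stft \<phi> g z) \<partial>lborel)"
      using f g \<phi> by (simp add: integrable_stft_mult_cnj)
    ultimately show ?thesis by (simp add: S_def algebra_simps)
  qed
  have z: "S (\<lambda>t. f t + c * g t) (\<lambda>t. f t + c * g t) = 0" for c
    by (intro diag sq_integrable_add f sq_integrable_cmult g)
  have "S f g + S g f = 0" "- \<i> * S f g + \<i> * S g f = 0"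
    using expand[of 1] expand[of \<i>] z[of 1] z[of \<i>] by (simp_all add: diag f g)
  then have "S f g = 0" by (simp add: algebra_simps) 
  then show ?thesis by (simp add: S_def)
qed

section \<open>The reproducing formula on the modulation space\<close>

lemma gauss_eq: "gauss t = complex_of_real (exp (- (pi * 1 * (norm t)\<^sup>2)))"
  by (simp add: gauss_def)

lemma gauss_borel [measurable]: "gauss \<in> borel_measurable borel"
  unfolding gauss_def[abs_def] by measurable

lemma sq_integrable_gauss: "sq_integrable (gauss :: real^'d \<Rightarrow> complex)"
proof -
  have "(\<lambda>t::real^'d. (cmod (gauss t))\<^sup>2) = (\<lambda>t. exp (- (pi * 2 * (norm t)\<^sup>2)))"
    by (simp add: gauss_def exp_double[symmetric] mult_ac)
  then show ?thesis unfolding sq_integrable_def using gaussian_integrable[of 2, where 'a="real^'d"] by simp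
qed

lemma l2sq_gauss_pos: "0 < l2sq (gauss :: real^'d \<Rightarrow> complex)"
proof -
  have "complex_of_real (l2sq (gauss :: real^'d \<Rightarrow> complex)) = (\<integral>t. complex_of_real (exp (- (pi * 2 * (norm (t::real^'d))\<^sup>2))) * cis (- (2 * pi * ((0::real^'d) \<bullet> t))) \<partial>lborel)"
    unfolding l2sq_def by (simp add: gauss_def exp_double[symmetric] mult_ac cis_zero flip: integral_complex_of_real)
  also have "\<dots> = complex_of_real ((1 / sqrt 2) ^ DIM(real^'d))"
    by (subst gaussian_fourier) auto
  finally show ?thesis by (simp only: of_real_eq_iff) simp
qed

text \<open>Shifting the integration variable by x/2 turns the product of the two Gaussians into a
  Gaussian in t times a Gaussian in x, by the parallelogram law; the t-integral is then a Gaussian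
  Fourier transform.\<close>

lemma stft_gauss_gauss:
  fixes z :: "(real^'d) \<times> (real^'d)"
  shows "cmod (stft gauss gauss z) = (1 / sqrt 2) ^ DIM(real^'d) * exp (- (pi * (1 / 2) * (norm z)\<^sup>2))"
proof -
  obtain x \<xi> where z: "z = (x, \<xi>)" by (cases z)
  let ?h = "\<lambda>t. gauss t * cnj (gauss (t - x)) * cis (- (2 * pi * (\<xi> \<bullet> t)))"
  let ?c = "complex_of_real (exp (- (pi / 2 * (norm x)\<^sup>2))) * cis (- (2 * pi * (\<xi> \<bullet> ((1 / 2) *\<^sub>R x))))"
  have "stft gauss gauss z = (\<integral>t. ?h t \<partial>lborel)"
    by (simp add: z stft_eq_fourier fourier_def)
  also have "\<dots> = (\<integral>t. ?h (t + (1 / 2) *\<^sub>R x) \<partial>lborel)"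
    by (rule integral_translate[symmetric]) measurable
  also have "\<dots> = (\<integral>t. ?c * (complex_of_real (exp (- (pi * 2 * (norm t)\<^sup>2))) * cis (- (2 * pi * (\<xi> \<bullet> t)))) \<partial>lborel)"
  proof (rule Bochner_Integration.integral_cong[OF refl])
    fix t :: "real^'d"
    have "(norm (t + (1 / 2) *\<^sub>R x))\<^sup>2 + (norm (t + (1 / 2) *\<^sub>R x - x))\<^sup>2 = 2 * (norm t)\<^sup>2 + (norm x)\<^sup>2 / 2"
      unfolding power2_norm_eq_inner by (simp add: algebra_simps inner_add_left inner_add_right inner_diff_left inner_diff_right inner_commute)
    then have "- (pi * (norm (t + (1 / 2) *\<^sub>R x))\<^sup>2) + - (pi * (norm (t + (1 / 2) *\<^sub>R x - x))\<^sup>2) = - (pi / 2 * (norm x)\<^sup>2) + - (pi * 2 * (norm t)\<^sup>2)"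
      by (simp add: algebra_simps flip: distrib_left)
    then have "exp (- (pi * (norm (t + (1 / 2) *\<^sub>R x))\<^sup>2)) * exp (- (pi * (norm (t + (1 / 2) *\<^sub>R x - x))\<^sup>2)) = exp (- (pi / 2 * (norm x)\<^sup>2)) * exp (- (pi * 2 * (norm t)\<^sup>2))"
      by (simp only: exp_add[symmetric])
    then have "gauss (t + (1 / 2) *\<^sub>R x) * cnj (gauss (t + (1 / 2) *\<^sub>R x - x)) = complex_of_real (exp (- (pi / 2 * (norm x)\<^sup>2))) * complex_of_real (exp (- (pi * 2 * (norm t)\<^sup>2)))"
      unfolding gauss_eq by (simp only: complex_cnj_complex_of_real of_real_mult[symmetric] mult_1_right)
    moreover have "cis (- (2 * pi * (\<xi> \<bullet> (t + (1 / 2) *\<^sub>R x)))) = cis (- (2 * pi * (\<xi> \<bullet> ((1 / 2) *\<^sub>R x)))) * cis (- (2 * pi * (\<xi> \<bullet> t)))"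
      by (simp add: cis_mult inner_add_right algebra_simps)
    ultimately show "?h (t + (1 / 2) *\<^sub>R x) = ?c * (complex_of_real (exp (- (pi * 2 * (norm t)\<^sup>2))) * cis (- (2 * pi * (\<xi> \<bullet> t))))"
      by (simp only: mult_ac)
  qed
  also have "\<dots> = ?c * complex_of_real ((1 / sqrt 2) ^ DIM(real^'d) * exp (- (pi * (norm \<xi>)\<^sup>2 / 2)))"
    by (subst integral_mult_right_zero) (subst gaussian_fourier, auto)
  finally have "cmod (stft gauss gauss z) = exp (- (pi / 2 * (norm x)\<^sup>2)) * ((1 / sqrt 2) ^ DIM(real^'d) * exp (- (pi * (norm \<xi>)\<^sup>2 / 2)))"
    by (simp only: norm_mult norm_of_real norm_cis) (simp add: abs_mult)
  also have "\<dots> = (1 / sqrt 2) ^ DIM(real^'d) * exp (- (pi * (1 / 2) * (norm z)\<^sup>2))"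
  proof -
    have "(norm z)\<^sup>2 = (norm x)\<^sup>2 + (norm \<xi>)\<^sup>2" by (simp add: z norm_Pair)
    then have "- (pi * (1 / 2) * (norm z)\<^sup>2) = - (pi / 2 * (norm x)\<^sup>2) + - (pi * (norm \<xi>)\<^sup>2 / 2)" by (simp add: algebra_simps)
    then show ?thesis by (simp only: exp_add mult_ac)
  qed
  finally show ?thesis .
qed

text \<open>That w \<ge> 1 follows from w 0 \<le> w 0 w 0 and w 0 \<le> w z w(-z) = (w z)^2.\<close>

lemma admissible_poly_weight:
  assumes "admissible_weight w"
  shows "poly_weight w"
proof
  note w = assms[unfolded admissible_weight_def]
  have pos: "0 < w z" and even: "w (- z) = w z" and sub: "w (z + z') \<le> w z * w z'" for z z' using w by blast+
  show "continuous_on UNIV w" "\<exists>C (N::nat). \<forall>z. w z \<le> C * (1 + norm z) ^ N" using w by blast+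
  show "w (- z) = w z" "w (z + z') \<le> w z * w z'" for z z' by (rule even sub)+
  have "1 \<le> w 0" using sub[of 0 0] pos[of 0] by simp
  fix z
  have "w 0 \<le> w z * w z" using sub[of z "- z"] even[of z] by simp
  then have "1 * 1 \<le> w z * w z" using \<open>1 \<le> w 0\<close> by simp
  then show "1 \<le> w z" using pos[of z] by (metis abs_le_square_iff abs_of_pos power2_eq_square zero_less_one)
qed

context poly_weight
begin

text \<open>L^1_w is a convolution algebra because w is submultiplicative.\<close>

lemma wnorm1_conv_int:
  assumes [measurable]: "\<theta> \<in> borel_measurable borel" "h \<in> borel_measurable borel"
  shows "wnorm1 (conv_int \<theta> h) \<le> wnorm1 \<theta> * wnorm1 h"
proof -
  have "wnorm1 (conv_int \<theta> h) = (\<integral>\<^sup>+ x. (\<integral>\<^sup>+ y. \<theta> (x - y) * h y * ennreal (w x) \<partial>lborel) \<partial>lborel)"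
    unfolding wnorm1_def conv_int_def by (simp add: nn_integral_multc)
  also have "\<dots> \<le> (\<integral>\<^sup>+ x. (\<integral>\<^sup>+ y. (\<theta> (x - y) * ennreal (w (x - y))) * (h y * ennreal (w y)) \<partial>lborel) \<partial>lborel)"
  proof (intro nn_integral_mono)
    fix x y
    have "ennreal (w x) \<le> ennreal (w (x - y)) * ennreal (w y)"
      using w_sub[of "x - y" y] by (simp add: ennreal_mult[symmetric] ennreal_leI)
    from mult_left_mono[OF this, of "\<theta> (x - y) * h y"]
    show "\<theta> (x - y) * h y * ennreal (w x) \<le> (\<theta> (x - y) * ennreal (w (x - y))) * (h y * ennreal (w y))"
      by (simp add: mult_ac)
  qed
  also have "\<dots> = (\<integral>\<^sup>+ y. (\<integral>\<^sup>+ x. (\<theta> (x - y) * ennreal (w (x - y))) * (h y * ennreal (w y)) \<partial>lborel) \<partial>lborel)"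
    by (rule lborel_pair.Fubini') simp
  also have "\<dots> = (\<integral>\<^sup>+ y. wnorm1 \<theta> * (h y * ennreal (w y)) \<partial>lborel)"
  proof (rule nn_integral_cong)
    fix y
    show "(\<integral>\<^sup>+ x. (\<theta> (x - y) * ennreal (w (x - y))) * (h y * ennreal (w y)) \<partial>lborel) = wnorm1 \<theta> * (h y * ennreal (w y))"
      using nn_integral_translate'[of "\<lambda>x. \<theta> x * ennreal (w x)" y] by (subst nn_integral_multc) (auto simp: wnorm1_def)
  qed
  also have "\<dots> = wnorm1 \<theta> * wnorm1 h" unfolding wnorm1_def[of h] by (rule nn_integral_cmult) measurable
  finally show ?thesis .
qed

lemma nn_integral_translate_w:
  assumes [measurable]: "\<theta> \<in> borel_measurable borel"
  shows "(\<integral>\<^sup>+ y. \<theta> (y - z) * ennreal (w y) \<partial>lborel) \<le> ennreal (w z) * wnorm1 \<theta>"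
proof -
  have "(\<integral>\<^sup>+ y. \<theta> (y - z) * ennreal (w y) \<partial>lborel) \<le> (\<integral>\<^sup>+ y. ennreal (w z) * (\<theta> (y - z) * ennreal (w (y - z))) \<partial>lborel)"
  proof (intro nn_integral_mono)
    fix y
    have "ennreal (w y) \<le> ennreal (w (y - z)) * ennreal (w z)"
      using w_sub[of "y - z" z] by (simp add: ennreal_mult[symmetric] ennreal_leI)
    from mult_left_mono[OF this, of "\<theta> (y - z)"]
    show "\<theta> (y - z) * ennreal (w y) \<le> ennreal (w z) * (\<theta> (y - z) * ennreal (w (y - z)))" by (simp add: mult_ac)
  qed
  also have "\<dots> = ennreal (w z) * wnorm1 \<theta>"
    using nn_integral_translate'[of "\<lambda>x. \<theta> x * ennreal (w x)" z] by (subst nn_integral_cmult) (auto simp: wnorm1_def)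
  finally show ?thesis .
qed

end

section \<open>A slowly varying majorant of the reproducing kernel\<close>

locale tf = poly_weight w for w :: "(real^'d) \<times> (real^'d) \<Rightarrow> real" +
  fixes \<phi> :: "real^'d \<Rightarrow> complex"
  assumes \<phi>_M1: "M1 w \<phi>" and \<phi>_norm: "l2sq \<phi> = 1"
begin

lemma \<phi>_sq: "sq_integrable \<phi>"
  using \<phi>_M1 by (simp add: M1_def)

lemma \<phi>_borel [measurable]: "\<phi> \<in> borel_measurable borel"
  by (rule sq_integrable_borel[OF \<phi>_sq])

definition amb :: "(real^'d) \<times> (real^'d) \<Rightarrow> ennreal" where
  "amb z = ennreal (cmod (stft gauss \<phi> z))"

lemma amb_borel [measurable]: "amb \<in> borel_measurable borel"
  unfolding amb_def by measurable

lemma amb_wnorm1: "wnorm1 amb < \<infinity>"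
  using \<phi>_M1 by (simp add: M1_def wnorm1_def amb_def ennreal_mult)

text \<open>Smoothing by \<open>sexp 1\<close> makes \<open>amb\<close> slowly varying, and it dominates \<open>amb\<close> because the ambiguity
  function of the Gaussian decays faster than exponentially.\<close>
abbreviation ambS :: "(real^'d) \<times> (real^'d) \<Rightarrow> ennreal" where
  "ambS \<equiv> conv_int (sexp 1) amb"

lemma slowly_varying_ambS: "slowly_varying (exp 1) ambS"
  by (intro slowly_varying_conv_int slowly_varying_sexp) simp_all

lemma ambS_wnorm1: "wnorm1 ambS < \<infinity>"
  using wnorm1_conv_int[of "sexp 1" amb] wnorm1_sexp_finite[of 1] amb_wnorm1
  by (auto simp: ennreal_mult_less_top elim!: order.strict_trans1)

text \<open>Moyal's identity with the Gaussian window, divided by the squared norm of the Gaussian.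
  It transfers estimates on inner products to the Gaussian transforms, in terms of which
  \<open>M1\<close> is defined.\<close>

lemma cmod_l2_inner_gauss_le:
  fixes f h :: "real^'d \<Rightarrow> complex"
  assumes f: "sq_integrable f" and h: "sq_integrable h"
  shows "ennreal (cmod (l2_inner f h)) \<le> ennreal (1 / l2sq (gauss :: real^'d \<Rightarrow> complex)) *
    (\<integral>\<^sup>+ z. ennreal (cmod (stft gauss f z)) * ennreal (cmod (stft gauss h z)) \<partial>lborel)"
proof -
  let ?c = "l2sq (gauss :: real^'d \<Rightarrow> complex)"
  have "l2_inner f h = complex_of_real (1 / ?c) * (\<integral>z. stft gauss f z * cnj (stft gauss h z) \<partial>lborel)"
    using Moyal[OF f h sq_integrable_gauss] less_imp_neq[OF l2sq_gauss_pos[where 'd='d]] by simp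
  then have "cmod (l2_inner f h) = (1 / ?c) * cmod (\<integral>z. stft gauss f z * cnj (stft gauss h z) \<partial>lborel)"
    by (simp only: norm_mult norm_of_real) simp
  then have "ennreal (cmod (l2_inner f h)) = ennreal (1 / ?c) * ennreal (cmod (\<integral>z. stft gauss f z * cnj (stft gauss h z) \<partial>lborel))"
    by (simp add: ennreal_mult[symmetric])
  also have "\<dots> \<le> ennreal (1 / ?c) * (\<integral>\<^sup>+ z. ennreal (cmod (stft gauss f z * cnj (stft gauss h z))) \<partial>lborel)"
    by (intro mult_left_mono integral_norm_bound_ennreal integrable_stft_mult_cnj f h sq_integrable_gauss) simp
  finally show ?thesis by (simp add: norm_mult ennreal_mult)
qed

text \<open>Expanding the inner product of \<phi> with pi(z) \<open>gauss\<close> over the Gaussian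
  transform bounds \<open>amb\<close> by its convolution with the ambiguity function of the
  Gaussian.\<close>

lemma amb_le_ambS:
  obtains C where "0 < C" "\<And>z. amb z \<le> ennreal C * ambS z"
proof -
  let ?c = "l2sq (gauss :: real^'d \<Rightarrow> complex)"
  obtain D where D: "0 < D" "\<And>x::(real^'d) \<times> (real^'d). exp (- (pi * (1 / 2) * (norm x)\<^sup>2)) \<le> D * exp (- norm x)"
    using gaussian_le_exp[of "1 / 2"] by (metis half_gt_zero_iff zero_less_one)
  define M where "M = (1 / sqrt 2) ^ DIM(real^'d) * D"
  have M: "0 < M" using D(1) by (simp add: M_def)
  have VM: "ennreal (cmod (stft gauss gauss z)) \<le> ennreal M * sexp 1 z" for z :: "(real^'d) \<times> (real^'d)"
  proof -
    have "cmod (stft gauss gauss z) \<le> (1 / sqrt 2) ^ DIM(real^'d) * (D * exp (- norm z))"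
      unfolding stft_gauss_gauss by (intro mult_left_mono D) simp
    also have "\<dots> \<le> M * exp (- (norm z / (2 * 1)))"
      using M by (simp add: M_def mult.assoc)  (use D in simp)
    finally show ?thesis using M by (simp add: sexp_def ennreal_mult[symmetric] ennreal_leI)
  qed
  show ?thesis
  proof (rule that[of "1 / ?c * M"])
    show "0 < 1 / ?c * M" using M l2sq_gauss_pos[where 'd='d] by simp
    fix z :: "(real^'d) \<times> (real^'d)"
    have "amb z \<le> ennreal (1 / ?c) * (\<integral>\<^sup>+ y. amb y * ennreal (cmod (stft gauss (tf_shift z gauss) y)) \<partial>lborel)"
      using cmod_l2_inner_gauss_le[OF \<phi>_sq sq_integrable_tf_shift[OF sq_integrable_gauss], of z]
      by (simp add: amb_def stft_def)
    also have "\<dots> \<le> ennreal (1 / ?c) * (\<integral>\<^sup>+ y. ennreal M * (sexp 1 (z - y) * amb y) \<partial>lborel)"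
    proof (intro mult_left_mono nn_integral_mono)
      fix y
      have "cmod (stft gauss (tf_shift z gauss) y) = cmod (stft gauss gauss (y - z))"
        by (simp add: stft_def[of gauss "tf_shift z gauss"] cmod_l2_inner_tf_shift sq_integrable_gauss)
      moreover have "sexp 1 (y - z) = sexp 1 (z - y)" by (metis minus_diff_eq sexp_uminus)
      ultimately have "ennreal (cmod (stft gauss (tf_shift z gauss) y)) \<le> ennreal M * sexp 1 (z - y)"
        using VM[of "y - z"] by simp
      from mult_left_mono[OF this, of "amb y"]
      show "amb y * ennreal (cmod (stft gauss (tf_shift z gauss) y)) \<le> ennreal M * (sexp 1 (z - y) * amb y)"
        by (simp add: mult_ac)
    qed simp
    also have "(\<integral>\<^sup>+ y. ennreal M * (sexp 1 (z - y) * amb y) \<partial>lborel) = ennreal M * ambS z"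
      unfolding conv_int_def by (rule nn_integral_cmult) measurable
    finally show "amb z \<le> ennreal (1 / ?c * M) * ambS z"
      using M l2sq_gauss_pos[where 'd='d] by (subst ennreal_mult) (simp_all only: mult.assoc, simp_all)
  qed
qed

definition ambC :: real where
  "ambC = (SOME C. 0 < C \<and> (\<forall>z. amb z \<le> ennreal C * ambS z))"

lemma ambC: "0 < ambC" "amb z \<le> ennreal ambC * ambS z"
proof -
  have "\<exists>C. 0 < C \<and> (\<forall>z. amb z \<le> ennreal C * ambS z)" using amb_le_ambS by metis
  from someI_ex[OF this] show "0 < ambC" "amb z \<le> ennreal ambC * ambS z"
    unfolding ambC_def by blast+
qed

text \<open>Expanding the inner product of two shifts of \<phi> over the Gaussian transform gives
  \<open>amb\<close> convolved with its reflection. One of the two factors is enlarged to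
  \<open>ambS\<close>, and the convolution inherits its slow variation.\<close>

definition Phi :: "(real^'d) \<times> (real^'d) \<Rightarrow> ennreal" where
  "Phi z = ennreal (ambC / l2sq (gauss :: real^'d \<Rightarrow> complex)) * conv_int (\<lambda>u. ambS (- u)) amb z"

lemma Phi_borel [measurable]: "Phi \<in> borel_measurable borel"
  unfolding Phi_def by measurable

lemma slowly_varying_Phi: "slowly_varying (exp 1) Phi"
proof -
  have "slowly_varying (exp 1) (\<lambda>u. ambS (- u))"
    unfolding slowly_varying_def
  proof (intro allI impI)
    fix z u :: "(real^'d) \<times> (real^'d)" assume "norm u \<le> 1"
    then show "ambS (- (z + u)) \<le> ennreal (exp 1) * ambS (- z)"
      using slowly_varying_ambS[unfolded slowly_varying_def, rule_format, of "- u" "- z"] by simp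
  qed
  then have "slowly_varying (exp 1) (conv_int (\<lambda>u. ambS (- u)) amb)" by (rule slowly_varying_conv_int) measurable
  then show ?thesis
    unfolding slowly_varying_def Phi_def by (auto intro!: mult_left_mono simp: mult.left_commute[of "ennreal (exp 1)"])
qed

lemma Phi_wnorm1: "wnorm1 Phi < \<infinity>"
proof -
  have "wnorm1 Phi = ennreal (ambC / l2sq (gauss :: real^'d \<Rightarrow> complex)) * wnorm1 (conv_int (\<lambda>u. ambS (- u)) amb)"
    unfolding wnorm1_def Phi_def mult.assoc by (rule nn_integral_cmult) measurable
  moreover have "wnorm1 (conv_int (\<lambda>u. ambS (- u)) amb) < \<infinity>"
  proof (rule order.strict_trans1)
    show "wnorm1 (conv_int (\<lambda>u. ambS (- u)) amb) \<le> wnorm1 ambS * wnorm1 amb"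
      using wnorm1_conv_int[of "\<lambda>u. ambS (- u)" amb] wnorm1_reflect[of ambS] by simp
    show "wnorm1 ambS * wnorm1 amb < \<infinity>" using ambS_wnorm1 amb_wnorm1 by (simp add: ennreal_mult_less_top)
  qed
  ultimately show ?thesis by (auto simp: ennreal_mult_less_top)
qed

lemma kernel_le_Phi:
  "ennreal (cmod (l2_inner (tf_shift z' \<phi>) (tf_shift z \<phi>))) \<le> Phi (z - z')"
proof -
  let ?c = "l2sq (gauss :: real^'d \<Rightarrow> complex)"
  have "cmod (l2_inner (tf_shift z' \<phi>) (tf_shift z \<phi>)) = cmod (l2_inner \<phi> (tf_shift (z - z') \<phi>))"
    using cmod_l2_inner_tf_shift[OF \<phi>_sq \<phi>_sq] by (simp add: stft_def)
  also have "ennreal \<dots> \<le> ennreal (1 / ?c) * (\<integral>\<^sup>+ y. amb y * ennreal (cmod (stft gauss (tf_shift (z - z') \<phi>) y)) \<partial>lborel)"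
    using cmod_l2_inner_gauss_le[OF \<phi>_sq sq_integrable_tf_shift[OF \<phi>_sq], of "z - z'"] by (simp add: amb_def)
  also have "\<dots> \<le> ennreal (1 / ?c) * (\<integral>\<^sup>+ y. ennreal ambC * (ambS (- ((z - z') - y)) * amb y) \<partial>lborel)"
  proof (intro mult_left_mono nn_integral_mono)
    fix y
    have "ennreal (cmod (stft gauss (tf_shift (z - z') \<phi>) y)) = amb (y - (z - z'))"
      by (simp add: stft_def[of gauss "tf_shift _ _"] cmod_l2_inner_tf_shift[OF \<phi>_sq sq_integrable_gauss] amb_def)
    then have "ennreal (cmod (stft gauss (tf_shift (z - z') \<phi>) y)) \<le> ennreal ambC * ambS (- ((z - z') - y))"
      using ambC(2)[of "y - (z - z')"] by simp
    from mult_left_mono[OF this, of "amb y"]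
    show "amb y * ennreal (cmod (stft gauss (tf_shift (z - z') \<phi>) y)) \<le> ennreal ambC * (ambS (- ((z - z') - y)) * amb y)"
      by (simp add: mult_ac)
  qed simp
  also have "(\<integral>\<^sup>+ y. ennreal ambC * (ambS (- ((z - z') - y)) * amb y) \<partial>lborel) = ennreal ambC * conv_int (\<lambda>u. ambS (- u)) amb (z - z')"
    unfolding conv_int_def[of "\<lambda>u. ambS (- u)"] by (rule nn_integral_cmult) measurable
  also have "ennreal (1 / ?c) * (ennreal ambC * conv_int (\<lambda>u. ambS (- u)) amb (z - z')) = Phi (z - z')"
    using ambC(1) l2sq_gauss_pos[where 'd='d] by (simp add: Phi_def mult.assoc[symmetric] ennreal_mult[symmetric])
  finally show ?thesis .
qed

end

section \<open>Continuity of time-frequency shifts in M^1_w\<close>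

text \<open>Since \<open>s\<close> takes finitely many values, the integral is a finite sum, through
  which a linear functional can be moved.\<close>

lemma integral_simple_compose:
  fixes K :: "'a \<Rightarrow> complex" and f :: "'b \<Rightarrow> complex"
  assumes K: "integrable M K" and fin: "finite (range s)" and [measurable]: "\<And>\<zeta>. {z \<in> space M. s z = \<zeta>} \<in> sets M"
  shows "integrable M (\<lambda>z. K z * f (s z))"
    and "(\<integral>z. K z * f (s z) \<partial>M) = (\<Sum>\<zeta>\<in>range s. (\<integral>z. K z * indicator {z. s z = \<zeta>} z \<partial>M) * f \<zeta>)"
proof -
  have eq: "K z * f (s z) = (\<Sum>\<zeta>\<in>range s. K z * indicator {z. s z = \<zeta>} z * f \<zeta>)" for z
  proof -
    have "(\<Sum>\<zeta>\<in>range s. K z * indicator {z. s z = \<zeta>} z * f \<zeta>) = (\<Sum>\<zeta>\<in>range s. if \<zeta> = s z then K z * f \<zeta> else 0)"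
      by (rule sum.cong) (auto simp: indicator_def)
    then show ?thesis using fin by simp
  qed
  have int: "integrable M (\<lambda>z. K z * indicator {z. s z = \<zeta>} z)" for \<zeta>
  proof (rule Bochner_Integration.integrable_bound[OF K])
    have [measurable]: "K \<in> borel_measurable M" using K by simp
    have "(\<lambda>z. if s z = \<zeta> then K z else 0) \<in> borel_measurable M" by measurable
    then show "(\<lambda>z. K z * indicator {z. s z = \<zeta>} z) \<in> borel_measurable M"
      by (rule measurable_cong[THEN iffD1, rotated]) (auto simp: indicator_def)
    show "AE z in M. norm (K z * indicator {z. s z = \<zeta>} z) \<le> norm (K z)"
      by (auto simp: indicator_def)
  qed
  show "integrable M (\<lambda>z. K z * f (s z))"
    unfolding eq by (intro Bochner_Integration.integrable_sum integrable_mult_left int)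
  show "(\<integral>z. K z * f (s z) \<partial>M) = (\<Sum>\<zeta>\<in>range s. (\<integral>z. K z * indicator {z. s z = \<zeta>} z \<partial>M) * f \<zeta>)"
    unfolding eq using int by (subst Bochner_Integration.integral_sum) auto
qed

lemma M1_sq: "M1 w f \<Longrightarrow> sq_integrable f"
  by (simp add: M1_def)

context tf
begin

definition stft_shift :: "(real^'d) \<times> (real^'d) \<Rightarrow> (real^'d) \<times> (real^'d) \<Rightarrow> complex" where
  "stft_shift z y = stft gauss (tf_shift z \<phi>) y"

lemma cmod_stft_shift: "ennreal (cmod (stft_shift z y)) = amb (y - z)"
  by (simp add: stft_shift_def stft_def[of gauss "tf_shift _ _"] cmod_l2_inner_tf_shift[OF \<phi>_sq sq_integrable_gauss] amb_def)

lemma stft_shift_borel [measurable]: "(\<lambda>(z, y). stft_shift z y) \<in> borel_measurable (borel \<Otimes>\<^sub>M borel)"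
proof -
  have "(\<lambda>p. \<integral>t. tf_shift (fst p) \<phi> t * cnj (tf_shift (snd p) gauss t) \<partial>lborel) \<in> borel_measurable (borel \<Otimes>\<^sub>M borel)"
    by (rule lborel.borel_measurable_lebesgue_integral) measurable
  then show ?thesis by (simp add: stft_shift_def stft_def l2_inner_def case_prod_beta)
qed

lemma gauss_shift_dominated:
  assumes "norm u \<le> M"
  shows "cmod (gauss (t + u)) \<le> exp (1 + M) * exp (- norm t)"
proof -
  have "0 \<le> (norm (t + u) - 1 / 2)\<^sup>2" by simp
  then have "norm (t + u) \<le> (norm (t + u))\<^sup>2 + 1" by (simp add: power2_diff power_divide)
  also have "\<dots> \<le> pi * (norm (t + u))\<^sup>2 + 1" using pi_gt3 by (intro add_mono mult_right_mono[of 1 pi, simplified]) auto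
  finally have "- (pi * (norm (t + u))\<^sup>2) \<le> 1 - norm (t + u)" by simp
  also have "\<dots> \<le> (1 + M) - norm t" using assms norm_triangle_ineq4[of "t + u" u] by simp
  finally have "exp (- (pi * (norm (t + u))\<^sup>2)) \<le> exp ((1 + M) + - norm t)" by simp
  then show ?thesis unfolding exp_add by (simp add: gauss_def)
qed

text \<open>Translating the integration variable moves the varying shift from \<phi>, of which only
  square integrability is available, to the Gaussian, which is continuous and uniformly dominated by
  \<open>gauss_shift_dominated\<close>.\<close>

lemma stft_shift_continuous:
  assumes z: "z \<longlonglongrightarrow> z0"
  shows "(\<lambda>n. stft_shift (z n) y) \<longlonglongrightarrow> stft_shift z0 y"
proof -
  let ?F = "\<lambda>z t. cis (2 * pi * (snd z \<bullet> (t + fst z))) * \<phi> t * cnj (tf_shift y gauss (t + fst z))"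
  have eq: "stft_shift z y = (\<integral>t. ?F z t \<partial>lborel)" for z
  proof -
    have "stft_shift z y = (\<integral>t. tf_shift z \<phi> (t + fst z) * cnj (tf_shift y gauss (t + fst z)) \<partial>lborel)"
      unfolding stft_shift_def stft_def l2_inner_def by (rule integral_translate[symmetric]) measurable
    then show ?thesis by (simp add: tf_shift_def)
  qed
  have zf: "(\<lambda>n. fst (z n)) \<longlonglongrightarrow> fst z0" and zs: "(\<lambda>n. snd (z n)) \<longlonglongrightarrow> snd z0"
    using z by (auto intro: tendsto_intros)
  have "Bseq (\<lambda>n. fst (z n) - fst y)"
    by (rule convergent_imp_Bseq[OF convergentI[OF tendsto_diff[OF zf tendsto_const]]])
  then obtain M where M: "\<And>n. norm (fst (z n) - fst y) \<le> M" by (auto simp: Bseq_def)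
  let ?e = "\<lambda>t::real^'d. complex_of_real (exp (- norm t))"
  have "sq_integrable ?e"
    unfolding sq_integrable_def
  proof
    show "integrable lborel (\<lambda>t. (cmod (?e t))\<^sup>2)"
    proof (rule Bochner_Integration.integrable_bound[OF integrable_exp_norm])
      show "AE t in lborel. norm ((cmod (?e t))\<^sup>2) \<le> norm (exp (- norm t))"
        by (auto simp: exp_double[symmetric])
    qed measurable
  qed measurable
  from integrable_mult_cnj[OF \<phi>_sq this] have ie: "integrable lborel (\<lambda>t. cmod (\<phi> t * cnj (?e t)))" by (rule integrable_norm)
  have contg: "isCont gauss x" for x :: "real^'d"
    unfolding gauss_def[abs_def] by (intro continuous_intros)
  show ?thesis
    unfolding eq
  proof (rule integral_dominated_convergence[where w = "\<lambda>t. exp (1 + M) * cmod (\<phi> t * cnj (?e t))"])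
    show "integrable lborel (\<lambda>t. exp (1 + M) * cmod (\<phi> t * cnj (?e t)))" using ie by (rule integrable_mult_right)
    show "AE t in lborel. (\<lambda>n. ?F (z n) t) \<longlonglongrightarrow> ?F z0 t"
    proof (rule AE_I2)
      fix t
      have c: "isCont cis x" for x using continuous_on_cis[OF continuous_on_id, of UNIV] by (simp add: continuous_on_eq_continuous_at)
      have "(\<lambda>n. gauss (t + fst (z n) - fst y)) \<longlonglongrightarrow> gauss (t + fst z0 - fst y)"
        by (rule isCont_tendsto_compose[OF contg]) (intro tendsto_intros zf)
      then show "(\<lambda>n. ?F (z n) t) \<longlonglongrightarrow> ?F z0 t"
        unfolding tf_shift_def
        by (intro tendsto_mult tendsto_cnj tendsto_const isCont_tendsto_compose[OF c] tendsto_inner tendsto_add zf zs)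
    qed
    fix n
    show "AE t in lborel. norm (?F (z n) t) \<le> exp (1 + M) * cmod (\<phi> t * cnj (?e t))"
    proof (rule AE_I2)
      fix t
      have "cmod (gauss (t + (fst (z n) - fst y))) \<le> exp (1 + M) * exp (- norm t)"
        by (rule gauss_shift_dominated[OF M])
      from mult_left_mono[OF this, of "cmod (\<phi> t)"]
      show "norm (?F (z n) t) \<le> exp (1 + M) * cmod (\<phi> t * cnj (?e t))"
        by (simp add: norm_mult tf_shift_def mult_ac add_diff_eq)
    qed
  qed measurable
qed

text \<open>The M^1_w norm of pi(z) \<phi> - pi(z') \<phi>.\<close>

definition wdist1 :: "(real^'d) \<times> (real^'d) \<Rightarrow> (real^'d) \<times> (real^'d) \<Rightarrow> ennreal" where
  "wdist1 z z' = (\<integral>\<^sup>+ y. ennreal (cmod (stft_shift z y - stft_shift z' y)) * ennreal (w y) \<partial>lborel)"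

lemma wdist1_le: "wdist1 z z' \<le> (ennreal (w z) + ennreal (w z')) * wnorm1 amb"
proof -
  have "wdist1 z z' \<le> (\<integral>\<^sup>+ y. amb (y - z) * ennreal (w y) + amb (y - z') * ennreal (w y) \<partial>lborel)"
    unfolding wdist1_def
  proof (intro nn_integral_mono)
    fix y
    have "ennreal (cmod (stft_shift z y - stft_shift z' y)) \<le> ennreal (cmod (stft_shift z y) + cmod (stft_shift z' y))"
      by (intro ennreal_leI norm_triangle_ineq4)
    also have "\<dots> = amb (y - z) + amb (y - z')" by (simp add: cmod_stft_shift)
    finally have "ennreal (cmod (stft_shift z y - stft_shift z' y)) * ennreal (w y) \<le> (amb (y - z) + amb (y - z')) * ennreal (w y)"
      by (rule mult_right_mono) simp
    then show "ennreal (cmod (stft_shift z y - stft_shift z' y)) * ennreal (w y) \<le> amb (y - z) * ennreal (w y) + amb (y - z') * ennreal (w y)"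
      by (simp add: distrib_right)
  qed
  also have "\<dots> = (\<integral>\<^sup>+ y. amb (y - z) * ennreal (w y) \<partial>lborel) + (\<integral>\<^sup>+ y. amb (y - z') * ennreal (w y) \<partial>lborel)"
    by (rule nn_integral_add) measurable
  also have "\<dots> \<le> ennreal (w z) * wnorm1 amb + ennreal (w z') * wnorm1 amb"
    by (intro add_mono nn_integral_translate_w) measurable
  finally show ?thesis by (simp add: distrib_right)
qed

text \<open>Dominated convergence; a majorant common to all shifts near z0 exists because
  \<open>amb\<close> is dominated by the slowly varying \<open>ambS\<close>.\<close>

lemma wdist1_tendsto_0:
  assumes z: "z \<longlonglongrightarrow> z0"
  shows "(\<lambda>n. wdist1 z0 (z n)) \<longlonglongrightarrow> 0"
proof -
  \<comment> \<open>Finitely many terms are dropped, so that all remaining points lie within the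
    unit distance for which slow variation is stated.\<close>
  have "eventually (\<lambda>n. dist (z n) z0 < 1) sequentially" using z by (simp add: tendsto_iff)
  then obtain N where N: "\<And>n. N \<le> n \<Longrightarrow> dist (z n) z0 < 1" by (auto simp: eventually_sequentially)
  let ?w = "\<lambda>y. (amb (y - z0) + ennreal (ambC * exp 1) * ambS (y - z0)) * ennreal (w y)"
  have "(\<lambda>n. wdist1 z0 (z (n + N))) \<longlonglongrightarrow> (\<integral>\<^sup>+ y. 0 \<partial>(lborel :: ((real^'d) \<times> (real^'d)) measure))"
    unfolding wdist1_def
  proof (rule nn_integral_dominated_convergence[where w = ?w])
    have "(\<integral>\<^sup>+ y. ?w y \<partial>lborel) = (\<integral>\<^sup>+ y. amb (y - z0) * ennreal (w y) + ennreal (ambC * exp 1) * (ambS (y - z0) * ennreal (w y)) \<partial>lborel)"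
      by (simp add: distrib_right mult.assoc)
    also have "\<dots> = (\<integral>\<^sup>+ y. amb (y - z0) * ennreal (w y) \<partial>lborel) + ennreal (ambC * exp 1) * (\<integral>\<^sup>+ y. ambS (y - z0) * ennreal (w y) \<partial>lborel)"
      by (subst nn_integral_add) (auto intro!: nn_integral_cmult)
    also have "\<dots> \<le> ennreal (w z0) * wnorm1 amb + ennreal (ambC * exp 1) * (ennreal (w z0) * wnorm1 ambS)"
      by (intro add_mono mult_left_mono nn_integral_translate_w) auto
    also have "\<dots> < \<infinity>" using amb_wnorm1 ambS_wnorm1 by (simp add: ennreal_mult_less_top)
    finally show "(\<integral>\<^sup>+ y. ?w y \<partial>lborel) < \<infinity>" .
    fix n
    show "AE y in lborel. ennreal (cmod (stft_shift z0 y - stft_shift (z (n + N)) y)) * ennreal (w y) \<le> ?w y"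
    proof (rule AE_I2, rule mult_right_mono)
      fix y
      have "norm (z0 - z (n + N)) \<le> 1" using N[of "n + N"] by (simp add: dist_norm norm_minus_commute)
      then have "ambS ((y - z0) + (z0 - z (n + N))) \<le> ennreal (exp 1) * ambS (y - z0)"
        using slowly_varying_ambS unfolding slowly_varying_def by blast
      then have "ambS (y - z (n + N)) \<le> ennreal (exp 1) * ambS (y - z0)" by simp
      then have "amb (y - z (n + N)) \<le> ennreal ambC * (ennreal (exp 1) * ambS (y - z0))"
        by (intro order_trans[OF ambC(2)] mult_left_mono) auto
      also have "\<dots> = ennreal (ambC * exp 1) * ambS (y - z0)"
        using ambC(1) by (simp add: ennreal_mult mult.assoc)
      finally have "amb (y - z0) + amb (y - z (n + N)) \<le> amb (y - z0) + ennreal (ambC * exp 1) * ambS (y - z0)"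
        by (rule add_left_mono)
      moreover have "ennreal (cmod (stft_shift z0 y - stft_shift (z (n + N)) y)) \<le> ennreal (cmod (stft_shift z0 y) + cmod (stft_shift (z (n + N)) y))"
        by (intro ennreal_leI norm_triangle_ineq4)
      then have "ennreal (cmod (stft_shift z0 y - stft_shift (z (n + N)) y)) \<le> amb (y - z0) + amb (y - z (n + N))"
        by (simp add: cmod_stft_shift)
      ultimately show "ennreal (cmod (stft_shift z0 y - stft_shift (z (n + N)) y)) \<le> amb (y - z0) + ennreal (ambC * exp 1) * ambS (y - z0)"
        by (rule order_trans[rotated])
    qed simp
    show "AE y in lborel. (\<lambda>n. ennreal (cmod (stft_shift z0 y - stft_shift (z (n + N)) y)) * ennreal (w y)) \<longlonglongrightarrow> 0"
    proof (rule AE_I2)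
      fix y
      have "(\<lambda>n. stft_shift (z (n + N)) y) \<longlonglongrightarrow> stft_shift z0 y" using stft_shift_continuous[OF z] by (rule LIMSEQ_ignore_initial_segment)
      then have "(\<lambda>n. cmod (stft_shift z0 y - stft_shift (z (n + N)) y) * w y) \<longlonglongrightarrow> cmod (stft_shift z0 y - stft_shift z0 y) * w y"
        by (intro tendsto_intros)
      then have "(\<lambda>n. cmod (stft_shift z0 y - stft_shift (z (n + N)) y) * w y) \<longlonglongrightarrow> 0" by simp
      from tendsto_ennrealI[OF this] show "(\<lambda>n. ennreal (cmod (stft_shift z0 y - stft_shift (z (n + N)) y)) * ennreal (w y)) \<longlonglongrightarrow> 0"
        by (simp add: ennreal_mult)
    qed
  qed measurable
  then have "(\<lambda>n. wdist1 z0 (z (n + N))) \<longlonglongrightarrow> 0" by simp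
  then show ?thesis by (rule LIMSEQ_offset)
qed

end

section \<open>Bounded functionals on M^1_w and integrals of time-frequency shifts\<close>

context poly_weight
begin

text \<open>Supplies the sample points for Riemann sums of integrals with values in M^1_w. The bound
  on \<open>w (s n z)\<close> keeps these sums dominated.\<close>

lemma simple_identity_approx:
  "\<exists>s Wc. 0 \<le> (Wc::real) \<and> (\<forall>n. simple_function lborel (s n)) \<and> (\<forall>n z. w (s n z) \<le> Wc * w z) \<and> (\<forall>z. (\<lambda>n. s n z) \<longlonglongrightarrow> (z :: 'a))"
proof -
  have "(\<lambda>z::'a. z) \<in> borel_measurable lborel" by simp
  from borel_measurable_implies_sequence_metric[OF this, of 0]
  obtain t where t: "\<And>n. simple_function lborel (t n)" "\<And>z::'a. (\<lambda>n. t n z) \<longlonglongrightarrow> z" by auto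
  \<comment> \<open>Sample points farther than 1 from z are replaced by 0; otherwise w at the sample
    point could not be compared with w z.\<close>
  define s where "s n z = (if dist (t n z) z \<le> 1 then t n z else 0)" for n z
  have [measurable]: "t n \<in> borel_measurable borel" for n
    using borel_measurable_simple_function[OF t(1)] by simp
  have m: "s n \<in> borel_measurable borel" for n unfolding s_def by measurable
  have sf: "simple_function lborel (s n)" for n
    unfolding simple_function_def
  proof
    have "s n ` space lborel \<subseteq> insert 0 (t n ` space lborel)" by (auto simp: s_def)
    then show "finite (s n ` space lborel)" using simple_functionD(1)[OF t(1)] finite_subset by blast
    show "\<forall>x\<in>s n ` space lborel. s n -` {x} \<inter> space lborel \<in> sets lborel"
      using measurable_sets[OF m] by auto
  qed
  have lim: "(\<lambda>n. s n z) \<longlonglongrightarrow> z" for z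
  proof (rule Lim_transform_eventually[OF t(2)])
    have "eventually (\<lambda>n. dist (t n z) z < 1) sequentially" using t(2) by (simp add: tendsto_iff)
    then show "eventually (\<lambda>n. t n z = s n z) sequentially" by eventually_elim (simp add: s_def)
  qed
  have le: "w (s n z) \<le> (w_unit_bound + w 0) * w z" for n z
  proof (cases "dist (t n z) z \<le> 1")
    case True
    have "w (t n z) \<le> w z * w (t n z - z)" using w_sub[of z "t n z - z"] by simp
    also have "\<dots> \<le> w z * w_unit_bound" using True by (intro mult_left_mono w_unit_bound(2)) (auto simp: dist_norm)
    also have "\<dots> \<le> (w_unit_bound + w 0) * w z" by (simp add: algebra_simps)
    finally show ?thesis using True by (simp add: s_def)
  next
    case False
    have "w 0 * 1 \<le> w 0 * w z" using w_ge1[of z] by (intro mult_left_mono) auto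
    then show ?thesis using False w_unit_bound(1) w_nonneg[of z] by (simp add: s_def distrib_right add_increasing)
  qed
  have "0 \<le> w_unit_bound + w 0" using w_unit_bound(1) w_nonneg[of 0] by simp
  then show ?thesis using sf le lim by blast
qed

end

context tf
begin

definition M1_nn_norm :: "(real^'d \<Rightarrow> complex) \<Rightarrow> ennreal" where
  "M1_nn_norm g = (\<integral>\<^sup>+ y. ennreal (cmod (stft gauss g y)) * ennreal (w y) \<partial>lborel)"

lemma M1_iff: "M1 w g \<longleftrightarrow> sq_integrable g \<and> M1_nn_norm g < \<infinity>"
  by (simp add: M1_def M1_nn_norm_def ennreal_mult)

lemma M1_norm_eq:
  assumes "M1 w g"
  shows "ennreal (M1_norm w g) = M1_nn_norm g"
proof -
  have [measurable]: "g \<in> borel_measurable borel" using assms by (intro sq_integrable_borel M1_sq)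
  have "M1_norm w g = enn2real (\<integral>\<^sup>+ y. ennreal (cmod (stft gauss g y) * w y) \<partial>lborel)"
    unfolding M1_norm_def by (rule integral_eq_nn_integral) auto
  then show ?thesis using assms by (simp add: M1_iff M1_nn_norm_def ennreal_mult less_top)
qed

lemma stft_gauss_sum:
  assumes "\<And>i. i \<in> I \<Longrightarrow> sq_integrable (f i)"
  shows "stft gauss (\<lambda>t. \<Sum>i\<in>I. c i * f i t) y = (\<Sum>i\<in>I. c i * stft gauss (f i) y)"
  unfolding stft_def using assms
  by (subst l2_inner_sum) (auto simp: l2_inner_cmult sq_integrable_cmult sq_integrable_tf_shift sq_integrable_gauss)

lemma M1_lincomb:
  assumes "M1 w f" "M1 w g"
  shows "M1 w (\<lambda>t. a * f t + b * g t)"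
proof -
  have sq: "sq_integrable f" "sq_integrable g" using assms by (auto simp: M1_iff)
  have [measurable]: "f \<in> borel_measurable borel" "g \<in> borel_measurable borel" using sq by (auto simp: sq_integrable_borel)
  have "M1_nn_norm (\<lambda>t. a * f t + b * g t) \<le> (\<integral>\<^sup>+ y. ennreal (cmod a) * (ennreal (cmod (stft gauss f y)) * ennreal (w y)) + ennreal (cmod b) * (ennreal (cmod (stft gauss g y)) * ennreal (w y)) \<partial>lborel)"
    unfolding M1_nn_norm_def
  proof (intro nn_integral_mono)
    fix y
    have "stft gauss (\<lambda>t. a * f t + b * g t) y = a * stft gauss f y + b * stft gauss g y"
      using sq by (simp add: stft_add sq_integrable_cmult sq_integrable_gauss stft_cmult)
    then have "ennreal (cmod (stft gauss (\<lambda>t. a * f t + b * g t) y)) \<le> ennreal (cmod a * cmod (stft gauss f y) + cmod b * cmod (stft gauss g y))"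
      by (intro ennreal_leI) (metis norm_mult norm_triangle_ineq)
    from mult_right_mono[OF this, of "ennreal (w y)"]
    show "ennreal (cmod (stft gauss (\<lambda>t. a * f t + b * g t) y)) * ennreal (w y) \<le> ennreal (cmod a) * (ennreal (cmod (stft gauss f y)) * ennreal (w y)) + ennreal (cmod b) * (ennreal (cmod (stft gauss g y)) * ennreal (w y))"
      by (simp add: ennreal_mult distrib_right mult.assoc)
  qed
  also have "\<dots> = ennreal (cmod a) * M1_nn_norm f + ennreal (cmod b) * M1_nn_norm g"
    unfolding M1_nn_norm_def by (subst nn_integral_add) (auto simp: nn_integral_cmult)
  also have "\<dots> < \<infinity>" using assms by (simp add: M1_iff ennreal_mult_less_top)
  finally show ?thesis using sq by (simp add: M1_iff sq_integrable_add sq_integrable_cmult)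
qed

lemma M1_0: "M1 w (\<lambda>t. 0)"
  using M1_lincomb[OF \<phi>_M1 \<phi>_M1, of 0 0] by simp

lemma M1_sum:
  assumes "\<And>i. i \<in> I \<Longrightarrow> M1 w (f i)"
  shows "M1 w (\<lambda>t. \<Sum>i\<in>I. c i * f i t)"
  using assms
proof (induction I rule: infinite_finite_induct)
  case (insert x I)
  then show ?case using M1_lincomb[of "f x" "\<lambda>t. \<Sum>i\<in>I. c i * f i t" "c x" 1] by simp
qed (simp_all add: M1_0)

lemma M1_tf_shift: "M1 w (tf_shift z \<phi>)"
proof -
  have "M1_nn_norm (tf_shift z \<phi>) \<le> ennreal (w z) * wnorm1 amb"
    using nn_integral_translate_w[of amb z] cmod_stft_shift[of z] by (simp add: M1_nn_norm_def stft_shift_def)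
  also have "\<dots> < \<infinity>" using amb_wnorm1 by (simp add: ennreal_mult_less_top)
  finally show ?thesis by (simp add: M1_iff sq_integrable_tf_shift \<phi>_sq)
qed

context
  fixes F :: "(real^'d \<Rightarrow> complex) \<Rightarrow> complex"
  assumes F: "Minf w F"
begin

lemma Minf_lin: "M1 w f \<Longrightarrow> M1 w g \<Longrightarrow> F (\<lambda>t. a * f t + b * g t) = cnj a * F f + cnj b * F g"
  using F by (simp add: Minf_def)

lemma Minf_0: "F (\<lambda>t. 0) = 0"
  using Minf_lin[OF \<phi>_M1 \<phi>_M1, of 0 0] by simp

lemma Minf_sum:
  assumes "\<And>i. i \<in> I \<Longrightarrow> M1 w (f i)"
  shows "F (\<lambda>t. \<Sum>i\<in>I. c i * f i t) = (\<Sum>i\<in>I. cnj (c i) * F (f i))"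
  using assms
proof (induction I rule: infinite_finite_induct)
  case (insert x I)
  then show ?case using Minf_lin[of "f x" "\<lambda>t. \<Sum>i\<in>I. c i * f i t" "c x" 1] M1_sum[of I f c] by simp
qed (simp_all add: Minf_0)

lemma Minf_bounded:
  obtains C where "0 \<le> C" "\<And>g. M1 w g \<Longrightarrow> ennreal (cmod (F g)) \<le> ennreal C * M1_nn_norm g"
proof -
  obtain C where C: "\<And>g. M1 w g \<Longrightarrow> cmod (F g) \<le> C * M1_norm w g" using F by (auto simp: Minf_def)
  show ?thesis
  proof (rule that[of "\<bar>C\<bar>"])
    fix g assume g: "M1 w g"
    have nn: "0 \<le> M1_norm w g" unfolding M1_norm_def by (intro integral_nonneg_AE) auto
    then have "cmod (F g) \<le> \<bar>C\<bar> * M1_norm w g" by (intro order_trans[OF C[OF g]] mult_right_mono) auto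
    then have "ennreal (cmod (F g)) \<le> ennreal (\<bar>C\<bar> * M1_norm w g)" by (rule ennreal_leI)
    then show "ennreal (cmod (F g)) \<le> ennreal \<bar>C\<bar> * M1_nn_norm g" using nn by (simp add: ennreal_mult M1_norm_eq[OF g])
  qed simp
qed

definition G :: "(real^'d) \<times> (real^'d) \<Rightarrow> complex" where
  "G z = F (tf_shift z \<phi>)"

lemma G_le_w:
  obtains C where "0 \<le> C" "\<And>z. cmod (G z) \<le> C * w z"
proof -
  obtain C where C: "0 \<le> C" "\<And>g. M1 w g \<Longrightarrow> ennreal (cmod (F g)) \<le> ennreal C * M1_nn_norm g" using Minf_bounded by blast
  obtain D where D: "0 < D" "wnorm1 amb \<le> ennreal D" using ennreal_bound_real[OF amb_wnorm1] by blast
  show ?thesis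
  proof (rule that[of "C * D"])
    fix z
    have "M1_nn_norm (tf_shift z \<phi>) \<le> ennreal (w z) * wnorm1 amb"
      using nn_integral_translate_w[of amb z] cmod_stft_shift[of z] by (simp add: M1_nn_norm_def stft_shift_def)
    also have "\<dots> \<le> ennreal (w z) * ennreal D" by (intro mult_left_mono D) simp
    finally have "ennreal C * M1_nn_norm (tf_shift z \<phi>) \<le> ennreal C * (ennreal (w z) * ennreal D)" by (rule mult_left_mono) simp
    with C(2)[OF M1_tf_shift] have "ennreal (cmod (G z)) \<le> ennreal C * (ennreal (w z) * ennreal D)"
      unfolding G_def by (rule order_trans)
    then have "ennreal (cmod (G z)) \<le> ennreal (C * D * w z)"
      using C(1) D(1) by (simp add: ennreal_mult[symmetric] mult_ac)
    then show "cmod (G z) \<le> C * D * w z" using C(1) D(1) by (simp add: ennreal_le_iff)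
  qed (use C D in simp)
qed

lemma G_dist_le:
  assumes "\<And>g. M1 w g \<Longrightarrow> ennreal (cmod (F g)) \<le> ennreal C * M1_nn_norm g"
  shows "ennreal (cmod (G z - G z')) \<le> ennreal C * wdist1 z z'"
proof -
  let ?d = "\<lambda>t. 1 * tf_shift z \<phi> t + (- 1) * tf_shift z' \<phi> t"
  have "G z - G z' = F ?d" using Minf_lin[OF M1_tf_shift M1_tf_shift, of 1 z "- 1" z'] by (simp add: G_def)
  then have "ennreal (cmod (G z - G z')) \<le> ennreal C * M1_nn_norm ?d"
    using assms[OF M1_lincomb[OF M1_tf_shift M1_tf_shift, of 1 z "- 1" z']] by simp
  also have "M1_nn_norm ?d = wdist1 z z'"
    unfolding M1_nn_norm_def wdist1_def stft_shift_def
    by (simp add: stft_diff sq_integrable_tf_shift \<phi>_sq sq_integrable_gauss)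
  finally show ?thesis .
qed

lemma G_tendsto:
  assumes "z \<longlonglongrightarrow> z0"
  shows "(\<lambda>n. G (z n)) \<longlonglongrightarrow> G z0"
proof -
  obtain C where C: "0 \<le> C" "\<And>g. M1 w g \<Longrightarrow> ennreal (cmod (F g)) \<le> ennreal C * M1_nn_norm g" using Minf_bounded by blast
  have lim: "(\<lambda>n. ennreal C * wdist1 z0 (z n)) \<longlonglongrightarrow> 0"
    using ennreal_tendsto_cmult[OF _ wdist1_tendsto_0[OF assms], of "ennreal C"] by simp
  have "(\<lambda>n. ennreal (cmod (G z0 - G (z n)))) \<longlonglongrightarrow> 0"
    by (rule tendsto_sandwich[OF always_eventually always_eventually tendsto_const lim]) (simp_all add: G_dist_le[OF C(2)])
  then have "(\<lambda>n. cmod (G z0 - G (z n))) \<longlonglongrightarrow> 0"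
    using tendsto_ennreal_iff[of "\<lambda>n. cmod (G z0 - G (z n))" sequentially 0] by simp
  then have "(\<lambda>n. G (z n) - G z0) \<longlonglongrightarrow> 0"
    by (subst tendsto_norm_zero_iff[symmetric]) (simp add: norm_minus_commute)
  then show ?thesis by (simp add: LIM_zero_iff)
qed

text \<open>By \<open>G_tendsto\<close> the function is sequentially continuous, hence a pointwise
  limit of its simple samples.\<close>

lemma G_borel [measurable]: "G \<in> borel_measurable borel"
proof -
  obtain s where s: "\<And>n. simple_function lborel (s n)" "\<And>z::(real^'d) \<times> (real^'d). (\<lambda>n. s n z) \<longlonglongrightarrow> z"
    using simple_identity_approx by blast
  have "(\<lambda>z. G (s n z)) \<in> borel_measurable lborel" for n
    by (intro borel_measurable_simple_function simple_function_compose1[OF s(1)])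
  then have "G \<in> borel_measurable lborel" by (rule borel_measurable_LIMSEQ_metric) (rule G_tendsto[OF s(2)])
  then show ?thesis by simp
qed

text \<open>F commutes with the integral g = \<integral> H(z) pi(z) \<phi> dz, although this
  representation is assumed only weakly in L^2. Riemann sums \<open>gn\<close> are linear
  combinations of shifts, where conjugate linearity suffices; they converge to g in M^1_w, and their
  images under F converge to the right-hand integral.\<close>

theorem Minf_integral:
  fixes H :: "(real^'d) \<times> (real^'d) \<Rightarrow> complex"
  assumes g: "sq_integrable g" and H [measurable]: "H \<in> borel_measurable borel"
    and Hw: "(\<integral>\<^sup>+ z. ennreal (cmod (H z)) * ennreal (w z) \<partial>lborel) < \<infinity>"
    and rep: "\<And>h. sq_integrable h \<Longrightarrow> l2_inner g h = (\<integral>z. H z * cnj (stft \<phi> h z) \<partial>lborel)"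
  shows "F g = (\<integral>z. cnj (H z) * G z \<partial>lborel)"
proof -
  have [measurable]: "g \<in> borel_measurable borel" using g by (rule sq_integrable_borel)
  have "(\<integral>\<^sup>+ z. ennreal (norm (H z)) \<partial>lborel) < \<infinity>"
    using nn_integral_le_wnorm1[of "\<lambda>z. ennreal (cmod (H z))"] Hw unfolding wnorm1_def by (rule order.strict_trans1)
  then have Hint: "integrable lborel H" by (simp add: integrable_iff_bounded)
  define L where "L = sqrt (l2sq \<phi>) * sqrt (l2sq (gauss :: real^'d \<Rightarrow> complex))"
  have stft_shift_le: "cmod (stft_shift z y) \<le> L" for z y
    using cmod_stft_le[OF sq_integrable_tf_shift[OF \<phi>_sq] sq_integrable_gauss, of z y] l2sq_tf_shift[OF \<phi>_sq, of z]
    by (simp add: stft_shift_def L_def)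
  have intg: "integrable lborel (\<lambda>z. H z * stft_shift (a z) y)" if [measurable]: "a \<in> borel_measurable borel" for a y
  proof (rule Bochner_Integration.integrable_bound)
    show "integrable lborel (\<lambda>z. L *\<^sub>R H z)" using Hint by simp
    show "AE z in lborel. norm (H z * stft_shift (a z) y) \<le> norm (L *\<^sub>R H z)"
    proof (rule AE_I2)
      fix z
      have "0 \<le> L" by (simp add: L_def)
      then show "norm (H z * stft_shift (a z) y) \<le> norm (L *\<^sub>R H z)"
        using stft_shift_le[of "a z" y] by (simp add: norm_mult mult.commute[of L] mult_left_mono)
    qed
  qed measurable
  have Vg: "stft gauss g y = (\<integral>z. H z * stft_shift z y \<partial>lborel)" for y
  proof -
    have "cnj (stft \<phi> (tf_shift y gauss) z) = stft_shift z y" for z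
      unfolding stft_def stft_shift_def by (rule l2_inner_commute[symmetric])
    then show ?thesis
      unfolding stft_def[of gauss g] using rep[OF sq_integrable_tf_shift[OF sq_integrable_gauss], of y] by simp
  qed
  obtain s Wc where Wc: "0 \<le> Wc" and s: "\<And>n. simple_function lborel (s n)" "\<And>n z. w (s n z) \<le> Wc * w z" "\<And>z. (\<lambda>n. s n z) \<longlonglongrightarrow> z"
    using simple_identity_approx by blast
  have sm [measurable]: "s n \<in> borel_measurable borel" for n
    using borel_measurable_simple_function[OF s(1)] by simp
  have fin: "finite (range (s n))" for n using simple_functionD(1)[OF s(1)[of n]] by simp
  have sset: "{z \<in> space lborel. s n z = \<zeta>} \<in> sets lborel" for n \<zeta> by simp
  obtain C where C: "0 \<le> C" "\<And>g. M1 w g \<Longrightarrow> ennreal (cmod (F g)) \<le> ennreal C * M1_nn_norm g" using Minf_bounded by blast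
  \<comment> \<open>Bounds the M^1_w distance of g from the n-th Riemann sum and, up to the norm of
    F, also the error of the scalar integral. One null sequence therefore settles both
    limits.\<close>
  define D where "D n = (\<integral>\<^sup>+ z. ennreal (cmod (H z)) * wdist1 z (s n z) \<partial>lborel)" for n
  have dist_m [measurable]: "(\<lambda>z. wdist1 z (s n z)) \<in> borel_measurable borel" for n
    unfolding wdist1_def by measurable
  have D0: "D \<longlonglongrightarrow> 0"
  proof -
    have "D \<longlonglongrightarrow> (\<integral>\<^sup>+ z. 0 \<partial>(lborel :: ((real^'d) \<times> (real^'d)) measure))"
      unfolding D_def
    proof (rule nn_integral_dominated_convergence[where w = "\<lambda>z. (ennreal (1 + Wc) * wnorm1 amb) * (ennreal (cmod (H z)) * ennreal (w z))"])
      show "AE z in lborel. ennreal (cmod (H z)) * wdist1 z (s n z) \<le> (ennreal (1 + Wc) * wnorm1 amb) * (ennreal (cmod (H z)) * ennreal (w z))" for n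
      proof (rule AE_I2)
        fix z
        have "w z + w (s n z) \<le> (1 + Wc) * w z" using s(2)[of n z] by (simp add: distrib_right)
        from ennreal_leI[OF this] have "ennreal (w z) + ennreal (w (s n z)) \<le> ennreal ((1 + Wc) * w z)" by simp
        then have "wdist1 z (s n z) \<le> ennreal ((1 + Wc) * w z) * wnorm1 amb"
          by (intro order_trans[OF wdist1_le] mult_right_mono) auto
        from mult_left_mono[OF this, of "ennreal (cmod (H z))"]
        show "ennreal (cmod (H z)) * wdist1 z (s n z) \<le> (ennreal (1 + Wc) * wnorm1 amb) * (ennreal (cmod (H z)) * ennreal (w z))"
          using Wc by (simp add: ennreal_mult mult_ac del: ennreal_plus)
      qed
      show "AE z in lborel. (\<lambda>n. ennreal (cmod (H z)) * wdist1 z (s n z)) \<longlonglongrightarrow> 0"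
      proof (rule AE_I2)
        fix z
        have "(\<lambda>n. ennreal (cmod (H z)) * wdist1 z (s n z)) \<longlonglongrightarrow> ennreal (cmod (H z)) * 0"
          by (intro ennreal_tendsto_cmult wdist1_tendsto_0 s(3)) simp
        then show "(\<lambda>n. ennreal (cmod (H z)) * wdist1 z (s n z)) \<longlonglongrightarrow> 0" by simp
      qed
      have "(\<integral>\<^sup>+ z. (ennreal (1 + Wc) * wnorm1 amb) * (ennreal (cmod (H z)) * ennreal (w z)) \<partial>lborel)
        = (ennreal (1 + Wc) * wnorm1 amb) * (\<integral>\<^sup>+ z. ennreal (cmod (H z)) * ennreal (w z) \<partial>lborel)"
        by (rule nn_integral_cmult) measurable
      also have "\<dots> < \<infinity>" using amb_wnorm1 Hw by (simp add: ennreal_mult_less_top)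
      finally show "(\<integral>\<^sup>+ z. (ennreal (1 + Wc) * wnorm1 amb) * (ennreal (cmod (H z)) * ennreal (w z)) \<partial>lborel) < \<infinity>" .
    qed measurable
    then show ?thesis by simp
  qed
  \<comment> \<open>Boundedness and linearity of F are available only on M^1_w, so g has to be shown
    to belong to it first.\<close>
  have Mg: "M1 w g"
  proof -
    have "M1_nn_norm g \<le> (\<integral>\<^sup>+ y. (\<integral>\<^sup>+ z. ennreal (cmod (H z)) * amb (y - z) * ennreal (w y) \<partial>lborel) \<partial>lborel)"
      unfolding M1_nn_norm_def
    proof (rule nn_integral_mono)
      fix y
      have "ennreal (cmod (stft gauss g y)) \<le> (\<integral>\<^sup>+ z. ennreal (cmod (H z * stft_shift z y)) \<partial>lborel)"
        unfolding Vg by (rule integral_norm_bound_ennreal) (rule intg, simp)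
      also have "\<dots> = (\<integral>\<^sup>+ z. ennreal (cmod (H z)) * amb (y - z) \<partial>lborel)"
        by (simp add: norm_mult ennreal_mult cmod_stft_shift)
      finally show "ennreal (cmod (stft gauss g y)) * ennreal (w y) \<le> (\<integral>\<^sup>+ z. ennreal (cmod (H z)) * amb (y - z) * ennreal (w y) \<partial>lborel)"
        by (simp add: nn_integral_multc mult_right_mono)
    qed
    also have "\<dots> = (\<integral>\<^sup>+ z. (\<integral>\<^sup>+ y. ennreal (cmod (H z)) * amb (y - z) * ennreal (w y) \<partial>lborel) \<partial>lborel)"
      by (rule lborel_pair.Fubini') simp
    also have "\<dots> \<le> (\<integral>\<^sup>+ z. wnorm1 amb * (ennreal (cmod (H z)) * ennreal (w z)) \<partial>lborel)"
    proof (rule nn_integral_mono)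
      fix z
      have "(\<integral>\<^sup>+ y. ennreal (cmod (H z)) * amb (y - z) * ennreal (w y) \<partial>lborel) = ennreal (cmod (H z)) * (\<integral>\<^sup>+ y. amb (y - z) * ennreal (w y) \<partial>lborel)"
        unfolding mult.assoc by (rule nn_integral_cmult) measurable
      also have "\<dots> \<le> ennreal (cmod (H z)) * (ennreal (w z) * wnorm1 amb)"
        by (intro mult_left_mono nn_integral_translate_w) auto
      finally show "(\<integral>\<^sup>+ y. ennreal (cmod (H z)) * amb (y - z) * ennreal (w y) \<partial>lborel) \<le> wnorm1 amb * (ennreal (cmod (H z)) * ennreal (w z))"
        by (simp add: mult_ac)
    qed
    also have "\<dots> = wnorm1 amb * (\<integral>\<^sup>+ z. ennreal (cmod (H z)) * ennreal (w z) \<partial>lborel)"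
      by (rule nn_integral_cmult) measurable
    also have "\<dots> < \<infinity>" using amb_wnorm1 Hw by (simp add: ennreal_mult_less_top)
    finally show ?thesis using g by (simp add: M1_iff)
  qed
  define c where "c n \<zeta> = (\<integral>z. H z * indicator {z. s n z = \<zeta>} z \<partial>lborel)" for n \<zeta>
  define gn where "gn n t = (\<Sum>\<zeta>\<in>range (s n). c n \<zeta> * tf_shift \<zeta> \<phi> t)" for n t
  have Mgn: "M1 w (gn n)" for n unfolding gn_def by (intro M1_sum M1_tf_shift)
  have Vgn: "stft gauss (gn n) y = (\<integral>z. H z * stft_shift (s n z) y \<partial>lborel)" for n y
    unfolding gn_def using integral_simple_compose(2)[OF Hint fin[of n] sset[of n], of "\<lambda>z. stft_shift z y"]
    by (subst stft_gauss_sum) (simp_all add: sq_integrable_tf_shift \<phi>_sq stft_shift_def c_def)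
  have cH: "integrable lborel (\<lambda>z. cnj (H z))" using Hint by simp
  have Fgn: "F (gn n) = (\<integral>z. cnj (H z) * G (s n z) \<partial>lborel)" for n
  proof -
    have "F (gn n) = (\<Sum>\<zeta>\<in>range (s n). cnj (c n \<zeta>) * G \<zeta>)"
      unfolding gn_def G_def by (rule Minf_sum[OF M1_tf_shift])
    also have "\<dots> = (\<Sum>\<zeta>\<in>range (s n). (\<integral>z. cnj (H z) * indicator {z. s n z = \<zeta>} z \<partial>lborel) * G \<zeta>)"
    proof (rule sum.cong[OF refl])
      fix \<zeta>
      have "cnj (c n \<zeta>) = (\<integral>z. cnj (H z * indicator {z. s n z = \<zeta>} z) \<partial>lborel)"
        unfolding c_def by (rule Bochner_Integration.integral_cnj[symmetric])
      also have "\<dots> = (\<integral>z. cnj (H z) * indicator {z. s n z = \<zeta>} z \<partial>lborel)"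
        by (rule Bochner_Integration.integral_cong) (auto simp: indicator_def)
      finally show "cnj (c n \<zeta>) * G \<zeta> = (\<integral>z. cnj (H z) * indicator {z. s n z = \<zeta>} z \<partial>lborel) * G \<zeta>" by simp
    qed
    also have "\<dots> = (\<integral>z. cnj (H z) * G (s n z) \<partial>lborel)"
      by (rule integral_simple_compose(2)[OF cH fin sset, symmetric])
    finally show ?thesis .
  qed
  have cD: "(\<lambda>n. ennreal C * D n) \<longlonglongrightarrow> 0"
    using ennreal_tendsto_cmult[OF _ D0, of "ennreal C"] by simp
  have conv: "x \<longlonglongrightarrow> l" if "\<And>n. ennreal (cmod (l - x n)) \<le> ennreal C * D n" for x :: "nat \<Rightarrow> complex" and l
  proof -
    have "(\<lambda>n. ennreal (cmod (l - x n))) \<longlonglongrightarrow> 0"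
      by (rule tendsto_sandwich[OF always_eventually always_eventually tendsto_const cD]) (simp_all add: that)
    then have "(\<lambda>n. cmod (l - x n)) \<longlonglongrightarrow> 0"
      using tendsto_ennreal_iff[of "\<lambda>n. cmod (l - x n)" sequentially 0] by simp
    then have "(\<lambda>n. x n - l) \<longlonglongrightarrow> 0" by (subst tendsto_norm_zero_iff[symmetric]) (simp add: norm_minus_commute)
    then show ?thesis by (simp add: LIM_zero_iff)
  qed
  have "(\<lambda>n. F (gn n)) \<longlonglongrightarrow> F g"
  proof (rule conv)
    fix n
    let ?d = "\<lambda>t. 1 * g t + (- 1) * gn n t"
    have "F g - F (gn n) = F ?d" using Minf_lin[OF Mg Mgn, of 1 "- 1" n] by simp
    then have "ennreal (cmod (F g - F (gn n))) \<le> ennreal C * M1_nn_norm ?d"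
      using C(2)[OF M1_lincomb[OF Mg Mgn, of 1 "- 1" n]] by simp
    also have "M1_nn_norm ?d \<le> D n"
    proof -
      have "M1_nn_norm ?d \<le> (\<integral>\<^sup>+ y. (\<integral>\<^sup>+ z. ennreal (cmod (H z)) * (ennreal (cmod (stft_shift z y - stft_shift (s n z) y)) * ennreal (w y)) \<partial>lborel) \<partial>lborel)"
        unfolding M1_nn_norm_def
      proof (rule nn_integral_mono)
        fix y
        have "stft gauss ?d y = stft gauss g y - stft gauss (gn n) y"
          using stft_diff[OF g M1_sq[OF Mgn] sq_integrable_gauss, of n y] by simp
        also have "\<dots> = (\<integral>z. H z * stft_shift z y - H z * stft_shift (s n z) y \<partial>lborel)"
          unfolding Vg Vgn by (intro Bochner_Integration.integral_diff[symmetric] intg) auto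
        also have "\<dots> = (\<integral>z. H z * (stft_shift z y - stft_shift (s n z) y) \<partial>lborel)" by (simp add: right_diff_distrib)
        finally have "ennreal (cmod (stft gauss ?d y)) \<le> (\<integral>\<^sup>+ z. ennreal (cmod (H z * (stft_shift z y - stft_shift (s n z) y))) \<partial>lborel)"
          using intg[of "\<lambda>z. z" y] intg[of "s n" y]
          by (simp only:) (intro integral_norm_bound_ennreal, simp add: right_diff_distrib)
        also have "\<dots> = (\<integral>\<^sup>+ z. ennreal (cmod (H z)) * ennreal (cmod (stft_shift z y - stft_shift (s n z) y)) \<partial>lborel)"
          by (simp add: norm_mult ennreal_mult)
        finally have "ennreal (cmod (stft gauss ?d y)) * ennreal (w y) \<le> (\<integral>\<^sup>+ z. ennreal (cmod (H z)) * ennreal (cmod (stft_shift z y - stft_shift (s n z) y)) \<partial>lborel) * ennreal (w y)"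
          by (rule mult_right_mono) simp
        then show "ennreal (cmod (stft gauss ?d y)) * ennreal (w y) \<le> (\<integral>\<^sup>+ z. ennreal (cmod (H z)) * (ennreal (cmod (stft_shift z y - stft_shift (s n z) y)) * ennreal (w y)) \<partial>lborel)"
          by (simp add: nn_integral_multc[symmetric] mult.assoc)
      qed
      also have "\<dots> = (\<integral>\<^sup>+ z. (\<integral>\<^sup>+ y. ennreal (cmod (H z)) * (ennreal (cmod (stft_shift z y - stft_shift (s n z) y)) * ennreal (w y)) \<partial>lborel) \<partial>lborel)"
        by (rule lborel_pair.Fubini') simp
      also have "\<dots> = D n" unfolding D_def wdist1_def by (simp add: nn_integral_cmult)
      finally show ?thesis .
    qed
    finally show "ennreal (cmod (F g - F (gn n))) \<le> ennreal C * D n" by (simp add: mult_left_mono)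
  qed
  moreover have "(\<lambda>n. F (gn n)) \<longlonglongrightarrow> (\<integral>z. cnj (H z) * G z \<partial>lborel)"
  proof (rule conv)
    fix n
    obtain B where B: "0 \<le> B" "\<And>z. cmod (G z) \<le> B * w z" using G_le_w by blast
    have i1: "integrable lborel (\<lambda>z. cnj (H z) * G z)"
    proof (rule Bochner_Integration.integrable_bound)
      show "integrable lborel (\<lambda>z. B * (cmod (H z) * w z))"
        using Hw by (intro integrable_mult_right) (simp add: integrable_iff_bounded ennreal_mult abs_mult)
      show "AE z in lborel. norm (cnj (H z) * G z) \<le> norm (B * (cmod (H z) * w z))"
      proof (rule AE_I2)
        fix z show "norm (cnj (H z) * G z) \<le> norm (B * (cmod (H z) * w z))"
          using mult_left_mono[OF B(2)[of z], of "cmod (H z)"] B(1) by (simp add: norm_mult abs_mult mult_ac)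
      qed
    qed measurable
    have i2: "integrable lborel (\<lambda>z. cnj (H z) * G (s n z))" by (rule integral_simple_compose(1)[OF cH fin sset])
    have "(\<integral>z. cnj (H z) * G z \<partial>lborel) - F (gn n) = (\<integral>z. cnj (H z) * (G z - G (s n z)) \<partial>lborel)"
      unfolding Fgn using i1 i2 by (simp add: right_diff_distrib)
    then have "ennreal (cmod ((\<integral>z. cnj (H z) * G z \<partial>lborel) - F (gn n))) \<le> (\<integral>\<^sup>+ z. ennreal (cmod (cnj (H z) * (G z - G (s n z)))) \<partial>lborel)"
      using i1 i2 by (simp only:) (intro integral_norm_bound_ennreal, simp add: right_diff_distrib)
    also have "\<dots> \<le> (\<integral>\<^sup>+ z. ennreal C * (ennreal (cmod (H z)) * wdist1 z (s n z)) \<partial>lborel)"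
    proof (rule nn_integral_mono)
      fix z
      show "ennreal (cmod (cnj (H z) * (G z - G (s n z)))) \<le> ennreal C * (ennreal (cmod (H z)) * wdist1 z (s n z))"
        using mult_left_mono[OF G_dist_le[OF C(2), of z "s n z"], of "ennreal (cmod (H z))"]
        by (simp add: norm_mult ennreal_mult mult_ac)
    qed
    also have "\<dots> = ennreal C * D n" unfolding D_def by (rule nn_integral_cmult) measurable
    finally show "ennreal (cmod ((\<integral>z. cnj (H z) * G z \<partial>lborel) - F (gn n))) \<le> ennreal C * D n" .
  qed
  ultimately show ?thesis by (rule LIMSEQ_unique)
qed

end

end

section \<open>Diagonalized localization operators\<close>

lemma sums_indicator: "(\<lambda>j. if j = k then (c :: complex) else 0) sums c"
  using sums_If_finite[of "\<lambda>j. j = k" "\<lambda>_. c"] by simp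

context
  fixes \<phi> :: "real^'d \<Rightarrow> complex" and m :: "(real^'d) \<times> (real^'d) \<Rightarrow> real"
    and lam :: "nat \<Rightarrow> real" and phis :: "nat \<Rightarrow> real^'d \<Rightarrow> complex"
  assumes diag: "diagonalizes \<phi> m lam phis" and \<phi>: "sq_integrable \<phi>" "l2sq \<phi> = 1"
    and m: "integrable lborel m" "\<And>z. 0 \<le> m z"
begin

lemma phis_sq: "sq_integrable (phis k)" and phis_orth: "l2_inner (phis j) (phis k) = (if j = k then 1 else 0)"
  and lam_nonneg: "0 \<le> lam k" and lam_Suc: "lam (Suc k) \<le> lam k"
  and diag_sums: "sq_integrable f \<Longrightarrow> sq_integrable g \<Longrightarrow>
      (\<lambda>k. complex_of_real (lam k) * l2_inner f (phis k) * l2_inner (phis k) g) sums loc_form \<phi> m f g"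
  using diag by (auto simp: diagonalizes_def)

lemma lam_mono: "j \<le> k \<Longrightarrow> lam k \<le> lam j"
  by (rule lift_Suc_antimono_le[of lam]) (auto simp: lam_Suc)

lemma l2sq_phis: "l2sq (phis k) = 1"
  using phis_orth[of k k] by (simp add: l2_inner_self)

lemma loc_form_phis:
  assumes "sq_integrable g"
  shows "loc_form \<phi> m (phis k) g = complex_of_real (lam k) * l2_inner (phis k) g"
proof -
  have "(\<lambda>j. if j = k then complex_of_real (lam k) * l2_inner (phis k) g else 0) sums loc_form \<phi> m (phis k) g"
    using diag_sums[OF phis_sq assms, of k] by (rule sums_cong[THEN iffD1, rotated]) (auto simp: phis_orth)
  then show ?thesis using sums_indicator sums_unique2 by blast
qed

lemma integrable_symbol_stft:
  assumes "sq_integrable f"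
  shows "integrable lborel (\<lambda>z. m z * (cmod (stft \<phi> f z))\<^sup>2)"
proof (rule Bochner_Integration.integrable_bound)
  have [measurable]: "f \<in> borel_measurable borel" "\<phi> \<in> borel_measurable borel" "m \<in> borel_measurable borel"
    using assms \<phi> m borel_measurable_integrable by (auto simp: sq_integrable_borel)
  show "integrable lborel (\<lambda>z. m z * l2sq f)" using m by simp
  show "AE z in lborel. norm (m z * (cmod (stft \<phi> f z))\<^sup>2) \<le> norm (m z * l2sq f)"
  proof (rule AE_I2)
    fix z
    have "(cmod (stft \<phi> f z))\<^sup>2 \<le> (sqrt (l2sq f))\<^sup>2"
      using cmod_stft_le[OF assms \<phi>(1), of z] \<phi>(2) by (intro power_mono) auto
    then show "norm (m z * (cmod (stft \<phi> f z))\<^sup>2) \<le> norm (m z * l2sq f)"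
      using m(2)[of z] by (simp add: mult_left_mono)
  qed
  show "(\<lambda>z. m z * (cmod (stft \<phi> f z))\<^sup>2) \<in> borel_measurable lborel" by measurable
qed

lemma loc_form_self:
  assumes "sq_integrable f"
  shows "loc_form \<phi> m f f = complex_of_real (\<integral>z. m z * (cmod (stft \<phi> f z))\<^sup>2 \<partial>lborel)"
proof -
  have "loc_form \<phi> m f f = (\<integral>z. complex_of_real (m z * (cmod (stft \<phi> f z))\<^sup>2) \<partial>lborel)"
    unfolding loc_form_def by (rule Bochner_Integration.integral_cong) (simp_all only: of_real_mult complex_norm_square mult.assoc)
  then show ?thesis by (simp only: integral_complex_of_real)
qed

lemma lam_eq: "lam k = (\<integral>z. m z * (cmod (stft \<phi> (phis k) z))\<^sup>2 \<partial>lborel)"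
proof -
  have "complex_of_real (lam k) = complex_of_real (\<integral>z. m z * (cmod (stft \<phi> (phis k) z))\<^sup>2 \<partial>lborel)"
    using loc_form_phis[OF phis_sq, of k k] loc_form_self[OF phis_sq, of k] by (simp add: phis_orth)
  then show ?thesis by (simp only: of_real_eq_iff)
qed

text \<open>A partial trace is at most the L^1 norm of the symbol: \<open>lam k\<close> is the
  integral of m |V_phi phi_k|^2, and at each z Bessel's inequality for pi(z) \<phi> bounds the sum
  of these squares by 1.\<close>

lemma sum_lam_le: "(\<Sum>k<n. lam k) \<le> (\<integral>z. m z \<partial>lborel)"
proof -
  have "(\<Sum>k<n. lam k) = (\<integral>z. (\<Sum>k<n. m z * (cmod (stft \<phi> (phis k) z))\<^sup>2) \<partial>lborel)"
    by (subst lam_eq, subst Bochner_Integration.integral_sum) (auto intro: integrable_symbol_stft phis_sq)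
  also have "\<dots> \<le> (\<integral>z. m z \<partial>lborel)"
  proof (rule integral_mono)
    show "integrable lborel (\<lambda>z. \<Sum>k<n. m z * (cmod (stft \<phi> (phis k) z))\<^sup>2)"
      by (intro Bochner_Integration.integrable_sum integrable_symbol_stft phis_sq)
    fix z
    have "(\<Sum>k<n. (cmod (stft \<phi> (phis k) z))\<^sup>2) = (\<Sum>k<n. (cmod (l2_inner (tf_shift z \<phi>) (phis k)))\<^sup>2)"
      unfolding stft_def by (subst l2_inner_commute) simp
    also have "\<dots> \<le> l2sq (tf_shift z \<phi>)"
      by (rule Bessel[OF phis_sq phis_orth sq_integrable_tf_shift[OF \<phi>(1)]])
    finally have "(\<Sum>k<n. (cmod (stft \<phi> (phis k) z))\<^sup>2) \<le> 1" using \<phi> by (simp add: l2sq_tf_shift)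
    from mult_left_mono[OF this m(2)[of z]] show "(\<Sum>k<n. m z * (cmod (stft \<phi> (phis k) z))\<^sup>2) \<le> m z"
      by (simp add: sum_distrib_left)
  qed (rule m)
  finally show ?thesis .
qed

text \<open>Indices start at 0, so \<open>lam n\<close> is the first eigenvalue left out by n
  eigenfunctions, and n + 1 terms of the partial trace are at least as large. The surplus term also
  covers n = 0.\<close>

lemma lam_le:
  assumes "\<alpha> * (\<integral>z. m z \<partial>lborel) \<le> real n" "0 < \<alpha>"
  shows "lam n \<le> 1 / \<alpha>"
proof -
  have "real (Suc n) * lam n \<le> (\<Sum>k<Suc n. lam k)"
    using sum_mono[of "{..<Suc n}" "\<lambda>_. lam n" lam] lam_mono[of _ n] by (simp add: less_Suc_eq_le)
  also have "\<dots> \<le> (\<integral>z. m z \<partial>lborel)" by (rule sum_lam_le)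
  finally have "\<alpha> * (real (Suc n) * lam n) \<le> real n"
    using assms by (meson mult_left_mono less_imp_le order_trans)
  then have le: "real (Suc n) * (\<alpha> * lam n) \<le> real n" by (simp only: mult_ac)
  have "\<alpha> * lam n \<le> 1"
  proof (rule ccontr)
    assume "\<not> \<alpha> * lam n \<le> 1"
    then have "real (Suc n) * 1 < real (Suc n) * (\<alpha> * lam n)" by (intro mult_strict_left_mono) auto
    from less_le_trans[OF this le] show False by simp
  qed
  then show ?thesis using assms(2) by (simp add: field_simps)
qed

text \<open>The integral is the quadratic form of the localization operator at the residual. Its
  coefficients below n vanish, the others meet eigenvalues at most \<open>lam n\<close>, and
  Bessel's inequality does the rest.\<close>

lemma symbol_stft_proj_residual_le:
  assumes h: "sq_integrable h"
  shows "(\<integral>z. m z * (cmod (stft \<phi> (proj_residual phis n h) z))\<^sup>2 \<partial>lborel) \<le> lam n * l2sq h"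
proof -
  let ?r = "proj_residual phis n h"
  have r: "sq_integrable ?r" by (rule sq_integrable_proj_residual[OF phis_sq phis_orth h])
  let ?I = "\<integral>z. m z * (cmod (stft \<phi> ?r z))\<^sup>2 \<partial>lborel"
  have "(\<lambda>k. complex_of_real (lam k * (cmod (l2_inner ?r (phis k)))\<^sup>2)) sums complex_of_real ?I"
    using diag_sums[OF r r] unfolding loc_form_self[OF r]
    by (rule sums_cong[THEN iffD1, rotated]) (simp add: l2_inner_commute[of "phis _" ?r] complex_norm_square mult.assoc del: of_real_power)
  then have s: "(\<lambda>k. lam k * (cmod (l2_inner ?r (phis k)))\<^sup>2) sums ?I" by (simp only: sums_of_real_iff)
  have "(\<Sum>k<N. lam k * (cmod (l2_inner ?r (phis k)))\<^sup>2) \<le> lam n * l2sq h" for N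
  proof -
    have "(\<Sum>k<N. lam k * (cmod (l2_inner ?r (phis k)))\<^sup>2) \<le> (\<Sum>k<N. lam n * (cmod (l2_inner ?r (phis k)))\<^sup>2)"
    proof (rule sum_mono)
      fix k
      show "lam k * (cmod (l2_inner ?r (phis k)))\<^sup>2 \<le> lam n * (cmod (l2_inner ?r (phis k)))\<^sup>2"
        using lam_mono[of n k] l2_inner_proj_residual[OF phis_sq phis_orth h, of n k] by (cases "k < n") (auto intro: mult_right_mono)
    qed
    also have "\<dots> = lam n * (\<Sum>k<N. (cmod (l2_inner ?r (phis k)))\<^sup>2)" by (simp add: sum_distrib_left)
    also have "\<dots> \<le> lam n * l2sq h"
      by (intro mult_left_mono lam_nonneg order_trans[OF Bessel[OF phis_sq phis_orth r] l2sq_proj_residual_le[OF phis_sq phis_orth h]])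
    finally show ?thesis .
  qed
  then show ?thesis using LIMSEQ_le_const2[OF s[unfolded sums_def]] by blast
qed

end

section \<open>Synthesis of vectors and the reproducing formula\<close>

context tf
begin

text \<open>The adjoint of V_phi applied to H.\<close>

definition synth :: "((real^'d) \<times> (real^'d) \<Rightarrow> complex) \<Rightarrow> real^'d \<Rightarrow> complex" where
  "synth H t = (\<integral>z. H z * tf_shift z \<phi> t \<partial>lborel)"

lemma l2_inner_tf_shift_left: "l2_inner (tf_shift z \<phi>) h = cnj (stft \<phi> h z)"
  unfolding stft_def by (rule l2_inner_commute)

lemma synth_props:
  assumes H: "integrable lborel H"
  shows "sq_integrable (synth H)"
    and "\<And>h. sq_integrable h \<Longrightarrow> l2_inner (synth H) h = (\<integral>z. H z * cnj (stft \<phi> h z) \<partial>lborel)"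
proof -
  have [measurable]: "H \<in> borel_measurable borel" using borel_measurable_integrable[OF H] by simp
  have sm [measurable]: "synth H \<in> borel_measurable borel"
    unfolding synth_def[abs_def] by (rule lborel.borel_measurable_lebesgue_integral) measurable
  let ?N = "\<integral>\<^sup>+ z. ennreal (cmod (H z)) \<partial>lborel"
  have N: "?N < \<infinity>" using H by (rule nn_integral_norm_finite)
  have pt: "(ennreal (cmod (synth H t)))\<^sup>2 \<le> ?N * (\<integral>\<^sup>+ z. ennreal (cmod (H z)) * (ennreal (cmod (tf_shift z \<phi> t)))\<^sup>2 \<partial>lborel)" for t
  proof -
    \<comment> \<open>Splitting |H| into two square roots and applying Cauchy-Schwarz bounds the
      squared synthesis by an integral linear in the squared shift of \<phi>.\<close>
    let ?s = "\<lambda>z. ennreal (sqrt (cmod (H z)))"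
    have s2: "(?s z)\<^sup>2 = ennreal (cmod (H z))" for z by (simp add: ennreal_power)
    have "ennreal (cmod (synth H t)) \<le> (\<integral>\<^sup>+ z. ennreal (cmod (H z * tf_shift z \<phi> t)) \<partial>lborel)"
    proof (cases "integrable lborel (\<lambda>z. H z * tf_shift z \<phi> t)")
      case True then show ?thesis unfolding synth_def by (rule integral_norm_bound_ennreal)
    next
      \<comment> \<open>Where the integral does not converge absolutely, \<open>synth H t\<close>
        has the default value 0.\<close>
      case False then show ?thesis by (simp add: synth_def not_integrable_integral_eq)
    qed
    also have "\<dots> = (\<integral>\<^sup>+ z. ?s z * (?s z * ennreal (cmod (tf_shift z \<phi> t))) \<partial>lborel)"
      using s2 by (simp add: norm_mult ennreal_mult mult.assoc[symmetric] power2_eq_square)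
    finally have "(ennreal (cmod (synth H t)))\<^sup>2 \<le> (\<integral>\<^sup>+ z. ?s z * (?s z * ennreal (cmod (tf_shift z \<phi> t))) \<partial>lborel)\<^sup>2"
      by (rule power_mono) simp
    also have "\<dots> \<le> (\<integral>\<^sup>+ z. (?s z)\<^sup>2 \<partial>lborel) * (\<integral>\<^sup>+ z. (?s z * ennreal (cmod (tf_shift z \<phi> t)))\<^sup>2 \<partial>lborel)"
      by (rule Cauchy_Schwarz_nn_integral) measurable
    also have "\<dots> = ?N * (\<integral>\<^sup>+ z. ennreal (cmod (H z)) * (ennreal (cmod (tf_shift z \<phi> t)))\<^sup>2 \<partial>lborel)"
      by (simp only: power_mult_distrib s2)
    finally show ?thesis .
  qed
  show sq: "sq_integrable (synth H)"
  proof (rule sq_integrableI_nn[OF sm])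
    have "(\<integral>\<^sup>+ t. (ennreal (cmod (synth H t)))\<^sup>2 \<partial>lborel) \<le> (\<integral>\<^sup>+ t. ?N * (\<integral>\<^sup>+ z. ennreal (cmod (H z)) * (ennreal (cmod (tf_shift z \<phi> t)))\<^sup>2 \<partial>lborel) \<partial>lborel)"
      by (intro nn_integral_mono pt)
    also have "\<dots> = ?N * (\<integral>\<^sup>+ t. (\<integral>\<^sup>+ z. ennreal (cmod (H z)) * (ennreal (cmod (tf_shift z \<phi> t)))\<^sup>2 \<partial>lborel) \<partial>lborel)"
      by (rule nn_integral_cmult) measurable
    also have "(\<integral>\<^sup>+ t. (\<integral>\<^sup>+ z. ennreal (cmod (H z)) * (ennreal (cmod (tf_shift z \<phi> t)))\<^sup>2 \<partial>lborel) \<partial>lborel)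
      = (\<integral>\<^sup>+ z. (\<integral>\<^sup>+ t. ennreal (cmod (H z)) * (ennreal (cmod (tf_shift z \<phi> t)))\<^sup>2 \<partial>lborel) \<partial>lborel)"
      by (rule lborel_pair.Fubini') simp
    also have "\<dots> = ?N"
    proof (rule nn_integral_cong)
      fix z
      show "(\<integral>\<^sup>+ t. ennreal (cmod (H z)) * (ennreal (cmod (tf_shift z \<phi> t)))\<^sup>2 \<partial>lborel) = ennreal (cmod (H z))"
        using nn_integral_l2sq[OF sq_integrable_tf_shift[OF \<phi>_sq], of z] l2sq_tf_shift[OF \<phi>_sq, of z] \<phi>_norm
        by (subst nn_integral_cmult) auto
    qed
    also have "?N * ?N < \<infinity>" using N by (simp add: ennreal_mult_less_top)
    finally show "(\<integral>\<^sup>+ t. (ennreal (cmod (synth H t)))\<^sup>2 \<partial>lborel) < \<infinity>" .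
  qed
  fix h :: "real^'d \<Rightarrow> complex" assume h: "sq_integrable h"
  have [measurable]: "h \<in> borel_measurable borel" using h by (rule sq_integrable_borel)
  have "l2_inner (synth H) h = (\<integral>t. (\<integral>z. H z * tf_shift z \<phi> t * cnj (h t) \<partial>lborel) \<partial>lborel)"
    by (simp add: l2_inner_def synth_def)
  also have "\<dots> = (\<integral>z. (\<integral>t. H z * tf_shift z \<phi> t * cnj (h t) \<partial>lborel) \<partial>lborel)"
  proof (rule Fubini_swap[symmetric])
    have "(\<integral>\<^sup>+ z. (\<integral>\<^sup>+ t. ennreal (norm (H z * tf_shift z \<phi> t * cnj (h t))) \<partial>lborel) \<partial>lborel) \<le> (\<integral>\<^sup>+ z. ennreal (cmod (H z)) * (1 * enn_rpow (1/2) (ennreal (l2sq h))) \<partial>lborel)"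
    proof (rule nn_integral_mono)
      fix z
      have "(\<integral>\<^sup>+ t. ennreal (norm (H z * tf_shift z \<phi> t * cnj (h t))) \<partial>lborel) = ennreal (cmod (H z)) * (\<integral>\<^sup>+ t. ennreal (cmod (tf_shift z \<phi> t)) * ennreal (cmod (h t)) \<partial>lborel)"
        by (subst nn_integral_cmult[symmetric]) (auto simp: norm_mult ennreal_mult mult.assoc)
      also have "\<dots> \<le> ennreal (cmod (H z)) * (enn_rpow (1/2) (\<integral>\<^sup>+ t. (ennreal (cmod (tf_shift z \<phi> t)))\<^sup>2 \<partial>lborel) * enn_rpow (1/2) (\<integral>\<^sup>+ t. (ennreal (cmod (h t)))\<^sup>2 \<partial>lborel))"
        by (intro mult_left_mono Cauchy_Schwarz_enn) simp_all
      also have "\<dots> = ennreal (cmod (H z)) * (1 * enn_rpow (1/2) (ennreal (l2sq h)))"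
        using \<phi>_norm enn_rpow_ennreal[of 1 "1/2"] by (simp add: nn_integral_l2sq sq_integrable_tf_shift \<phi>_sq h l2sq_tf_shift)
      finally show "(\<integral>\<^sup>+ t. ennreal (norm (H z * tf_shift z \<phi> t * cnj (h t))) \<partial>lborel) \<le> ennreal (cmod (H z)) * (1 * enn_rpow (1/2) (ennreal (l2sq h)))" .
    qed
    also have "\<dots> = ?N * (1 * enn_rpow (1/2) (ennreal (l2sq h)))"
      by (rule nn_integral_multc) measurable
    also have "\<dots> < \<infinity>" using N by (simp add: enn_rpow_ennreal ennreal_mult_less_top)
    finally show "(\<integral>\<^sup>+ z. (\<integral>\<^sup>+ t. ennreal (norm (H z * tf_shift z \<phi> t * cnj (h t))) \<partial>lborel) \<partial>lborel) < \<infinity>" .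
  qed measurable
  also have "\<dots> = (\<integral>z. H z * l2_inner (tf_shift z \<phi>) h \<partial>lborel)"
    by (simp add: l2_inner_def mult.assoc)
  also have "\<dots> = (\<integral>z. H z * cnj (stft \<phi> h z) \<partial>lborel)" by (simp add: l2_inner_tf_shift_left)
  finally show "l2_inner (synth H) h = (\<integral>z. H z * cnj (stft \<phi> h z) \<partial>lborel)" .
qed

text \<open>Pairing the vector with itself gives its squared norm as the integral of H against its
  own transform; Cauchy-Schwarz and the isometry of V_phi leave one factor of the norm to
  cancel.\<close>

lemma synth_norm_le:
  assumes H: "integrable lborel H"
  shows "ennreal (sqrt (l2sq (synth H))) \<le> enn_rpow (1/2) (\<integral>\<^sup>+ z. (ennreal (cmod (H z)))\<^sup>2 \<partial>lborel)"
proof -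
  have [measurable]: "H \<in> borel_measurable borel" using borel_measurable_integrable[OF H] by simp
  have sq: "sq_integrable (synth H)" by (rule synth_props(1)[OF H])
  have [measurable]: "synth H \<in> borel_measurable borel" using sq by (rule sq_integrable_borel)
  let ?s = "sqrt (l2sq (synth H))" and ?h = "enn_rpow (1/2) (\<integral>\<^sup>+ z. (ennreal (cmod (H z)))\<^sup>2 \<partial>lborel)"
  have "ennreal ?s * ennreal ?s = ennreal (cmod (l2_inner (synth H) (synth H)))"
    by (simp add: l2_inner_self ennreal_mult[symmetric])
  also have "\<dots> \<le> (\<integral>\<^sup>+ z. ennreal (cmod (H z)) * ennreal (cmod (stft \<phi> (synth H) z)) \<partial>lborel)"
  proof -
    have "ennreal (cmod (\<integral>z. H z * cnj (stft \<phi> (synth H) z) \<partial>lborel)) \<le> (\<integral>\<^sup>+ z. ennreal (cmod (H z * cnj (stft \<phi> (synth H) z))) \<partial>lborel)"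
    proof (cases "integrable lborel (\<lambda>z. H z * cnj (stft \<phi> (synth H) z))")
      case True then show ?thesis by (rule integral_norm_bound_ennreal)
    next
      case False then show ?thesis by (simp add: not_integrable_integral_eq)
    qed
    then show ?thesis by (simp add: synth_props(2)[OF H sq] norm_mult ennreal_mult)
  qed
  also have "\<dots> \<le> ?h * enn_rpow (1/2) (\<integral>\<^sup>+ z. (ennreal (cmod (stft \<phi> (synth H) z)))\<^sup>2 \<partial>lborel)"
    by (rule Cauchy_Schwarz_enn) measurable
  also have "enn_rpow (1/2) (\<integral>\<^sup>+ z. (ennreal (cmod (stft \<phi> (synth H) z)))\<^sup>2 \<partial>lborel) = ennreal ?s"
    by (simp add: Moyal_norm[OF sq \<phi>_sq] \<phi>_norm enn_rpow_ennreal powr_half_sqrt)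
  finally have le: "ennreal ?s * ennreal ?s \<le> ennreal ?s * ?h" by (simp add: mult.commute)
  show ?thesis
  proof (cases "?s = 0")
    case False
    then have "ennreal ?s \<noteq> 0" by (simp add: ennreal_eq_0_iff not_le less_le)
    then show ?thesis using le ennreal_mult_le_mult_iff[of "ennreal ?s" "ennreal ?s" ?h] by simp
  qed simp
qed

context
  fixes F :: "(real^'d \<Rightarrow> complex) \<Rightarrow> complex"
  assumes F: "Minf w F"
begin

abbreviation GF :: "(real^'d) \<times> (real^'d) \<Rightarrow> complex" where "GF \<equiv> G F"

abbreviation ga :: "(real^'d) \<times> (real^'d) \<Rightarrow> ennreal" where "ga z \<equiv> ennreal (cmod (G F z))"

lemma GF_borel [measurable]: "GF \<in> borel_measurable borel"
  by (rule G_borel[OF F])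

lemma kernel_G_integrable: "integrable lborel (\<lambda>z'. l2_inner (tf_shift z' \<phi>) (tf_shift z \<phi>) * GF z')"
proof -
  obtain C where C: "0 \<le> C" "\<And>z. cmod (GF z) \<le> C * w z" using G_le_w[OF F] by blast
  have m: "(\<lambda>z'. l2_inner (tf_shift z' \<phi>) (tf_shift z \<phi>)) \<in> borel_measurable borel"
    unfolding l2_inner_def by (rule lborel.borel_measurable_lebesgue_integral) measurable
  have "(\<integral>\<^sup>+ z'. ennreal (norm (l2_inner (tf_shift z' \<phi>) (tf_shift z \<phi>) * GF z')) \<partial>lborel)
     \<le> (\<integral>\<^sup>+ z'. ennreal C * (Phi (z - z') * ennreal (w z')) \<partial>lborel)"
  proof (intro nn_integral_mono)
    fix z'
    have "ga z' \<le> ennreal C * ennreal (w z')" using C(2)[of z'] C(1) by (simp add: ennreal_mult[symmetric] ennreal_leI)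
    from mult_mono[OF kernel_le_Phi[of z' z] this]
    show "ennreal (norm (l2_inner (tf_shift z' \<phi>) (tf_shift z \<phi>) * GF z')) \<le> ennreal C * (Phi (z - z') * ennreal (w z'))"
      by (simp add: norm_mult ennreal_mult mult_ac)
  qed
  also have "\<dots> = ennreal C * (\<integral>\<^sup>+ z'. Phi (z - z') * ennreal (w z') \<partial>lborel)"
    by (rule nn_integral_cmult) measurable
  also have "(\<integral>\<^sup>+ z'. Phi (z - z') * ennreal (w z') \<partial>lborel) = (\<integral>\<^sup>+ z'. Phi (- (z' - z)) * ennreal (w z') \<partial>lborel)" by simp
  also have "\<dots> \<le> ennreal (w z) * wnorm1 (\<lambda>u. Phi (- u))"
    by (rule nn_integral_translate_w) measurable
  also have "ennreal C * \<dots> < \<infinity>" using Phi_wnorm1 by (simp add: wnorm1_reflect ennreal_mult_less_top)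
  finally have "(\<integral>\<^sup>+ z'. ennreal (norm (l2_inner (tf_shift z' \<phi>) (tf_shift z \<phi>) * GF z')) \<partial>lborel) < \<infinity>"
    by (simp add: mult_left_mono)
  then show ?thesis using m by (simp add: integrable_iff_bounded)
qed

text \<open>By Moyal's identity pi(z) \<phi> is synthesized from its own transform, which lies in
  L^1_w by \<open>kernel_le_Phi\<close>; F is then applied under the integral.\<close>

lemma reproducing: "GF z = (\<integral>z'. l2_inner (tf_shift z' \<phi>) (tf_shift z \<phi>) * GF z' \<partial>lborel)"
proof -
  let ?H = "stft \<phi> (tf_shift z \<phi>)"
  have [measurable]: "tf_shift z \<phi> \<in> borel_measurable borel" by measurable
  have Hw: "(\<integral>\<^sup>+ z'. ennreal (cmod (?H z')) * ennreal (w z') \<partial>lborel) < \<infinity>"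
  proof (rule order.strict_trans1)
    show "(\<integral>\<^sup>+ z'. ennreal (cmod (?H z')) * ennreal (w z') \<partial>lborel) \<le> (\<integral>\<^sup>+ z'. Phi (z' - z) * ennreal (w z') \<partial>lborel)"
      unfolding stft_def by (intro nn_integral_mono mult_right_mono kernel_le_Phi) auto
    show "(\<integral>\<^sup>+ z'. Phi (z' - z) * ennreal (w z') \<partial>lborel) < \<infinity>"
      using nn_integral_translate_w[OF Phi_borel, of z] Phi_wnorm1 by (auto simp: ennreal_mult_less_top elim!: order.strict_trans1)
  qed
  have "F (tf_shift z \<phi>) = (\<integral>z'. cnj (?H z') * GF z' \<partial>lborel)"
  proof (rule Minf_integral[OF F _ _ Hw])
    show "l2_inner (tf_shift z \<phi>) h = (\<integral>z'. ?H z' * cnj (stft \<phi> h z') \<partial>lborel)" if "sq_integrable h" for h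
      using Moyal[OF sq_integrable_tf_shift[OF \<phi>_sq] that \<phi>_sq] by (simp add: \<phi>_norm)
  qed (simp_all add: sq_integrable_tf_shift \<phi>_sq)
  moreover have "cnj (?H z') = l2_inner (tf_shift z' \<phi>) (tf_shift z \<phi>)" for z'
    by (rule l2_inner_tf_shift_left[symmetric])
  ultimately show ?thesis by (simp add: G_def[OF F])
qed

lemma ga_le_conv_int: "ga z \<le> conv_int Phi ga z"
proof -
  have "ga z \<le> (\<integral>\<^sup>+ z'. ennreal (cmod (l2_inner (tf_shift z' \<phi>) (tf_shift z \<phi>) * GF z')) \<partial>lborel)"
    by (subst reproducing) (rule integral_norm_bound_ennreal[OF kernel_G_integrable])
  also have "\<dots> \<le> conv_int Phi ga z"
    unfolding conv_int_def by (intro nn_integral_mono) (auto simp: norm_mult ennreal_mult intro!: mult_right_mono kernel_le_Phi)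
  finally show ?thesis .
qed

section \<open>Pairing a functional with a localization operator\<close>

context
  fixes m :: "(real^'d) \<times> (real^'d) \<Rightarrow> real"
    and lam :: "nat \<Rightarrow> real" and phis :: "nat \<Rightarrow> real^'d \<Rightarrow> complex"
  assumes diag: "diagonalizes \<phi> m lam phis"
    and m: "integrable lborel m" "\<And>z. 0 \<le> m z"
    and mw: "(\<integral>\<^sup>+ z. ennreal (m z) * ennreal (w z) \<partial>lborel) < \<infinity>"
begin

lemma m_borel [measurable]: "m \<in> borel_measurable borel"
  using borel_measurable_integrable[OF m(1)] by simp

lemma mw_integrable: "integrable lborel (\<lambda>z. m z * w z)"
  using mw m(2) by (simp add: integrable_iff_bounded ennreal_mult abs_mult)

text \<open>The eigenfunction scaled by its eigenvalue is the image of \<open>phis k\<close> under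
  the localization operator, hence synthesized from the L^1_w function m V_phi phi_k. This places it
  in M^1_w and makes F computable on it; the factor \<open>lam k\<close> is essential for
  this.\<close>

lemma F_eigenfunction:
  "F (\<lambda>t. complex_of_real (lam k) * phis k t) = (\<integral>z. complex_of_real (m z) * cnj (stft \<phi> (phis k) z) * GF z \<partial>lborel)"
proof -
  note sq = phis_sq[OF diag \<phi>_sq \<phi>_norm m]
  have [measurable]: "phis k \<in> borel_measurable borel" by (rule sq_integrable_borel[OF sq])
  let ?H = "\<lambda>z. complex_of_real (m z) * stft \<phi> (phis k) z"
  have le1: "cmod (stft \<phi> (phis k) z) \<le> 1" for z
    using cmod_stft_le[OF sq \<phi>_sq, of k z] l2sq_phis[OF diag \<phi>_sq \<phi>_norm m] \<phi>_norm by simp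
  have "(\<integral>\<^sup>+ z. ennreal (cmod (?H z)) * ennreal (w z) \<partial>lborel) \<le> (\<integral>\<^sup>+ z. ennreal (m z) * ennreal (w z) \<partial>lborel)"
    using le1 m(2) by (intro nn_integral_mono mult_right_mono ennreal_leI) (auto simp: norm_mult intro: mult_left_le)
  also note mw
  finally have Hw: "(\<integral>\<^sup>+ z. ennreal (cmod (?H z)) * ennreal (w z) \<partial>lborel) < \<infinity>" .
  have "F (\<lambda>t. complex_of_real (lam k) * phis k t) = (\<integral>z. cnj (?H z) * GF z \<partial>lborel)"
  proof (rule Minf_integral[OF F _ _ Hw])
    show "l2_inner (\<lambda>t. complex_of_real (lam k) * phis k t) h = (\<integral>z. ?H z * cnj (stft \<phi> h z) \<partial>lborel)" if "sq_integrable h" for h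
      using loc_form_phis[OF diag \<phi>_sq \<phi>_norm m that, of k] by (simp add: l2_inner_cmult loc_form_def)
  qed (simp_all add: sq_integrable_cmult sq)
  then show ?thesis by simp
qed

lemma symbol_G_integrable:
  assumes f: "sq_integrable f"
  shows "integrable lborel (\<lambda>z. complex_of_real (m z) * cnj (stft \<phi> f z) * GF z)"
proof -
  obtain C where C: "0 \<le> C" "\<And>z. cmod (GF z) \<le> C * w z" using G_le_w[OF F] by blast
  have [measurable]: "f \<in> borel_measurable borel" by (rule sq_integrable_borel[OF f])
  show ?thesis
  proof (rule Bochner_Integration.integrable_bound)
    show "integrable lborel (\<lambda>z. (sqrt (l2sq f) * C) * (m z * w z))" using mw_integrable by (rule integrable_mult_right)
    show "AE z in lborel. norm (complex_of_real (m z) * cnj (stft \<phi> f z) * GF z) \<le> norm ((sqrt (l2sq f) * C) * (m z * w z))"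
    proof (rule AE_I2)
      fix z
      have "cmod (stft \<phi> f z) * cmod (GF z) \<le> sqrt (l2sq f) * (C * w z)"
        using cmod_stft_le[OF f \<phi>_sq, of z] \<phi>_norm by (intro mult_mono C) auto
      from mult_left_mono[OF this m(2)[of z]]
      show "norm (complex_of_real (m z) * cnj (stft \<phi> f z) * GF z) \<le> norm ((sqrt (l2sq f) * C) * (m z * w z))"
        using m(2)[of z] C(1) by (simp add: norm_mult abs_mult mult_ac)
    qed
  qed measurable
qed

text \<open>The integral is F evaluated at the localization operator applied to h. The projection of
  h to the first n eigenfunctions produces the coefficients. For the residual, Cauchy-Schwarz and
  \<open>lam n\<close> are used near \<gamma>; far from \<gamma> its transform is simply bounded by
  the norm of h.\<close>

lemma symbol_pairing_le:
  assumes h: "sq_integrable h"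
  shows "ennreal (cmod (\<integral>z. complex_of_real (m z) * cnj (stft \<phi> h z) * GF z \<partial>lborel))
   \<le> ((\<Sum>j<n. ennreal (cmod (F (\<lambda>t. complex_of_real (lam j) * phis j t))))
      + (ennreal (sqrt (lam n)) * enn_rpow (1/2) (\<integral>\<^sup>+ z. indicator {z. norm (z - \<gamma>) \<le> r} z * (ennreal (m z) * (ga z)\<^sup>2) \<partial>lborel)
         + (\<integral>\<^sup>+ z. indicator {z. r < norm (z - \<gamma>)} z * (ennreal (m z) * ga z) \<partial>lborel))) * ennreal (sqrt (l2sq h))"
    (is "_ \<le> (?P + (?L * enn_rpow (1/2) ?near + ?far)) * ?s")
proof -
  note D = diag \<phi>_sq \<phi>_norm m
  note sq = phis_sq[OF D] and orth = phis_orth[OF D]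
  have [measurable]: "h \<in> borel_measurable borel" by (rule sq_integrable_borel[OF h])
  let ?r = "proj_residual phis n h"
  have r: "sq_integrable ?r" by (rule sq_integrable_proj_residual[OF sq orth h])
  have [measurable]: "?r \<in> borel_measurable borel" by (rule sq_integrable_borel[OF r])
  let ?I = "\<lambda>f. \<integral>z. complex_of_real (m z) * cnj (stft \<phi> f z) * GF z \<partial>lborel"
  have V: "stft \<phi> h z = (\<Sum>j<n. l2_inner h (phis j) * stft \<phi> (phis j) z) + stft \<phi> ?r z" for z
  proof -
    have "stft \<phi> (\<lambda>t. \<Sum>j<n. l2_inner h (phis j) * phis j t) z = (\<Sum>j<n. l2_inner h (phis j) * stft \<phi> (phis j) z)"
      unfolding stft_def by (rule l2_inner_proj[OF sq orth sq_integrable_tf_shift[OF \<phi>_sq]])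
    then show ?thesis
      using stft_diff[OF h sq_integrable_proj[OF sq orth, where f = h and n = n] \<phi>_sq, of z] by (simp add: proj_residual_def)
  qed
  have split: "?I h = (\<Sum>j<n. cnj (l2_inner h (phis j)) * F (\<lambda>t. complex_of_real (lam j) * phis j t)) + ?I ?r"
  proof -
    have "?I h = (\<integral>z. (\<Sum>j<n. cnj (l2_inner h (phis j)) * (complex_of_real (m z) * cnj (stft \<phi> (phis j) z) * GF z))
        + complex_of_real (m z) * cnj (stft \<phi> ?r z) * GF z \<partial>lborel)"
      by (rule Bochner_Integration.integral_cong) (simp_all add: V algebra_simps sum_distrib_left sum_distrib_right)
    also have "\<dots> = (\<Sum>j<n. cnj (l2_inner h (phis j)) * ?I (phis j)) + ?I ?r"
      using symbol_G_integrable[OF sq] symbol_G_integrable[OF r]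
      by (subst Bochner_Integration.integral_add) (auto intro!: Bochner_Integration.integrable_sum simp: Bochner_Integration.integral_sum)
    finally show ?thesis by (simp add: F_eigenfunction)
  qed
  have lq: "sqrt (l2sq ?r) \<le> sqrt (l2sq h)" using l2sq_proj_residual_le[OF sq orth h] by simp
  have 1: "ennreal (cmod (\<Sum>j<n. cnj (l2_inner h (phis j)) * F (\<lambda>t. complex_of_real (lam j) * phis j t))) \<le> ?P * ?s"
  proof -
    have "cmod (\<Sum>j<n. cnj (l2_inner h (phis j)) * F (\<lambda>t. complex_of_real (lam j) * phis j t))
      \<le> (\<Sum>j<n. cmod (F (\<lambda>t. complex_of_real (lam j) * phis j t)) * sqrt (l2sq h))"
    proof (rule sum_norm_le)
      fix j
      have "cmod (l2_inner h (phis j)) \<le> sqrt (l2sq h)"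
        using cmod_l2_inner_le[OF h sq, of j] l2sq_phis[OF D] by simp
      from mult_left_mono[OF this, of "cmod (F (\<lambda>t. complex_of_real (lam j) * phis j t))"]
      show "cmod (cnj (l2_inner h (phis j)) * F (\<lambda>t. complex_of_real (lam j) * phis j t)) \<le> cmod (F (\<lambda>t. complex_of_real (lam j) * phis j t)) * sqrt (l2sq h)"
        by (simp add: norm_mult mult.commute)
    qed
    also have "\<dots> = (\<Sum>j<n. cmod (F (\<lambda>t. complex_of_real (lam j) * phis j t))) * sqrt (l2sq h)"
      by (rule sum_distrib_right[symmetric])
    finally show ?thesis
      by (subst sum_ennreal) (auto simp: ennreal_mult[symmetric] sum_nonneg intro: ennreal_leI)
  qed
  have "ennreal (cmod (?I ?r)) \<le> (\<integral>\<^sup>+ z. ennreal (cmod (complex_of_real (m z) * cnj (stft \<phi> ?r z) * GF z)) \<partial>lborel)"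
    by (rule integral_norm_bound_ennreal[OF symbol_G_integrable[OF r]])
  also have "\<dots> \<le> (\<integral>\<^sup>+ z. (indicator {z. norm (z - \<gamma>) \<le> r} z * (ennreal (sqrt (m z)) * ga z)) * (ennreal (sqrt (m z)) * ennreal (cmod (stft \<phi> ?r z)))
      + indicator {z. r < norm (z - \<gamma>)} z * (ennreal (m z) * ga z) * ?s \<partial>lborel)"
  proof (rule nn_integral_mono)
    fix z
    have eq: "ennreal (cmod (complex_of_real (m z) * cnj (stft \<phi> ?r z) * GF z)) = ennreal (m z) * ga z * ennreal (cmod (stft \<phi> ?r z))"
      using m(2)[of z] by (simp add: norm_mult ennreal_mult mult_ac)
    show "ennreal (cmod (complex_of_real (m z) * cnj (stft \<phi> ?r z) * GF z)) \<le> (indicator {z. norm (z - \<gamma>) \<le> r} z * (ennreal (sqrt (m z)) * ga z)) * (ennreal (sqrt (m z)) * ennreal (cmod (stft \<phi> ?r z)))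
      + indicator {z. r < norm (z - \<gamma>)} z * (ennreal (m z) * ga z) * ?s"
    proof (cases "norm (z - \<gamma>) \<le> r")
      case True
      have "ennreal (m z) = ennreal (sqrt (m z)) * ennreal (sqrt (m z))" using m(2)[of z] by (simp add: ennreal_mult[symmetric])
      then show ?thesis unfolding eq using True by (simp add: mult_ac)
    next
      case False
      have "ennreal (cmod (stft \<phi> ?r z)) \<le> ?s"
        using cmod_stft_le[OF r \<phi>_sq, of z] \<phi>_norm by (intro ennreal_leI order_trans[OF _ lq]) simp
      from mult_left_mono[OF this, of "ennreal (m z) * ga z"] show ?thesis unfolding eq using False by simp
    qed
  qed
  also have "\<dots> = (\<integral>\<^sup>+ z. (indicator {z. norm (z - \<gamma>) \<le> r} z * (ennreal (sqrt (m z)) * ga z)) * (ennreal (sqrt (m z)) * ennreal (cmod (stft \<phi> ?r z))) \<partial>lborel) + ?far * ?s"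
    by (subst nn_integral_add) (auto simp: nn_integral_multc)
  also have "\<dots> \<le> enn_rpow (1/2) ?near * (?L * ?s) + ?far * ?s"
  proof (rule add_right_mono)
    have "(\<integral>\<^sup>+ z. (indicator {z. norm (z - \<gamma>) \<le> r} z * (ennreal (sqrt (m z)) * ga z)) * (ennreal (sqrt (m z)) * ennreal (cmod (stft \<phi> ?r z))) \<partial>lborel)
      \<le> enn_rpow (1/2) (\<integral>\<^sup>+ z. (indicator {z. norm (z - \<gamma>) \<le> r} z * (ennreal (sqrt (m z)) * ga z))\<^sup>2 \<partial>lborel) * enn_rpow (1/2) (\<integral>\<^sup>+ z. (ennreal (sqrt (m z)) * ennreal (cmod (stft \<phi> ?r z)))\<^sup>2 \<partial>lborel)"
      by (rule Cauchy_Schwarz_enn) measurable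
    also have "(\<integral>\<^sup>+ z. (indicator {z. norm (z - \<gamma>) \<le> r} z * (ennreal (sqrt (m z)) * ga z))\<^sup>2 \<partial>lborel) = ?near"
      using m(2) by (intro nn_integral_cong) (auto simp: indicator_def power_mult_distrib ennreal_power)
    also have "enn_rpow (1/2) (\<integral>\<^sup>+ z. (ennreal (sqrt (m z)) * ennreal (cmod (stft \<phi> ?r z)))\<^sup>2 \<partial>lborel) \<le> ?L * ?s"
    proof -
      have "(\<integral>\<^sup>+ z. (ennreal (sqrt (m z)) * ennreal (cmod (stft \<phi> ?r z)))\<^sup>2 \<partial>lborel) = (\<integral>\<^sup>+ z. ennreal (m z * (cmod (stft \<phi> ?r z))\<^sup>2) \<partial>lborel)"
        using m(2) by (intro nn_integral_cong) (simp add: power_mult_distrib ennreal_power ennreal_mult)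
      also have "\<dots> = ennreal (\<integral>z. m z * (cmod (stft \<phi> ?r z))\<^sup>2 \<partial>lborel)"
        using m(2) by (intro nn_integral_eq_integral integrable_symbol_stft[OF D r]) auto
      also have "\<dots> \<le> ennreal (lam n * l2sq h)" by (intro ennreal_leI symbol_stft_proj_residual_le[OF D h])
      also have "\<dots> = (?L * ?s)\<^sup>2" using lam_nonneg[OF D, of n] by (simp add: power_mult_distrib ennreal_power ennreal_mult)
      finally show ?thesis by (rule enn_rpow_half_le)
    qed
    finally show "(\<integral>\<^sup>+ z. (indicator {z. norm (z - \<gamma>) \<le> r} z * (ennreal (sqrt (m z)) * ga z)) * (ennreal (sqrt (m z)) * ennreal (cmod (stft \<phi> ?r z))) \<partial>lborel) \<le> enn_rpow (1/2) ?near * (?L * ?s)"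
      by (simp add: mult_left_mono)
  qed
  finally have 2: "ennreal (cmod (?I ?r)) \<le> enn_rpow (1/2) ?near * (?L * ?s) + ?far * ?s" .
  have "ennreal (cmod (?I h)) \<le> ennreal (cmod (\<Sum>j<n. cnj (l2_inner h (phis j)) * F (\<lambda>t. complex_of_real (lam j) * phis j t))) + ennreal (cmod (?I ?r))"
    unfolding split by (subst ennreal_plus[symmetric]) (auto intro: ennreal_leI norm_triangle_ineq simp del: ennreal_plus)
  also have "\<dots> \<le> ?P * ?s + (enn_rpow (1/2) ?near * (?L * ?s) + ?far * ?s)" by (intro add_mono 1 2)
  also have "\<dots> = (?P + (?L * enn_rpow (1/2) ?near + ?far)) * ?s"
  proof -
    have "P * s + (X * (L * s) + f * s) = (P + (L * X + f)) * s" for P X L f s :: ennreal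
      by (simp add: algebra_simps)
    then show ?thesis .
  qed
  finally show ?thesis .
qed

end

end

lemma weighted_exp_bounded:
  assumes "1 \<le> R"
  obtains D where "0 < D" "\<And>z. exp (- (norm (z - y) / R)) * w z \<le> D"
proof -
  obtain D where D: "0 < D" "\<And>z. w z \<le> D * exp (1 / R * norm z)" using w_le_exp[of "1 / R"] assms by auto
  show ?thesis
  proof (rule that[of "D * exp (norm y / R)"])
    fix z
    have "norm z / R \<le> (norm y + norm (z - y)) / R"
      using assms norm_triangle_ineq[of y "z - y"] by (intro divide_right_mono) auto
    then have e: "exp (- (norm (z - y) / R)) * exp (1 / R * norm z) \<le> exp (norm y / R)"
      by (simp add: exp_add[symmetric] add_divide_distrib)
    have "exp (- (norm (z - y) / R)) * w z \<le> exp (- (norm (z - y) / R)) * (D * exp (1 / R * norm z))"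
      by (intro mult_left_mono D) simp
    also have "\<dots> = D * (exp (- (norm (z - y) / R)) * exp (1 / R * norm z))" by simp
    also have "\<dots> \<le> D * exp (norm y / R)" using D(1) e by (intro mult_left_mono) auto
    finally show "exp (- (norm (z - y) / R)) * w z \<le> D * exp (norm y / R)" .
  qed (use D in simp)
qed

section \<open>The local energy inequality for a functional\<close>

context
  fixes F :: "(real^'d \<Rightarrow> complex) \<Rightarrow> complex" and m :: "(real^'d) \<times> (real^'d) \<Rightarrow> real"
    and lam :: "nat \<Rightarrow> real" and phis :: "nat \<Rightarrow> real^'d \<Rightarrow> complex"
  assumes F: "Minf w F" and diag: "diagonalizes \<phi> m lam phis"
    and m: "integrable lborel m" "\<And>z. 0 \<le> m z"
    and mw: "(\<integral>\<^sup>+ z. ennreal (m z) * ennreal (w z) \<partial>lborel) < \<infinity>"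
begin

text \<open>With \<rho> the damping factor, the energy is the integral of m G cnj(\<rho> G). Here
  \<rho> G is replaced by V_phi h, where h is synthesized from the truncation of \<rho> G to the
  ball: the V_phi h part is estimated by \<open>symbol_pairing_le\<close>, the difference by the
  reproducing kernel.\<close>

lemma local_energy_bound:
  fixes y \<gamma> :: "(real^'d) \<times> (real^'d)"
  assumes R: "1 \<le> R"
  defines "e \<equiv> \<lambda>z z'. exp (- (norm (z - y) / R)) - exp (- (norm (z' - y) / R)) * indicator (ball \<gamma> R) z'"
  shows "(\<integral>\<^sup>+ z. ennreal (m z) * (sexp R (z - y) * ennreal (cmod (G F z)))\<^sup>2 \<partial>lborel)
    \<le> ((\<Sum>j<n. ennreal (cmod (F (\<lambda>t. complex_of_real (lam j) * phis j t))))
      + (ennreal (sqrt (lam n)) * enn_rpow (1/2) (\<integral>\<^sup>+ z. indicator {z. norm (z - \<gamma>) \<le> r} z * (ennreal (m z) * (ennreal (cmod (G F z)))\<^sup>2) \<partial>lborel)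
         + (\<integral>\<^sup>+ z. indicator {z. r < norm (z - \<gamma>)} z * (ennreal (m z) * ennreal (cmod (G F z))) \<partial>lborel)))
      * enn_rpow (1/2) (\<integral>\<^sup>+ z. indicator (ball \<gamma> R) z * ((sexp R (z - y))\<^sup>2 * ennreal (cmod (G F z)))\<^sup>2 \<partial>lborel)
      + (\<integral>\<^sup>+ z. (\<integral>\<^sup>+ z'. ennreal (m z) * (ennreal (cmod (G F z)) * (Phi (z - z') * (ennreal \<bar>e z z'\<bar> * ennreal (cmod (G F z'))))) \<partial>lborel) \<partial>lborel)"
    (is "?lhs \<le> ?X * ?S + ?J")
proof -
  note [measurable] = G_borel[OF F]
  have [measurable]: "m \<in> borel_measurable borel" using borel_measurable_integrable[OF m(1)] by simp
  obtain C where C: "0 \<le> C" "\<And>z. cmod (G F z) \<le> C * w z" using G_le_w[OF F] by blast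
  obtain D where D: "0 < D" "\<And>z. exp (- (norm (z - y) / R)) * w z \<le> D" using weighted_exp_bounded[OF R] by blast
  define \<rho> where "\<rho> z = exp (- (norm (z - y) / R))" for z
  have \<rho>: "0 \<le> \<rho> z" "\<rho> z \<le> 1" for z using R by (auto simp: \<rho>_def)
  have [measurable]: "\<rho> \<in> borel_measurable borel" unfolding \<rho>_def by measurable
  have [measurable]: "indicator (ball \<gamma> R) \<in> borel_measurable (borel :: ((real^'d) \<times> (real^'d)) measure)"
    by (intro borel_measurable_indicator) auto
  have \<rho>s: "(sexp R (z - y))\<^sup>2 = ennreal (\<rho> z)" for z using sexp_square[OF R] by (simp add: \<rho>_def)
  have \<rho>G: "cmod (complex_of_real (\<rho> z) * G F z) \<le> C * D" for z
  proof -
    have "\<rho> z * cmod (G F z) \<le> \<rho> z * (C * w z)" by (intro mult_left_mono C \<rho>)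
    also have "\<dots> = C * (\<rho> z * w z)" by simp
    also have "\<dots> \<le> C * D" using C(1) D(2)[of z] by (intro mult_left_mono) (auto simp: \<rho>_def)
    finally show ?thesis using \<rho>(1) by (simp add: norm_mult)
  qed
  \<comment> \<open>The truncation is bounded with bounded support, hence integrable, so that its
    synthesis lies in L^2.\<close>
  define H where "H z = indicator (ball \<gamma> R) z * (complex_of_real (\<rho> z) * G F z)" for z
  have [measurable]: "H \<in> borel_measurable borel"
  proof -
    have "(\<lambda>z. if z \<in> ball \<gamma> R then complex_of_real (\<rho> z) * G F z else 0) \<in> borel_measurable borel" by measurable
    then show ?thesis by (rule measurable_cong[THEN iffD1, rotated]) (auto simp: H_def indicator_def)
  qed
  have Hint: "integrable lborel H"
  proof (rule Bochner_Integration.integrable_bound)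
    show "integrable lborel (\<lambda>z. (C * D) * indicator (ball \<gamma> R) z :: real)"
      using emeasure_bounded_finite[of "ball \<gamma> R"] by (intro integrable_mult_right integrable_real_indicator) auto
    show "AE z in lborel. norm (H z) \<le> norm ((C * D) * indicator (ball \<gamma> R) z :: real)"
      using \<rho>G C(1) D(1) by (auto simp: H_def indicator_def simp del: mem_ball norm_mult)
  qed measurable
  define h where "h = synth H"
  have h: "sq_integrable h" unfolding h_def by (rule synth_props(1)[OF Hint])
  have [measurable]: "h \<in> borel_measurable borel" by (rule sq_integrable_borel[OF h])
  have hS: "ennreal (sqrt (l2sq h)) \<le> ?S"
  proof -
    have "(\<integral>\<^sup>+ z. (ennreal (cmod (H z)))\<^sup>2 \<partial>lborel) = (\<integral>\<^sup>+ z. indicator (ball \<gamma> R) z * ((sexp R (z - y))\<^sup>2 * ennreal (cmod (G F z)))\<^sup>2 \<partial>lborel)"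
      using \<rho>(1) by (intro nn_integral_cong) (auto simp: H_def indicator_def norm_mult ennreal_mult \<rho>s)
    then show ?thesis using synth_norm_le[OF Hint] by (simp add: h_def)
  qed
  let ?K = "\<lambda>z z'. l2_inner (tf_shift z' \<phi>) (tf_shift z \<phi>)"
  have err: "ennreal (cmod (complex_of_real (\<rho> z) * G F z - stft \<phi> h z)) \<le> (\<integral>\<^sup>+ z'. Phi (z - z') * (ennreal \<bar>e z z'\<bar> * ennreal (cmod (G F z'))) \<partial>lborel)" for z
  proof -
    have km: "(\<lambda>z'. ?K z z') \<in> borel_measurable borel"
      unfolding l2_inner_def by (rule lborel.borel_measurable_lebesgue_integral) measurable
    have Vh: "stft \<phi> h z = (\<integral>z'. H z' * ?K z z' \<partial>lborel)"
      unfolding stft_def h_def using synth_props(2)[OF Hint sq_integrable_tf_shift[OF \<phi>_sq], of z]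
      by (simp add: l2_inner_tf_shift_left)
    have kG: "integrable lborel (\<lambda>z'. ?K z z' * G F z')" by (rule kernel_G_integrable[OF F])
    have kH: "integrable lborel (\<lambda>z'. H z' * ?K z z')"
    proof (rule Bochner_Integration.integrable_bound[OF kG])
      show "(\<lambda>z'. H z' * ?K z z') \<in> borel_measurable lborel" using km by measurable
      show "AE z' in lborel. norm (H z' * ?K z z') \<le> norm (?K z z' * G F z')"
      proof (rule AE_I2)
        fix z'
        have "cmod (H z') \<le> 1 * cmod (G F z')"
          using \<rho>[of z'] by (auto simp: H_def indicator_def norm_mult intro!: mult_left_le_one_le)
        then show "norm (H z' * ?K z z') \<le> norm (?K z z' * G F z')" by (simp add: norm_mult mult.commute mult_left_mono mult_right_mono)
      qed
    qed
    have i: "integrable lborel (\<lambda>z'. ?K z z' * (complex_of_real (e z z') * G F z'))"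
      and eq: "complex_of_real (\<rho> z) * G F z - stft \<phi> h z = (\<integral>z'. ?K z z' * (complex_of_real (e z z') * G F z') \<partial>lborel)"
    proof -
      \<comment> \<open>Since \<rho> z does not depend on z', it can be carried into the reproducing
        integral for G z, and the two integrals combine under one kernel.\<close>
      have pt: "?K z z' * (complex_of_real (e z z') * G F z') = complex_of_real (\<rho> z) * (?K z z' * G F z') - H z' * ?K z z'" for z'
        by (simp add: e_def \<rho>_def H_def indicator_def algebra_simps)
      show "integrable lborel (\<lambda>z'. ?K z z' * (complex_of_real (e z z') * G F z'))"
        unfolding pt using kG kH by simp
      have "complex_of_real (\<rho> z) * G F z - stft \<phi> h z = complex_of_real (\<rho> z) * (\<integral>z'. ?K z z' * G F z' \<partial>lborel) - (\<integral>z'. H z' * ?K z z' \<partial>lborel)"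
        by (simp only: Vh reproducing[OF F, of z])
      then show "complex_of_real (\<rho> z) * G F z - stft \<phi> h z = (\<integral>z'. ?K z z' * (complex_of_real (e z z') * G F z') \<partial>lborel)"
        unfolding pt using kG kH by simp
    qed
    have "ennreal (cmod (complex_of_real (\<rho> z) * G F z - stft \<phi> h z)) \<le> (\<integral>\<^sup>+ z'. ennreal (cmod (?K z z' * (complex_of_real (e z z') * G F z'))) \<partial>lborel)"
      unfolding eq by (rule integral_norm_bound_ennreal[OF i])
    also have "\<dots> \<le> (\<integral>\<^sup>+ z'. Phi (z - z') * (ennreal \<bar>e z z'\<bar> * ennreal (cmod (G F z'))) \<partial>lborel)"
    proof (rule nn_integral_mono)
      fix z'
      have "ennreal (cmod (?K z z' * (complex_of_real (e z z') * G F z'))) = ennreal (cmod (?K z z')) * (ennreal \<bar>e z z'\<bar> * ennreal (cmod (G F z')))"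
        by (simp add: norm_mult ennreal_mult)
      then show "ennreal (cmod (?K z z' * (complex_of_real (e z z') * G F z'))) \<le> Phi (z - z') * (ennreal \<bar>e z z'\<bar> * ennreal (cmod (G F z')))"
        using kernel_le_Phi[of z' z] by (simp add: mult_right_mono)
    qed
    finally show ?thesis .
  qed
  let ?A = "\<lambda>z. complex_of_real (m z) * cnj (stft \<phi> h z) * G F z"
  let ?B = "\<lambda>z. complex_of_real (m z) * G F z * cnj (complex_of_real (\<rho> z) * G F z - stft \<phi> h z)"
  have iA: "integrable lborel ?A" by (rule symbol_G_integrable[OF F diag m mw h])
  have iL: "integrable lborel (\<lambda>z. m z * \<rho> z * (cmod (G F z))\<^sup>2)"
  proof (rule Bochner_Integration.integrable_bound)
    show "integrable lborel (\<lambda>z. (C * D * C) * (m z * w z))"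
      using mw_integrable[OF F diag m mw] by (rule integrable_mult_right)
    show "AE z in lborel. norm (m z * \<rho> z * (cmod (G F z))\<^sup>2) \<le> norm ((C * D * C) * (m z * w z))"
    proof (rule AE_I2)
      fix z
      have "(\<rho> z * cmod (G F z)) * cmod (G F z) \<le> (C * D) * (C * w z)"
        using \<rho>G[of z] \<rho>(1)[of z] C(1) D(1) C(2)[of z]
        by (intro mult_mono[of "\<rho> z * cmod (G F z)"]) (auto simp: norm_mult)
      from mult_left_mono[OF this m(2)[of z]]
      show "norm (m z * \<rho> z * (cmod (G F z))\<^sup>2) \<le> norm ((C * D * C) * (m z * w z))"
        using m(2)[of z] \<rho>(1)[of z] C(1) D(1) by (simp add: abs_mult power2_eq_square mult_ac)
    qed
  qed measurable
  have AB: "complex_of_real (m z * \<rho> z * (cmod (G F z))\<^sup>2) = ?A z + ?B z" for z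
    by (simp add: complex_norm_square algebra_simps del: of_real_power)
  have iL': "integrable lborel (\<lambda>z. complex_of_real (m z * \<rho> z * (cmod (G F z))\<^sup>2))"
    using iL by (simp only: integrable_of_real)
  have iB: "integrable lborel ?B"
    using Bochner_Integration.integrable_diff[OF iL' iA] unfolding AB by simp
  have "?lhs = (\<integral>\<^sup>+ z. ennreal (m z * \<rho> z * (cmod (G F z))\<^sup>2) \<partial>lborel)"
    using m(2) \<rho>(1) by (intro nn_integral_cong) (simp add: power_mult_distrib \<rho>s ennreal_mult ennreal_power mult.assoc)
  also have "\<dots> = ennreal (\<integral>z. m z * \<rho> z * (cmod (G F z))\<^sup>2 \<partial>lborel)"
    using m(2) \<rho>(1) by (intro nn_integral_eq_integral iL) auto
  also have "\<dots> \<le> ennreal (cmod (\<integral>z. ?A z \<partial>lborel) + cmod (\<integral>z. ?B z \<partial>lborel))"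
  proof (rule ennreal_leI)
    have "complex_of_real (\<integral>z. m z * \<rho> z * (cmod (G F z))\<^sup>2 \<partial>lborel) = (\<integral>z. ?A z \<partial>lborel) + (\<integral>z. ?B z \<partial>lborel)"
      unfolding integral_complex_of_real[symmetric] AB by (rule Bochner_Integration.integral_add[OF iA iB])
    then have "cmod (complex_of_real (\<integral>z. m z * \<rho> z * (cmod (G F z))\<^sup>2 \<partial>lborel)) \<le> cmod (\<integral>z. ?A z \<partial>lborel) + cmod (\<integral>z. ?B z \<partial>lborel)"
      by (simp only: norm_triangle_ineq)
    then show "(\<integral>z. m z * \<rho> z * (cmod (G F z))\<^sup>2 \<partial>lborel) \<le> cmod (\<integral>z. ?A z \<partial>lborel) + cmod (\<integral>z. ?B z \<partial>lborel)"
      unfolding norm_of_real by simp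
  qed
  also have "\<dots> = ennreal (cmod (\<integral>z. ?A z \<partial>lborel)) + ennreal (cmod (\<integral>z. ?B z \<partial>lborel))" by simp
  also have "\<dots> \<le> ?X * ennreal (sqrt (l2sq h)) + ?J"
  proof (rule add_mono)
    show "ennreal (cmod (\<integral>z. ?A z \<partial>lborel)) \<le> ?X * ennreal (sqrt (l2sq h))"
      by (rule symbol_pairing_le[OF F diag m mw h])
    have "ennreal (cmod (\<integral>z. ?B z \<partial>lborel)) \<le> (\<integral>\<^sup>+ z. ennreal (cmod (?B z)) \<partial>lborel)"
      by (rule integral_norm_bound_ennreal[OF iB])
    also have "\<dots> \<le> (\<integral>\<^sup>+ z. (ennreal (m z) * ennreal (cmod (G F z))) * (\<integral>\<^sup>+ z'. Phi (z - z') * (ennreal \<bar>e z z'\<bar> * ennreal (cmod (G F z'))) \<partial>lborel) \<partial>lborel)"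
    proof (rule nn_integral_mono)
      fix z
      have "ennreal (cmod (?B z)) = (ennreal (m z) * ennreal (cmod (G F z))) * ennreal (cmod (complex_of_real (\<rho> z) * G F z - stft \<phi> h z))"
        using m(2)[of z] by (simp only: norm_mult norm_of_real complex_mod_cnj abs_of_nonneg ennreal_mult norm_ge_zero mult_nonneg_nonneg)
      also have "\<dots> \<le> (ennreal (m z) * ennreal (cmod (G F z))) * (\<integral>\<^sup>+ z'. Phi (z - z') * (ennreal \<bar>e z z'\<bar> * ennreal (cmod (G F z'))) \<partial>lborel)"
        by (intro mult_left_mono err) simp
      finally show "ennreal (cmod (?B z)) \<le> \<dots>" .
    qed
    also have "\<dots> = ?J"
    proof (rule nn_integral_cong)
      fix z
      have [measurable]: "e z \<in> borel_measurable borel" unfolding e_def by measurable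
      show "(ennreal (m z) * ennreal (cmod (G F z))) * (\<integral>\<^sup>+ z'. Phi (z - z') * (ennreal \<bar>e z z'\<bar> * ennreal (cmod (G F z'))) \<partial>lborel)
        = (\<integral>\<^sup>+ z'. ennreal (m z) * (ennreal (cmod (G F z)) * (Phi (z - z') * (ennreal \<bar>e z z'\<bar> * ennreal (cmod (G F z'))))) \<partial>lborel)"
        unfolding mult.assoc[symmetric, of "ennreal (m z)"] by (rule nn_integral_cmult[symmetric]) measurable
    qed
    finally show "ennreal (cmod (\<integral>z. ?B z \<partial>lborel)) \<le> ?J" .
  qed
  also have "\<dots> \<le> ?X * ?S + ?J" by (intro add_right_mono mult_left_mono hS) simp
  finally show ?thesis .
qed

end

end

section \<open>The frame inequalities\<close>

lemma local_esssup_le_iff: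
  "local_esssup g z \<le> c \<longleftrightarrow> (AE y in lborel. norm y \<le> 1 \<longrightarrow> ennreal \<bar>g (z + y)\<bar> \<le> c)"
proof
  have eq: "local_esssup g z = LpN top lborel (\<lambda>y. indicator {y. norm y \<le> 1} y * ennreal \<bar>g (z + y)\<bar>)"
    unfolding local_esssup_def LpN_def by (simp add: indicator_def if_distrib cong: if_cong)
  {
    assume "local_esssup g z \<le> c"
    have "AE y in lborel. indicator {y. norm y \<le> 1} y * ennreal \<bar>g (z + y)\<bar> \<le> local_esssup g z"
      unfolding eq by (rule AE_le_LpN_top)
    then show "AE y in lborel. norm y \<le> 1 \<longrightarrow> ennreal \<bar>g (z + y)\<bar> \<le> c"
      by eventually_elim (use \<open>local_esssup g z \<le> c\<close> in \<open>auto simp: indicator_def\<close>)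
  }
  {
    assume "AE y in lborel. norm y \<le> 1 \<longrightarrow> ennreal \<bar>g (z + y)\<bar> \<le> c"
    then show "local_esssup g z \<le> c" unfolding local_esssup_def by (auto intro: Inf_lower)
  }
qed

text \<open>A sublevel set is the zero set of the function giving the measure of {y. norm y \<le> 1
  and |g(z + y)| > c}, and that function is measurable by Fubini.\<close>

lemma local_esssup_borel [measurable]:
  fixes g :: "'a::euclidean_space \<Rightarrow> real"
  assumes [measurable]: "g \<in> borel_measurable borel"
  shows "local_esssup g \<in> borel_measurable borel"
proof (rule borel_measurableI_le)
  fix c
  let ?f = "\<lambda>z. \<integral>\<^sup>+ y. indicator {y. norm y \<le> 1 \<and> c < ennreal \<bar>g (z + y)\<bar>} y \<partial>lborel"
  have m: "(\<lambda>p. if norm (snd p) \<le> 1 \<and> c < ennreal \<bar>g (fst p + snd p)\<bar> then 1 else 0 :: ennreal) \<in> borel_measurable (borel \<Otimes>\<^sub>M lborel)"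
    by measurable
  have f: "?f \<in> borel_measurable borel"
    by (rule lborel.borel_measurable_nn_integral) (use m in \<open>simp add: case_prod_beta indicator_def of_bool_def\<close>)
  have "local_esssup g z \<le> c \<longleftrightarrow> ?f z = 0" for z
  proof -
    have "?f z = 0 \<longleftrightarrow> (AE y in lborel. indicator {y. norm y \<le> 1 \<and> c < ennreal \<bar>g (z + y)\<bar>} y = (0::ennreal))"
      by (rule nn_integral_0_iff_AE) measurable
    also have "\<dots> \<longleftrightarrow> (AE y in lborel. norm y \<le> 1 \<longrightarrow> ennreal \<bar>g (z + y)\<bar> \<le> c)"
      by (rule AE_cong) (auto simp: indicator_def not_less)
    finally show ?thesis by (simp add: local_esssup_le_iff)
  qed
  then have "{z \<in> space borel. local_esssup g z \<le> c} = {z \<in> space borel. ?f z = 0}" by simp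
  also have "\<dots> \<in> sets borel" using f by measurable
  finally show "{z \<in> space borel. local_esssup g z \<le> c} \<in> sets borel" .
qed

text \<open>For every y the local essential supremum at y bounds |g z| for almost all z near y.
  Fubini for null sets exchanges the roles of y and z, after which one averages over y in the unit
  ball around z.\<close>

lemma AE_le_average_local_esssup:
  fixes g :: "'a::euclidean_space \<Rightarrow> real"
  assumes [measurable]: "g \<in> borel_measurable borel"
  shows "AE z in lborel. ennreal (unit_vol TYPE('a)) * ennreal \<bar>g z\<bar> \<le> (\<integral>\<^sup>+ y. indicator (ball z 1) y * local_esssup g y \<partial>lborel)"
proof -
  let ?P = "\<lambda>z y. y \<in> ball z 1 \<longrightarrow> ennreal \<bar>g z\<bar> \<le> local_esssup g y"
  have P: "Measurable.pred (lborel \<Otimes>\<^sub>M lborel) (\<lambda>p. fst p \<in> ball (snd p) 1 \<longrightarrow> ennreal \<bar>g (snd p)\<bar> \<le> local_esssup g (fst p))"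
    unfolding mem_ball by measurable
  have "AE y in lborel. AE z in lborel. ?P z y"
  proof (rule AE_I2)
    fix y :: 'a
    have "AE u in lborel. norm u \<le> 1 \<longrightarrow> ennreal \<bar>g (y + u)\<bar> \<le> local_esssup g y"
      using local_esssup_le_iff[of g y "local_esssup g y"] by simp
    then have "AE u in distr lborel borel ((+) (- y)). norm u \<le> 1 \<longrightarrow> ennreal \<bar>g (y + u)\<bar> \<le> local_esssup g y"
      by (subst lborel_distr_plus)
    then have "AE z in lborel. norm (- y + z) \<le> 1 \<longrightarrow> ennreal \<bar>g (y + (- y + z))\<bar> \<le> local_esssup g y"
      by (subst (asm) AE_distr_iff) auto
    then show "AE z in lborel. ?P z y"
      by eventually_elim (auto simp: dist_norm)
  qed
  then have "AE z in lborel. AE y in lborel. ?P z y"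
    by (subst lborel_pair.AE_commute[symmetric]) (use P in \<open>simp_all add: pred_def space_pair_measure\<close>)
  then show ?thesis
  proof eventually_elim
    case (elim z)
    have "ennreal (unit_vol TYPE('a)) * ennreal \<bar>g z\<bar> = (\<integral>\<^sup>+ y. indicator (ball z 1) y * ennreal \<bar>g z\<bar> \<partial>lborel)"
      by (simp add: nn_integral_ball)
    also have "\<dots> \<le> (\<integral>\<^sup>+ y. indicator (ball z 1) y * local_esssup g y \<partial>lborel)"
      using elim by (intro nn_integral_mono_AE) (auto elim!: eventually_mono simp: indicator_def)
    finally show ?case .
  qed
qed

text \<open>Convolution of the local essential supremum with \<open>sexp 1\<close> dominates its
  unit-ball average and is slowly varying, while the L^1_w norm stays finite.\<close>

lemma (in poly_weight) Wiener_majorant: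
  fixes g :: "'a \<Rightarrow> real"
  assumes "wiener_W w g"
  obtains E where "E \<in> borel_measurable borel" "slowly_varying (exp 1) E" "wnorm1 E < \<infinity>" "AE z in lborel. ennreal \<bar>g z\<bar> \<le> E z"
proof -
  have gm [measurable]: "g \<in> borel_measurable borel" and gw: "wnorm1 (local_esssup g) < \<infinity>"
    using assms by (auto simp: wiener_W_def wnorm1_def)
  let ?V = "unit_vol TYPE('a)"
  have V: "0 < ?V" by (rule unit_vol_pos)
  define E where "E z = ennreal (exp 1 / ?V) * conv_int (sexp 1) (local_esssup g) z" for z
  show ?thesis
  proof (rule that[of E])
    show "E \<in> borel_measurable borel" unfolding E_def by measurable
    have "slowly_varying (exp 1) (conv_int (sexp 1) (local_esssup g))" by (intro slowly_varying_conv_int slowly_varying_sexp) simp_all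
    then show "slowly_varying (exp 1) E"
      unfolding slowly_varying_def E_def by (auto intro!: mult_left_mono simp: mult.left_commute[of "ennreal (exp 1)"])
    have "wnorm1 E = ennreal (exp 1 / ?V) * wnorm1 (conv_int (sexp 1) (local_esssup g))"
      unfolding wnorm1_def E_def mult.assoc by (rule nn_integral_cmult) measurable
    moreover have "wnorm1 (conv_int (sexp 1) (local_esssup g)) < \<infinity>"
    proof (rule order.strict_trans1[OF wnorm1_conv_int])
      show "wnorm1 (sexp 1) * wnorm1 (local_esssup g) < \<infinity>" using wnorm1_sexp_finite[of 1] gw by (simp add: ennreal_mult_less_top)
    qed simp_all
    ultimately show "wnorm1 E < \<infinity>" by (simp add: ennreal_mult_less_top)
    show "AE z in lborel. ennreal \<bar>g z\<bar> \<le> E z"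
      using AE_le_average_local_esssup[OF gm]
    proof eventually_elim
      case (elim z)
      have "(\<integral>\<^sup>+ y. indicator (ball z 1) y * local_esssup g y \<partial>lborel) \<le> (\<integral>\<^sup>+ y. ennreal (exp 1) * (sexp 1 (z - y) * local_esssup g y) \<partial>lborel)"
      proof (rule nn_integral_mono)
        fix y
        have "1 \<le> ennreal (exp 1) * sexp 1 (z - y)" if "y \<in> ball z 1"
        proof -
          have "norm (z - y) / (2 * 1) \<le> 1" using that by (simp add: dist_norm)
          then have "1 \<le> exp 1 * exp (- (norm (z - y) / (2 * 1)))" by (simp add: exp_add[symmetric])
          then show ?thesis by (simp add: sexp_def ennreal_mult[symmetric])
        qed
        from mult_right_mono[OF this, of "local_esssup g y"]
        show "indicator (ball z 1) y * local_esssup g y \<le> ennreal (exp 1) * (sexp 1 (z - y) * local_esssup g y)"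
          by (cases "y \<in> ball z 1") (simp_all add: mult.assoc del: mem_ball)
      qed
      also have "\<dots> = ennreal (exp 1) * conv_int (sexp 1) (local_esssup g) z"
        unfolding conv_int_def by (rule nn_integral_cmult) measurable
      finally have "ennreal ?V * ennreal \<bar>g z\<bar> \<le> ennreal (exp 1) * conv_int (sexp 1) (local_esssup g) z"
        using elim by (rule order_trans[rotated])
      from mult_left_mono[OF this, of "ennreal (1 / ?V)"]
      show ?case using V by (simp add: E_def mult.assoc[symmetric] ennreal_mult[symmetric])
    qed
  qed
qed

section \<open>Sequences indexed by pairs\<close>

lemma nn_integral_fibre:
  fixes N :: "'a \<Rightarrow> nat" and \<Gamma> :: "'a set"
  defines "S \<equiv> {(\<gamma>, k). \<gamma> \<in> \<Gamma> \<and> k < N \<gamma>}"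
  assumes "\<gamma> \<in> \<Gamma>"
  shows "(\<integral>\<^sup>+ s. (if fst s = \<gamma> then 1 else 0) * h s \<partial>count_space S) = (\<Sum>k<N \<gamma>. h (\<gamma>, k) :: ennreal)"
proof -
  have "(\<integral>\<^sup>+ s. (if fst s = \<gamma> then 1 else 0) * h s \<partial>count_space S) = (\<Sum>s\<in>Pair \<gamma> ` {..<N \<gamma>}. (if fst s = \<gamma> then 1 else 0) * h s)"
    using assms(2) by (intro nn_integral_count_space') (auto simp: S_def)
  also have "\<dots> = (\<Sum>k<N \<gamma>. h (\<gamma>, k))"
    by (subst sum.reindex) (auto simp: inj_on_def)
  finally show ?thesis .
qed

text \<open>Schur's test for the kernel that is 1 where the first component equals \<gamma>: row
  sums are N \<gamma> \<le> M and column sums are 1. This is where boundedness of the N \<gamma>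
  enters; it affects the frame constants but not \<alpha>.\<close>

lemma LpN_fibres:
  fixes N :: "'a \<Rightarrow> nat" and \<Gamma> :: "'a set"
  defines "S \<equiv> {(\<gamma>, k). \<gamma> \<in> \<Gamma> \<and> k < N \<gamma>}"
  assumes \<Gamma>: "countable \<Gamma>" and N: "\<And>\<gamma>. \<gamma> \<in> \<Gamma> \<Longrightarrow> N \<gamma> \<le> M" and M: "1 \<le> M" and p: "1 \<le> p"
  shows "LpN p (count_space \<Gamma>) (\<lambda>\<gamma>. \<Sum>k<N \<gamma>. h (\<gamma>, k)) \<le> ennreal (2 * real M) * LpN p (count_space S) h"
    and "LpN p (count_space S) (\<lambda>s. T (fst s)) \<le> ennreal (2 * real M) * LpN p (count_space \<Gamma>) T"
proof -
  have "countable (\<Gamma> \<times> (UNIV :: nat set))" using \<Gamma> by simp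
  then have S: "countable S" by (rule countable_subset[rotated]) (auto simp: S_def)
  let ?k = "\<lambda>\<gamma> s. if fst s = \<gamma> then 1 else 0 :: ennreal"
  have row: "(\<integral>\<^sup>+ s. ?k \<gamma> s \<partial>count_space S) \<le> ennreal (real M)" if "\<gamma> \<in> \<Gamma>" for \<gamma>
    using nn_integral_fibre[OF that, of N "\<lambda>_. 1"] N[OF that] by (simp add: S_def ennreal_of_nat_eq_real_of_nat ennreal_leI)
  have single: "(\<integral>\<^sup>+ \<gamma>. ?k \<gamma> s * T' \<gamma> \<partial>count_space \<Gamma>) = T' (fst s)" if "s \<in> S" for s and T' :: "'a \<Rightarrow> ennreal"
  proof -
    have "(\<integral>\<^sup>+ \<gamma>. ?k \<gamma> s * T' \<gamma> \<partial>count_space \<Gamma>) = (\<Sum>\<gamma>\<in>{fst s}. ?k \<gamma> s * T' \<gamma>)"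
      using that by (intro nn_integral_count_space') (auto simp: S_def)
    then show ?thesis by simp
  qed
  have col: "(\<integral>\<^sup>+ \<gamma>. ?k \<gamma> s \<partial>count_space \<Gamma>) \<le> ennreal (real M)" if "s \<in> S" for s
    using single[OF that, of "\<lambda>_. 1"] M by simp
  have "LpN p (count_space \<Gamma>) (\<lambda>\<gamma>. \<Sum>k<N \<gamma>. h (\<gamma>, k)) \<le> LpN p (count_space \<Gamma>) (\<lambda>\<gamma>. \<integral>\<^sup>+ s. ?k \<gamma> s * h s \<partial>count_space S)"
    unfolding S_def by (intro LpN_mono[OF p]) (simp add: nn_integral_fibre)
  also have "\<dots> \<le> ennreal (2 * real M) * LpN p (count_space S) h"
    using row col M p
    by (intro Schur_test sigma_finite_count \<Gamma> S measurable_count_pair) auto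
  finally show "LpN p (count_space \<Gamma>) (\<lambda>\<gamma>. \<Sum>k<N \<gamma>. h (\<gamma>, k)) \<le> ennreal (2 * real M) * LpN p (count_space S) h" .
  have "LpN p (count_space S) (\<lambda>s. T (fst s)) \<le> LpN p (count_space S) (\<lambda>s. \<integral>\<^sup>+ \<gamma>. ?k \<gamma> s * T \<gamma> \<partial>count_space \<Gamma>)"
    by (intro LpN_mono[OF p]) (simp add: single)
  also have "\<dots> \<le> ennreal (2 * real M) * LpN p (count_space \<Gamma>) T"
    using row col M p
    by (intro Schur_test sigma_finite_count \<Gamma> S measurable_count_pair) auto
  finally show "LpN p (count_space S) (\<lambda>s. T (fst s)) \<le> ennreal (2 * real M) * LpN p (count_space \<Gamma>) T" .
qed

lemma AE_lborel_translate:
  fixes c :: "'a::euclidean_space"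
  assumes "AE z in lborel. P z"
  shows "AE z in lborel. P (z - c)"
proof -
  have "AE z in distr lborel borel ((+) (- c)). P z" using assms by (subst lborel_distr_plus)
  then have "AE z in lborel. P (- c + z)" by (rule AE_distrD[rotated]) simp
  then show ?thesis by (simp add: add.commute)
qed

section \<open>Assembly of the two frame inequalities\<close>

locale phase_frame = tf w \<phi> + phase w \<Gamma> K "exp 1" Phi E "\<lambda>\<gamma> z. ennreal (\<eta> \<gamma> z)" A B
  for w :: "(real^'d) \<times> (real^'d) \<Rightarrow> real" and \<phi> \<Gamma> K E and \<eta> :: "(real^'d) \<times> (real^'d) \<Rightarrow> (real^'d) \<times> (real^'d) \<Rightarrow> real" and A B +
  fixes lam :: "(real^'d) \<times> (real^'d) \<Rightarrow> nat \<Rightarrow> real" and phis :: "(real^'d) \<times> (real^'d) \<Rightarrow> nat \<Rightarrow> real^'d \<Rightarrow> complex"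
  assumes \<eta>_nonneg: "\<And>\<gamma> z. \<gamma> \<in> \<Gamma> \<Longrightarrow> 0 \<le> \<eta> \<gamma> z"
    and \<eta>_int: "\<And>\<gamma>. \<gamma> \<in> \<Gamma> \<Longrightarrow> integrable lborel (\<eta> \<gamma>)"
    and diag: "\<And>\<gamma>. \<gamma> \<in> \<Gamma> \<Longrightarrow> diagonalizes \<phi> (\<eta> \<gamma>) (lam \<gamma>) (phis \<gamma>)"
begin

lemma \<eta>_le_E: "\<gamma> \<in> \<Gamma> \<Longrightarrow> AE z in lborel. ennreal (\<eta> \<gamma> z) \<le> E (z - \<gamma>)"
  using \<eta>_le by eventually_elim auto

lemma \<eta>_w_finite:
  assumes "\<gamma> \<in> \<Gamma>"
  shows "(\<integral>\<^sup>+ z. ennreal (\<eta> \<gamma> z) * ennreal (w z) \<partial>lborel) < \<infinity>"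
proof (rule order.strict_trans1)
  show "(\<integral>\<^sup>+ z. ennreal (\<eta> \<gamma> z) * ennreal (w z) \<partial>lborel) \<le> (\<integral>\<^sup>+ z. E (z - \<gamma>) * ennreal (w z) \<partial>lborel)"
    using \<eta>_le_E[OF assms] by (intro nn_integral_mono_AE) (auto elim!: eventually_mono intro: mult_right_mono)
  show "(\<integral>\<^sup>+ z. E (z - \<gamma>) * ennreal (w z) \<partial>lborel) < \<infinity>"
    by (rule order.strict_trans1[OF nn_integral_translate_w[OF E_borel]]) (use E_wnorm1 in \<open>simp add: ennreal_mult_less_top\<close>)
qed

abbreviation coef :: "((real^'d \<Rightarrow> complex) \<Rightarrow> complex) \<Rightarrow> (real^'d) \<times> (real^'d) \<Rightarrow> nat \<Rightarrow> ennreal" where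
  "coef F \<gamma> k \<equiv> ennreal (cmod (F (\<lambda>t. complex_of_real (lam \<gamma> k) * phis \<gamma> k t)))"

abbreviation gab :: "((real^'d \<Rightarrow> complex) \<Rightarrow> complex) \<Rightarrow> (real^'d) \<times> (real^'d) \<Rightarrow> ennreal" where
  "gab F z \<equiv> ennreal (cmod (F (tf_shift z \<phi>)))"

lemma gab_borel:
  assumes "Minf w F"
  shows "(\<lambda>z. cmod (F (tf_shift z \<phi>))) \<in> borel_measurable borel" "gab F \<in> borel_measurable borel"
proof -
  note [measurable] = GF_borel[OF assms]
  have "(\<lambda>z. cmod (G F z)) \<in> borel_measurable borel" by measurable
  then show "(\<lambda>z. cmod (F (tf_shift z \<phi>))) \<in> borel_measurable borel" by (simp add: G_def[OF assms])
  then show "gab F \<in> borel_measurable borel" by measurable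
qed

lemma coef_le:
  assumes F: "Minf w F" and \<gamma>: "\<gamma> \<in> \<Gamma>"
  shows "coef F \<gamma> k \<le> (\<integral>\<^sup>+ z. E (z - \<gamma>) * gab F z \<partial>lborel)"
proof -
  note D = diag[OF \<gamma>] and m = \<eta>_int[OF \<gamma>] \<eta>_nonneg[OF \<gamma>] and mw = \<eta>_w_finite[OF \<gamma>]
  have sq: "sq_integrable (phis \<gamma> k)" by (rule phis_sq[OF D \<phi>_sq \<phi>_norm m])
  have "coef F \<gamma> k \<le> (\<integral>\<^sup>+ z. ennreal (cmod (complex_of_real (\<eta> \<gamma> z) * cnj (stft \<phi> (phis \<gamma> k) z) * G F z)) \<partial>lborel)"
    unfolding F_eigenfunction[OF F D m mw] by (rule integral_norm_bound_ennreal[OF symbol_G_integrable[OF F D m mw sq]])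
  also have "\<dots> \<le> (\<integral>\<^sup>+ z. E (z - \<gamma>) * gab F z \<partial>lborel)"
  proof (rule nn_integral_mono_AE, use \<eta>_le_E[OF \<gamma>] in eventually_elim)
    case (elim z)
    have "cmod (stft \<phi> (phis \<gamma> k) z) \<le> 1"
      using cmod_stft_le[OF sq \<phi>_sq, of z] l2sq_phis[OF D \<phi>_sq \<phi>_norm m] \<phi>_norm by simp
    then have "ennreal (cmod (complex_of_real (\<eta> \<gamma> z) * cnj (stft \<phi> (phis \<gamma> k) z) * G F z)) \<le> ennreal (\<eta> \<gamma> z * 1 * cmod (G F z))"
      using m(2)[of z] unfolding norm_mult norm_of_real complex_mod_cnj
      by (intro ennreal_leI mult_right_mono mult_mono) auto
    also have "\<dots> \<le> E (z - \<gamma>) * gab F z"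
      using elim m(2)[of z] by (simp add: ennreal_mult mult_right_mono G_def[OF F])
    finally show ?case .
  qed
  finally show ?thesis .
qed

text \<open>Slow variation bounds a value by a local average, and that by the integral. The bound
  becomes the M in the choice of \<alpha>.\<close>

lemma E_bounded:
  obtains M where "0 < M" "\<And>z. E z \<le> ennreal M"
proof -
  have "ennreal (exp 1 / unit_vol TYPE((real^'d) \<times> (real^'d))) * (\<integral>\<^sup>+ z. E z \<partial>lborel) < \<infinity>"
    using nn_integral_finite[OF E_wnorm1] by (simp add: ennreal_mult_less_top)
  then obtain M where M: "0 < M" "ennreal (exp 1 / unit_vol TYPE((real^'d) \<times> (real^'d))) * (\<integral>\<^sup>+ z. E z \<partial>lborel) \<le> ennreal M"
    by (rule ennreal_bound_real)
  show ?thesis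
  proof (rule that[OF M(1)])
    fix z
    have "E z \<le> ennreal (exp 1 / unit_vol TYPE((real^'d) \<times> (real^'d))) * (\<integral>\<^sup>+ y. indicator (ball z 1) y * E y \<partial>lborel)"
      by (rule slowly_varying_local_average[OF E_slowly_varying _ E_borel]) simp
    also have "\<dots> \<le> ennreal (exp 1 / unit_vol TYPE((real^'d) \<times> (real^'d))) * (\<integral>\<^sup>+ z. E z \<partial>lborel)"
      by (intro mult_left_mono nn_integral_mono) (auto simp: indicator_def)
    finally show "E z \<le> ennreal M" using M(2) by (rule order_trans)
  qed
qed

text \<open>Within distance r of \<gamma> the squared \<open>sexp r\<close> is at least 1/e, whence
  the factor \<open>M * exp 1\<close>.\<close>

lemma near_part_le:
  assumes \<gamma>: "\<gamma> \<in> \<Gamma>" and r: "1 \<le> r" and M: "0 < M" "\<And>z. E z \<le> ennreal M" and [measurable]: "g \<in> borel_measurable borel"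
  shows "enn_rpow (1/2) (\<integral>\<^sup>+ z. indicator {z. norm (z - \<gamma>) \<le> r} z * (ennreal (\<eta> \<gamma> z) * (g z)\<^sup>2) \<partial>lborel)
    \<le> ennreal (sqrt (M * exp 1)) * loc2 r g \<gamma>"
proof (rule enn_rpow_half_le)
  have "(\<integral>\<^sup>+ z. indicator {z. norm (z - \<gamma>) \<le> r} z * (ennreal (\<eta> \<gamma> z) * (g z)\<^sup>2) \<partial>lborel) \<le> (\<integral>\<^sup>+ z. ennreal (M * exp 1) * (sexp r (z - \<gamma>) * g z)\<^sup>2 \<partial>lborel)"
  proof (rule nn_integral_mono_AE, use \<eta>_le_E[OF \<gamma>] in eventually_elim)
    case (elim z)
    show ?case
    proof (cases "norm (z - \<gamma>) \<le> r")
      case True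
      then have "norm (z - \<gamma>) / r \<le> 1" using r by simp
      then have "1 \<le> exp 1 * exp (- (norm (z - \<gamma>) / r))" by (simp add: exp_add[symmetric])
      then have "M * 1 \<le> M * (exp 1 * exp (- (norm (z - \<gamma>) / r)))" using M(1) by (intro mult_left_mono) auto
      then have "ennreal M \<le> ennreal (M * exp 1) * (sexp r (z - \<gamma>))\<^sup>2"
        using M(1) r by (simp add: sexp_square ennreal_mult[symmetric] ennreal_leI mult.assoc)
      then have "ennreal (\<eta> \<gamma> z) \<le> ennreal (M * exp 1) * (sexp r (z - \<gamma>))\<^sup>2"
        using elim M(2)[of "z - \<gamma>"] by (meson order_trans)
      from mult_right_mono[OF this, of "(g z)\<^sup>2"] show ?thesis
        using True by (simp add: power_mult_distrib mult.assoc)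
    qed simp
  qed
  also have "\<dots> = ennreal (M * exp 1) * (\<integral>\<^sup>+ z. (sexp r (z - \<gamma>) * g z)\<^sup>2 \<partial>lborel)"
    by (rule nn_integral_cmult) measurable
  also have "\<dots> = (ennreal (sqrt (M * exp 1)) * loc2 r g \<gamma>)\<^sup>2"
    using M(1) by (simp add: power_mult_distrib loc2_def enn_rpow_half_sq ennreal_power)
  finally show "(\<integral>\<^sup>+ z. indicator {z. norm (z - \<gamma>) \<le> r} z * (ennreal (\<eta> \<gamma> z) * (g z)\<^sup>2) \<partial>lborel) \<le> (ennreal (sqrt (M * exp 1)) * loc2 r g \<gamma>)\<^sup>2" .
qed

text \<open>Here the hypothesis on N \<gamma> enters: it yields
  \<open>lam \<gamma> (N \<gamma>)\<close> \<le> t^2 / (M e), and the root of this times the root of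
  M e from \<open>near_part_le\<close> is at most \<open>t\<close>.\<close>

lemma local_energy_truncated:
  assumes F: "Minf w F" and R: "1 \<le> R" and r: "1 \<le> r" and t: "0 < t"
    and M: "0 < M" "\<And>z. E z \<le> ennreal M"
    and N: "\<And>\<gamma>. \<gamma> \<in> \<Gamma> \<Longrightarrow> M * exp 1 / t\<^sup>2 * (\<integral>z. \<eta> \<gamma> z \<partial>lborel) \<le> real (N \<gamma>)"
  shows "local_energy R (gab F) (\<lambda>\<gamma>. (\<Sum>k<N \<gamma>. coef F \<gamma> k) + (ennreal t * loc2 r (gab F) \<gamma> + (\<integral>\<^sup>+ z. tail r (z - \<gamma>) * gab F z \<partial>lborel)))"
  unfolding local_energy_def
proof (intro allI ballI)
  fix y \<gamma> assume \<gamma>: "\<gamma> \<in> \<Gamma>"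
  note D = diag[OF \<gamma>] and m = \<eta>_int[OF \<gamma>] \<eta>_nonneg[OF \<gamma>] and mw = \<eta>_w_finite[OF \<gamma>]
  note [measurable] = gab_borel(1)[OF F]
  let ?L = "ennreal (sqrt (lam \<gamma> (N \<gamma>)))"
  let ?near = "\<integral>\<^sup>+ z. indicator {z. norm (z - \<gamma>) \<le> r} z * (ennreal (\<eta> \<gamma> z) * (gab F z)\<^sup>2) \<partial>lborel"
  let ?far = "\<integral>\<^sup>+ z. indicator {z. r < norm (z - \<gamma>)} z * (ennreal (\<eta> \<gamma> z) * gab F z) \<partial>lborel"
  have "lam \<gamma> (N \<gamma>) \<le> 1 / (M * exp 1 / t\<^sup>2)"
    using N[OF \<gamma>] M(1) t by (intro lam_le[OF D \<phi>_sq \<phi>_norm m]) auto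
  then have "lam \<gamma> (N \<gamma>) * (M * exp 1) \<le> t\<^sup>2" using M(1) t by (simp add: field_simps)
  then have "sqrt (lam \<gamma> (N \<gamma>)) * sqrt (M * exp 1) \<le> t"
    using real_sqrt_le_mono t by (fastforce simp: real_sqrt_mult)
  then have Lt: "?L * ennreal (sqrt (M * exp 1)) \<le> ennreal t"
    using lam_nonneg[OF D \<phi>_sq \<phi>_norm m] M(1) by (simp add: ennreal_mult[symmetric] ennreal_leI)
  have "?L * enn_rpow (1/2) ?near \<le> ?L * (ennreal (sqrt (M * exp 1)) * loc2 r (gab F) \<gamma>)"
    by (intro mult_left_mono near_part_le[OF \<gamma> r M]) auto
  also have "\<dots> \<le> ennreal t * loc2 r (gab F) \<gamma>"
    unfolding mult.assoc[symmetric] by (intro mult_right_mono Lt) simp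
  finally have 1: "?L * enn_rpow (1/2) ?near \<le> ennreal t * loc2 r (gab F) \<gamma>" .
  have 2: "?far \<le> (\<integral>\<^sup>+ z. tail r (z - \<gamma>) * gab F z \<partial>lborel)"
  proof (rule nn_integral_mono_AE, use \<eta>_le_E[OF \<gamma>] in eventually_elim)
    case (elim z)
    then show ?case by (auto simp: tail_def indicator_def intro: mult_right_mono)
  qed
  let ?S = "enn_rpow (1/2) (\<integral>\<^sup>+ z. indicator (ball \<gamma> R) z * ((sexp R (z - y))\<^sup>2 * gab F z)\<^sup>2 \<partial>lborel)"
  have "(\<integral>\<^sup>+ z. ennreal (\<eta> \<gamma> z) * (sexp R (z - y) * gab F z)\<^sup>2 \<partial>lborel)
    \<le> ((\<Sum>k<N \<gamma>. coef F \<gamma> k) + (?L * enn_rpow (1/2) ?near + ?far)) * ?S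
     + (\<integral>\<^sup>+ z. (\<integral>\<^sup>+ z'. ennreal (\<eta> \<gamma> z) * (gab F z * (Phi (z - z') * (cutoff_err R y \<gamma> z z' * gab F z'))) \<partial>lborel) \<partial>lborel)"
    using local_energy_bound[OF F D m mw R, where y = y and \<gamma> = \<gamma> and n = "N \<gamma>" and r = r] by (simp add: G_def[OF F] cutoff_err_def)
  also have "\<dots> \<le> ((\<Sum>k<N \<gamma>. coef F \<gamma> k) + (ennreal t * loc2 r (gab F) \<gamma> + (\<integral>\<^sup>+ z. tail r (z - \<gamma>) * gab F z \<partial>lborel))) * ?S
     + (\<integral>\<^sup>+ z. (\<integral>\<^sup>+ z'. ennreal (\<eta> \<gamma> z) * (gab F z * (Phi (z - z') * (cutoff_err R y \<gamma> z z' * gab F z'))) \<partial>lborel) \<partial>lborel)"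
    by (intro add_right_mono mult_right_mono add_left_mono add_mono 1 2) simp
  finally show "(\<integral>\<^sup>+ z. ennreal (\<eta> \<gamma> z) * (sexp R (z - y) * gab F z)\<^sup>2 \<partial>lborel) \<le> \<dots>" .
qed

lemma frame_bounds:
  assumes Cv: "0 < Cv"
  shows "\<exists>\<alpha>>0. \<forall>v N p. moderated Cv v \<longrightarrow> (\<forall>\<gamma>\<in>\<Gamma>. \<alpha> * (\<integral>z. \<eta> \<gamma> z \<partial>lborel) \<le> real (N \<gamma>)) \<longrightarrow> bdd_above (N ` \<Gamma>) \<longrightarrow> 1 \<le> p \<longrightarrow>
    (\<exists>a b. 0 < a \<and> 0 < b \<and> (\<forall>F. Minf w F \<and> LpN p lborel (\<lambda>z. gab F z * ennreal (v z)) < top \<longrightarrow>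
       ennreal a * LpN p lborel (\<lambda>z. gab F z * ennreal (v z))
         \<le> LpN p (count_space {(\<gamma>, k). \<gamma> \<in> \<Gamma> \<and> k < N \<gamma>}) (\<lambda>s. coef F (fst s) (snd s) * ennreal (v (fst s))) \<and>
       LpN p (count_space {(\<gamma>, k). \<gamma> \<in> \<Gamma> \<and> k < N \<gamma>}) (\<lambda>s. coef F (fst s) (snd s) * ennreal (v (fst s)))
         \<le> ennreal b * LpN p lborel (\<lambda>z. gab F z * ennreal (v z))))"
proof -
  obtain R r t D where RrtD: "1 \<le> R" "1 \<le> r" "0 < t" "0 < D"
    and lower: "\<And>v g P p C. moderated Cv v \<Longrightarrow> g \<in> borel_measurable borel \<Longrightarrow> (\<And>z. g z \<le> conv_int Phi g z)
      \<Longrightarrow> (\<And>z. g z \<le> ennreal (C * w z))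
      \<Longrightarrow> local_energy R g (\<lambda>\<gamma>. P \<gamma> + (ennreal t * loc2 r g \<gamma> + (\<integral>\<^sup>+ z. tail r (z - \<gamma>) * g z \<partial>lborel))) \<Longrightarrow> 1 \<le> p
      \<Longrightarrow> LpN p lborel (\<lambda>x. g x * ennreal (v x)) < \<infinity>
      \<Longrightarrow> LpN p lborel (\<lambda>x. g x * ennreal (v x)) \<le> ennreal D * LpN p (count_space \<Gamma>) (\<lambda>x. P x * ennreal (v x))"
    using local_energy_truncated_bound[OF Cv] by blast
  obtain C where C: "0 < C"
    and upper: "\<And>Cv v g p. moderated Cv v \<Longrightarrow> g \<in> borel_measurable borel \<Longrightarrow> 1 \<le> p \<Longrightarrow>
       LpN p (count_space \<Gamma>) (\<lambda>\<gamma>. (\<integral>\<^sup>+ z. E (z - \<gamma>) * g z \<partial>lborel) * ennreal (v \<gamma>))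
       \<le> ennreal (2 * Cv * C) * LpN p lborel (\<lambda>x. g x * ennreal (v x))"
    using lattice_norm_le by blast
  obtain M where M: "0 < M" "\<And>z. E z \<le> ennreal M" using E_bounded by blast
  show ?thesis
  proof (rule exI[of _ "M * exp 1 / t\<^sup>2"], intro conjI allI impI)
    show "0 < M * exp 1 / t\<^sup>2" using M RrtD by simp
    fix v N and p :: ennreal
    assume v: "moderated Cv v" and N: "\<forall>\<gamma>\<in>\<Gamma>. M * exp 1 / t\<^sup>2 * (\<integral>z. \<eta> \<gamma> z \<partial>lborel) \<le> real (N \<gamma>)"
      and bdd: "bdd_above (N ` \<Gamma>)" and p: "1 \<le> p"
    obtain Nm0 where "\<And>\<gamma>. \<gamma> \<in> \<Gamma> \<Longrightarrow> N \<gamma> \<le> Nm0" using bdd by (auto simp: bdd_above_def)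
    \<comment> \<open>The successor guarantees a bound of at least 1, as \<open>LpN_fibres\<close>
      requires, even if every N \<gamma> is 0.\<close>
    then have Nm: "\<And>\<gamma>. \<gamma> \<in> \<Gamma> \<Longrightarrow> N \<gamma> \<le> Suc Nm0" by (simp add: le_SucI)
    define n where "n = real (Suc Nm0)"
    have n: "0 < n" by (simp add: n_def)
    let ?S = "{(\<gamma>, k). \<gamma> \<in> \<Gamma> \<and> k < N \<gamma>}"
    show "\<exists>a b. 0 < a \<and> 0 < b \<and> (\<forall>F. Minf w F \<and> LpN p lborel (\<lambda>z. gab F z * ennreal (v z)) < top \<longrightarrow>
       ennreal a * LpN p lborel (\<lambda>z. gab F z * ennreal (v z))
         \<le> LpN p (count_space ?S) (\<lambda>s. coef F (fst s) (snd s) * ennreal (v (fst s))) \<and>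
       LpN p (count_space ?S) (\<lambda>s. coef F (fst s) (snd s) * ennreal (v (fst s)))
         \<le> ennreal b * LpN p lborel (\<lambda>z. gab F z * ennreal (v z)))"
    \<comment> \<open>The lower constant combines the factor D of the absorption with the passage
      from pairs to \<Gamma>, the upper one the same passage with \<open>lattice_norm_le\<close>.
      Neither depends on p.\<close>
    proof (rule exI[of _ "1 / (D * (2 * n))"], rule exI[of _ "2 * n * (2 * Cv * C)"], intro conjI allI impI)
      show "0 < 1 / (D * (2 * n))" "0 < 2 * n * (2 * Cv * C)" using RrtD n Cv C by simp_all
      fix F assume "Minf w F \<and> LpN p lborel (\<lambda>z. gab F z * ennreal (v z)) < top"
      then have F: "Minf w F" and fin: "LpN p lborel (\<lambda>z. gab F z * ennreal (v z)) < \<infinity>"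
        by (simp_all add: infinity_ennreal_def)
      let ?L = "LpN p lborel (\<lambda>z. gab F z * ennreal (v z))"
        and ?c = "LpN p (count_space ?S) (\<lambda>s. coef F (fst s) (snd s) * ennreal (v (fst s)))"
      obtain C' where C': "0 \<le> C'" "\<And>z. cmod (G F z) \<le> C' * w z" using G_le_w[OF F] by blast
      have "?L \<le> ennreal D * LpN p (count_space \<Gamma>) (\<lambda>\<gamma>. (\<Sum>k<N \<gamma>. coef F \<gamma> k) * ennreal (v \<gamma>))"
      proof (rule lower[where C = C', OF v gab_borel(2)[OF F] _ _ _ p fin])
        show "gab F z \<le> conv_int Phi (gab F) z" for z using ga_le_conv_int[OF F, of z] by (simp add: G_def[OF F])
        show "gab F z \<le> ennreal (C' * w z)" for z using C'(2)[of z] by (intro ennreal_leI) (simp add: G_def[OF F])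
        show "local_energy R (gab F) (\<lambda>\<gamma>. (\<Sum>k<N \<gamma>. coef F \<gamma> k) + (ennreal t * loc2 r (gab F) \<gamma> + (\<integral>\<^sup>+ z. tail r (z - \<gamma>) * gab F z \<partial>lborel)))"
          using N by (intro local_energy_truncated[OF F RrtD(1,2,3) M]) auto
      qed
      also have "\<dots> \<le> ennreal D * (ennreal (2 * n) * ?c)"
        using LpN_fibres(1)[where N = N and M = "Suc Nm0", OF countable_\<Gamma> Nm _ p, where h = "\<lambda>s. coef F (fst s) (snd s) * ennreal (v (fst s))"]
        by (intro mult_left_mono) (simp_all add: n_def sum_distrib_right del: sum_ennreal of_nat_Suc)
      finally have "ennreal (1 / (D * (2 * n))) * ?L \<le> ennreal (1 / (D * (2 * n))) * (ennreal D * (ennreal (2 * n) * ?c))"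
        by (rule mult_left_mono) simp
      also have "\<dots> = ennreal (1 / (D * (2 * n)) * D * (2 * n)) * ?c"
        using RrtD n by (intro ennreal_mult3) auto
      also have "1 / (D * (2 * n)) * D * (2 * n) = 1" using RrtD n by simp
      finally show "ennreal (1 / (D * (2 * n))) * ?L \<le> ?c" by simp
      have "?c \<le> LpN p (count_space ?S) (\<lambda>s. (\<integral>\<^sup>+ z. E (z - fst s) * gab F z \<partial>lborel) * ennreal (v (fst s)))"
        by (intro LpN_mono[OF p] mult_right_mono coef_le[OF F]) auto
      also have "\<dots> \<le> ennreal (2 * n) * LpN p (count_space \<Gamma>) (\<lambda>\<gamma>. (\<integral>\<^sup>+ z. E (z - \<gamma>) * gab F z \<partial>lborel) * ennreal (v \<gamma>))"
        using LpN_fibres(2)[where N = N and M = "Suc Nm0", OF countable_\<Gamma> Nm _ p, where T = "\<lambda>\<gamma>. (\<integral>\<^sup>+ z. E (z - \<gamma>) * gab F z \<partial>lborel) * ennreal (v \<gamma>)"]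
        by (simp add: n_def del: of_nat_Suc)
      also have "\<dots> \<le> ennreal (2 * n) * (ennreal (2 * Cv * C) * ?L)"
        by (intro mult_left_mono upper[OF v gab_borel(2)[OF F] p]) simp
      also have "\<dots> = ennreal (2 * n * (2 * Cv * C)) * ?L" using n Cv C by (simp add: ennreal_mult[symmetric] mult.assoc[symmetric])
      finally show "?c \<le> ennreal (2 * n * (2 * Cv * C)) * ?L" .
    qed
  qed
qed

end

text \<open>Choosing \<alpha> after \<open>Cv\<close> but before the weight, the numbers and the
  exponent expresses both its uniformity over weights with a common constant and its validity for
  all p simultaneously.\<close>

theorem theorem5p5:
  fixes w :: "(real^'d) \<times> (real^'d) \<Rightarrow> real"
    and \<phi> :: "real^'d \<Rightarrow> complex"
    and \<Gamma> :: "((real^'d) \<times> (real^'d)) set"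
    and \<eta> :: "(real^'d) \<times> (real^'d) \<Rightarrow> (real^'d) \<times> (real^'d) \<Rightarrow> real"
    and lam :: "(real^'d) \<times> (real^'d) \<Rightarrow> nat \<Rightarrow> real"
    and phis :: "(real^'d) \<times> (real^'d) \<Rightarrow> nat \<Rightarrow> real^'d \<Rightarrow> complex"
  assumes w_adm: "admissible_weight w"
    and phi_M1: "M1 w \<phi>"
    and phi_norm: "(\<integral>t. (cmod (\<phi> t))\<^sup>2 \<partial>lborel) = 1"
    and eta_meas: "\<forall>\<gamma>\<in>\<Gamma>. \<eta> \<gamma> \<in> borel_measurable lborel"
    and eta_nonneg: "\<forall>\<gamma>\<in>\<Gamma>. \<forall>z. 0 \<le> \<eta> \<gamma> z"
    and eta_L1: "\<forall>\<gamma>\<in>\<Gamma>. integrable lborel (\<eta> \<gamma>)"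
    and eta_Linf: "\<forall>\<gamma>\<in>\<Gamma>. \<exists>B. AE z in lborel. \<eta> \<gamma> z \<le> B"
    and spread: "well_spread w \<Gamma> \<eta>"
    and partition: "\<exists>A B. 0 < A \<and> A \<le> B \<and>
        (\<forall>z. ennreal A \<le> (\<integral>\<^sup>+ \<gamma>. ennreal (\<eta> \<gamma> z) \<partial>count_space \<Gamma>)
           \<and> (\<integral>\<^sup>+ \<gamma>. ennreal (\<eta> \<gamma> z) \<partial>count_space \<Gamma>) \<le> ennreal B)"
    and diag: "\<forall>\<gamma>\<in>\<Gamma>. diagonalizes \<phi> (\<eta> \<gamma>) (lam \<gamma>) (phis \<gamma>)"
  shows "\<forall>Cv. \<exists>\<alpha>>0. \<forall>v N.
           moderated_with w Cv v \<and>
           (\<forall>\<gamma>\<in>\<Gamma>. \<alpha> * (\<integral>z. \<eta> \<gamma> z \<partial>lborel) \<le> real (N \<gamma>)) \<and>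
           bdd_above (N ` \<Gamma>)
           \<longrightarrow> (\<forall>p::ennreal. 1 \<le> p \<longrightarrow>
                 (\<exists>A B. 0 < A \<and> 0 < B \<and>
                    (\<forall>F. Minf w F \<and> Mp_norm p \<phi> v F < top \<longrightarrow>
                       ennreal A * Mp_norm p \<phi> v F
                         \<le> Lp_norm p (count_space {(\<gamma>, k). \<gamma> \<in> \<Gamma> \<and> k < N \<gamma>})
                              (\<lambda>(\<gamma>, k). cmod (F (\<lambda>t. complex_of_real (lam \<gamma> k) * phis \<gamma> k t)) * v \<gamma>)
                       \<and> Lp_norm p (count_space {(\<gamma>, k). \<gamma> \<in> \<Gamma> \<and> k < N \<gamma>})
                              (\<lambda>(\<gamma>, k). cmod (F (\<lambda>t. complex_of_real (lam \<gamma> k) * phis \<gamma> k t)) * v \<gamma>)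
                         \<le> ennreal B * Mp_norm p \<phi> v F)))"
proof
  fix Cv :: real
  interpret poly_weight w by (rule admissible_poly_weight[OF w_adm])
  interpret tf w \<phi> by standard (use phi_M1 phi_norm in \<open>simp_all add: l2sq_def\<close>)
  obtain K where K: "separated_by K \<Gamma>" using spread by (auto simp: well_spread_def separated_by_def)
  obtain g where g: "wiener_W w g" and \<eta>g: "\<And>\<gamma> z. \<gamma> \<in> \<Gamma> \<Longrightarrow> \<bar>\<eta> \<gamma> z\<bar> \<le> g (z - \<gamma>)"
    using spread unfolding well_spread_def by blast
  obtain E where E: "E \<in> borel_measurable borel" "slowly_varying (exp 1) E" "wnorm1 E < \<infinity>" "AE z in lborel. ennreal \<bar>g z\<bar> \<le> E z"
    using Wiener_majorant[OF g] by blast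
  obtain A B where AB: "0 < A" "A \<le> B" "\<And>z. ennreal A \<le> (\<integral>\<^sup>+ \<gamma>. ennreal (\<eta> \<gamma> z) \<partial>count_space \<Gamma>)"
    "\<And>z. (\<integral>\<^sup>+ \<gamma>. ennreal (\<eta> \<gamma> z) \<partial>count_space \<Gamma>) \<le> ennreal B"
    using partition by blast
  interpret phase_frame w \<phi> \<Gamma> K E \<eta> A B lam phis
  proof unfold_locales
    show "1 \<le> exp (1::real)" by simp
    show "(\<lambda>z. ennreal (\<eta> \<gamma> z)) \<in> borel_measurable borel" if "\<gamma> \<in> \<Gamma>" for \<gamma>
      using eta_meas that by auto
    have "AE z in lborel. ennreal (\<eta> \<gamma> z) \<le> E (z - \<gamma>)" if "\<gamma> \<in> \<Gamma>" for \<gamma>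
      using AE_lborel_translate[OF E(4), of \<gamma>]
    proof eventually_elim
      case (elim z)
      have "\<eta> \<gamma> z \<le> \<bar>g (z - \<gamma>)\<bar>" using \<eta>g[OF that, of z] by simp
      then show ?case using elim by (meson ennreal_leI order_trans)
    qed
    \<comment> \<open>Countability of \<Gamma> merges the exceptional null sets of the individual
      symbols into one.\<close>
    then show "AE z in lborel. \<forall>\<gamma>\<in>\<Gamma>. ennreal (\<eta> \<gamma> z) \<le> E (z - \<gamma>)"
      by (subst AE_ball_countable) (use separated_by_countable[OF K] in auto)
  qed (use K slowly_varying_Phi Phi_wnorm1 E AB eta_nonneg eta_L1 diag in auto)
  have eq: "moderated_with w Cv v = moderated Cv v" for v
    unfolding moderated_with_def moderated_def measurable_lborel2 by (rule refl)
  show "\<exists>\<alpha>>0. \<forall>v N.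
           moderated_with w Cv v \<and>
           (\<forall>\<gamma>\<in>\<Gamma>. \<alpha> * (\<integral>z. \<eta> \<gamma> z \<partial>lborel) \<le> real (N \<gamma>)) \<and>
           bdd_above (N ` \<Gamma>)
           \<longrightarrow> (\<forall>p::ennreal. 1 \<le> p \<longrightarrow>
                 (\<exists>A B. 0 < A \<and> 0 < B \<and>
                    (\<forall>F. Minf w F \<and> Mp_norm p \<phi> v F < top \<longrightarrow>
                       ennreal A * Mp_norm p \<phi> v F
                         \<le> Lp_norm p (count_space {(\<gamma>, k). \<gamma> \<in> \<Gamma> \<and> k < N \<gamma>})
                              (\<lambda>(\<gamma>, k). cmod (F (\<lambda>t. complex_of_real (lam \<gamma> k) * phis \<gamma> k t)) * v \<gamma>)
                       \<and> Lp_norm p (count_space {(\<gamma>, k). \<gamma> \<in> \<Gamma> \<and> k < N \<gamma>})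
                              (\<lambda>(\<gamma>, k). cmod (F (\<lambda>t. complex_of_real (lam \<gamma> k) * phis \<gamma> k t)) * v \<gamma>)
                         \<le> ennreal B * Mp_norm p \<phi> v F)))"
  proof (cases "0 < Cv")
    case False
    have "\<not> moderated_with w Cv v" for v
      using moderated_Cv_pos[of Cv v] False eq by blast
    then show ?thesis by (intro exI[of _ 1]) auto
  next
    case True
    from frame_bounds[OF True] obtain \<alpha> where \<alpha>: "0 < \<alpha>"
      and frame: "\<forall>v N p. moderated Cv v \<longrightarrow> (\<forall>\<gamma>\<in>\<Gamma>. \<alpha> * (\<integral>z. \<eta> \<gamma> z \<partial>lborel) \<le> real (N \<gamma>)) \<longrightarrow> bdd_above (N ` \<Gamma>) \<longrightarrow> 1 \<le> p \<longrightarrow>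
    (\<exists>a b. 0 < a \<and> 0 < b \<and> (\<forall>F. Minf w F \<and> LpN p lborel (\<lambda>z. gab F z * ennreal (v z)) < top \<longrightarrow>
       ennreal a * LpN p lborel (\<lambda>z. gab F z * ennreal (v z))
         \<le> LpN p (count_space {(\<gamma>, k). \<gamma> \<in> \<Gamma> \<and> k < N \<gamma>}) (\<lambda>s. coef F (fst s) (snd s) * ennreal (v (fst s))) \<and>
       LpN p (count_space {(\<gamma>, k). \<gamma> \<in> \<Gamma> \<and> k < N \<gamma>}) (\<lambda>s. coef F (fst s) (snd s) * ennreal (v (fst s)))
         \<le> ennreal b * LpN p lborel (\<lambda>z. gab F z * ennreal (v z))))"
      by (elim exE conjE) (rule that)
    show ?thesis
    proof (rule exI[of _ \<alpha>], intro conjI allI impI, rule \<alpha>)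
      fix v :: "(real^'d) \<times> (real^'d) \<Rightarrow> real" and N :: "(real^'d) \<times> (real^'d) \<Rightarrow> nat" and p :: ennreal
      assume H: "moderated_with w Cv v \<and> (\<forall>\<gamma>\<in>\<Gamma>. \<alpha> * (\<integral>z. \<eta> \<gamma> z \<partial>lborel) \<le> real (N \<gamma>)) \<and> bdd_above (N ` \<Gamma>)"
        and p: "1 \<le> p"
      have v: "moderated Cv v" using H by (simp add: eq)
      then have v0: "0 \<le> v z" for z by (metis moderated_def less_imp_le)
      have M: "Mp_norm p \<phi> v F = LpN p lborel (\<lambda>z. gab F z * ennreal (v z))" for F
        unfolding Mp_norm_def by (subst Lp_norm_eq_LpN) (auto simp: v0 ennreal_mult)
      have L: "Lp_norm p (count_space S) (\<lambda>(\<gamma>, k). cmod (F (\<lambda>t. complex_of_real (lam \<gamma> k) * phis \<gamma> k t)) * v \<gamma>)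
        = LpN p (count_space S) (\<lambda>s. coef F (fst s) (snd s) * ennreal (v (fst s)))" for F S
        by (subst Lp_norm_eq_LpN) (auto simp: v0 ennreal_mult case_prod_beta)
      have N: "\<forall>\<gamma>\<in>\<Gamma>. \<alpha> * (\<integral>z. \<eta> \<gamma> z \<partial>lborel) \<le> real (N \<gamma>)" and bdd: "bdd_above (N ` \<Gamma>)" 
        using conjunct2[OF H] by (rule conjunct1, rule conjunct2)
      note fr = frame[THEN spec, THEN spec, THEN spec, THEN mp, THEN mp, THEN mp, THEN mp, OF v N bdd p]
      show "\<exists>A B. 0 < A \<and> 0 < B \<and>
                    (\<forall>F. Minf w F \<and> Mp_norm p \<phi> v F < top \<longrightarrow>
                       ennreal A * Mp_norm p \<phi> v F
                         \<le> Lp_norm p (count_space {(\<gamma>, k). \<gamma> \<in> \<Gamma> \<and> k < N \<gamma>})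
                              (\<lambda>(\<gamma>, k). cmod (F (\<lambda>t. complex_of_real (lam \<gamma> k) * phis \<gamma> k t)) * v \<gamma>)
                       \<and> Lp_norm p (count_space {(\<gamma>, k). \<gamma> \<in> \<Gamma> \<and> k < N \<gamma>})
                              (\<lambda>(\<gamma>, k). cmod (F (\<lambda>t. complex_of_real (lam \<gamma> k) * phis \<gamma> k t)) * v \<gamma>)
                         \<le> ennreal B * Mp_norm p \<phi> v F)"
        unfolding M L by (rule fr)
    qed
  qed
qed

end
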